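(* Let $\mathcal H$ be an infinite dimensional Hilbert space and let $\mathcal K$ denote $S_2(\mathcal H)$, regarded as a Hilbert space. Let $1\le p\le 2$. Then the Banach algebras $B(\mathcal K)\otimes^\gamma S_p(\mathcal H)$ and $B_0(\mathcal K)\otimes^\gamma S_p(\mathcal H)$ (projective tensor products) are not Arens regular, where $B(\mathcal K)$ and $B_0(\mathcal K)$ are the Banach algebras of bounded, respectively compact, operators on $\mathcal K$, and $S_p(\mathcal H)$ has composition as multiplication.
   Context: Hilbert spaces are complex. For a Hilbert space $\mathcal H$ and $1\le p<\infty$, $S_p(\mathcal H)$ is the set of $T\in B(\mathcal H)$ with $\|T\|_p:=\operatorname{Tr}(|T|^p)^{1/p}<\infty$; it is a Banach algebra under composition with norm $\|\cdot\|_p$. $S_2(\mathcal H)$ is a Hilbert space with inner product $\langle A,B\rangle=\operatorname{Tr}(B^*A)$. $B(\mathcal K)$ and $B_0(\mathcal K)$ carry the operator norm and composition. Projective tensor product: for Banach algebras $A,B$, the algebraic tensor product $A\otimes B$ has multiplication determined by $(x_1\otimes y_1)(x_2\otimes y_2)=x_1x_2\otimes y_1y_2$ and norm $\|u\|_\gamma=\inf\{\sum_{i=1}^n\|x_i\|\|y_i\| : u=\sum_{i=1}^n x_i\otimes y_i\}$; its completion is the Banach algebra $A\otimes^\gamma B$. Arens regularity: let $A$ be a normed algebra. For $a\in A$, $\omega\in A^*$, $f\in A^{**}$ define $\omega_a,{}_a\omega\in A^*$ by $\omega_a(b)=\omega(ab)$, ${}_a\omega(b)=\omega(ba)$, and $\omega_f,{}_f\omega\in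 A^*$ by $\omega_f(a)=f({}_a\omega)$, ${}_f\omega(a)=f(\omega_a)$. For $f,g\in A^{**}$ set $(f\Box g)(\omega)=f({}_g\omega)$ and $(f\diamond g)(\omega)=g(\omega_f)$ for $\omega\in A^*$. $A$ is Arens regular if $f\Box g=f\diamond g$ for all $f,g\in A^{**}$. *)

theory Defs
  imports "HOL-Analysis.Analysis" "HOL-Computational_Algebra.Polynomial" "HOL-Library.Multiset"
begin

section \<open>Complex normed spaces, Hilbert spaces and normed algebras with explicit carriers\<close>

text \<open>
  The algebra \<open>S\<^sub>p(H)\<close> depends on a real parameter and \<open>S\<^sub>2(H)\<close> has to serve as a Hilbert
  space again, so all structures are records with explicit carriers.  Maps between such structures
  are \<^const>\<open>extensional\<close>, which makes equality of functions equality on the carrier.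
\<close>

record 'a nspace =
  carrier :: "'a set"
  vzero :: 'a
  vadd :: "'a \<Rightarrow> 'a \<Rightarrow> 'a"
  vscale :: "complex \<Rightarrow> 'a \<Rightarrow> 'a"
  vnorm :: "'a \<Rightarrow> real"

record 'a hilbert = "'a nspace" +
  cinner :: "'a \<Rightarrow> 'a \<Rightarrow> complex"

record 'a nalgebra = "'a nspace" +
  vmult :: "'a \<Rightarrow> 'a \<Rightarrow> 'a"

definition vdist :: "('a, 'm) nspace_scheme \<Rightarrow> 'a \<Rightarrow> 'a \<Rightarrow> real" where
  "vdist X x y = vnorm X (vadd X x (vscale X (- 1) y))"

definition tends_to :: "('a, 'm) nspace_scheme \<Rightarrow> (nat \<Rightarrow> 'a) \<Rightarrow> 'a \<Rightarrow> bool" where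
  "tends_to X s l \<longleftrightarrow> l \<in> carrier X \<and> (\<lambda>n. vdist X (s n) l) \<longlonglongrightarrow> 0"

definition cauchy_seq :: "('a, 'm) nspace_scheme \<Rightarrow> (nat \<Rightarrow> 'a) \<Rightarrow> bool" where
  "cauchy_seq X s \<longleftrightarrow> range s \<subseteq> carrier X \<and>
     (\<forall>e>0. \<exists>N. \<forall>m\<ge>N. \<forall>n\<ge>N. vdist X (s m) (s n) < e)"

locale complex_vector_space =
  fixes X :: "('a, 'm) nspace_scheme"
  assumes zero_closed: "vzero X \<in> carrier X"
    and add_closed: "\<lbrakk>x \<in> carrier X; y \<in> carrier X\<rbrakk> \<Longrightarrow> vadd X x y \<in> carrier X"
    and scale_closed: "x \<in> carrier X \<Longrightarrow> vscale X a x \<in> carrier X"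
    and add_assoc: "\<lbrakk>x \<in> carrier X; y \<in> carrier X; z \<in> carrier X\<rbrakk> \<Longrightarrow>
          vadd X (vadd X x y) z = vadd X x (vadd X y z)"
    and add_commute: "\<lbrakk>x \<in> carrier X; y \<in> carrier X\<rbrakk> \<Longrightarrow> vadd X x y = vadd X y x"
    and add_zero: "x \<in> carrier X \<Longrightarrow> vadd X x (vzero X) = x"
    and add_inverse: "x \<in> carrier X \<Longrightarrow> \<exists>y\<in>carrier X. vadd X x y = vzero X"
    and scale_one: "x \<in> carrier X \<Longrightarrow> vscale X 1 x = x"
    and scale_scale: "x \<in> carrier X \<Longrightarrow> vscale X a (vscale X b x) = vscale X (a * b) x"
    and scale_add_left: "x \<in> carrier X \<Longrightarrow>
          vscale X (a + b) x = vadd X (vscale X a x) (vscale X b x)"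
    and scale_add_right: "\<lbrakk>x \<in> carrier X; y \<in> carrier X\<rbrakk> \<Longrightarrow>
          vscale X a (vadd X x y) = vadd X (vscale X a x) (vscale X a y)"

locale hilbert_space = complex_vector_space X for X :: "('a, 'm) hilbert_scheme" +
  assumes inner_add: "\<lbrakk>x \<in> carrier X; y \<in> carrier X; z \<in> carrier X\<rbrakk> \<Longrightarrow>
          cinner X (vadd X x y) z = cinner X x z + cinner X y z"
    and inner_scale: "\<lbrakk>x \<in> carrier X; y \<in> carrier X\<rbrakk> \<Longrightarrow>
          cinner X (vscale X a x) y = a * cinner X x y"
    and inner_commute: "\<lbrakk>x \<in> carrier X; y \<in> carrier X\<rbrakk> \<Longrightarrow> cinner X y x = cnj (cinner X x y)"
    and inner_pos: "\<lbrakk>x \<in> carrier X; x \<noteq> vzero X\<rbrakk> \<Longrightarrow> 0 < Re (cinner X x x)"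
    and norm_eq: "x \<in> carrier X \<Longrightarrow> vnorm X x = sqrt (Re (cinner X x x))"
    and complete: "cauchy_seq X s \<Longrightarrow> \<exists>l. tends_to X s l"

definition linear_subspace :: "('a, 'm) nspace_scheme \<Rightarrow> 'a set \<Rightarrow> bool" where
  "linear_subspace X S \<longleftrightarrow> S \<subseteq> carrier X \<and> vzero X \<in> S \<and>
     (\<forall>x\<in>S. \<forall>y\<in>S. vadd X x y \<in> S) \<and> (\<forall>a. \<forall>x\<in>S. vscale X a x \<in> S)"

definition linear_span :: "('a, 'm) nspace_scheme \<Rightarrow> 'a set \<Rightarrow> 'a set" where
  "linear_span X F = \<Inter> {S. linear_subspace X S \<and> F \<subseteq> S}"

definition infinite_dimensional :: "('a, 'm) nspace_scheme \<Rightarrow> bool" where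
  "infinite_dimensional X \<longleftrightarrow> \<not> (\<exists>F. finite F \<and> F \<subseteq> carrier X \<and> linear_span X F = carrier X)"


section \<open>Bounded and compact operators\<close>

definition bounded_ops ::
  "('a, 'm) nspace_scheme \<Rightarrow> ('b, 'n) nspace_scheme \<Rightarrow> ('a \<Rightarrow> 'b) nspace" where
  "bounded_ops X Y = \<lparr>
     carrier = {T \<in> carrier X \<rightarrow>\<^sub>E carrier Y.
       (\<forall>x\<in>carrier X. \<forall>y\<in>carrier X. T (vadd X x y) = vadd Y (T x) (T y)) \<and>
       (\<forall>a. \<forall>x\<in>carrier X. T (vscale X a x) = vscale Y a (T x)) \<and>
       (\<exists>M. \<forall>x\<in>carrier X. vnorm Y (T x) \<le> M * vnorm X x)},
     vzero = (\<lambda>x\<in>carrier X. vzero Y),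
     vadd = (\<lambda>S T. \<lambda>x\<in>carrier X. vadd Y (S x) (T x)),
     vscale = (\<lambda>a T. \<lambda>x\<in>carrier X. vscale Y a (T x)),
     vnorm = (\<lambda>T. SUP x \<in> {x \<in> carrier X. vnorm X x \<le> 1}. vnorm Y (T x)) \<rparr>"

definition bounded_algebra :: "('a, 'm) nspace_scheme \<Rightarrow> ('a \<Rightarrow> 'a) nalgebra" where
  "bounded_algebra X =
     nspace.extend (bounded_ops X X) (nalgebra.fields (compose (carrier X)))"

definition compact_operator :: "('a, 'm) nspace_scheme \<Rightarrow> ('a \<Rightarrow> 'a) \<Rightarrow> bool" where
  "compact_operator X T \<longleftrightarrow>
     (\<forall>s. (\<forall>n. s n \<in> carrier X \<and> vnorm X (s n) \<le> 1) \<longrightarrow>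
       (\<exists>r l. strict_mono (r :: nat \<Rightarrow> nat) \<and> tends_to X (\<lambda>n. T (s (r n))) l))"

definition compact_algebra :: "('a, 'm) nspace_scheme \<Rightarrow> ('a \<Rightarrow> 'a) nalgebra" where
  "compact_algebra X = (bounded_algebra X)
     \<lparr>carrier := {T \<in> carrier (bounded_algebra X). compact_operator X T}\<rparr>"


section \<open>Schatten classes\<close>

definition adjoint_op :: "('a, 'm) hilbert_scheme \<Rightarrow> ('a \<Rightarrow> 'a) \<Rightarrow> 'a \<Rightarrow> 'a" where
  "adjoint_op X T = (THE S. S \<in> carrier (bounded_algebra X) \<and>
     (\<forall>x\<in>carrier X. \<forall>y\<in>carrier X. cinner X (T x) y = cinner X x (S y)))"

definition op_poly :: "('a, 'm) nspace_scheme \<Rightarrow> real poly \<Rightarrow> ('a \<Rightarrow> 'a) \<Rightarrow> 'a \<Rightarrow> 'a" where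
  "op_poly X q T = (let A = bounded_algebra X in
     fold_coeffs (\<lambda>c S. vadd A (vscale A (of_real c) (\<lambda>x\<in>carrier X. x)) (vmult A T S))
       q (vzero A))"

text \<open>
  Continuous functional calculus, used only for positive \<open>T\<close> and \<open>f\<close> continuous on
  \<open>[0, \<parallel>T\<parallel>]\<close>, an interval that contains the spectrum of \<open>T\<close>: \<open>f(T)\<close> is the norm limit of
  \<open>q\<^sub>n(T)\<close> for real polynomials \<open>q\<^sub>n\<close> tending to \<open>f\<close> uniformly on this interval.
\<close>

definition fun_calculus ::
  "('a, 'm) nspace_scheme \<Rightarrow> (real \<Rightarrow> real) \<Rightarrow> ('a \<Rightarrow> 'a) \<Rightarrow> 'a \<Rightarrow> 'a" where
  "fun_calculus X f T = (THE S. S \<in> carrier (bounded_algebra X) \<and>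
     (\<forall>q. uniform_limit {0..vnorm (bounded_algebra X) T} (\<lambda>n t. poly (q n) t) f sequentially \<longrightarrow>
       tends_to (bounded_algebra X) (\<lambda>n. op_poly X (q n) T) S))"

definition abs_op :: "('a, 'm) hilbert_scheme \<Rightarrow> ('a \<Rightarrow> 'a) \<Rightarrow> 'a \<Rightarrow> 'a" where
  "abs_op X T = fun_calculus X sqrt (compose (carrier X) (adjoint_op X T) T)"

definition abs_op_power :: "('a, 'm) hilbert_scheme \<Rightarrow> real \<Rightarrow> ('a \<Rightarrow> 'a) \<Rightarrow> 'a \<Rightarrow> 'a" where
  "abs_op_power X p T = fun_calculus X (\<lambda>t. t powr p) (abs_op X T)"

definition orthonormal_basis :: "('a, 'm) hilbert_scheme \<Rightarrow> 'a set \<Rightarrow> bool" where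
  "orthonormal_basis X E \<longleftrightarrow> E \<subseteq> carrier X \<and>
     (\<forall>d\<in>E. \<forall>e\<in>E. cinner X d e = (if d = e then 1 else 0)) \<and>
     (\<forall>x\<in>carrier X. (\<forall>e\<in>E. cinner X x e = 0) \<longrightarrow> x = vzero X)"

text \<open>
  The trace of a positive operator lies in \<open>[0, \<infinity>]\<close>; the trace of a trace class operator is a
  complex number.  Neither depends on the orthonormal basis.
\<close>

definition positive_trace :: "('a, 'm) hilbert_scheme \<Rightarrow> ('a \<Rightarrow> 'a) \<Rightarrow> ennreal" where
  "positive_trace X T =
     (\<Sum>\<^sub>\<infinity>e\<in>(SOME E. orthonormal_basis X E). ennreal (Re (cinner X (T e) e)))"

definition trace_op :: "('a, 'm) hilbert_scheme \<Rightarrow> ('a \<Rightarrow> 'a) \<Rightarrow> complex" where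
  "trace_op X T = (\<Sum>\<^sub>\<infinity>e\<in>(SOME E. orthonormal_basis X E). cinner X (T e) e)"

definition schatten :: "real \<Rightarrow> ('a, 'm) hilbert_scheme \<Rightarrow> ('a \<Rightarrow> 'a) nalgebra" where
  "schatten p X = (bounded_algebra X)
     \<lparr>carrier := {T \<in> carrier (bounded_algebra X). positive_trace X (abs_op_power X p T) < \<infinity>},
      vnorm := (\<lambda>T. enn2real (positive_trace X (abs_op_power X p T)) powr (1 / p))\<rparr>"

definition hilbert_schmidt :: "('a, 'm) hilbert_scheme \<Rightarrow> ('a \<Rightarrow> 'a) hilbert" where
  "hilbert_schmidt X = nspace.extend (nspace.truncate (schatten 2 X))
     (hilbert.fields (\<lambda>A B. trace_op X (compose (carrier X) (adjoint_op X B) A)))"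


section \<open>The projective tensor product\<close>

text \<open>
  A formal sum \<open>\<Sum> x\<^sub>i \<otimes> y\<^sub>i\<close> is the multiset of its pairs \<open>(x\<^sub>i, y\<^sub>i)\<close>.  The algebraic tensor product
  consists of the classes of formal sums modulo the bilinearity relations; scalars are absorbed
  into the first factor.
\<close>

definition formal_sums ::
  "('a, 'm) nspace_scheme \<Rightarrow> ('b, 'n) nspace_scheme \<Rightarrow> ('a \<times> 'b) multiset set" where
  "formal_sums A B = {u. set_mset u \<subseteq> carrier A \<times> carrier B}"

inductive tensor_step ::
  "('a, 'm) nspace_scheme \<Rightarrow> ('b, 'n) nspace_scheme \<Rightarrow>
   ('a \<times> 'b) multiset \<Rightarrow> ('a \<times> 'b) multiset \<Rightarrow> bool"
  for A B where
  add_left: "\<lbrakk>x \<in> carrier A; x' \<in> carrier A; y \<in> carrier B; w \<in> formal_sums A B\<rbrakk> \<Longrightarrow>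
    tensor_step A B (w + {#(vadd A x x', y)#}) (w + {#(x, y), (x', y)#})"
| add_right: "\<lbrakk>x \<in> carrier A; y \<in> carrier B; y' \<in> carrier B; w \<in> formal_sums A B\<rbrakk> \<Longrightarrow>
    tensor_step A B (w + {#(x, vadd B y y')#}) (w + {#(x, y), (x, y')#})"
| scale: "\<lbrakk>x \<in> carrier A; y \<in> carrier B; w \<in> formal_sums A B\<rbrakk> \<Longrightarrow>
    tensor_step A B (w + {#(vscale A a x, y)#}) (w + {#(x, vscale B a y)#})"
| zero: "\<lbrakk>y \<in> carrier B; w \<in> formal_sums A B\<rbrakk> \<Longrightarrow>
    tensor_step A B (w + {#(vzero A, y)#}) w"

definition tensor_class ::
  "('a, 'm) nspace_scheme \<Rightarrow> ('b, 'n) nspace_scheme \<Rightarrow>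
   ('a \<times> 'b) multiset \<Rightarrow> ('a \<times> 'b) multiset set" where
  "tensor_class A B u = {v. equivclp (tensor_step A B) u v}"

definition alg_tensor ::
  "('a, 'm) nalgebra_scheme \<Rightarrow> ('b, 'n) nalgebra_scheme \<Rightarrow> ('a \<times> 'b) multiset set nalgebra" where
  "alg_tensor A B = \<lparr>
     carrier = tensor_class A B ` formal_sums A B,
     vzero = tensor_class A B {#},
     vadd = (\<lambda>P Q. \<Union>u\<in>P. \<Union>v\<in>Q. tensor_class A B (u + v)),
     vscale = (\<lambda>a P. \<Union>u\<in>P. tensor_class A B {#(vscale A a x, y). (x, y) \<in># u#}),
     vnorm = (\<lambda>P. INF u\<in>P. \<Sum>(x, y)\<in>#u. vnorm A x * vnorm B y),
     vmult = (\<lambda>P Q. \<Union>u\<in>P. \<Union>v\<in>Q. tensor_class A B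
       (\<Sum>(x, y)\<in>#u. {#(vmult A x x', vmult B y y'). (x', y') \<in># v#})) \<rparr>"

definition null_class :: "('a, 'm) nspace_scheme \<Rightarrow> (nat \<Rightarrow> 'a) \<Rightarrow> (nat \<Rightarrow> 'a) set" where
  "null_class A s = {t. cauchy_seq A t \<and> (\<lambda>n. vdist A (s n) (t n)) \<longlonglongrightarrow> 0}"

text \<open>Completion: Cauchy sequences modulo null sequences.\<close>

definition algebra_completion :: "('a, 'm) nalgebra_scheme \<Rightarrow> (nat \<Rightarrow> 'a) set nalgebra" where
  "algebra_completion A = \<lparr>
     carrier = null_class A ` {s. cauchy_seq A s},
     vzero = null_class A (\<lambda>n. vzero A),
     vadd = (\<lambda>P Q. \<Union>s\<in>P. \<Union>t\<in>Q. null_class A (\<lambda>n. vadd A (s n) (t n))),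
     vscale = (\<lambda>a P. \<Union>s\<in>P. null_class A (\<lambda>n. vscale A a (s n))),
     vnorm = (\<lambda>P. THE r. \<forall>s\<in>P. (\<lambda>n. vnorm A (s n)) \<longlonglongrightarrow> r),
     vmult = (\<lambda>P Q. \<Union>s\<in>P. \<Union>t\<in>Q. null_class A (\<lambda>n. vmult A (s n) (t n))) \<rparr>"

definition proj_tensor ::
  "('a, 'm) nalgebra_scheme \<Rightarrow> ('b, 'n) nalgebra_scheme \<Rightarrow>
   (nat \<Rightarrow> ('a \<times> 'b) multiset set) set nalgebra"  (infixr "\<otimes>\<^sub>\<gamma>" 70) where
  "A \<otimes>\<^sub>\<gamma> B = algebra_completion (alg_tensor A B)"


section \<open>Arens regularity\<close>

definition complex_space :: "complex nspace" where
  "complex_space = \<lparr>carrier = UNIV, vzero = 0, vadd = (+), vscale = (*), vnorm = cmod\<rparr>"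

definition dual :: "('a, 'm) nspace_scheme \<Rightarrow> ('a \<Rightarrow> complex) nspace" where
  "dual X = bounded_ops X complex_space"

text \<open>
  \<open>left_translate A \<omega> a\<close> is \<open>\<omega>\<^sub>a\<close>, with \<open>\<omega>\<^sub>a(b) = \<omega>(ab)\<close>; \<open>right_translate A a \<omega>\<close> is
  \<open>\<^sub>a\<omega>\<close>, with \<open>\<^sub>a\<omega>(b) = \<omega>(ba)\<close>.  Likewise \<open>left_action A \<omega> f\<close> is \<open>\<omega>\<^sub>f\<close> and
  \<open>right_action A f \<omega>\<close> is \<open>\<^sub>f\<omega>\<close>.
\<close>

definition left_translate :: "('a, 'm) nalgebra_scheme \<Rightarrow> ('a \<Rightarrow> complex) \<Rightarrow> 'a \<Rightarrow> 'a \<Rightarrow> complex" where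
  "left_translate A \<omega> a = (\<lambda>b\<in>carrier A. \<omega> (vmult A a b))"

definition right_translate :: "('a, 'm) nalgebra_scheme \<Rightarrow> 'a \<Rightarrow> ('a \<Rightarrow> complex) \<Rightarrow> 'a \<Rightarrow> complex" where
  "right_translate A a \<omega> = (\<lambda>b\<in>carrier A. \<omega> (vmult A b a))"

definition left_action ::
  "('a, 'm) nalgebra_scheme \<Rightarrow> ('a \<Rightarrow> complex) \<Rightarrow> (('a \<Rightarrow> complex) \<Rightarrow> complex) \<Rightarrow> 'a \<Rightarrow> complex" where
  "left_action A \<omega> f = (\<lambda>a\<in>carrier A. f (right_translate A a \<omega>))"

definition right_action ::
  "('a, 'm) nalgebra_scheme \<Rightarrow> (('a \<Rightarrow> complex) \<Rightarrow> complex) \<Rightarrow> ('a \<Rightarrow> complex) \<Rightarrow> 'a \<Rightarrow> complex" where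
  "right_action A f \<omega> = (\<lambda>a\<in>carrier A. f (left_translate A \<omega> a))"

definition arens_box ::
  "('a, 'm) nalgebra_scheme \<Rightarrow> (('a \<Rightarrow> complex) \<Rightarrow> complex) \<Rightarrow> (('a \<Rightarrow> complex) \<Rightarrow> complex) \<Rightarrow>
   ('a \<Rightarrow> complex) \<Rightarrow> complex" where
  "arens_box A f g = (\<lambda>\<omega>\<in>carrier (dual A). f (right_action A g \<omega>))"

definition arens_diamond ::
  "('a, 'm) nalgebra_scheme \<Rightarrow> (('a \<Rightarrow> complex) \<Rightarrow> complex) \<Rightarrow> (('a \<Rightarrow> complex) \<Rightarrow> complex) \<Rightarrow>
   ('a \<Rightarrow> complex) \<Rightarrow> complex" where
  "arens_diamond A f g = (\<lambda>\<omega>\<in>carrier (dual A). g (left_action A \<omega> f))"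

definition arens_regular :: "('a, 'm) nalgebra_scheme \<Rightarrow> bool" where
  "arens_regular A \<longleftrightarrow>
     (\<forall>f\<in>carrier (dual (dual A)). \<forall>g\<in>carrier (dual (dual A)). arens_box A f g = arens_diamond A f g)"

end

theory Submission
  imports Defs "HOL-Computational_Algebra.Fundamental_Theorem_Algebra"
begin

text \<open>
  Fix an orthonormal sequence \<open>e\<^sub>0, e\<^sub>1, \<dots>\<close> in \<open>H\<close> with matrix units \<open>E\<^sub>i\<^sub>j\<close>.  The bilinear form
  \<open>m(T, S) = \<langle>T(S) e\<^sub>0, e\<^sub>0\<rangle>\<close> is bounded because \<open>\<parallel>S\<parallel>\<^sub>2 \<le> 2 \<parallel>S\<parallel>\<^sub>p\<close>, so it induces a functional on the
  projective tensor product.  Let \<open>S\<^sub>i = E\<^sub>i\<^sub>0\<close>, \<open>S'\<^sub>j = E\<^sub>0\<^sub>j\<close>, \<open>T\<^sub>i(A) = \<langle>A e\<^sub>0, e\<^sub>i\<rangle> E\<^sub>0\<^sub>0\<close> and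
  \<open>T'\<^sub>j(A) = \<Sum>\<^sub>k\<^sub>\<le>\<^sub>j \<langle>A e\<^sub>j, e\<^sub>k\<rangle> E\<^sub>k\<^sub>0\<close>; the last two are finite rank contractions of \<open>S\<^sub>2\<close>.  Then
  \<open>m(T\<^sub>i T'\<^sub>j, S\<^sub>i S'\<^sub>j)\<close> is \<open>1\<close> for \<open>i \<le> j\<close> and \<open>0\<close> otherwise, so the two iterated limits of the functional
  along the bounded sequences \<open>T\<^sub>i \<otimes> S\<^sub>i\<close> and \<open>T'\<^sub>j \<otimes> S'\<^sub>j\<close> differ.  Limits along an ultrafilter turn them into
  elements of the bidual whose two Arens products differ.

  The quantities \<open>\<parallel>T\<parallel>\<^sub>p\<close> need not be shown to be norms.  It suffices that \<open>S\<^sub>p\<close> is closed under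
  the operations and that products are bounded up to a constant.
\<close>

section \<open>Real square-summable families\<close>

text \<open>The obstacle is to show that S_p, defined through a functional calculus on an abstract
  complex Hilbert space, is closed under sums and products. Operators are moved to a real space
  \<open>l2\<close>, where operator norms, completeness and limits of polynomials are at hand.
  Multiplication by i becomes an operator there, and commuting with it expresses complex linearity.

  Closure under sums is real interpolation. The trace of min(|T|^2, s|T|) behaves like the
  K-functional of the pair (trace class, Hilbert-Schmidt), so it is subadditive up to a constant
  independent of s; weighted sums over dyadic s recover the trace of |T|^p. The cutoffs R / max(s,
  |R|) stand in for the partial isometry of a polar decomposition. Products pass through S_2: both
  factors lie in S_2, and a product of two Hilbert-Schmidt operators is trace class, hence in S_p.

  The order \<open>i \<le> j\<close> in the counterexample is produced by truncating a column of A
  after entry j. Bessel's inequality keeps the truncation contractive although its rank grows, and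
  finite rank lets the same sequences serve bounded and compact operators.\<close>

typedef 'i l2 = "{f :: 'i \<Rightarrow> real. (\<lambda>i. (f i)\<^sup>2) summable_on UNIV}"
  morphisms cf Abs_l2
  by (rule exI[of _ "\<lambda>_. 0"]) simp

lemma summable_on_cf_square: "(\<lambda>i. (cf x i)\<^sup>2) summable_on UNIV"
  using cf[of x] by simp

lemma cf_Abs: "(\<lambda>i. (f i)\<^sup>2) summable_on UNIV \<Longrightarrow> cf (Abs_l2 f) = f"
  by (simp add: Abs_l2_inverse)

lemma l2_eqI: "(\<And>i. cf x i = cf y i) \<Longrightarrow> x = y"
  using cf_inject[of x y] by auto

lemma summable_on_mult_square:
  fixes f g :: "'i \<Rightarrow> real"
  assumes "(\<lambda>i. (f i)\<^sup>2) summable_on UNIV" "(\<lambda>i. (g i)\<^sup>2) summable_on UNIV"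
  shows "(\<lambda>i. f i * g i) summable_on UNIV"
proof -
  have "(\<lambda>i. (f i)\<^sup>2 + (g i)\<^sup>2) summable_on UNIV"
    by (rule summable_on_add[OF assms])
  moreover have "norm (f i * g i) \<le> (f i)\<^sup>2 + (g i)\<^sup>2" for i
  proof -
    have "0 \<le> \<bar>f i\<bar> * \<bar>g i\<bar>" by simp
    moreover have "2 * (\<bar>f i\<bar> * \<bar>g i\<bar>) \<le> (f i)\<^sup>2 + (g i)\<^sup>2"
      using sum_squares_bound[of "\<bar>f i\<bar>" "\<bar>g i\<bar>"] by (simp add: mult.assoc)
    ultimately show ?thesis unfolding real_norm_def abs_mult by linarith
  qed
  ultimately have "(\<lambda>i. norm (f i * g i)) summable_on UNIV"
    by (rule summable_on_comparison_test) (rule norm_ge_zero)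
  thus ?thesis by (rule abs_summable_summable)
qed

lemma summable_on_add_square:
  fixes f g :: "'i \<Rightarrow> real"
  assumes "(\<lambda>i. (f i)\<^sup>2) summable_on UNIV" "(\<lambda>i. (g i)\<^sup>2) summable_on UNIV"
  shows "(\<lambda>i. (f i + g i)\<^sup>2) summable_on UNIV"
proof -
  have "(\<lambda>i. (f i)\<^sup>2 + (g i)\<^sup>2 + 2 * (f i * g i)) summable_on UNIV"
    by (rule summable_on_add[OF summable_on_add[OF assms]
          summable_on_cmult_right[OF summable_on_mult_square[OF assms]]])
  thus ?thesis by (simp add: power2_sum mult.assoc)
qed

lemma summable_on_scale_square:
  fixes f :: "'i \<Rightarrow> real"
  assumes "(\<lambda>i. (f i)\<^sup>2) summable_on UNIV"
  shows "(\<lambda>i. (c * f i)\<^sup>2) summable_on UNIV"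
  using assms by (simp add: power_mult_distrib summable_on_cmult_right)

instantiation l2 :: (type) real_vector
begin

definition "0 = Abs_l2 (\<lambda>_. 0)"
definition "x + y = Abs_l2 (\<lambda>i. cf x i + cf y i)"
definition "c *\<^sub>R x = Abs_l2 (\<lambda>i. c * cf x i)"
definition "- (x :: 'a l2) = (- 1) *\<^sub>R x"
definition "(x :: 'a l2) - y = x + (- y)"

lemma cf_zero [simp]: "cf 0 i = 0"
  by (simp add: zero_l2_def cf_Abs)

lemma cf_add [simp]: "cf (x + y) i = cf x i + cf y i"
  by (simp add: plus_l2_def cf_Abs summable_on_add_square summable_on_cf_square)

lemma cf_scaleR [simp]: "cf (c *\<^sub>R x) i = c * cf x i"
  by (simp add: scaleR_l2_def cf_Abs summable_on_scale_square summable_on_cf_square)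

lemma cf_uminus [simp]: "cf (- x) i = - cf x i"
  by (simp add: uminus_l2_def)

lemma cf_diff [simp]: "cf (x - y) i = cf x i - cf y i"
  by (simp add: minus_l2_def)

instance
  by standard (auto intro!: l2_eqI simp: distrib_left distrib_right)

end

lemma summable_on_cf_mult: "(\<lambda>i. cf x i * cf y i) summable_on UNIV"
  by (simp add: summable_on_mult_square summable_on_cf_square)

instantiation l2 :: (type) real_inner
begin

definition "inner (x :: 'a l2) y = (\<Sum>\<^sub>\<infinity>i. cf x i * cf y i)"
definition "norm (x :: 'a l2) = sqrt (inner x x)"
definition "dist (x :: 'a l2) y = norm (x - y)"
definition "sgn (x :: 'a l2) = inverse (norm x) *\<^sub>R x"
definition [code del]: "(uniformity :: ('a l2 \<times> 'a l2) filter) =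
  (INF e\<in>{0 <..}. principal {(x, y). dist x y < e})"
definition [code del]: "open (U :: 'a l2 set) \<longleftrightarrow>
  (\<forall>x\<in>U. eventually (\<lambda>(x', y). x' = x \<longrightarrow> y \<in> U) uniformity)"

instance
proof
  show "dist x y = norm (x - y)" for x y :: "'a l2"
    by (rule dist_l2_def)
  show "sgn x = inverse (norm x) *\<^sub>R x" for x :: "'a l2"
    by (rule sgn_l2_def)
  show "norm x = sqrt (inner x x)" for x :: "'a l2"
    by (rule norm_l2_def)
  show "(uniformity :: ('a l2 \<times> 'a l2) filter) = (INF e\<in>{0 <..}. principal {(x, y). dist x y < e})"
    by (rule uniformity_l2_def)
  show "open U \<longleftrightarrow> (\<forall>x\<in>U. eventually (\<lambda>(x', y). x' = x \<longrightarrow> y \<in> U) uniformity)"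
    for U :: "'a l2 set"
    by (rule open_l2_def)
  show "inner x y = inner y x" for x y :: "'a l2"
    by (simp add: inner_l2_def mult.commute)
  show "inner (x + y) z = inner x z + inner y z" for x y z :: "'a l2"
    by (simp add: inner_l2_def distrib_right infsum_add summable_on_cf_mult)
  show "inner (r *\<^sub>R x) y = r * inner x y" for r and x y :: "'a l2"
    by (simp add: inner_l2_def mult.assoc infsum_cmult_right')
  show "0 \<le> inner x x" for x :: "'a l2"
    by (simp add: inner_l2_def infsum_nonneg)
  show "inner x x = 0 \<longleftrightarrow> x = 0" for x :: "'a l2"
  proof
    assume "inner x x = 0"
    hence *: "(\<Sum>\<^sub>\<infinity>i. cf x i * cf x i) \<le> 0" by (simp add: inner_l2_def)
    have "cf x i * cf x i = 0" for i
      by (rule nonneg_infsum_le_0D[OF *]) (auto intro: summable_on_cf_mult)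
    thus "x = 0" by (intro l2_eqI) simp
  qed (simp add: inner_l2_def)
qed

end

lemma norm_square_l2: "(norm x)\<^sup>2 = (\<Sum>\<^sub>\<infinity>i. (cf x i)\<^sup>2)"
  unfolding power2_norm_eq_inner inner_l2_def by (simp only: power2_eq_square)

lemma has_sum_norm_square: "((\<lambda>i. (cf x i)\<^sup>2) has_sum (norm x)\<^sup>2) UNIV"
  by (simp add: norm_square_l2 summable_on_cf_square)

lemma finite_sum_cf_le: "finite F \<Longrightarrow> (\<Sum>i\<in>F. (cf x i)\<^sup>2) \<le> (norm x)\<^sup>2"
  using finite_sum_le_has_sum[OF has_sum_norm_square] by auto

lemma cf_le_norm: "\<bar>cf x i\<bar> \<le> norm x"
  using finite_sum_cf_le[of "{i}" x] by (simp add: abs_le_square_iff[symmetric])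

lemma summable_on_bounded_sums:
  fixes f :: "'i \<Rightarrow> real"
  assumes "\<And>i. f i \<ge> 0" "\<And>F. finite F \<Longrightarrow> sum f F \<le> c"
  shows "f summable_on UNIV" "infsum f UNIV \<le> c"
proof -
  show s: "f summable_on UNIV"
    by (rule nonneg_bdd_above_summable_on) (use assms in \<open>auto intro!: bdd_aboveI[of _ c]\<close>)
  show "infsum f UNIV \<le> c"
    by (rule infsum_le_finite_sums[OF s]) (use assms in auto)
qed

lemma l2_of_bounded_sums:
  assumes "\<And>F. finite F \<Longrightarrow> (\<Sum>i\<in>F. (f i)\<^sup>2) \<le> c\<^sup>2" "c \<ge> 0"
  shows "cf (Abs_l2 f) = f" "norm (Abs_l2 f) \<le> c"
proof -
  have *: "(\<lambda>i. (f i)\<^sup>2) summable_on UNIV" "(\<Sum>\<^sub>\<infinity>i. (f i)\<^sup>2) \<le> c\<^sup>2"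
    using summable_on_bounded_sums[of "\<lambda>i. (f i)\<^sup>2" "c\<^sup>2"] assms by auto
  thus 1: "cf (Abs_l2 f) = f" by (intro cf_Abs)
  show "norm (Abs_l2 f) \<le> c"
    by (rule power2_le_imp_le) (use * 1 assms in \<open>auto simp: norm_square_l2\<close>)
qed

instance l2 :: (type) banach
proof
  fix X :: "nat \<Rightarrow> 'a l2"
  assume X: "Cauchy X"
  have "Cauchy (\<lambda>n. cf (X n) i)" for i
  proof (rule CauchyI)
    fix e :: real assume "e > 0"
    then obtain M where "\<forall>m\<ge>M. \<forall>n\<ge>M. norm (X m - X n) < e" using CauchyD[OF X] by blast
    moreover have "norm (cf (X m) i - cf (X n) i) \<le> norm (X m - X n)" for m n
      using cf_le_norm[of "X m - X n" i] by simp
    ultimately show "\<exists>M. \<forall>m\<ge>M. \<forall>n\<ge>M. norm (cf (X m) i - cf (X n) i) < e"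
      by (meson le_less_trans)
  qed
  hence "\<exists>l. (\<lambda>n. cf (X n) i) \<longlonglongrightarrow> l" for i
    using real_Cauchy_convergent convergent_def by blast
  then obtain f where f: "\<And>i. (\<lambda>n. cf (X n) i) \<longlonglongrightarrow> f i" by metis
  \<comment> \<open>Finite partial sums of the squared tail pass to the limit in the second index,
    so \<open>X m - f\<close> lies in \<open>l2\<close> with small norm before \<open>f\<close> is
    known to lie there; then \<open>f\<close> is \<open>X M\<close> minus such a tail.\<close>
  have key: "\<exists>M. \<forall>m\<ge>M. cf (Abs_l2 (\<lambda>i. cf (X m) i - f i)) = (\<lambda>i. cf (X m) i - f i) \<and>
       norm (Abs_l2 (\<lambda>i. cf (X m) i - f i)) \<le> e" if e: "e > 0" for e
  proof -
    obtain M where M: "\<And>m n. m \<ge> M \<Longrightarrow> n \<ge> M \<Longrightarrow> norm (X m - X n) < e"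
      using CauchyD[OF X e] by blast
    have "(\<Sum>i\<in>F. (cf (X m) i - f i)\<^sup>2) \<le> e\<^sup>2" if "m \<ge> M" "finite F" for m F
    proof (rule LIMSEQ_le_const2)
      show "(\<lambda>n. \<Sum>i\<in>F. (cf (X m) i - cf (X n) i)\<^sup>2) \<longlonglongrightarrow> (\<Sum>i\<in>F. (cf (X m) i - f i)\<^sup>2)"
        by (intro tendsto_intros f)
      have "(\<Sum>i\<in>F. (cf (X m) i - cf (X n) i)\<^sup>2) \<le> e\<^sup>2" if "n \<ge> M" for n
      proof -
        have "(\<Sum>i\<in>F. (cf (X m) i - cf (X n) i)\<^sup>2) \<le> (norm (X m - X n))\<^sup>2"
          using finite_sum_cf_le[OF \<open>finite F\<close>, of "X m - X n"] by simp
        also have "\<dots> \<le> e\<^sup>2"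
          using M[OF \<open>m \<ge> M\<close> that] by (intro power_mono) auto
        finally show ?thesis .
      qed
      thus "\<exists>N. \<forall>n\<ge>N. (\<Sum>i\<in>F. (cf (X m) i - cf (X n) i)\<^sup>2) \<le> e\<^sup>2" by blast
    qed
    thus ?thesis using e by (intro exI[of _ M]) (auto intro!: l2_of_bounded_sums)
  qed
  obtain M where "cf (Abs_l2 (\<lambda>i. cf (X M) i - f i)) = (\<lambda>i. cf (X M) i - f i)"
    using key[of 1] by auto
  hence "cf (X M - Abs_l2 (\<lambda>i. cf (X M) i - f i)) = f"
    by (auto simp: fun_eq_iff)
  then obtain l where l: "cf l = f" by blast
  have "X \<longlonglongrightarrow> l"
  proof (rule LIMSEQ_I)
    fix r :: real assume "r > 0"
    then obtain M where M: "\<And>m. m \<ge> M \<Longrightarrow> cf (Abs_l2 (\<lambda>i. cf (X m) i - f i)) = (\<lambda>i. cf (X m) i - f i) \<and>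
       norm (Abs_l2 (\<lambda>i. cf (X m) i - f i)) \<le> r / 2" using key[of "r/2"] by auto
    have "norm (X m - l) < r" if "m \<ge> M" for m
    proof -
      have "X m - l = Abs_l2 (\<lambda>i. cf (X m) i - f i)"
        by (rule l2_eqI) (use M[OF that] l in \<open>simp add: fun_eq_iff\<close>)
      thus ?thesis using M[OF that] \<open>r > 0\<close> by simp
    qed
    thus "\<exists>no. \<forall>n\<ge>no. norm (X n - l) < r" by blast
  qed
  thus "convergent X" by (auto simp: convergent_def)
qed

definition ev :: "'i \<Rightarrow> 'i l2" where
  "ev i = Abs_l2 (\<lambda>j. of_bool (j = i))"

lemma cf_ev [simp]: "cf (ev i) j = of_bool (j = i)"
proof -
  have "(\<lambda>j. (of_bool (j = i) :: real)\<^sup>2) summable_on UNIV"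
    by (rule finite_nonzero_values_imp_summable_on) (auto intro: finite_subset[of _ "{i}"])
  thus ?thesis by (simp add: ev_def cf_Abs)
qed

lemma inner_ev_right [simp]: "inner x (ev i) = cf x i"
proof -
  have "inner x (ev i) = (\<Sum>\<^sub>\<infinity>j\<in>{i}. cf x j * of_bool (j = i))"
    unfolding inner_l2_def cf_ev by (rule infsum_cong_neutral) auto
  thus ?thesis by simp
qed

lemma inner_ev_left [simp]: "inner (ev i) x = cf x i"
  by (subst inner_commute) simp

lemma cf_sum: "cf (sum f A) i = (\<Sum>j\<in>A. cf (f j) i)"
  by (induction A rule: infinite_finite_induct) auto

text \<open>Finite partial sums are orthogonal projections of \<open>x\<close>, so their squared
  distance to \<open>x\<close> is the norm square minus a partial sum of squared
  coefficients.\<close>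

lemma has_sum_ev: "((\<lambda>i. cf x i *\<^sub>R ev i) has_sum x) UNIV"
proof -
  have eq: "(norm ((\<Sum>i\<in>F. cf x i *\<^sub>R ev i) - x))\<^sup>2 = (norm x)\<^sup>2 - (\<Sum>i\<in>F. (cf x i)\<^sup>2)" if "finite F" for F
  proof -
    let ?s = "\<Sum>i\<in>F. cf x i *\<^sub>R ev i"
    have 1: "inner ?s x = (\<Sum>i\<in>F. (cf x i)\<^sup>2)"
      by (simp add: inner_sum_left power2_eq_square)
    have "inner ?s ?s = (\<Sum>i\<in>F. cf x i * cf ?s i)"
      by (subst inner_sum_left) simp
    also have "\<dots> = (\<Sum>i\<in>F. (cf x i)\<^sup>2)"
      using that by (intro sum.cong) (auto simp: cf_sum power2_eq_square if_distrib of_bool_def cong: if_cong)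
    finally have 2: "inner ?s ?s = (\<Sum>i\<in>F. (cf x i)\<^sup>2)" .
    show ?thesis
      unfolding power2_norm_eq_inner inner_diff_left inner_diff_right inner_commute[of x ?s] 1 2
      by (simp add: power2_norm_eq_inner)
  qed
  let ?s = "\<lambda>F. \<Sum>i\<in>F. cf x i *\<^sub>R ev i" and ?L = "finite_subsets_at_top UNIV"
  have "((\<lambda>F. (norm x)\<^sup>2 - (\<Sum>i\<in>F. (cf x i)\<^sup>2)) \<longlongrightarrow> (norm x)\<^sup>2 - (norm x)\<^sup>2) ?L"
    by (intro tendsto_diff tendsto_const has_sum_norm_square[unfolded has_sum_def])
  hence "((\<lambda>F. (norm (?s F - x))\<^sup>2) \<longlongrightarrow> (norm x)\<^sup>2 - (norm x)\<^sup>2) ?L"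
    by (rule Lim_transform_eventually)
       (use eq in \<open>auto intro!: eventually_finite_subsets_at_top_weakI\<close>)
  from tendsto_real_sqrt[OF this] have "((\<lambda>F. ?s F - x) \<longlongrightarrow> 0) ?L"
    by (simp add: tendsto_norm_zero_iff)
  thus ?thesis unfolding has_sum_def by (rule LIM_zero_cancel)
qed

lemma blinfun_eq_ev:
  fixes A B :: "'i l2 \<Rightarrow>\<^sub>L 'b::real_normed_vector"
  assumes "\<And>i. A (ev i) = B (ev i)"
  shows "A = B"
proof (rule blinfun_eqI)
  fix x
  have "((\<lambda>i. cf x i *\<^sub>R A (ev i)) has_sum A x) UNIV" "((\<lambda>i. cf x i *\<^sub>R A (ev i)) has_sum B x) UNIV"
    using has_sum_bounded_linear[OF blinfun.bounded_linear_right has_sum_ev, of A x]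
      has_sum_bounded_linear[OF blinfun.bounded_linear_right has_sum_ev, of B x]
    by (simp_all add: o_def blinfun.scaleR_right assms)
  thus "A x = B x" by (rule has_sum_unique)
qed

text \<open>Testing \<open>f\<close> on the finite combination \<open>?s\<close> of its own values
  gives |?s|^2 = f(?s) \<le> |f| |?s|. This bounds all partial sums of squares, and hence also the
  norm of the representing vector.\<close>

lemma riesz_l2:
  fixes f :: "'i l2 \<Rightarrow>\<^sub>L real"
  shows "\<exists>y. (\<forall>x. f x = inner x y) \<and> norm y \<le> norm f"
proof -
  have "(\<Sum>i\<in>F. (f (ev i))\<^sup>2) \<le> (norm f)\<^sup>2" if F: "finite F" for F
  proof -
    let ?s = "\<Sum>i\<in>F. (f (ev i)) *\<^sub>R ev i" and ?S = "\<Sum>i\<in>F. (f (ev i))\<^sup>2"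
    have "f ?s = ?S" by (simp add: blinfun.sum_right blinfun.scaleR_right power2_eq_square)
    have "inner ?s ?s = (\<Sum>i\<in>F. f (ev i) * cf ?s i)"
      by (subst inner_sum_left) simp
    also have "\<dots> = ?S"
      using F by (intro sum.cong) (auto simp: cf_sum power2_eq_square if_distrib of_bool_def cong: if_cong)
    finally have n: "(norm ?s)\<^sup>2 = ?S" by (simp add: power2_norm_eq_inner)
    have S0: "?S \<ge> 0" by (simp add: sum_nonneg)
    have "?S \<le> norm f * norm ?s"
      using norm_blinfun[of f ?s] \<open>f ?s = ?S\<close> S0 by simp
    hence "(norm ?s)\<^sup>2 \<le> norm f * norm ?s" by (simp add: n)
    hence "norm ?s \<le> norm f" by (cases "norm ?s = 0") (auto simp: power2_eq_square)
    hence "(norm ?s)\<^sup>2 \<le> (norm f)\<^sup>2" by (intro power_mono) auto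
    thus ?thesis by (simp add: n)
  qed
  note * = l2_of_bounded_sums[of "\<lambda>i. f (ev i)" "norm f", OF this norm_ge_zero]
  define y where "y = Abs_l2 (\<lambda>i. f (ev i))"
  have "f = blinfun_inner_left y"
    by (rule blinfun_eq_ev) (use *(1) in \<open>simp add: y_def inner_commute\<close>)
  hence "f x = inner x y" for x by (simp add: inner_commute)
  thus ?thesis using *(2) y_def by blast
qed

lemma inner_eqI: "u = v" if "\<And>x. inner x u = inner x v" for u v :: "'a::real_inner"
proof -
  have "inner (u - v) (u - v) = 0" using that[of "u - v"] by (simp add: inner_diff_right)
  thus ?thesis by simp
qed

section \<open>Adjoints on real l2\<close>

type_synonym 'i op = "'i l2 \<Rightarrow>\<^sub>L 'i l2"

text \<open>The representing vectors are chosen pointwise by Riesz. Uniqueness makes the choice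
  linear, and the norm bound in \<open>riesz_l2\<close> makes it bounded.\<close>

lemma adj_exists: "\<exists>B :: 'i op. \<forall>x y. inner (blinfun_apply A x) y = inner x (blinfun_apply B y)"
  for A :: "'i op"
proof -
  have "\<exists>z. (\<forall>x. inner (A x) y = inner x z) \<and> norm z \<le> norm y * norm A" for y
  proof -
    obtain z where z: "\<forall>x. (blinfun_inner_left y o\<^sub>L A) x = inner x z" "norm z \<le> norm (blinfun_inner_left y o\<^sub>L A)"
      using riesz_l2 by blast
    have "norm (blinfun_inner_left y) \<le> norm y"
      by (rule norm_blinfun_bound) (auto simp: Cauchy_Schwarz_ineq2 mult.commute)
    hence "norm (blinfun_inner_left y o\<^sub>L A) \<le> norm y * norm A"
      using norm_blinfun_compose[of "blinfun_inner_left y" A] by (meson mult_right_mono norm_ge_zero order_trans)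
    thus ?thesis using z by (intro exI[of _ z]) simp
  qed
  then obtain B where B: "\<And>x y. inner (A x) y = inner x (B y)" "\<And>y. norm (B y) \<le> norm y * norm A"
    by metis
  have "bounded_linear B"
    by (rule bounded_linear_intro[of _ "norm A"]; (rule inner_eqI)?)
       (auto simp: inner_add_right B(1)[symmetric] B(2))
  thus ?thesis using B by (intro exI[of _ "Blinfun B"]) (simp add: bounded_linear_Blinfun_apply)
qed

definition adj :: "'i op \<Rightarrow> 'i op" where
  "adj A = (SOME B. \<forall>x y. inner (blinfun_apply A x) y = inner x (blinfun_apply B y))"

lemma inner_adj: "inner (blinfun_apply A x) y = inner x (adj A y)"
  using someI_ex[OF adj_exists[of A]] unfolding adj_def by blast

lemma inner_adj': "inner (adj A x) y = inner x (blinfun_apply A y)"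
  by (rule trans[OF inner_commute trans[OF inner_adj[symmetric] inner_commute]])

lemma adj_unique:
  assumes "\<And>x y. inner (blinfun_apply A x) y = inner x (blinfun_apply B y)"
  shows "adj A = B"
  by (rule blinfun_eqI, rule inner_eqI) (rule trans[OF inner_adj[symmetric] assms])

lemma adj_adj [simp]: "adj (adj A) = A"
  by (rule adj_unique) (rule inner_adj')

lemma adj_comp: "adj (A o\<^sub>L B) = adj B o\<^sub>L adj A"
  by (rule adj_unique) (simp only: blinfun_apply_blinfun_compose inner_adj)

lemma norm_adj_le: "norm (adj A) \<le> norm A"
proof (rule norm_blinfun_bound)
  fix x
  have "(norm (adj A x))\<^sup>2 = inner (A (adj A x)) x"
    by (simp only: power2_norm_eq_inner inner_adj[of A])
  also have "\<dots> \<le> norm (A (adj A x)) * norm x" by (rule norm_cauchy_schwarz)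
  also have "\<dots> \<le> norm A * norm (adj A x) * norm x"
    by (intro mult_right_mono norm_blinfun) auto
  finally show "norm (adj A x) \<le> norm A * norm x"
    by (cases "norm (adj A x) = 0") (auto simp: power2_eq_square mult_ac)
qed simp

section \<open>Functional calculus of positive operators\<close>

text \<open>Over the reals a nonnegative quadratic form does not force symmetry, so symmetry is a
  conjunct of its own.\<close>

definition pos_op :: "'i op \<Rightarrow> bool" where
  "pos_op A \<longleftrightarrow> (\<forall>x y. inner (blinfun_apply A x) y = inner x (blinfun_apply A y)) \<and>
     (\<forall>x. 0 \<le> inner (blinfun_apply A x) x)"

lemma pos_op_adj_comp: "pos_op (adj T o\<^sub>L T)"
  by (simp add: pos_op_def inner_adj')  (simp add: inner_adj)

lemma blinfun_compose_id_right: "A o\<^sub>L id_blinfun = A"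
  by (rule blinfun_eqI) simp

section \<open>Polynomials of an operator\<close>

definition pol :: "real poly \<Rightarrow> 'i op \<Rightarrow> 'i op" where
  "pol q A = fold_coeffs (\<lambda>c S. c *\<^sub>R id_blinfun + (A o\<^sub>L S)) q 0"

lemma pol_0 [simp]: "pol 0 A = 0"
  by (simp add: pol_def)

lemma pol_pCons: "pol (pCons c q) A = c *\<^sub>R id_blinfun + (A o\<^sub>L pol q A)"
proof (cases "c = 0 \<and> q = 0")
  case True
  thus ?thesis by simp
next
  case False
  thus ?thesis
    by (cases "q = 0") (auto simp: pol_def fold_coeffs_pCons_coeff_not_0_eq fold_coeffs_pCons_not_0_0_eq)
qed

lemma pol_pCons_apply [simp]: "pol (pCons c q) A x = c *\<^sub>R x + A (pol q A x)"
  by (simp add: pol_pCons blinfun.bilinear_simps)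

lemma pol_add: "pol (p + q) A x = pol p A x + pol q A x"
  by (induction p q rule: poly_induct2) (simp_all add: algebra_simps blinfun.bilinear_simps)

lemma pol_smult: "pol (smult a p) A x = a *\<^sub>R pol p A x"
  by (induction p) (simp_all add: algebra_simps blinfun.bilinear_simps)

lemma pol_diff: "pol (p - q) A x = pol p A x - pol q A x"
  using pol_add[of p "smult (- 1) q" A x] pol_smult[of "- 1" q A x] by simp

lemma pol_mult: "pol (p * q) A x = pol p A (pol q A x)"
  by (induction p) (simp_all add: pol_add pol_smult)

lemma pol_commute:
  fixes A B :: "'i op"
  assumes "\<And>x. blinfun_apply B (A x) = A (B x)"
  shows "blinfun_apply B (pol q A x) = pol q A (B x)"
  by (induction q arbitrary: x) (simp_all add: blinfun.bilinear_simps assms)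

lemma pol_self_adjoint:
  fixes A :: "'i op"
  assumes "\<And>x y. inner (blinfun_apply A x) y = inner x (A y)"
  shows "inner (pol q A x) y = inner x (pol q A y)"
  by (induction q arbitrary: x y)
     (simp_all add: inner_add_left inner_add_right assms pol_commute[where B = A and A = A])

text \<open>Settles the degenerate case \<open>norm A = 0\<close>, which the cone argument excludes,
  and is the polynomial case of \<open>fc_kernel\<close>.\<close>

lemma pol_kernel:
  fixes A :: "'i op"
  assumes "blinfun_apply A x = 0"
  shows "pol q A x = poly q 0 *\<^sub>R x"
proof (cases q)
  case (pCons c r)
  have "A (pol r A x) = pol r A (A x)" by (rule pol_commute) simp
  thus ?thesis by (simp add: pCons assms)
qed

section \<open>Polynomials nonnegative on an interval\<close>

text \<open>
  Each generator is visibly positive at a positive operator of norm at most \<open>M\<close>, and for \<open>M > 0\<close> every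
  polynomial that is nonnegative on \<open>[0, M]\<close> lies in the cone.
\<close>

inductive cone :: "real \<Rightarrow> real poly \<Rightarrow> bool" for M where
  sq: "cone M (s * s)"
| t_sq: "cone M ([:0, 1:] * (s * s))"
| Mt_sq: "cone M ([:M, -1:] * (s * s))"
| t_Mt_sq: "cone M ([:0, 1:] * ([:M, -1:] * (s * s)))"
| add: "cone M p \<Longrightarrow> cone M q \<Longrightarrow> cone M (p + q)"

lemma cone_mult_square: "cone M p \<Longrightarrow> cone M (r * r * p)"
proof (induction rule: cone.induct)
  case (sq s)
  show ?case using cone.sq[of M "r * s"] by (simp only: mult_ac)
next
  case (t_sq s)
  show ?case using cone.t_sq[of M "r * s"] by (simp only: mult_ac)
next
  case (Mt_sq s)
  show ?case using cone.Mt_sq[of M "r * s"] by (simp only: mult_ac)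
next
  case (t_Mt_sq s)
  show ?case using cone.t_Mt_sq[of M "r * s"] by (simp only: mult_ac)
next
  case (add p q)
  thus ?case by (simp only: distrib_left cone.add)
qed

text \<open>A repeated factor t is absorbed into the square, so the four types of generator are
  permuted; multiplication by M - t works in the same way.\<close>

lemma cone_mult_t: "cone M p \<Longrightarrow> cone M ([:0, 1:] * p)"
proof (induction rule: cone.induct)
  case (sq s)
  show ?case by (rule cone.t_sq)
next
  case (t_sq s)
  show ?case using cone.sq[of M "[:0, 1:] * s"] by (simp only: mult_ac)
next
  case (Mt_sq s)
  show ?case by (rule cone.t_Mt_sq)
next
  case (t_Mt_sq s)
  show ?case using cone.Mt_sq[of M "[:0, 1:] * s"] by (simp only: mult_ac)
next
  case (add p q)
  thus ?case by (simp only: distrib_left cone.add)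
qed

lemma cone_mult_Mt: "cone M p \<Longrightarrow> cone M ([:M, -1:] * p)"
proof (induction rule: cone.induct)
  case (sq s)
  show ?case by (rule cone.Mt_sq)
next
  case (t_sq s)
  show ?case using cone.t_Mt_sq[of M s] by (simp only: mult_ac)
next
  case (Mt_sq s)
  show ?case using cone.sq[of M "[:M, -1:] * s"] by (simp only: mult_ac)
next
  case (t_Mt_sq s)
  show ?case using cone.t_sq[of M "[:M, -1:] * s"] by (simp only: mult_ac)
next
  case (add p q)
  thus ?case by (simp only: distrib_left cone.add)
qed

lemma cone_smult:
  assumes "cone M p" "c \<ge> 0"
  shows "cone M (smult c p)"
  using cone_mult_square[OF assms(1), of "[:sqrt c:]"] assms(2) by simp

text \<open>Dividing by t - c loses the sign exactly at c. Continuity restores it, since no point of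
  a nondegenerate interval is isolated.\<close>

lemma poly_nonneg_extend:
  fixes r :: "real poly"
  assumes lu: "l < u" and nn: "\<And>t. l \<le> t \<Longrightarrow> t \<le> u \<Longrightarrow> t \<noteq> c \<Longrightarrow> 0 \<le> poly r t"
    and t: "l \<le> t" "t \<le> u"
  shows "0 \<le> poly r t"
proof (cases "t = c")
  case True
  have "t islimpt {l..u}"
    using lu t by (simp add: islimpt_Icc)
  hence nb: "at t within {l..u} \<noteq> bot" by (simp add: trivial_limit_within)
  have "(poly r \<longlongrightarrow> poly r t) (at t within {l..u})"
    by (intro tendsto_intros)
  moreover have "\<forall>\<^sub>F s in at t within {l..u}. 0 \<le> poly r s"
    using nn True by (auto simp: eventually_at_filter)
  ultimately show ?thesis using tendsto_lowerbound nb by blast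
qed (use nn t in auto)

lemma poly_map_of_real_add:
  "poly (map_poly complex_of_real (p + q)) z =
     poly (map_poly complex_of_real p) z + poly (map_poly complex_of_real q) z"
  by (induction p q rule: poly_induct2) (simp_all add: map_poly_pCons algebra_simps)

lemma poly_map_of_real_smult:
  "poly (map_poly complex_of_real (smult a p)) z = of_real a * poly (map_poly complex_of_real p) z"
  by (induction p) (simp_all add: map_poly_pCons algebra_simps)

lemma poly_map_of_real_mult:
  "poly (map_poly complex_of_real (p * q)) z =
     poly (map_poly complex_of_real p) z * poly (map_poly complex_of_real q) z"
  by (induction p)
     (simp_all add: map_poly_pCons poly_map_of_real_add poly_map_of_real_smult algebra_simps)

lemma poly_map_of_real_of_real:
  "poly (map_poly complex_of_real p) (of_real a) = of_real (poly p a)"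
  by (induction p) (simp_all add: map_poly_pCons)

text \<open>The Markov-Lukacs representation, by induction on the degree: a root of the complexified
  polynomial is split off, and the kind of root decides which operation of the cone restores the
  factor.\<close>

lemma cone_if_nonneg:
  assumes "M > 0" "\<And>t. 0 \<le> t \<Longrightarrow> t \<le> M \<Longrightarrow> 0 \<le> poly q t"
  shows "cone M q"
  using assms(2)
proof (induction "degree q" arbitrary: q rule: less_induct)
  case less
  show ?case
  proof (cases "degree q = 0")
    case True
    then obtain c where c: "q = [:c:]" by (metis degree_eq_zeroE)
    hence "c \<ge> 0" using less.prems[of 0] \<open>M > 0\<close> by simp
    thus ?thesis using cone_smult[OF cone.sq[of M 1], of c] by (simp add: c one_pCons)
  next
    case False
    let ?Q = "map_poly complex_of_real q"
    have "\<not> constant (poly ?Q)"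
      using False by (simp add: constant_degree degree_map_poly)
    then obtain z where z: "poly ?Q z = 0" using fundamental_theorem_of_algebra by blast
    have q0: "q \<noteq> 0" using False by auto
    show ?thesis
    proof (cases "Im z = 0")
      case False
      \<comment> \<open>The real quadratic with roots \<open>z\<close> and its conjugate. A
        remainder a + b t that vanishes at a non-real point is zero, so \<open>d\<close> divides
        \<open>q\<close>.\<close>
      define d where "d = [:(Re z)\<^sup>2 + (Im z)\<^sup>2, - 2 * Re z, 1:]"
      have dz: "poly (map_poly complex_of_real d) z = 0"
        by (simp add: d_def map_poly_pCons complex_eq_iff power2_eq_square algebra_simps)
      have d0: "d \<noteq> 0" "degree d = 2" by (auto simp: d_def)
      define r where "r = q mod d"
      have dr: "degree r < 2" using degree_mod_less[OF d0(1), of q] d0 by (auto simp: r_def)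
      have qeq: "q = q div d * d + r" by (simp add: r_def)
      have "poly ?Q z = poly (map_poly complex_of_real (q div d)) z * poly (map_poly complex_of_real d) z
          + poly (map_poly complex_of_real r) z"
        by (subst qeq) (simp only: poly_map_of_real_add poly_map_of_real_mult)
      hence rz: "poly (map_poly complex_of_real r) z = 0" using z dz by simp
      obtain a b where ab: "r = [:a, b:]"
      proof -
        have "r = [:coeff r 0, coeff r 1:]"
          using dr by (intro poly_eqI) (auto simp: coeff_pCons coeff_eq_0 split: nat.splits)
        thus ?thesis using that by blast
      qed
      have "b = 0" "a = 0" using rz False by (auto simp: ab map_poly_pCons complex_eq_iff)
      hence qd: "q = d * (q div d)" using qeq ab by (simp add: mult.commute)
      let ?k = "q div d"
      have dpos: "poly d t > 0" for t
      proof -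
        have "poly d t = (t - Re z)\<^sup>2 + (Im z)\<^sup>2" by (simp add: d_def power2_eq_square algebra_simps)
        thus ?thesis using False by (simp add: add_nonneg_pos)
      qed
      have "cone M ?k"
      proof (rule less.hyps)
        have "?k \<noteq> 0" using qd q0 by auto
        thus "degree ?k < degree q" using degree_mult_eq[OF d0(1), of ?k] qd d0 by simp
        fix t assume "0 \<le> t" "t \<le> M"
        hence "0 \<le> poly d t * poly ?k t" using less.prems[of t] qd by (metis poly_mult)
        thus "0 \<le> poly ?k t" using dpos[of t] by (simp add: zero_le_mult_iff)
      qed
      \<comment> \<open>As a sum of two squares, (t - Re z)^2 + (Im z)^2, the factor
        \<open>d\<close> keeps polynomials in the cone.\<close>
      hence "cone M ([:- Re z, 1:] * [:- Re z, 1:] * ?k + [:Im z:] * [:Im z:] * ?k)"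
        by (intro cone.add cone_mult_square)
      moreover have "[:- Re z, 1:] * [:- Re z, 1:] + [:Im z:] * [:Im z:] = d"
        by (simp add: d_def power2_eq_square)
      ultimately show ?thesis using qd by (metis distrib_right)
    next
      case True
      define a where "a = Re z"
      have za: "z = of_real a" using True by (simp add: a_def complex_eq_iff)
      have "poly q a = 0"
        using z unfolding za by (simp add: poly_map_of_real_of_real)
      then obtain r where r: "q = [:-a, 1:] * r" by (metis poly_eq_0_iff_dvd dvd_def)
      have r0: "r \<noteq> 0" using r q0 by auto
      have degr: "degree r < degree q" unfolding r by (subst degree_mult_eq) (use r0 in auto)
      have pq: "poly q t = (t - a) * poly r t" for t by (simp add: r algebra_simps)
      \<comment> \<open>A root at or left of 0 gives the factor t + (- a), one at or right of M
        gives (M - t) + (a - M) after a change of sign. An interior root calls for a second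
        division.\<close>
      consider "a \<le> 0" | "a \<ge> M" | "0 < a" "a < M" by linarith
      thus ?thesis
      proof cases
        case 1
        have nn: "0 \<le> poly r t" if "0 \<le> t" "t \<le> M" "t \<noteq> 0" for t
          using less.prems[of t] that 1 by (simp add: pq zero_le_mult_iff)
        have "cone M r"
          by (rule less.hyps[OF degr]) (rule poly_nonneg_extend[OF assms(1) nn])
        hence "cone M ([:0, 1:] * r + smult (- a) r)"
          using 1 by (intro cone.add cone_mult_t cone_smult) auto
        moreover have "[:0, 1:] * r + smult (- a) r = q"
          by (simp add: r)
        ultimately show ?thesis by simp
      next
        case 2
        have nn: "0 \<le> poly (- r) t" if "0 \<le> t" "t \<le> M" "t \<noteq> M" for t
          using less.prems[of t] that 2 by (simp add: pq zero_le_mult_iff)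
        have "cone M (- r)"
          by (rule less.hyps) (use degr poly_nonneg_extend[OF assms(1) nn] in auto)
        hence "cone M ([:M, -1:] * (- r) + smult (a - M) (- r))"
          using 2 by (intro cone.add cone_mult_Mt cone_smult) auto
        moreover have "[:M, -1:] * (- r) + smult (a - M) (- r) = q"
          by (simp add: r smult_diff_left)
        ultimately show ?thesis by simp
      next
        case 3
        have 31: "0 \<le> poly r t" if "a \<le> t" "t \<le> M" "t \<noteq> a" for t
          using less.prems[of t] that 3 by (simp add: pq zero_le_mult_iff)
        have 32: "0 \<le> poly (- r) t" if "0 \<le> t" "t \<le> a" "t \<noteq> a" for t
          using less.prems[of t] that 3 by (simp add: pq zero_le_mult_iff)
        \<comment> \<open>The quotient is nonnegative to the right of the root and nonpositive to
          the left, so it vanishes there: an interior root has even multiplicity.\<close>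
        have "poly r a = 0"
          using poly_nonneg_extend[OF 3(2) 31, where t = a] poly_nonneg_extend[OF 3(1) 32, where t = a] 3
          by (intro order_antisym) auto
        then obtain s where s: "r = [:-a, 1:] * s" by (metis poly_eq_0_iff_dvd dvd_def)
        have s0: "s \<noteq> 0" using s r0 by auto
        have degs: "degree s < degree q"
        proof -
          have "degree s < degree r" unfolding s by (subst degree_mult_eq) (use s0 in auto)
          thus ?thesis using degr by simp
        qed
        have trace_sum: "poly q t = (t - a)\<^sup>2 * poly s t" for t
          by (simp add: r s power2_eq_square algebra_simps)
        have nn: "0 \<le> poly s t" if "0 \<le> t" "t \<le> M" "t \<noteq> a" for t
          using less.prems[of t] that by (simp add: trace_sum zero_le_mult_iff)
        have "cone M s"
          by (rule less.hyps[OF degs]) (rule poly_nonneg_extend[OF assms(1) nn])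
        hence "cone M ([:-a, 1:] * [:-a, 1:] * s)" by (rule cone_mult_square)
        moreover have "[:-a, 1:] * [:-a, 1:] * s = q" by (simp only: r s mult.assoc)
        ultimately show ?thesis by simp
      qed
    qed
  qed
qed

text \<open>Because s(A) is symmetric and commutes with A, every generator becomes a quadratic form
  at s(A) x. That M - A is nonnegative is Cauchy-Schwarz together with
  \<open>norm A \<le> M\<close>.\<close>

lemma pol_cone_nonneg:
  assumes A: "pos_op A" "norm A \<le> M" "M > 0" and c: "cone M q"
  shows "0 \<le> inner (pol q A x) x"
proof -
  have sa: "inner (A x) y = inner x (A y)" for x y using A(1) by (simp add: pos_op_def)
  have trace_sum: "0 \<le> inner (A x) x" for x using A(1) unfolding pos_op_def by blast
  have le: "inner (A y) y \<le> M * inner y y" for y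
  proof -
    have "inner (A y) y \<le> norm (A y) * norm y" by (rule norm_cauchy_schwarz)
    also have "\<dots> \<le> (M * norm y) * norm y"
      using order_trans[OF norm_blinfun[of A y] mult_right_mono[OF A(2) norm_ge_zero]]
      by (intro mult_right_mono) auto
    finally show ?thesis by (simp add: power2_norm_eq_inner[symmetric] power2_eq_square mult.assoc)
  qed
  note psa = pol_self_adjoint[OF sa]
  have comm: "A (pol s A x) = pol s A (A x)" for s x by (rule pol_commute) simp
  from c show ?thesis
  proof (induction)
    case (sq s)
    have "inner (pol s A (pol s A x)) x = inner (pol s A x) (pol s A x)" by (rule psa)
    thus ?case by (simp add: pol_mult)
  next
    case (t_sq s)
    have "inner (A (pol s A (pol s A x))) x = inner (A (pol s A x)) (pol s A x)"
      by (simp only: comm psa)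
    thus ?case using trace_sum[of "pol s A x"] by (simp add: pol_mult)
  next
    case (Mt_sq s)
    let ?y = "pol s A x"
    have "inner (A (pol s A ?y)) x = inner (A ?y) ?y"
      by (simp only: comm psa)
    moreover have "inner (pol s A ?y) x = inner ?y ?y" by (simp add: psa)
    ultimately show ?case using le[of ?y]
      by (simp only: pol_mult) (simp add: inner_diff_left blinfun.bilinear_simps)
  next
    case (t_Mt_sq s)
    let ?y = "pol s A x"
    let ?D = "\<lambda>v. M *\<^sub>R v - A v"
    have D: "0 \<le> inner (?D v) v" for v using le[of v] by (simp add: inner_diff_left)
    \<comment> \<open>The product of the commuting positive operators A and M - A is treated without
      square roots: M t (M - t) = (M - t) t^2 + t (M - t)^2, and each term is a positive form at one
      vector.\<close>
    have "M * inner (A (?D ?y)) ?y = inner (?D (A ?y)) (A ?y) + inner (A (?D ?y)) (?D ?y)"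
      by (simp add: inner_diff_left inner_diff_right blinfun.bilinear_simps sa algebra_simps)
    also have "\<dots> \<ge> 0" using D[of "A ?y"] trace_sum[of "?D ?y"] by simp
    finally have *: "0 \<le> inner (A (?D ?y)) ?y" using A(3) by (simp add: zero_le_mult_iff)
    have 1: "A (pol s A v) = pol s A (A v)" for v by (rule comm)
    have "?D (pol s A ?y) = pol s A (?D ?y)"
      by (simp add: comm blinfun.bilinear_simps)
    hence "inner (A (?D (pol s A ?y))) x = inner (A (?D ?y)) ?y"
      by (simp only: comm psa)
    with * show ?case by (simp only: pol_mult) (simp add: blinfun.bilinear_simps)
  next
    case (add p q)
    thus ?case by (simp add: pol_add inner_add_left)
  qed
qed

text \<open>This takes the place of the spectral theorem: positivity on [0, |A|] passes to the
  operator through the cone, and all later estimates for functions of A rest on it.\<close>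

lemma pol_nonneg:
  assumes A: "pos_op A" and q: "\<And>t. 0 \<le> t \<Longrightarrow> t \<le> norm A \<Longrightarrow> 0 \<le> poly q t"
  shows "0 \<le> inner (pol q A x) x"
proof (cases "norm A = 0")
  case True
  hence "pol q A x = poly q 0 *\<^sub>R x" by (intro pol_kernel) simp
  thus ?thesis using q[of 0] by simp
next
  case False
  thus ?thesis using A q by (intro pol_cone_nonneg[of A "norm A"] cone_if_nonneg) auto
qed

text \<open>Positivity applied to c^2 - q^2: by symmetry of q(A) its form at x is c^2 |x|^2 - |q(A)
  x|^2.\<close>

lemma norm_pol_le:
  assumes A: "pos_op A" and q: "\<And>t. 0 \<le> t \<Longrightarrow> t \<le> norm A \<Longrightarrow> \<bar>poly q t\<bar> \<le> c"
  shows "norm (pol q A) \<le> c"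
proof -
  have c0: "c \<ge> 0" using q[of 0] by (smt (verit) norm_ge_zero)
  have "norm (pol q A x) \<le> c * norm x" for x
  proof (rule power2_le_imp_le)
    have "0 \<le> inner (pol ([:c * c:] - q * q) A x) x"
    proof (rule pol_nonneg[OF A])
      fix t assume "0 \<le> t" "t \<le> norm A"
      hence "\<bar>poly q t\<bar>\<^sup>2 \<le> c\<^sup>2" using q by (intro power_mono) auto
      thus "0 \<le> poly ([:c * c:] - q * q) t" by (simp add: power2_eq_square)
    qed
    moreover have "inner (pol q A (pol q A x)) x = inner (pol q A x) (pol q A x)"
      by (rule pol_self_adjoint) (use A in \<open>simp add: pos_op_def\<close>)
    ultimately show "(norm (pol q A x))\<^sup>2 \<le> (c * norm x)\<^sup>2"
      by (simp add: pol_diff pol_mult inner_diff_left power_mult_distrib power2_norm_eq_inner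
          power2_eq_square[of c] blinfun.bilinear_simps)
  qed (use c0 in simp)
  thus ?thesis using c0 by (intro norm_blinfun_bound) auto
qed

section \<open>Continuous functions of a positive operator\<close>

abbreviation approx :: "real \<Rightarrow> (nat \<Rightarrow> real poly) \<Rightarrow> (real \<Rightarrow> real) \<Rightarrow> bool" where
  "approx M q f \<equiv> uniform_limit {0..M} (\<lambda>n t. poly (q n) t) f sequentially"

lemma approx_exists:
  assumes "continuous_on {0..M} f"
  shows "\<exists>q. approx M q f"
proof -
  have "\<exists>q. \<forall>t\<in>{0..M}. \<bar>f t - poly q t\<bar> < inverse (real (Suc n))" for n
  proof -
    obtain g where g: "real_polynomial_function g" "\<And>x. x \<in> {0..M} \<Longrightarrow> \<bar>f x - g x\<bar> < inverse (real (Suc n))"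
      using Stone_Weierstrass_real_polynomial_function[OF compact_Icc assms, of "inverse (real (Suc n))"]
      by auto
    then obtain a m where "g = (\<lambda>x. \<Sum>i\<le>m. a i * x ^ i)"
      unfolding real_polynomial_function_iff_sum by blast
    hence "g x = poly (\<Sum>i\<le>m. monom (a i) i) x" for x by (simp add: poly_sum poly_monom)
    thus ?thesis using g(2) by (intro exI[of _ "\<Sum>i\<le>m. monom (a i) i"]) simp
  qed
  then obtain q where q: "\<And>n t. t \<in> {0..M} \<Longrightarrow> \<bar>f t - poly (q n) t\<bar> < inverse (real (Suc n))" by metis
  have "approx M q f"
  proof (rule uniform_limitI)
    fix e :: real assume "e > 0"
    then obtain N where N: "inverse (real (Suc N)) < e" using reals_Archimedean by blast
    have "dist (poly (q n) t) (f t) < e" if "n \<ge> N" "t \<in> {0..M}" for n t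
    proof -
      have "inverse (real (Suc n)) \<le> inverse (real (Suc N))" using that by simp
      also have "\<dots> < e" by (rule N)
      finally show ?thesis using q[OF that(2), of n] unfolding dist_real_def by linarith
    qed
    thus "\<forall>\<^sub>F n in sequentially. \<forall>x\<in>{0..M}. dist (poly (q n) x) (f x) < e"
      unfolding eventually_sequentially by blast
  qed
  thus ?thesis by blast
qed

text \<open>Comparing two approximating sequences at once yields both convergence and independence
  of the sequence.\<close>

lemma pol_Cauchy_aux:
  assumes A: "pos_op A" and q: "approx (norm A) q f" "approx (norm A) q' f" and e: "e > 0"
  shows "\<exists>N. \<forall>m\<ge>N. \<forall>n\<ge>N. norm (pol (q m) A - pol (q' n) A) \<le> e"
proof -
  obtain N where N: "\<And>n t. n \<ge> N \<Longrightarrow> t \<in> {0..norm A} \<Longrightarrow> dist (poly (q n) t) (f t) < e / 2"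
    using q(1) e unfolding uniform_limit_sequentially_iff by (meson half_gt_zero)
  obtain N' where N': "\<And>n t. n \<ge> N' \<Longrightarrow> t \<in> {0..norm A} \<Longrightarrow> dist (poly (q' n) t) (f t) < e / 2"
    using q(2) e unfolding uniform_limit_sequentially_iff by (meson half_gt_zero)
  have "norm (pol (q m) A - pol (q' n) A) \<le> e" if "m \<ge> max N N'" "n \<ge> max N N'" for m n
  proof -
    have "pol (q m) A - pol (q' n) A = pol (q m - q' n) A"
      by (rule blinfun_eqI) (simp add: pol_diff blinfun.bilinear_simps)
    moreover have "norm (pol (q m - q' n) A) \<le> e"
    proof (rule norm_pol_le[OF A])
      fix t assume "0 \<le> t" "t \<le> norm A"
      hence "dist (poly (q m) t) (f t) < e / 2" "dist (poly (q' n) t) (f t) < e / 2"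
        using N N' that by auto
      thus "\<bar>poly (q m - q' n) t\<bar> \<le> e" unfolding poly_diff dist_real_def by linarith
    qed
    ultimately show ?thesis by simp
  qed
  thus ?thesis by blast
qed

definition fc :: "(real \<Rightarrow> real) \<Rightarrow> 'i op \<Rightarrow> 'i op" where
  "fc f A = lim (\<lambda>n. pol ((SOME q. approx (norm A) q f) n) A)"

lemma fc_tendsto:
  assumes A: "pos_op A" and q: "approx (norm A) q f"
  shows "(\<lambda>n. pol (q n) A) \<longlonglongrightarrow> fc f A"
proof -
  define p where "p = (SOME q. approx (norm A) q f)"
  have p: "approx (norm A) p f" unfolding p_def by (rule someI[of "\<lambda>q. approx (norm A) q f"]) (rule q)
  have "Cauchy (\<lambda>n. pol (p n) A)"
  proof (rule CauchyI)
    fix e :: real assume "e > 0"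
    then obtain N where N: "\<forall>m\<ge>N. \<forall>n\<ge>N. norm (pol (p m) A - pol (p n) A) \<le> e / 2"
      using pol_Cauchy_aux[OF A p p, of "e / 2"] by auto
    show "\<exists>M. \<forall>m\<ge>M. \<forall>n\<ge>M. norm (pol (p m) A - pol (p n) A) < e"
      using \<open>e > 0\<close> by (intro exI[of _ N]) (use N in force)
  qed
  hence lp: "(\<lambda>n. pol (p n) A) \<longlonglongrightarrow> fc f A"
    unfolding fc_def p_def[symmetric] by (simp add: Cauchy_convergent_iff convergent_LIMSEQ_iff)
  have "(\<lambda>n. pol (q n) A - pol (p n) A) \<longlonglongrightarrow> 0"
  proof (rule LIMSEQ_I)
    fix r :: real assume r: "r > 0"
    obtain N where "\<forall>m\<ge>N. \<forall>n\<ge>N. norm (pol (q m) A - pol (p n) A) \<le> r / 2"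
      using pol_Cauchy_aux[OF A q p, of "r / 2"] r by auto
    thus "\<exists>no. \<forall>n\<ge>no. norm (pol (q n) A - pol (p n) A - 0) < r"
      using r by (intro exI[of _ N]) force
  qed
  from tendsto_add[OF this lp] show ?thesis by simp
qed

lemma fc_obtain:
  assumes "pos_op A" "continuous_on {0..norm A} f"
  obtains q where "approx (norm A) q f" "(\<lambda>n. pol (q n) A) \<longlonglongrightarrow> fc f A"
    "\<And>x. (\<lambda>n. pol (q n) A x) \<longlonglongrightarrow> fc f A x"
proof -
  obtain q where q: "approx (norm A) q f" using approx_exists[OF assms(2)] by blast
  have "(\<lambda>n. pol (q n) A x) \<longlonglongrightarrow> fc f A x" for x
    using fc_tendsto[OF assms(1) q] by (intro tendsto_intros)
  thus ?thesis using that fc_tendsto[OF assms(1) q] q by blast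
qed

lemma fc_unique:
  assumes "pos_op A" "approx (norm A) q f" "(\<lambda>n. pol (q n) A) \<longlonglongrightarrow> S"
  shows "fc f A = S"
  using LIMSEQ_unique fc_tendsto[OF assms(1,2)] assms(3) by blast

lemma fc_poly: "pos_op A \<Longrightarrow> fc (poly q) A = pol q A"
  by (rule fc_unique[of _ "\<lambda>_. q"]) (auto simp: uniform_limit_const)

lemma fc_cong:
  assumes "\<And>t. 0 \<le> t \<Longrightarrow> t \<le> norm A \<Longrightarrow> f t = g t"
  shows "fc f A = fc g A"
proof -
  have "approx (norm A) q f \<longleftrightarrow> approx (norm A) q g" for q
    by (rule uniform_limit_cong') (use assms in auto)
  thus ?thesis by (simp add: fc_def)
qed

lemma fc_const: "pos_op A \<Longrightarrow> fc (\<lambda>_. c) A = c *\<^sub>R id_blinfun"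
  using fc_poly[of A "[:c:]"] fc_cong[of A "\<lambda>_. c" "poly [:c:]"]
  by (simp add: pol_pCons)

lemma fc_ident: "pos_op A \<Longrightarrow> fc (\<lambda>t. t) A = A"
  using fc_poly[of A "[:0, 1:]"] fc_cong[of A "\<lambda>t. t" "poly [:0, 1:]"]
  by (simp add: pol_pCons blinfun_compose_id_right)

lemma fc_add:
  assumes A: "pos_op A" and f: "continuous_on {0..norm A} f" and g: "continuous_on {0..norm A} g"
  shows "fc (\<lambda>t. f t + g t) A = fc f A + fc g A"
proof -
  obtain p where p: "approx (norm A) p f" "(\<lambda>n. pol (p n) A) \<longlonglongrightarrow> fc f A" using fc_obtain[OF A f] by blast
  obtain q where q: "approx (norm A) q g" "(\<lambda>n. pol (q n) A) \<longlonglongrightarrow> fc g A" using fc_obtain[OF A g] by blast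
  have eq: "pol (p n + q n) A = pol (p n) A + pol (q n) A" for n
    by (rule blinfun_eqI) (simp add: pol_add blinfun.bilinear_simps)
  show ?thesis
    by (rule fc_unique[OF A, of "\<lambda>n. p n + q n"])
       (use p q in \<open>auto simp: eq intro!: uniform_limit_add tendsto_add\<close>)
qed

lemma fc_mult:
  assumes A: "pos_op A" and f: "continuous_on {0..norm A} f" and g: "continuous_on {0..norm A} g"
  shows "fc (\<lambda>t. f t * g t) A = fc f A o\<^sub>L fc g A"
proof -
  obtain p where p: "approx (norm A) p f" "(\<lambda>n. pol (p n) A) \<longlonglongrightarrow> fc f A" using fc_obtain[OF A f] by blast
  obtain q where q: "approx (norm A) q g" "(\<lambda>n. pol (q n) A) \<longlonglongrightarrow> fc g A" using fc_obtain[OF A g] by blast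
  have eq: "pol (p n * q n) A = pol (p n) A o\<^sub>L pol (q n) A" for n
    by (rule blinfun_eqI) (simp add: pol_mult)
  have "bounded (f ` {0..norm A})" "bounded (g ` {0..norm A})"
    using compact_continuous_image[OF f] compact_continuous_image[OF g] by (auto intro: compact_imp_bounded)
  hence "approx (norm A) (\<lambda>n. p n * q n) (\<lambda>t. f t * g t)"
    using uniform_lim_mult[OF p(1) q(1)] by simp
  moreover have "(\<lambda>n. pol (p n * q n) A) \<longlonglongrightarrow> (fc f A o\<^sub>L fc g A)"
    unfolding eq by (rule bounded_bilinear.tendsto[OF bounded_bilinear_blinfun_compose p(2) q(2)])
  ultimately show ?thesis by (rule fc_unique[OF A])
qed

lemma fc_cmult:
  assumes A: "pos_op A" and f: "continuous_on {0..norm A} f"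
  shows "fc (\<lambda>t. c * f t) A = c *\<^sub>R fc f A"
  using fc_mult[OF A continuous_on_const f, of c]
  by (simp add: fc_const[OF A]) (auto intro!: blinfun_eqI simp: blinfun.bilinear_simps)

lemma fc_self_adjoint:
  assumes A: "pos_op A" and f: "continuous_on {0..norm A} f"
  shows "inner (fc f A x) y = inner x (fc f A y)"
proof -
  obtain p where p: "\<And>x. (\<lambda>n. pol (p n) A x) \<longlonglongrightarrow> fc f A x" using fc_obtain[OF A f] by blast
  have "inner (pol (p n) A x) y = inner x (pol (p n) A y)" for n
    by (rule pol_self_adjoint) (use A in \<open>simp add: pos_op_def\<close>)
  moreover have "(\<lambda>n. inner (pol (p n) A x) y) \<longlonglongrightarrow> inner (fc f A x) y"
    "(\<lambda>n. inner x (pol (p n) A y)) \<longlonglongrightarrow> inner x (fc f A y)"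
    by (intro tendsto_intros p)+
  ultimately show ?thesis using LIMSEQ_unique by auto
qed

lemma fc_nonneg:
  assumes A: "pos_op A" and f: "continuous_on {0..norm A} f" and nn: "\<And>t. 0 \<le> t \<Longrightarrow> t \<le> norm A \<Longrightarrow> 0 \<le> f t"
  shows "0 \<le> inner (fc f A x) x"
proof -
  obtain p where p: "approx (norm A) p f" "\<And>x. (\<lambda>n. pol (p n) A x) \<longlonglongrightarrow> fc f A x" using fc_obtain[OF A f] by blast
  have lim: "(\<lambda>n. inner (pol (p n) A x) x) \<longlonglongrightarrow> inner (fc f A x) x"
    by (intro tendsto_intros p)
  \<comment> \<open>Approximants of a nonnegative function may dip below zero; adding the constant e
    repairs this at the cost of e |x|^2, and e tends to 0 at the end.\<close>
  have "- e * inner x x \<le> inner (fc f A x) x" if e: "e > 0" for e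
  proof (rule LIMSEQ_le_const[OF lim])
    obtain N where N: "\<And>n t. n \<ge> N \<Longrightarrow> t \<in> {0..norm A} \<Longrightarrow> dist (poly (p n) t) (f t) < e"
      using p(1) e unfolding uniform_limit_sequentially_iff by meson
    have "- e * inner x x \<le> inner (pol (p n) A x) x" if "n \<ge> N" for n
    proof -
      have "0 \<le> inner (pol (p n + [:e:]) A x) x"
      proof (rule pol_nonneg[OF A])
        fix t assume t: "0 \<le> t" "t \<le> norm A"
        hence "dist (poly (p n) t) (f t) < e" using N that by simp
        thus "0 \<le> poly (p n + [:e:]) t" using nn[OF t] by (simp add: dist_real_def)
      qed
      thus ?thesis by (simp add: pol_add inner_add_left)
    qed
    thus "\<exists>N. \<forall>n\<ge>N. - e * inner x x \<le> inner (pol (p n) A x) x" by blast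
  qed
  hence *: "- inner (fc f A x) x \<le> e * inner x x" if "e > 0" for e using that by (simp add: minus_le_iff)
  have "- inner (fc f A x) x \<le> 0 * inner x x"
  proof (rule tendsto_lowerbound)
    show "((\<lambda>e. e * inner x x) \<longlongrightarrow> 0 * inner x x) (at_right 0)" by (intro tendsto_intros)
    show "\<forall>\<^sub>F e in at_right 0. - inner (fc f A x) x \<le> e * inner x x"
      using * by (auto simp: eventually_at_filter)
  qed simp
  thus ?thesis by simp
qed

lemma fc_mono:
  assumes A: "pos_op A" and f: "continuous_on {0..norm A} f" and g: "continuous_on {0..norm A} g"
    and le: "\<And>t. 0 \<le> t \<Longrightarrow> t \<le> norm A \<Longrightarrow> f t \<le> g t"
  shows "inner (fc f A x) x \<le> inner (fc g A x) x"
proof -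
  have m: "continuous_on {0..norm A} (\<lambda>t. (- 1) * f t)" by (intro continuous_intros f)
  have c: "continuous_on {0..norm A} (\<lambda>t. g t + (- 1) * f t)" by (intro continuous_intros f g)
  have "0 \<le> inner (fc (\<lambda>t. g t + (- 1) * f t) A x) x"
    by (rule fc_nonneg[OF A c]) (use le in simp)
  thus ?thesis
    by (simp only: fc_add[OF A g m] fc_cmult[OF A f]) (simp add: blinfun.bilinear_simps inner_diff_left)
qed

lemma norm_fc_apply_le:
  assumes A: "pos_op A" and f: "continuous_on {0..norm A} f"
    and le: "\<And>t. 0 \<le> t \<Longrightarrow> t \<le> norm A \<Longrightarrow> \<bar>f t\<bar> \<le> c"
  shows "norm (fc f A x) \<le> c * norm x"
proof (rule power2_le_imp_le)
  have c0: "c \<ge> 0" using le[of 0] by (smt (verit) norm_ge_zero)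
  have ff: "continuous_on {0..norm A} (\<lambda>t. f t * f t)" by (intro continuous_intros f)
  have "(norm (fc f A x))\<^sup>2 = inner (fc (\<lambda>t. f t * f t) A x) x"
    by (simp add: power2_norm_eq_inner fc_self_adjoint[OF A f] fc_mult[OF A f f] inner_commute)
  also have "\<dots> \<le> inner (fc (\<lambda>t. c * c) A x) x"
  proof (rule fc_mono[OF A ff])
    fix t assume "0 \<le> t" "t \<le> norm A"
    hence "\<bar>f t\<bar>\<^sup>2 \<le> c\<^sup>2" using le by (intro power_mono) auto
    thus "f t * f t \<le> c * c" by (simp add: power2_eq_square)
  qed (intro continuous_intros)
  also have "\<dots> = (c * norm x)\<^sup>2"
    by (simp add: fc_const[OF A] blinfun.bilinear_simps power2_norm_eq_inner power_mult_distrib power2_eq_square[of c])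
  finally show "(norm (fc f A x))\<^sup>2 \<le> (c * norm x)\<^sup>2" .
  show "0 \<le> c * norm x" using c0 by simp
qed

text \<open>Later \<open>B\<close> is multiplication by i or the projection onto the embedded
  Hilbert space; this is how f(A) inherits complex linearity and compatibility with the
  embedding.\<close>

lemma fc_commute:
  fixes A B :: "'i op"
  assumes A: "pos_op A" and f: "continuous_on {0..norm A} f"
    and c: "\<And>x. blinfun_apply B (A x) = A (B x)"
  shows "blinfun_apply B (fc f A x) = fc f A (B x)"
proof -
  obtain p where p: "\<And>x. (\<lambda>n. pol (p n) A x) \<longlonglongrightarrow> fc f A x" using fc_obtain[OF A f] by blast
  have "(\<lambda>n. blinfun_apply B (pol (p n) A x)) \<longlonglongrightarrow> blinfun_apply B (fc f A x)"
    by (intro tendsto_intros p)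
  thus ?thesis using LIMSEQ_unique p[of "B x"] by (simp add: pol_commute[OF c])
qed

text \<open>On its kernel A acts as the number 0, so f(A) acts as f(0). It is applied to vectors
  orthogonal to the embedded Hilbert space, which transferred operators annihilate.\<close>

lemma fc_kernel:
  fixes A :: "'i op"
  assumes A: "pos_op A" and f: "continuous_on {0..norm A} f" and x: "blinfun_apply A x = 0"
  shows "fc f A x = f 0 *\<^sub>R x"
proof -
  obtain p where p: "approx (norm A) p f" "\<And>x. (\<lambda>n. pol (p n) A x) \<longlonglongrightarrow> fc f A x" using fc_obtain[OF A f] by blast
  have "(\<lambda>n. poly (p n) 0) \<longlonglongrightarrow> f 0"
    using tendsto_uniform_limitI[OF p(1)] by simp
  hence "(\<lambda>n. poly (p n) 0 *\<^sub>R x) \<longlonglongrightarrow> f 0 *\<^sub>R x" by (intro tendsto_intros)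
  thus ?thesis using p(2)[of x] LIMSEQ_unique by (simp add: pol_kernel[OF x])
qed

section \<open>The absolute value\<close>

definition absop :: "'i op \<Rightarrow> 'i op" where
  "absop T = fc sqrt (adj T o\<^sub>L T)"

lemma continuous_on_sqrt_id: "continuous_on S sqrt"
  by (intro continuous_intros)

lemma pos_absop: "pos_op (absop T)"
  unfolding pos_op_def absop_def
  by (intro conjI allI fc_self_adjoint fc_nonneg pos_op_adj_comp continuous_on_sqrt_id) simp

lemma absop_square: "absop T o\<^sub>L absop T = adj T o\<^sub>L T"
proof -
  let ?B = "adj T o\<^sub>L T"
  have "absop T o\<^sub>L absop T = fc (\<lambda>t. sqrt t * sqrt t) ?B"
    unfolding absop_def by (rule fc_mult[symmetric]) (intro pos_op_adj_comp continuous_on_sqrt_id)+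
  also have "\<dots> = fc (\<lambda>t. t) ?B" by (rule fc_cong) simp
  finally show ?thesis by (simp add: fc_ident pos_op_adj_comp)
qed

lemma norm_absop_apply: "norm (absop T x) = norm (T x)"
proof -
  have sa: "inner (absop T x) y = inner x (absop T y)" for x y using pos_absop[of T] by (simp add: pos_op_def)
  have "absop T (absop T x) = adj T (T x)"
    using absop_square[of T] by (metis blinfun_apply_blinfun_compose)
  hence "inner (absop T x) (absop T x) = inner (T x) (T x)"
    by (simp only: sa inner_adj[of T])
  thus ?thesis by (simp add: norm_eq_sqrt_inner)
qed

section \<open>Trace inequalities\<close>

text \<open>A partial trace; \<open>hsum\<close> is likewise a partial squared Hilbert-Schmidt norm.
  Finite trace is expressed by a bound uniform over finite F, which keeps infinite sums out of the
  inequalities.\<close>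

definition quad :: "'i set \<Rightarrow> 'i op \<Rightarrow> real" where
  "quad F A = (\<Sum>i\<in>F. inner (blinfun_apply A (ev i)) (ev i))"

definition hsum :: "'i set \<Rightarrow> 'i op \<Rightarrow> real" where
  "hsum F X = (\<Sum>i\<in>F. (norm (blinfun_apply X (ev i)))\<^sup>2)"

lemma hsum_nonneg: "0 \<le> hsum F X"
  by (simp add: hsum_def sum_nonneg)

lemma has_sum_sum_finite:
  fixes f :: "'n \<Rightarrow> 'a \<Rightarrow> real"
  assumes "finite N" "\<And>n. n \<in> N \<Longrightarrow> (f n has_sum a n) UNIV"
  shows "((\<lambda>i. \<Sum>n\<in>N. f n i) has_sum (\<Sum>n\<in>N. a n)) UNIV"
  using assms
proof (induction N)
  case (insert x N)
  have "(f x has_sum a x) UNIV" using insert.prems by auto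
  moreover have "((\<lambda>i. \<Sum>n\<in>N. f n i) has_sum (\<Sum>n\<in>N. a n)) UNIV"
    using insert.prems by (intro insert.IH) auto
  ultimately have "((\<lambda>i. f x i + (\<Sum>n\<in>N. f n i)) has_sum (a x + (\<Sum>n\<in>N. a n))) UNIV"
    by (rule has_sum_add)
  thus ?case using insert.hyps by simp
qed simp

text \<open>Rows and columns of one matrix of squares are summed. Finitely many rows meet all
  columns, which is why the bound on X is asked for every finite set.\<close>

lemma hsum_adj_le:
  assumes c: "\<And>F. finite F \<Longrightarrow> hsum F X \<le> c" and G: "finite G"
  shows "hsum G (adj X) \<le> c"
proof -
  have cf: "cf (adj X (ev j)) i = cf (X (ev i)) j" for i j
    by (metis inner_adj' inner_ev_left inner_ev_right)
  have "((\<lambda>i. \<Sum>j\<in>G. (cf (adj X (ev j)) i)\<^sup>2) has_sum hsum G (adj X)) UNIV"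
    unfolding hsum_def by (rule has_sum_sum_finite[OF G]) (rule has_sum_norm_square)
  thus ?thesis
  proof (rule has_sum_le_finite_sums)
    fix F :: "'a set" assume F: "finite F"
    have "(\<Sum>i\<in>F. \<Sum>j\<in>G. (cf (adj X (ev j)) i)\<^sup>2) \<le> hsum F X"
      unfolding hsum_def cf by (intro sum_mono finite_sum_cf_le G)
    also have "\<dots> \<le> c" by (rule c[OF F])
    finally show "(\<Sum>i\<in>F. \<Sum>j\<in>G. (cf (adj X (ev j)) i)\<^sup>2) \<le> c" .
  qed
qed

lemma hsum_comp_le:
  assumes "\<And>x. norm (blinfun_apply Y x) \<le> s * norm x" "hsum F X \<le> c"
  shows "hsum F (Y o\<^sub>L X) \<le> s\<^sup>2 * c"
proof -
  have "hsum F (Y o\<^sub>L X) \<le> (\<Sum>i\<in>F. s\<^sup>2 * (norm (X (ev i)))\<^sup>2)"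
    unfolding hsum_def
  proof (rule sum_mono)
    fix i
    have "(norm (Y (X (ev i))))\<^sup>2 \<le> (s * norm (X (ev i)))\<^sup>2"
      by (intro power_mono assms) auto
    thus "(norm ((Y o\<^sub>L X) (ev i)))\<^sup>2 \<le> s\<^sup>2 * (norm (X (ev i)))\<^sup>2"
      by (simp add: power_mult_distrib)
  qed
  also have "\<dots> = s\<^sup>2 * hsum F X" by (simp add: hsum_def sum_distrib_left)
  also have "\<dots> \<le> s\<^sup>2 * c" by (intro mult_left_mono assms) auto
  finally show ?thesis .
qed

text \<open>The operator norm lies below the Hilbert-Schmidt norm: coordinate j of X x is the inner
  product of x with \<open>adj X (ev j)\<close>, and the squares of these vectors are summed by
  \<open>hsum_adj_le\<close>.\<close>

lemma norm_apply_le_hsum: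
  assumes c: "\<And>F. finite F \<Longrightarrow> hsum F X \<le> c"
  shows "(norm (blinfun_apply X x))\<^sup>2 \<le> c * (norm x)\<^sup>2"
proof (rule has_sum_le_finite_sums[OF has_sum_norm_square])
  fix G :: "'a set" assume G: "finite G"
  have "(cf (X x) j)\<^sup>2 \<le> (norm (adj X (ev j)))\<^sup>2 * (norm x)\<^sup>2" for j
  proof -
    have "\<bar>cf (X x) j\<bar> = \<bar>inner x (adj X (ev j))\<bar>" by (metis inner_adj inner_ev_right)
    also have "\<dots> \<le> norm x * norm (adj X (ev j))" by (rule Cauchy_Schwarz_ineq2)
    finally have "\<bar>cf (X x) j\<bar>\<^sup>2 \<le> (norm x * norm (adj X (ev j)))\<^sup>2" by (intro power_mono) auto
    thus ?thesis by (simp add: power_mult_distrib mult.commute)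
  qed
  hence "(\<Sum>j\<in>G. (cf (X x) j)\<^sup>2) \<le> hsum G (adj X) * (norm x)\<^sup>2"
    unfolding hsum_def sum_distrib_right by (rule sum_mono)
  also have "\<dots> \<le> c * (norm x)\<^sup>2"
    by (intro mult_right_mono hsum_adj_le c G) auto
  finally show "(\<Sum>j\<in>G. (cf (X x) j)\<^sup>2) \<le> c * (norm x)\<^sup>2" .
qed

lemma sum_inner_le:
  assumes "(\<Sum>i\<in>F. (norm (u i))\<^sup>2) \<le> a" "(\<Sum>i\<in>F. (norm (v i))\<^sup>2) \<le> b"
  shows "(\<Sum>i\<in>F. inner (u i) (v i)) \<le> sqrt a * sqrt b"
proof -
  have "(\<Sum>i\<in>F. inner (u i) (v i)) \<le> (\<Sum>i\<in>F. \<bar>norm (u i)\<bar> * \<bar>norm (v i)\<bar>)"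
    by (intro sum_mono) (auto intro: norm_cauchy_schwarz)
  also have "\<dots> \<le> L2_set (\<lambda>i. norm (u i)) F * L2_set (\<lambda>i. norm (v i)) F"
    by (rule L2_set_mult_ineq)
  also have "\<dots> \<le> sqrt a * sqrt b"
    unfolding L2_set_def
  proof (intro mult_mono real_sqrt_le_mono assms)
    have "0 \<le> (\<Sum>i\<in>F. (norm (u i))\<^sup>2)" by (rule sum_nonneg) simp
    thus "0 \<le> sqrt a" using assms(1) by simp
    show "0 \<le> sqrt (\<Sum>i\<in>F. (norm (v i))\<^sup>2)" by (simp add: sum_nonneg)
  qed
  finally show ?thesis .
qed

lemma quad_fc_mono:
  assumes "pos_op A" "continuous_on {0..norm A} f" "continuous_on {0..norm A} g"
    "\<And>t. 0 \<le> t \<Longrightarrow> t \<le> norm A \<Longrightarrow> f t \<le> g t"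
  shows "quad F (fc f A) \<le> quad F (fc g A)"
  unfolding quad_def by (intro sum_mono fc_mono assms)

lemma quad_fc_cmult:
  assumes "pos_op A" "continuous_on {0..norm A} f"
  shows "quad F (fc (\<lambda>t. c * f t) A) = c * quad F (fc f A)"
  by (simp add: quad_def fc_cmult[OF assms] blinfun.bilinear_simps sum_distrib_left)

lemma quad_fc_add:
  assumes "pos_op A" "continuous_on {0..norm A} f" "continuous_on {0..norm A} g"
  shows "quad F (fc (\<lambda>t. f t + g t) A) = quad F (fc f A) + quad F (fc g A)"
  by (simp only: quad_def fc_add[OF assms] blinfun.add_left inner_add_left sum.distrib)

lemma quad_fc_const:
  assumes "pos_op A"
  shows "quad F (fc (\<lambda>t. c) A) = c * card F"
  by (simp add: quad_def fc_const[OF assms] blinfun.bilinear_simps)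

text \<open>The polarised form of |T|^2 = \<open>adj T o\<^sub>L T\<close>. It exchanges T and |T|
  inside inner products and so does the work of a polar decomposition.\<close>

lemma inner_absop: "inner (absop T x) (absop T y) = inner (blinfun_apply T x) (T y)"
proof -
  have sa: "inner (absop T x) y = inner x (absop T y)" for x y
    using pos_absop[of T] unfolding pos_op_def by blast
  have "absop T (absop T y) = adj T (T y)"
    using absop_square[of T] by (metis blinfun_apply_blinfun_compose)
  thus ?thesis by (simp only: sa inner_adj[of T])
qed

lemma inner_fc_square:
  assumes f: "continuous_on {0..norm (absop T)} f"
  shows "inner (fc (\<lambda>t. t * t * f t) (absop T) x) x = inner (T x) (T (fc f (absop T) x))"
proof -
  note A = pos_absop[of T]
  have id: "continuous_on {0..norm (absop T)} (\<lambda>t. t)" by (rule continuous_on_id)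
  have tf: "continuous_on {0..norm (absop T)} (\<lambda>t. t * f t)" by (intro continuous_intros f)
  have "fc (\<lambda>t. t * (t * f t)) (absop T) x = absop T (absop T (fc f (absop T) x))"
    by (simp add: fc_mult[OF A id tf] fc_mult[OF A id f] fc_ident[OF A])
  moreover have "inner (absop T (absop T y)) x = inner (T y) (T x)" for y
    using inner_absop[of T y x] A unfolding pos_op_def by auto
  ultimately show ?thesis by (simp add: inner_commute mult.assoc)
qed

lemma hsum_fc:
  assumes A: "pos_op A" and f: "continuous_on {0..norm A} f"
  shows "hsum F (fc f A) = quad F (fc (\<lambda>t. f t * f t) A)"
proof -
  have "(norm (fc f A x))\<^sup>2 = inner (fc (\<lambda>t. f t * f t) A x) x" for x
    using fc_self_adjoint[OF A f, of "fc f A x" x] by (simp add: power2_norm_eq_inner fc_mult[OF A f f])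
  thus ?thesis by (simp only: hsum_def quad_def)
qed

lemma hsum_comp_fc:
  assumes f: "continuous_on {0..norm (absop T)} f"
  shows "hsum F (T o\<^sub>L fc f (absop T)) = quad F (fc (\<lambda>t. t * t * (f t * f t)) (absop T))"
proof -
  note A = pos_absop[of T]
  let ?A = "absop T"
  have ff: "continuous_on {0..norm ?A} (\<lambda>t. f t * f t)" by (intro continuous_intros f)
  have "inner (T (fc f ?A x)) (T (fc f ?A x)) = inner (T x) (T (fc (\<lambda>t. f t * f t) ?A x))" for x
  proof -
    have id: "continuous_on {0..norm ?A} (\<lambda>t. t)" by (rule continuous_on_id)
    have tf: "continuous_on {0..norm ?A} (\<lambda>t. t * f t)" by (intro continuous_intros f)
    have "absop T (fc f ?A x) = fc f ?A (absop T x)" by (rule fc_commute[OF A f]) simp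
    hence "inner (absop T (fc f ?A x)) (absop T (fc f ?A x)) = inner (absop T x) (fc f ?A (absop T (fc f ?A x)))"
      by (simp only: fc_self_adjoint[OF A f])
    also have "fc f ?A (absop T (fc f ?A x)) = absop T (fc f ?A (fc f ?A x))"
      by (rule fc_commute[OF A f, symmetric]) simp
    finally show ?thesis by (simp add: inner_absop fc_mult[OF A f f])
  qed
  thus ?thesis unfolding hsum_def quad_def
    by (simp add: power2_norm_eq_inner inner_fc_square[OF ff] del: inner_ev_right)
qed

lemma norm_comp_fc_le:
  assumes f: "continuous_on {0..norm (absop T)} f"
    and le: "\<And>t. 0 \<le> t \<Longrightarrow> t \<le> norm (absop T) \<Longrightarrow> \<bar>t * f t\<bar> \<le> c"
  shows "norm ((T o\<^sub>L fc f (absop T)) x) \<le> c * norm x"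
proof -
  note A = pos_absop[of T]
  let ?A = "absop T"
  have id: "continuous_on {0..norm ?A} (\<lambda>t. t)" by (rule continuous_on_id)
  have tf: "continuous_on {0..norm ?A} (\<lambda>t. t * f t)" by (intro continuous_intros f)
  have "norm (T (fc f ?A x)) = norm (fc (\<lambda>t. t * f t) ?A x)"
    by (simp add: fc_mult[OF A id f] fc_ident[OF A] norm_absop_apply)
  also have "\<dots> \<le> c * norm x" by (rule norm_fc_apply_le[OF A tf le])
  finally show ?thesis by simp
qed

section \<open>Slices between trace class and Hilbert-Schmidt operators\<close>

text \<open>
  The functions \<open>slice_h s t = min (t\<^sup>2) (s t)\<close>, for \<open>s > 0\<close>, interpolate between trace class and
  Hilbert-Schmidt: splitting \<open>T\<close> by the functions \<open>slice_g\<close> and \<open>slice_k slice_l = 1 - slice_g\<close> of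
  \<open>|T|\<close> writes \<open>T\<close> as the sum of a Hilbert-Schmidt operator and a product of two Hilbert-Schmidt
  operators.
\<close>

definition slice_h :: "real \<Rightarrow> real \<Rightarrow> real" where "slice_h s t = min (t * t) (s * t)"
definition slice_g :: "real \<Rightarrow> real \<Rightarrow> real" where "slice_g s t = s / max s t"
definition slice_l :: "real \<Rightarrow> real \<Rightarrow> real" where "slice_l s t = sqrt (max 0 (t - s))"
definition slice_k :: "real \<Rightarrow> real \<Rightarrow> real" where "slice_k s t = slice_l s t / max s t"

lemma continuous_on_hgkl:
  assumes "s > 0"
  shows "continuous_on S (slice_h s)" "continuous_on S (slice_g s)" "continuous_on S (slice_l s)" "continuous_on S (slice_k s)"
proof -
  have m: "max s t \<noteq> 0" for t using assms by (auto simp: max_def)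
  show "continuous_on S (slice_h s)" unfolding slice_h_def[abs_def] by (intro continuous_intros)
  show "continuous_on S (slice_g s)" unfolding slice_g_def[abs_def] by (intro continuous_intros) (use m in auto)
  show "continuous_on S (slice_l s)" unfolding slice_l_def[abs_def] by (intro continuous_intros)
  show "continuous_on S (slice_k s)" unfolding slice_k_def[abs_def] slice_l_def by (intro continuous_intros) (use m in auto)
qed

lemma g_k_l: "s > 0 \<Longrightarrow> slice_g s t + slice_k s t * slice_l s t = 1"
  by (auto simp: slice_g_def slice_k_def slice_l_def max_def field_simps)

lemma square_g: "s > 0 \<Longrightarrow> t \<ge> 0 \<Longrightarrow> t * t * slice_g s t = slice_h s t"
  by (cases "t \<le> s") (auto simp: slice_g_def slice_h_def max_def min_def mult_right_mono)

lemma t_g_le: "s > 0 \<Longrightarrow> t \<ge> 0 \<Longrightarrow> \<bar>t * slice_g s t\<bar> \<le> s"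
  by (auto simp: slice_g_def max_def)

lemma square_g_g_le: "s > 0 \<Longrightarrow> t \<ge> 0 \<Longrightarrow> t * t * (slice_g s t * slice_g s t) \<le> slice_h s t"
proof -
  assume s: "s > 0" "t \<ge> 0"
  have "slice_g s t \<le> 1" "slice_g s t \<ge> 0" using s by (auto simp: slice_g_def max_def)
  hence "(t * t * slice_g s t) * slice_g s t \<le> (t * t * slice_g s t) * 1" using s by (intro mult_left_mono) auto
  thus ?thesis using square_g[OF s] by (simp add: mult.assoc)
qed

lemma l_l_le: "s > 0 \<Longrightarrow> t \<ge> 0 \<Longrightarrow> slice_l s t * slice_l s t \<le> (1 / s) * slice_h s t"
proof -
  assume s: "s > 0" "t \<ge> 0"
  have "s * (slice_l s t * slice_l s t) \<le> slice_h s t"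
  proof (cases "t \<le> s")
    case True thus ?thesis using s by (simp add: slice_l_def slice_h_def)
  next
    case False
    hence "slice_l s t * slice_l s t = t - s" by (simp add: slice_l_def)
    moreover have "slice_h s t = s * t" using False s by (simp add: slice_h_def min_def)
    ultimately show ?thesis using s by (simp add: algebra_simps)
  qed
  thus ?thesis using s by (simp add: field_simps)
qed

lemma square_k_k: "s > 0 \<Longrightarrow> t \<ge> 0 \<Longrightarrow> t * t * (slice_k s t * slice_k s t) = slice_l s t * slice_l s t"
  by (cases "t \<le> s") (auto simp: slice_k_def slice_l_def max_def)

text \<open>The two parts of S meet the two bounds on W. The part with \<open>slice_g\<close> is
  Hilbert-Schmidt with square at most a and is paired with the Hilbert-Schmidt bound x of W. The
  other part is a product of two operators with squares at most a / s and is paired with the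
  operator bound s of W, so that s cancels.\<close>

lemma slice_summand:
  fixes S Y W :: "'i op"
  assumes s: "s > 0" and F: "finite F"
    and a: "\<And>F. finite F \<Longrightarrow> quad F (fc (slice_h s) (absop S)) \<le> a"
    and W: "\<And>x. norm (W x) \<le> s * norm x" "hsum F W \<le> x"
  shows "(\<Sum>i\<in>F. inner (Y (S (ev i))) (W (ev i))) \<le> norm Y * (sqrt a * sqrt x) + norm Y * a"
proof -
  note B = pos_absop[of S]
  let ?B = "absop S"
  note c = continuous_on_hgkl[OF s, of "{0..norm ?B}"]
  have a0: "a \<ge> 0" using a[of "{}"] by (simp add: quad_def)
  have x0: "x \<ge> 0" using W(2) hsum_nonneg[of F W] by linarith
  have l2: "quad F (fc (\<lambda>t. slice_l s t * slice_l s t) ?B) \<le> a / s" if "finite F" for F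
  proof -
    have "quad F (fc (\<lambda>t. slice_l s t * slice_l s t) ?B) \<le> quad F (fc (\<lambda>t. (1 / s) * slice_h s t) ?B)"
      by (rule quad_fc_mono[OF B]) (intro continuous_intros c l_l_le[OF s]; assumption)+
    also have "\<dots> = (1 / s) * quad F (fc (slice_h s) ?B)" by (rule quad_fc_cmult[OF B c(1)])
    also have "\<dots> \<le> (1 / s) * a" using s by (intro mult_left_mono a that) auto
    finally show ?thesis by simp
  qed
  have hl: "hsum F (fc (slice_l s) ?B) \<le> a / s"
    using l2[OF F] by (simp add: hsum_fc[OF B c(3)])
  have hk: "hsum F (S o\<^sub>L fc (slice_k s) ?B) \<le> a / s" if "finite F" for F
  proof -
    have "hsum F (S o\<^sub>L fc (slice_k s) ?B) = quad F (fc (\<lambda>t. slice_l s t * slice_l s t) ?B)"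
      unfolding hsum_comp_fc[OF c(4)] by (rule arg_cong[of _ _ "quad F"], rule fc_cong) (rule square_k_k[OF s])
    thus ?thesis using l2[OF that] by simp
  qed
  have hg: "hsum F (S o\<^sub>L fc (slice_g s) ?B) \<le> a"
  proof -
    have "hsum F (S o\<^sub>L fc (slice_g s) ?B) \<le> quad F (fc (slice_h s) ?B)"
      unfolding hsum_comp_fc[OF c(2)]
      by (rule quad_fc_mono[OF B]) (intro continuous_intros c square_g_g_le[OF s]; assumption)+
    thus ?thesis using a[OF F] by simp
  qed
  have split: "S e = S (fc (slice_g s) ?B e) + S (fc (slice_k s) ?B (fc (slice_l s) ?B e))" for e
  proof -
    have kl: "continuous_on {0..norm ?B} (\<lambda>t. slice_k s t * slice_l s t)" by (intro continuous_intros c)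
    have "fc (\<lambda>t. slice_g s t + slice_k s t * slice_l s t) ?B = fc (\<lambda>t. 1) ?B" by (rule fc_cong) (rule g_k_l[OF s])
    hence "fc (slice_g s) ?B + (fc (slice_k s) ?B o\<^sub>L fc (slice_l s) ?B) = id_blinfun"
      by (simp add: fc_add[OF B c(2) kl] fc_mult[OF B c(4,3)] fc_const[OF B])
    hence "(fc (slice_g s) ?B + (fc (slice_k s) ?B o\<^sub>L fc (slice_l s) ?B)) e = e" by simp
    hence "fc (slice_g s) ?B e + fc (slice_k s) ?B (fc (slice_l s) ?B e) = e" by (simp add: blinfun.bilinear_simps)
    thus ?thesis by (metis blinfun.add_right)
  qed
  have 1: "(\<Sum>i\<in>F. inner ((Y o\<^sub>L (S o\<^sub>L fc (slice_g s) ?B)) (ev i)) (W (ev i))) \<le> sqrt ((norm Y)\<^sup>2 * a) * sqrt x"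
    by (rule sum_inner_le)
       (use W(2) hsum_comp_le[OF norm_blinfun hg, of Y] in \<open>simp_all only: hsum_def\<close>)
  let ?U = "Y o\<^sub>L (S o\<^sub>L fc (slice_k s) ?B)"
  have hU: "hsum F ?U \<le> (norm Y)\<^sup>2 * (a / s)" if "finite F" for F
    by (rule hsum_comp_le[OF norm_blinfun hk[OF that]])
  have adjW: "norm (adj W x) \<le> s * norm x" for x
  proof -
    have "norm W \<le> s" using s W(1) by (intro norm_blinfun_bound) auto
    hence "norm (adj W) \<le> s" using norm_adj_le[of W] by linarith
    thus ?thesis by (meson norm_blinfun mult_right_mono norm_ge_zero order_trans)
  qed
  \<comment> \<open>\<open>hsum_comp_le\<close> only handles a bounded factor on the left, but here
    W stands on the right of \<open>adj ?U\<close>; taking adjoints reverses the order.\<close>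
  have "hsum F (adj (adj W o\<^sub>L ?U)) \<le> s\<^sup>2 * ((norm Y)\<^sup>2 * (a / s))"
    by (rule hsum_adj_le[OF _ F]) (rule hsum_comp_le[OF adjW hU])
  hence hV: "hsum F (adj ?U o\<^sub>L W) \<le> s * (norm Y)\<^sup>2 * a"
    using s by (simp add: adj_comp power2_eq_square)
  have 2: "(\<Sum>i\<in>F. inner (fc (slice_l s) ?B (ev i)) ((adj ?U o\<^sub>L W) (ev i))) \<le> sqrt (a / s) * sqrt (s * (norm Y)\<^sup>2 * a)"
    by (rule sum_inner_le) (use hl hV in \<open>simp_all only: hsum_def\<close>)
  have "inner (Y (S e)) (W e) = inner ((Y o\<^sub>L (S o\<^sub>L fc (slice_g s) ?B)) e) (W e)
      + inner (fc (slice_l s) ?B e) ((adj ?U o\<^sub>L W) e)" for e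
  proof -
    have "inner (fc (slice_l s) ?B e) (adj ?U (W e)) = inner (?U (fc (slice_l s) ?B e)) (W e)" by (rule inner_adj[symmetric])
    thus ?thesis by (subst split) (simp add: blinfun.add_right inner_add_left)
  qed
  hence "(\<Sum>i\<in>F. inner (Y (S (ev i))) (W (ev i))) \<le> sqrt ((norm Y)\<^sup>2 * a) * sqrt x + sqrt (a / s) * sqrt (s * (norm Y)\<^sup>2 * a)"
    using 1 2 by (simp only: sum.distrib)
  also have "sqrt ((norm Y)\<^sup>2 * a) * sqrt x = norm Y * (sqrt a * sqrt x)" by (simp add: real_sqrt_mult)
  also have "sqrt (a / s) * sqrt (s * (norm Y)\<^sup>2 * a) = norm Y * a"
    using s a0 by (simp add: real_sqrt_mult real_sqrt_divide)
  finally show ?thesis .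
qed

text \<open>Since t^2 g_s(t) = h_s(t), the partial trace becomes the pairing of R with its cutoff R
  g_s(|R|). The gain is that the first argument is linear in R, so a sum R can be split there. The
  cutoff replaces each singular value t by min(t, s), whence its operator bound s.\<close>

lemma quad_h_eq:
  assumes s: "s > 0"
  shows "quad F (fc (slice_h s) (absop R)) = (\<Sum>i\<in>F. inner (R (ev i)) ((R o\<^sub>L fc (slice_g s) (absop R)) (ev i)))"
proof -
  have "fc (slice_h s) (absop R) = fc (\<lambda>t. t * t * slice_g s t) (absop R)"
    by (rule fc_cong) (simp add: square_g[OF s])
  thus ?thesis by (simp add: quad_def inner_fc_square[OF continuous_on_hgkl(2)[OF s]] del: inner_ev_right)
qed

lemma hsum_cutoff_le:
  assumes s: "s > 0"
  shows "hsum F (R o\<^sub>L fc (slice_g s) (absop R)) \<le> quad F (fc (slice_h s) (absop R))"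
  unfolding hsum_comp_fc[OF continuous_on_hgkl(2)[OF s]]
  by (rule quad_fc_mono[OF pos_absop]) (intro continuous_intros continuous_on_hgkl[OF s] square_g_g_le[OF s]; assumption)+

lemma norm_cutoff_le:
  assumes s: "s > 0"
  shows "norm ((R o\<^sub>L fc (slice_g s) (absop R)) x) \<le> s * norm x"
  by (rule norm_comp_fc_le[OF continuous_on_hgkl(2)[OF s]]) (rule t_g_le[OF s])

text \<open>With x the partial trace on the left, \<open>slice_summand\<close> gives x \<le> u sqrt
  x + q, and sqrt x is absorbed by u sqrt x \<le> (u^2 + x) / 2. The constants do not involve s, so
  the inequality may be integrated over s. The left factors Y and Z make room for complex scalars,
  which are operators on the real space.\<close>

lemma slice_sum:
  fixes S T Y Z :: "'i op"
  assumes s: "s > 0" and F: "finite F"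
    and a: "\<And>F. finite F \<Longrightarrow> quad F (fc (slice_h s) (absop S)) \<le> a"
    and b: "\<And>F. finite F \<Longrightarrow> quad F (fc (slice_h s) (absop T)) \<le> b"
  shows "quad F (fc (slice_h s) (absop ((Y o\<^sub>L S) + (Z o\<^sub>L T))))
     \<le> 2 * ((norm Y)\<^sup>2 + norm Y) * a + 2 * ((norm Z)\<^sup>2 + norm Z) * b"
proof -
  define R where "R = (Y o\<^sub>L S) + (Z o\<^sub>L T)"
  let ?W = "R o\<^sub>L fc (slice_g s) (absop R)"
  define x where "x = quad F (fc (slice_h s) (absop R))"
  have W: "hsum F ?W \<le> x" unfolding x_def by (rule hsum_cutoff_le[OF s])
  have x0: "x \<ge> 0" using W hsum_nonneg[of F ?W] by linarith
  have a0: "a \<ge> 0" "b \<ge> 0" using a[of "{}"] b[of "{}"] by (simp_all add: quad_def)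
  define u where "u = norm Y * sqrt a + norm Z * sqrt b"
  have "x = (\<Sum>i\<in>F. inner (Y (S (ev i))) (?W (ev i))) + (\<Sum>i\<in>F. inner (Z (T (ev i))) (?W (ev i)))"
    unfolding x_def quad_h_eq[OF s] sum.distrib[symmetric]
    by (rule sum.cong) (simp_all add: R_def blinfun.add_left inner_add_left)
  also have "\<dots> \<le> (norm Y * (sqrt a * sqrt x) + norm Y * a) + (norm Z * (sqrt b * sqrt x) + norm Z * b)"
    using slice_summand[OF s F a norm_cutoff_le[OF s] W] slice_summand[OF s F b norm_cutoff_le[OF s] W]
    by (intro add_mono)
  also have "\<dots> = u * sqrt x + (norm Y * a + norm Z * b)" by (simp add: u_def algebra_simps)
  finally have "x \<le> u * sqrt x + (norm Y * a + norm Z * b)" .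
  moreover have "u * sqrt x \<le> (u\<^sup>2 + x) / 2"
    using sum_squares_bound[of u "sqrt x"] x0 by simp
  moreover have "x \<le> v + 2 * q" if "x \<le> w + q" "w \<le> (v + x) / 2" for v w q :: real
    using that by (simp add: field_simps)
  ultimately have "x \<le> u\<^sup>2 + 2 * (norm Y * a + norm Z * b)" by blast
  moreover have "u\<^sup>2 \<le> 2 * ((norm Y)\<^sup>2 * a) + 2 * ((norm Z)\<^sup>2 * b)"
    using sum_squares_bound[of "norm Y * sqrt a" "norm Z * sqrt b"] a0
    by (simp add: u_def power2_sum power_mult_distrib) (simp add: mult_ac)
  ultimately show ?thesis unfolding x_def R_def by (simp add: algebra_simps)
qed

text \<open>On the spectrum t \<le> h_s(t) / s + s. For a fixed finite F the error is s times the
  cardinality of F and vanishes as s tends to 0.\<close>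

lemma quad_le_from_slices:
  assumes A: "pos_op A" and sl: "\<And>s. s > 0 \<Longrightarrow> quad F (fc (slice_h s) A) \<le> s * c"
  shows "quad F A \<le> c"
proof -
  have "quad F A \<le> c + s * card F" if s: "s > 0" for s :: real
  proof -
    note ch = continuous_on_hgkl(1)[OF s, of "{0..norm A}"]
    have c1: "continuous_on {0..norm A} (\<lambda>t. (1 / s) * slice_h s t)" by (intro continuous_intros ch)
    have "quad F (fc (\<lambda>t. t) A) \<le> quad F (fc (\<lambda>t. (1 / s) * slice_h s t + s) A)"
    proof (rule quad_fc_mono[OF A])
      fix t assume t: "0 \<le> t" "t \<le> norm A"
      show "t \<le> (1 / s) * slice_h s t + s"
      proof (cases "t \<le> s")
        case True
        have "0 \<le> (1 / s) * slice_h s t" using s t by (simp add: slice_h_def)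
        thus ?thesis using True by linarith
      next
        case False
        hence "slice_h s t = s * t" using s by (simp add: slice_h_def min_def)
        thus ?thesis using s by simp
      qed
    qed (intro continuous_intros c1)+
    also have "\<dots> = (1 / s) * quad F (fc (slice_h s) A) + s * card F"
      by (simp only: quad_fc_add[OF A c1 continuous_on_const] quad_fc_cmult[OF A ch] quad_fc_const[OF A])
    also have "\<dots> \<le> (1 / s) * (s * c) + s * card F"
      using s by (intro add_right_mono mult_left_mono sl) auto
    finally show ?thesis using s by (simp add: fc_ident[OF A])
  qed
  hence "\<forall>\<^sub>F s::real in at_right 0. quad F A \<le> c + s * card F" by (auto simp: eventually_at_filter)
  moreover have "((\<lambda>s::real. c + s * card F) \<longlongrightarrow> c + (0::real) * card F) (at_right 0)" by (intro tendsto_intros)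
  ultimately have "quad F A \<le> c + (0::real) * card F"
    by (intro tendsto_lowerbound[of _ _ "at_right (0::real)"]) auto
  thus ?thesis by simp
qed

section \<open>Products of Hilbert-Schmidt operators and the inclusion of S_p in S_2\<close>

lemma continuous_on_powr_nonneg: "p > 0 \<Longrightarrow> continuous_on {0..M} (\<lambda>t::real. t powr p)"
  by (intro continuous_on_powr' continuous_intros) auto

text \<open>The usual proof pairs S T with the partial isometry of its polar decomposition. Here the
  cutoff \<open>?W\<close> divided by s is a contraction approximating that isometry; moving it to S
  and applying Cauchy-Schwarz bounds every slice linearly in s, hence the trace of |S T|.\<close>

lemma schatten_comp:
  fixes S T :: "'i op"
  assumes p: "1 \<le> p" and F: "finite F"
    and S: "\<And>F. finite F \<Longrightarrow> hsum F S \<le> a" and T: "\<And>F. finite F \<Longrightarrow> hsum F T \<le> b"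
  shows "quad F (fc (\<lambda>t. t powr p) (absop (S o\<^sub>L T))) \<le> (sqrt a * sqrt b) powr p"
proof -
  define R where "R = S o\<^sub>L T"
  let ?A = "absop R"
  note A = pos_absop[of R]
  have a0: "a \<ge> 0" "b \<ge> 0" using S[of "{}"] T[of "{}"] by (simp_all add: hsum_def)
  have slice: "quad F (fc (slice_h s) ?A) \<le> s * (sqrt a * sqrt b)" if s: "s > 0" and F: "finite F" for s F
  proof -
    let ?W = "R o\<^sub>L fc (slice_g s) ?A"
    have "norm ?W \<le> s" using s norm_cutoff_le[OF s] by (intro norm_blinfun_bound) auto
    hence "norm (adj ?W) \<le> s" using norm_adj_le[of ?W] by linarith
    hence adjW: "norm (adj ?W x) \<le> s * norm x" for x
      by (meson norm_blinfun mult_right_mono norm_ge_zero order_trans)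
    have "hsum F (adj (adj ?W o\<^sub>L S)) \<le> s\<^sup>2 * a"
      by (rule hsum_adj_le[OF _ F]) (rule hsum_comp_le[OF adjW S])
    hence hV: "hsum F (adj S o\<^sub>L ?W) \<le> s\<^sup>2 * a" by (simp add: adj_comp)
    have "quad F (fc (slice_h s) ?A) = (\<Sum>i\<in>F. inner (T (ev i)) ((adj S o\<^sub>L ?W) (ev i)))"
      unfolding quad_h_eq[OF s]
    proof (rule sum.cong)
      fix i
      have "inner (S (T (ev i))) (?W (ev i)) = inner (T (ev i)) (adj S (?W (ev i)))" by (rule inner_adj)
      thus "inner (R (ev i)) (?W (ev i)) = inner (T (ev i)) ((adj S o\<^sub>L ?W) (ev i))"
        by (simp add: R_def)
    qed simp
    also have "\<dots> \<le> sqrt b * sqrt (s\<^sup>2 * a)"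
      by (rule sum_inner_le) (use T[OF F] hV in \<open>simp_all only: hsum_def\<close>)
    finally show ?thesis using s by (simp add: real_sqrt_mult mult_ac)
  qed
  have q1: "quad F ?A \<le> sqrt a * sqrt b"
    by (rule quad_le_from_slices[OF A]) (rule slice[OF _ F])
  have "norm ?A \<le> sqrt a * sqrt b"
  proof (rule norm_blinfun_bound)
    fix x
    have "norm (S y) \<le> sqrt a * norm y" for y
      by (rule power2_le_imp_le) (use norm_apply_le_hsum[OF S, of y] a0 in \<open>auto simp: power_mult_distrib\<close>)
    moreover have "norm (T y) \<le> sqrt b * norm y" for y
      by (rule power2_le_imp_le) (use norm_apply_le_hsum[OF T, of y] a0 in \<open>auto simp: power_mult_distrib\<close>)
    ultimately have "norm (S (T x)) \<le> sqrt a * (sqrt b * norm x)"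
      by (meson a0 mult_left_mono order_trans real_sqrt_ge_zero)
    thus "norm (?A x) \<le> sqrt a * sqrt b * norm x" by (simp add: norm_absop_apply R_def mult.assoc)
  qed (use a0 in simp)
  hence nA: "norm ?A powr (p - 1) \<le> (sqrt a * sqrt b) powr (p - 1)"
    using p by (intro powr_mono2) auto
  \<comment> \<open>From trace class to the power p: on [0, |A|] one has t^p \<le> |A|^(p-1) t, and
    |A| is bounded by the product of the Hilbert-Schmidt norms.\<close>
  have "quad F (fc (\<lambda>t. t powr p) ?A) \<le> quad F (fc (\<lambda>t. norm ?A powr (p - 1) * t) ?A)"
  proof (rule quad_fc_mono[OF A])
    show "continuous_on {0..norm ?A} (\<lambda>t. t powr p)" using p by (intro continuous_on_powr_nonneg) auto
    fix t assume t: "0 \<le> t" "t \<le> norm ?A"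
    show "t powr p \<le> norm ?A powr (p - 1) * t"
    proof (cases "t = 0")
      case False
      hence "t powr p = t powr (p - 1) * t" using t powr_add[of t "p - 1" 1] by simp
      also have "\<dots> \<le> norm ?A powr (p - 1) * t" using p t by (intro mult_right_mono powr_mono2) auto
      finally show ?thesis .
    qed simp
  qed (intro continuous_intros)
  also have "\<dots> = norm ?A powr (p - 1) * quad F ?A"
    by (simp add: quad_fc_cmult[OF A continuous_on_id] fc_ident[OF A])
  also have "\<dots> \<le> (sqrt a * sqrt b) powr (p - 1) * (sqrt a * sqrt b)"
    by (rule order_trans[OF mult_left_mono[OF q1] mult_right_mono[OF nA]]) (use a0 in auto)
  also have "\<dots> = (sqrt a * sqrt b) powr p"
    using powr_add[of "sqrt a * sqrt b" "p - 1" 1] a0 by (cases "sqrt a * sqrt b = 0") (use p in auto)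
  finally show ?thesis by (simp add: R_def)
qed

lemma hsum_eq_quad: "hsum F T = quad F (fc (\<lambda>t. t * t) (absop T))"
  using hsum_comp_fc[where f = "\<lambda>_. 1" and T = T and F = F, OF continuous_on_const]
  by (simp add: fc_const[OF pos_absop] blinfun_compose_id_right)

text \<open>On the spectrum t^2 \<le> |A|^(2-p) t^p, so only the operator norm has to be controlled
  by c. For this |T|^(p/2) is regarded as a Hilbert-Schmidt operator: its operator norm bounds the
  form of |T|^p by c.\<close>

lemma schatten_le_hsum:
  fixes T :: "'i op"
  assumes p: "1 \<le> p" "p \<le> 2" and F: "finite F"
    and T: "\<And>F. finite F \<Longrightarrow> quad F (fc (\<lambda>t. t powr p) (absop T)) \<le> c"
  shows "hsum F T \<le> c powr (2 / p)"
proof -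
  let ?A = "absop T"
  note A = pos_absop[of T]
  have c0: "c \<ge> 0" using T[of "{}"] by (simp add: quad_def)
  have cp: "continuous_on {0..norm ?A} (\<lambda>t. t powr p)" using p by (intro continuous_on_powr_nonneg) auto
  have cp2: "continuous_on {0..norm ?A} (\<lambda>t. t powr (p / 2))" using p by (intro continuous_on_powr_nonneg) auto
  let ?D = "fc (\<lambda>t. t powr (p / 2)) ?A"
  have DD: "fc (\<lambda>t. t powr (p / 2) * t powr (p / 2)) ?A = fc (\<lambda>t. t powr p) ?A"
    by (simp add: powr_add[symmetric])
  have "hsum F ?D \<le> c" if "finite F" for F
    using T[OF that] by (simp only: hsum_fc[OF A cp2] DD)
  hence D: "(norm (?D x))\<^sup>2 \<le> c * (norm x)\<^sup>2" for x by (rule norm_apply_le_hsum)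
  have Dq: "inner (fc (\<lambda>t. t powr p) ?A x) x \<le> c * (norm x)\<^sup>2" for x
  proof -
    have "inner (fc (\<lambda>t. t powr p) ?A x) x = (norm (?D x))\<^sup>2"
      by (simp only: DD[symmetric] fc_mult[OF A cp2 cp2] blinfun_apply_blinfun_compose
          fc_self_adjoint[OF A cp2, of "?D x"] power2_norm_eq_inner)
    thus ?thesis using D[of x] by simp
  qed
  have pw: "t * t \<le> norm ?A powr (2 - p) * t powr p" if t: "0 \<le> t" "t \<le> norm ?A" for t
  proof (cases "t = 0")
    case False
    hence "t * t = t powr (2 - p) * t powr p" using t by (simp add: powr_add[symmetric] power2_eq_square)
    also have "\<dots> \<le> norm ?A powr (2 - p) * t powr p"
      using p t by (intro mult_right_mono powr_mono2) auto
    finally show ?thesis .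
  qed simp
  have cpp: "continuous_on {0..norm ?A} (\<lambda>t. norm ?A powr (2 - p) * t powr p)"
    by (intro continuous_intros cp)
  have ct: "continuous_on {0..norm ?A} (\<lambda>t. t * t)" by (intro continuous_intros)
  \<comment> \<open>The same pointwise inequality gives |A|^2 \<le> |A|^(2-p) c; dividing by the
    power of |A| leaves |A|^p \<le> c.\<close>
  have nA: "norm ?A powr p \<le> c"
  proof (cases "norm ?A = 0")
    case False
    let ?C = "norm ?A powr (2 - p) * c"
    have "norm (?A x) \<le> sqrt ?C * norm x" for x
    proof (rule power2_le_imp_le)
      have "(norm (?A x))\<^sup>2 = inner (fc (\<lambda>t. t * t) ?A x) x"
        using inner_fc_square[where f = "\<lambda>_. 1" and T = T and x = x, OF continuous_on_const]
        by (simp add: fc_const[OF A] power2_norm_eq_inner inner_absop)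
      also have "\<dots> \<le> inner (fc (\<lambda>t. norm ?A powr (2 - p) * t powr p) ?A x) x"
        by (rule fc_mono[OF A ct cpp pw])
      also have "\<dots> = norm ?A powr (2 - p) * inner (fc (\<lambda>t. t powr p) ?A x) x"
        by (simp add: fc_cmult[OF A cp] blinfun.bilinear_simps)
      also have "\<dots> \<le> norm ?A powr (2 - p) * (c * (norm x)\<^sup>2)"
        by (intro mult_left_mono Dq) auto
      finally show "(norm (?A x))\<^sup>2 \<le> (sqrt ?C * norm x)\<^sup>2"
        using c0 by (simp add: power_mult_distrib)
    qed (use c0 in simp)
    hence "norm ?A \<le> sqrt ?C" using c0 by (intro norm_blinfun_bound) auto
    hence "(norm ?A)\<^sup>2 \<le> (sqrt ?C)\<^sup>2" by (intro power_mono) auto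
    hence "(norm ?A)\<^sup>2 \<le> ?C" using c0 by simp
    moreover have "(norm ?A)\<^sup>2 = norm ?A powr (2 - p) * norm ?A powr p"
      using False by (simp add: powr_add[symmetric])
    ultimately show ?thesis using False by simp
  qed (use c0 in simp)
  have "hsum F T \<le> quad F (fc (\<lambda>t. norm ?A powr (2 - p) * t powr p) ?A)"
    unfolding hsum_eq_quad by (rule quad_fc_mono[OF A ct cpp pw])
  also have "\<dots> = norm ?A powr (2 - p) * quad F (fc (\<lambda>t. t powr p) ?A)" by (rule quad_fc_cmult[OF A cp])
  also have "\<dots> \<le> norm ?A powr (2 - p) * c" by (intro mult_left_mono T F) auto
  also have "\<dots> \<le> c powr ((2 - p) / p) * c"
  proof (intro mult_right_mono c0)
    have "(norm ?A powr p) powr ((2 - p) / p) \<le> c powr ((2 - p) / p)"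
      using p nA by (intro powr_mono2) auto
    thus "norm ?A powr (2 - p) \<le> c powr ((2 - p) / p)" using p by (simp add: powr_powr)
  qed
  also have "\<dots> = c powr (2 / p)"
  proof (cases "c = 0")
    case False
    have "(2 - p) / p + 1 = 2 / p" using p by (simp add: field_simps)
    thus ?thesis using powr_add[of c "(2 - p) / p" 1] c0 by simp
  qed simp
  finally show ?thesis .
qed

subsection \<open>Dyadic decomposition of powers\<close>

text \<open>
  For \<open>1 < p < 2\<close> the power \<open>t powr p\<close> is comparable on \<open>[0, M]\<close> with a weighted sum of the functions
  \<open>slice_h (M / 2 ^ n)\<close>, so that the stability of the slices under sums carries over to the powers.
  At \<open>p = 1\<close> and \<open>p = 2\<close> the geometric series diverge, and these cases are treated directly.
\<close>

definition dyadic :: "real \<Rightarrow> nat \<Rightarrow> real" where "dyadic M n = M / 2 ^ n"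

definition dyadic_sum :: "real \<Rightarrow> real \<Rightarrow> nat \<Rightarrow> real \<Rightarrow> real" where
  "dyadic_sum M p N t = (\<Sum>n\<le>N. dyadic M n powr (p - 2) * slice_h (dyadic M n) t)"

lemma dyadic_pos: "M > 0 \<Longrightarrow> dyadic M n > 0"
  by (simp add: dyadic_def)

lemma dyadic_Suc: "dyadic M (Suc n) = dyadic M n / 2"
  by (simp add: dyadic_def)

text \<open>While s_n \<ge> t the terms s_n^(p-2) t^2 grow geometrically, as p < 2, and the last
  one, comparable to t^p, dominates. Once s_n < t the terms s_n^(p-1) t decay geometrically, as p >
  1. The two geometric series give the two constants.\<close>

lemma dyadic_sum_upper:
  assumes p: "1 < p" "p < 2" and M: "M > 0" and t: "0 \<le> t" "t \<le> M"
  shows "dyadic_sum M p N t \<le> (1 / (1 - 2 powr (p - 2)) + 1 / (1 - 2 powr (1 - p))) * t powr p"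
proof (cases "t = 0")
  case True thus ?thesis by (simp add: dyadic_sum_def slice_h_def)
next
  case False
  hence t0: "t > 0" using t by simp
  define q1 where "q1 = 2 powr (p - 2)"
  define q2 where "q2 = 2 powr (1 - p)"
  define K1 where "K1 = 1 / (1 - q1)"
  define K2 where "K2 = 1 / (1 - q2)"
  have q: "0 < q1" "q1 < 1" "0 < q2" "q2 < 1"
    using p powr_less_mono[of "p - 2" 0 2] powr_less_mono[of "1 - p" 0 2] by (auto simp: q1_def q2_def)
  \<comment> \<open>The sum K of a geometric series of ratio q satisfies K q + 1 = K; this fixed
    point equation carries the induction.\<close>
  have K1: "K1 * q1 + 1 = K1" "K1 \<ge> 1" using q by (auto simp: K1_def field_simps)
  have K2: "K2 * q2 + 1 = K2" "K2 \<ge> 1" using q by (auto simp: K2_def field_simps)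
  have s1: "dyadic M n powr (p - 2) = q1 * dyadic M (Suc n) powr (p - 2)" for n
  proof -
    have "dyadic M n = 2 * dyadic M (Suc n)" by (simp add: dyadic_Suc)
    thus ?thesis using dyadic_pos[OF M, of "Suc n"] by (simp add: powr_mult q1_def)
  qed
  have s2: "dyadic M (Suc n) powr (p - 1) = q2 * dyadic M n powr (p - 1)" for n
    using dyadic_pos[OF M, of n] by (simp add: dyadic_Suc powr_divide q2_def powr_diff field_simps)
  have tp: "t * t * t powr (p - 2) = t powr p" "t * t powr (p - 1) = t powr p"
    using t0 powr_add[of t 2 "p - 2"] powr_add[of t 1 "p - 1"] by (simp_all add: power2_eq_square)
  \<comment> \<open>The subtracted term \<open>K2 * (t * (q2 * dyadic M N powr (p - 1)))\<close> is
    the sum of all terms beyond N, reserved for the rest of the induction.\<close>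
  have claim: "(dyadic M N \<ge> t \<longrightarrow> dyadic_sum M p N t \<le> K1 * (t * t * dyadic M N powr (p - 2))) \<and>
    (dyadic M N < t \<longrightarrow> dyadic_sum M p N t \<le> K1 * t powr p + K2 * (t * (t powr (p - 1) - q2 * dyadic M N powr (p - 1))))"
  proof (induction N)
    case 0
    have "slice_h M t = t * t" using t by (simp add: slice_h_def min_def mult_right_mono)
    moreover have "1 * (t * t * M powr (p - 2)) \<le> K1 * (t * t * M powr (p - 2))"
      using t K1 by (intro mult_right_mono) auto
    ultimately show ?case using t by (simp add: dyadic_sum_def dyadic_def mult_ac)
  next
    case (Suc N)
    let ?s = "dyadic M (Suc N)"
    have sp: "?s > 0" "dyadic M N > 0" using dyadic_pos[OF M] by auto
    have step: "dyadic_sum M p (Suc N) t = dyadic_sum M p N t + ?s powr (p - 2) * slice_h ?s t"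
      by (simp add: dyadic_sum_def)
    have small: "?s powr (p - 2) * slice_h ?s t = t * ?s powr (p - 1)" if "?s < t"
    proof -
      have "slice_h ?s t = ?s * t" using that t0 by (simp add: slice_h_def min_def)
      moreover have "?s powr (p - 1) = ?s powr (p - 2) * ?s" using powr_add[of ?s "p - 2" 1] sp by simp
      ultimately show ?thesis by simp
    qed
    consider "?s \<ge> t" | "?s < t" "dyadic M N \<ge> t" | "dyadic M N < t" by linarith
    thus ?case
    proof cases
      case 1
      hence "dyadic M N \<ge> t" using sp by (simp add: dyadic_Suc)
      hence "dyadic_sum M p N t \<le> K1 * (t * t * (q1 * ?s powr (p - 2)))" using Suc by (simp add: s1[of N])
      moreover have "slice_h ?s t = t * t" using 1 t0 by (simp add: slice_h_def min_def mult_right_mono)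
      ultimately have "dyadic_sum M p (Suc N) t \<le> (K1 * q1 + 1) * (t * t * ?s powr (p - 2))"
        unfolding step by (simp add: algebra_simps)
      thus ?thesis using 1 K1 by simp
    next
      case 2
      have "dyadic M N powr (p - 2) \<le> t powr (p - 2)" using 2 t0 p by (intro powr_mono2') auto
      hence "K1 * (t * t * dyadic M N powr (p - 2)) \<le> K1 * (t * t * t powr (p - 2))"
        using K1 t0 by (intro mult_left_mono) auto
      hence A: "dyadic_sum M p N t \<le> K1 * t powr p" using Suc 2 by (simp add: tp)
      have "?s powr (p - 1) \<le> t powr (p - 1)" using 2 sp p by (intro powr_mono2) auto
      hence "K2 * (?s powr (p - 1)) \<le> K2 * t powr (p - 1)" using K2 by (intro mult_left_mono) auto
      hence "(K2 * q2 + 1) * (?s powr (p - 1)) \<le> K2 * t powr (p - 1)" using K2 by simp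
      hence "?s powr (p - 1) \<le> K2 * (t powr (p - 1) - q2 * ?s powr (p - 1))"
        by (simp add: algebra_simps)
      hence "t * ?s powr (p - 1) \<le> t * (K2 * (t powr (p - 1) - q2 * ?s powr (p - 1)))"
        using t0 by (intro mult_left_mono) auto
      hence "t * ?s powr (p - 1) \<le> K2 * (t * (t powr (p - 1) - q2 * ?s powr (p - 1)))"
        by (simp only: mult.left_commute)
      from add_mono[OF A this] 2 show ?thesis unfolding step small[OF 2(1)] by auto
    next
      case 3
      hence st: "?s < t" using sp by (simp add: dyadic_Suc)
      have "dyadic_sum M p N t \<le> K1 * t powr p + K2 * (t * (t powr (p - 1) - ?s powr (p - 1)))"
        using Suc 3 by (simp add: s2)
      hence "dyadic_sum M p (Suc N) t \<le> K1 * t powr p + K2 * (t * (t powr (p - 1) - ?s powr (p - 1))) + t * ?s powr (p - 1)"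
        unfolding step small[OF st] by simp
      also have "\<dots> = K1 * t powr p + K2 * (t * (t powr (p - 1) - q2 * ?s powr (p - 1)))
          + (K2 * q2 + 1 - K2) * (t * ?s powr (p - 1))"
        by (simp add: algebra_simps)
      also have "\<dots> = K1 * t powr p + K2 * (t * (t powr (p - 1) - q2 * ?s powr (p - 1)))"
        using K2 by simp
      finally show ?thesis using st by simp
    qed
  qed
  have "dyadic_sum M p N t \<le> K1 * t powr p + K2 * t powr p"
  proof (cases "dyadic M N \<ge> t")
    case True
    have "dyadic M N powr (p - 2) \<le> t powr (p - 2)" using True t0 p by (intro powr_mono2') auto
    hence "K1 * (t * t * dyadic M N powr (p - 2)) \<le> K1 * (t * t * t powr (p - 2))"
      using K1 t0 by (intro mult_left_mono) auto
    hence "dyadic_sum M p N t \<le> K1 * t powr p" using claim True by (simp add: tp)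
    moreover have "K2 * t powr p \<ge> 0" using K2 by simp
    ultimately show ?thesis by linarith
  next
    case False
    hence "dyadic_sum M p N t \<le> K1 * t powr p + K2 * (t * (t powr (p - 1) - q2 * dyadic M N powr (p - 1)))"
      using claim by simp
    also have "\<dots> \<le> K1 * t powr p + K2 * (t * t powr (p - 1))"
      using K2 t0 q by (intro add_left_mono mult_left_mono) auto
    finally show ?thesis by (simp add: tp)
  qed
  thus ?thesis by (simp add: K1_def K2_def q1_def q2_def distrib_right)
qed

text \<open>One term suffices. The first scale s_m below t is at least t / 2, since s_0 = M is not
  below t, and its term s_m^(p-1) t is at least t^p / 2. If no scale up to N is below t, the
  remainder s_N^p takes over.\<close>

lemma dyadic_sum_lower:
  assumes p: "1 \<le> p" "p \<le> 2" and M: "M > 0" and t: "0 \<le> t" "t \<le> M"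
  shows "t powr p \<le> 2 * dyadic_sum M p N t + dyadic M N powr p"
proof (cases "t \<le> dyadic M N")
  case True
  have "0 \<le> dyadic_sum M p N t" unfolding dyadic_sum_def
    by (intro sum_nonneg mult_nonneg_nonneg) (use t dyadic_pos[OF M] in \<open>auto simp: slice_h_def less_imp_le\<close>)
  moreover have "t powr p \<le> dyadic M N powr p" using True t p by (intro powr_mono2) auto
  ultimately show ?thesis by simp
next
  case False
  define m where "m = (LEAST n. dyadic M n < t)"
  have m: "dyadic M m < t" "m \<le> N" unfolding m_def
    using False LeastI[of "\<lambda>n. dyadic M n < t" N] Least_le[of "\<lambda>n. dyadic M n < t" N] by auto
  have "m \<noteq> 0" using m(1) t by (intro notI) (simp add: dyadic_def)
  then obtain j where j: "m = Suc j" by (cases m) auto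
  have "\<not> dyadic M j < t" using not_less_Least[of j "\<lambda>n. dyadic M n < t"] j by (simp add: m_def)
  hence jt: "t / 2 \<le> dyadic M m" by (simp add: j dyadic_Suc)
  have sp: "dyadic M m > 0" by (rule dyadic_pos[OF M])
  have t0: "t > 0" using m sp by linarith
  have "t powr p / 2 \<le> dyadic M m powr (p - 2) * slice_h (dyadic M m) t"
  proof -
    have "slice_h (dyadic M m) t = dyadic M m * t" using m t0 by (simp add: slice_h_def min_def)
    moreover have "dyadic M m powr (p - 1) = dyadic M m powr (p - 2) * dyadic M m" using powr_add[of "dyadic M m" "p - 2" 1] sp by simp
    ultimately have e: "dyadic M m powr (p - 2) * slice_h (dyadic M m) t = dyadic M m powr (p - 1) * t" by simp
    have "(t / 2) powr (p - 1) \<le> dyadic M m powr (p - 1)" using jt t0 p by (intro powr_mono2) auto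
    moreover have "(t / 2) powr (p - 1) \<ge> t powr (p - 1) / 2"
    proof -
      have "2 powr (p - 1) \<le> 2 powr (1::real)" using p by (intro powr_mono) auto
      hence "t powr (p - 1) / 2 \<le> t powr (p - 1) / 2 powr (p - 1)" by (intro divide_left_mono) auto
      thus ?thesis using t0 by (simp add: powr_divide)
    qed
    ultimately have "t powr (p - 1) / 2 * t \<le> dyadic M m powr (p - 1) * t" using t0 by (intro mult_right_mono) auto
    moreover have "t powr (p - 1) * t = t powr p" using t0 powr_add[of t "p - 1" 1] by simp
    ultimately show ?thesis using e by simp
  qed
  also have "\<dots> \<le> dyadic_sum M p N t"
    unfolding dyadic_sum_def
    by (rule member_le_sum) (use m t dyadic_pos[OF M] in \<open>auto simp: slice_h_def less_imp_le\<close>)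
  finally show ?thesis using powr_ge_zero[of "dyadic M N" p] by linarith
qed

lemma continuous_on_dyadic_sum: "M > 0 \<Longrightarrow> continuous_on S (dyadic_sum M p N)"
  unfolding dyadic_sum_def[abs_def] by (intro continuous_intros continuous_on_hgkl dyadic_pos)

lemma fc_sum:
  assumes A: "pos_op A" and f: "\<And>n. n \<in> N \<Longrightarrow> continuous_on {0..norm A} (f n)" and N: "finite N"
  shows "quad F (fc (\<lambda>t. \<Sum>n\<in>N. f n t) A) = (\<Sum>n\<in>N. quad F (fc (f n) A))"
  using N f
proof (induction N)
  case empty
  show ?case by (simp add: quad_fc_const[OF A])
next
  case (insert x N)
  have 1: "continuous_on {0..norm A} (f x)" using insert.prems by auto
  have 2: "continuous_on {0..norm A} (\<lambda>t. \<Sum>n\<in>N. f n t)"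
    using insert.prems by (intro continuous_intros) auto
  show ?case using insert by (simp add: quad_fc_add[OF A 1 2])
qed

lemma quad_dyadic_sum:
  assumes A: "pos_op A" and M: "M > 0"
  shows "quad F (fc (dyadic_sum M p N) A) = (\<Sum>n\<le>N. dyadic M n powr (p - 2) * quad F (fc (slice_h (dyadic M n)) A))"
proof -
  note ch = continuous_on_hgkl(1)[OF dyadic_pos[OF M], of "{0..norm A}"]
  have "quad F (fc (dyadic_sum M p N) A) = (\<Sum>n\<le>N. quad F (fc (\<lambda>t. dyadic M n powr (p - 2) * slice_h (dyadic M n) t) A))"
    unfolding dyadic_sum_def[abs_def] by (rule fc_sum[OF A]) (auto intro!: continuous_intros ch)
  thus ?thesis by (simp add: quad_fc_cmult[OF A ch])
qed

text \<open>Bounds for the single slices must be chosen so that their weighted sums stay bounded as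
  well. Suprema taken slice by slice might be approached on different sets F; the full sums of the
  nonnegative diagonal entries serve all slices at once.\<close>

lemma dyadic_traces:
  fixes A :: "'i op"
  assumes p: "1 < p" "p < 2" and A: "pos_op A" "norm A \<le> M" and M: "M > 0"
    and c: "\<And>F. finite F \<Longrightarrow> quad F (fc (\<lambda>t. t powr p) A) \<le> c"
  shows "\<exists>a. (\<forall>n F. finite F \<longrightarrow> quad F (fc (slice_h (dyadic M n)) A) \<le> a n) \<and>
    (\<forall>N. (\<Sum>n\<le>N. dyadic M n powr (p - 2) * a n)
       \<le> (1 / (1 - 2 powr (p - 2)) + 1 / (1 - 2 powr (1 - p))) * c)"
proof -
  define K where "K = 1 / (1 - 2 powr (p - 2)) + 1 / (1 - 2 powr (1 - p))"
  note ch = continuous_on_hgkl(1)[OF dyadic_pos[OF M], of "{0..norm A}"]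
  have cp: "continuous_on {0..norm A} (\<lambda>t. t powr p)" using p by (intro continuous_on_powr_nonneg) auto
  have "2 powr (p - 2) < 1" "2 powr (1 - p) < 1"
    using p powr_less_mono[of "p - 2" 0 2] powr_less_mono[of "1 - p" 0 2] by auto
  hence K0: "K \<ge> 0" by (simp add: K_def)
  have up: "quad F (fc (dyadic_sum M p N) A) \<le> K * c" if F: "finite F" for F N
  proof -
    have "quad F (fc (dyadic_sum M p N) A) \<le> quad F (fc (\<lambda>t. K * t powr p) A)"
    proof (rule quad_fc_mono[OF A(1) continuous_on_dyadic_sum[OF M]])
      show "continuous_on {0..norm A} (\<lambda>t. K * t powr p)" by (intro continuous_intros cp)
      show "dyadic_sum M p N t \<le> K * t powr p" if "0 \<le> t" "t \<le> norm A" for t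
        unfolding K_def using that A(2) by (intro dyadic_sum_upper p M) auto
    qed
    also have "\<dots> = K * quad F (fc (\<lambda>t. t powr p) A)" by (rule quad_fc_cmult[OF A(1) cp])
    also have "\<dots> \<le> K * c" by (intro mult_left_mono c F K0)
    finally show ?thesis .
  qed
  define f where "f n i = inner (fc (slice_h (dyadic M n)) A (ev i)) (ev i)" for n i
  have fq: "sum (f n) F = quad F (fc (slice_h (dyadic M n)) A)" for n F by (simp add: f_def quad_def)
  have f0: "f n i \<ge> 0" for n i unfolding f_def
    by (rule fc_nonneg[OF A(1) ch]) (use dyadic_pos[OF M] in \<open>auto simp: slice_h_def less_imp_le\<close>)
  \<comment> \<open>A single slice is one term of a weighted sum that is already bounded; this makes
    its diagonal summable.\<close>
  have bnd: "sum (f n) F \<le> K * c / dyadic M n powr (p - 2)" if F: "finite F" for n F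
  proof -
    have w: "dyadic M n powr (p - 2) > 0" using dyadic_pos[OF M, of n] by simp
    have "dyadic M n powr (p - 2) * sum (f n) F \<le> (\<Sum>m\<le>n. dyadic M m powr (p - 2) * sum (f m) F)"
      by (rule member_le_sum) (auto intro!: mult_nonneg_nonneg sum_nonneg f0)
    also have "\<dots> \<le> K * c" using up[OF F, of n] by (simp add: quad_dyadic_sum[OF A(1) M] fq)
    finally show ?thesis using w by (simp add: field_simps)
  qed
  define a where "a n = infsum (f n) UNIV" for n
  have hs: "(f n has_sum a n) UNIV" for n
    unfolding a_def using summable_on_bounded_sums(1)[OF f0 bnd] by (rule has_sum_infsum)
  show ?thesis
  proof (intro exI[of _ a] conjI allI impI)
    show "quad F (fc (slice_h (dyadic M n)) A) \<le> a n" if F: "finite F" for n F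
      using finite_sum_le_has_sum[OF hs F] f0 by (simp add: fq)
    show "(\<Sum>n\<le>N. dyadic M n powr (p - 2) * a n) \<le> (1 / (1 - 2 powr (p - 2)) + 1 / (1 - 2 powr (1 - p))) * c" for N
    proof -
      have "((\<lambda>i. \<Sum>n\<le>N. dyadic M n powr (p - 2) * f n i) has_sum (\<Sum>n\<le>N. dyadic M n powr (p - 2) * a n)) UNIV"
        by (intro has_sum_sum_finite has_sum_cmult_right hs) auto
      hence "(\<Sum>n\<le>N. dyadic M n powr (p - 2) * a n) \<le> K * c"
      proof (rule has_sum_le_finite_sums)
        fix F :: "'i set" assume F: "finite F"
        have "(\<Sum>i\<in>F. \<Sum>n\<le>N. dyadic M n powr (p - 2) * f n i) = (\<Sum>n\<le>N. dyadic M n powr (p - 2) * sum (f n) F)"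
          by (subst sum.swap) (simp add: sum_distrib_left)
        thus "(\<Sum>i\<in>F. \<Sum>n\<le>N. dyadic M n powr (p - 2) * f n i) \<le> K * c"
          using up[OF F, of N] by (simp add: quad_dyadic_sum[OF A(1) M] fq)
      qed
      thus ?thesis by (simp add: K_def)
    qed
  qed
qed

text \<open>Subadditivity of the slices is summed with dyadic weights: upper comparison for S and T,
  lower comparison for the sum. At p = 1 slices alone suffice because h_s(t) \<le> s t, and at p = 2
  the pointwise inequality |u + v|^2 \<le> 2|u|^2 + 2|v|^2 does.\<close>

theorem schatten_sum:
  fixes S T Y Z :: "'i op"
  assumes p: "1 \<le> p" "p \<le> 2"
    and S: "\<And>F. finite F \<Longrightarrow> quad F (fc (\<lambda>t. t powr p) (absop S)) \<le> \<sigma>"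
    and T: "\<And>F. finite F \<Longrightarrow> quad F (fc (\<lambda>t. t powr p) (absop T)) \<le> \<tau>"
  shows "\<exists>c. \<forall>F. finite F \<longrightarrow> quad F (fc (\<lambda>t. t powr p) (absop ((Y o\<^sub>L S) + (Z o\<^sub>L T)))) \<le> c"
proof -
  define R where "R = (Y o\<^sub>L S) + (Z o\<^sub>L T)"
  note A = pos_absop[of R] and B = pos_absop[of S] and C = pos_absop[of T]
  define \<alpha> where "\<alpha> = 2 * ((norm Y)\<^sup>2 + norm Y)"
  define \<beta> where "\<beta> = 2 * ((norm Z)\<^sup>2 + norm Z)"
  have ab0: "\<alpha> \<ge> 0" "\<beta> \<ge> 0" by (simp_all add: \<alpha>_def \<beta>_def)
  consider "p = 1" | "p = 2" | "1 < p" "p < 2" using p by linarith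
  hence "\<exists>c. \<forall>F. finite F \<longrightarrow> quad F (fc (\<lambda>t. t powr p) (absop R)) \<le> c"
  proof cases
    case 1
    have eq: "fc (\<lambda>t. t powr p) D = D" if D: "pos_op D" for D :: "'i op"
    proof -
      have "fc (\<lambda>t. t powr p) D = fc (\<lambda>t. t) D" by (rule fc_cong) (simp add: 1)
      thus ?thesis by (simp add: fc_ident[OF D])
    qed
    have sl: "quad F (fc (slice_h s) D) \<le> s * c" if D: "pos_op D" and s: "s > 0" and c: "quad F D \<le> c"
      for D :: "'i op" and s c F
    proof -
      have "quad F (fc (slice_h s) D) \<le> quad F (fc (\<lambda>t. s * t) D)"
        by (rule quad_fc_mono[OF D continuous_on_hgkl(1)[OF s]]) (auto intro!: continuous_intros simp: slice_h_def)
      also have "\<dots> = s * quad F D" by (simp add: quad_fc_cmult[OF D continuous_on_id] fc_ident[OF D])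
      also have "\<dots> \<le> s * c" using s c by (intro mult_left_mono) auto
      finally show ?thesis .
    qed
    have "quad F (absop R) \<le> \<alpha> * \<sigma> + \<beta> * \<tau>" if F: "finite F" for F
    proof (rule quad_le_from_slices[OF A])
      fix s :: real assume s: "s > 0"
      have "quad F (fc (slice_h s) (absop R)) \<le> \<alpha> * (s * \<sigma>) + \<beta> * (s * \<tau>)"
        unfolding R_def \<alpha>_def \<beta>_def
        by (rule slice_sum[OF s F]) (rule sl[OF _ s], use S T B C in \<open>simp_all add: eq\<close>)+
      thus "quad F (fc (slice_h s) (absop R)) \<le> s * (\<alpha> * \<sigma> + \<beta> * \<tau>)" by (simp add: algebra_simps)
    qed
    thus ?thesis by (auto simp: eq[OF A])
  next
    case 2
    have eq: "quad F (fc (\<lambda>t. t powr p) (absop D)) = hsum F D" for D :: "'i op" and F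
    proof -
      have "fc (\<lambda>t. t powr p) (absop D) = fc (\<lambda>t. t * t) (absop D)"
        by (rule fc_cong) (auto simp: 2 powr_numeral power2_eq_square)
      thus ?thesis by (simp add: hsum_eq_quad)
    qed
    have "hsum F R \<le> 2 * ((norm Y)\<^sup>2 * \<sigma>) + 2 * ((norm Z)\<^sup>2 * \<tau>)" if F: "finite F" for F
    proof -
      have "hsum F R \<le> (\<Sum>i\<in>F. 2 * (norm ((Y o\<^sub>L S) (ev i)))\<^sup>2 + 2 * (norm ((Z o\<^sub>L T) (ev i)))\<^sup>2)"
        unfolding hsum_def
      proof (rule sum_mono)
        fix i
        let ?u = "(Y o\<^sub>L S) (ev i)" and ?v = "(Z o\<^sub>L T) (ev i)"
        have "(norm (R (ev i)))\<^sup>2 \<le> (norm ?u + norm ?v)\<^sup>2"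
          unfolding R_def blinfun.add_left by (intro power_mono norm_triangle_ineq) auto
        thus "(norm (R (ev i)))\<^sup>2 \<le> 2 * (norm ?u)\<^sup>2 + 2 * (norm ?v)\<^sup>2"
          using sum_squares_bound[of "norm ?u" "norm ?v"] by (simp add: power2_sum)
      qed
      also have "\<dots> = 2 * hsum F (Y o\<^sub>L S) + 2 * hsum F (Z o\<^sub>L T)"
        by (simp add: hsum_def sum.distrib sum_distrib_left)
      also have "\<dots> \<le> 2 * ((norm Y)\<^sup>2 * \<sigma>) + 2 * ((norm Z)\<^sup>2 * \<tau>)"
        using S[OF F] T[OF F] by (intro add_mono mult_left_mono hsum_comp_le norm_blinfun) (auto simp: eq)
      finally show ?thesis .
    qed
    thus ?thesis by (auto simp: eq)
  next
    case 3
    \<comment> \<open>One dyadic scale has to cover the spectra of all three operators; the summand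
      1 makes it positive.\<close>
    define M where "M = norm (absop R) + norm (absop S) + norm (absop T) + 1"
    have M: "M > 0" "norm (absop R) \<le> M" "norm (absop S) \<le> M" "norm (absop T) \<le> M"
      by (simp_all add: M_def add_nonneg_pos)
    define K where "K = 1 / (1 - 2 powr (p - 2)) + 1 / (1 - 2 powr (1 - p))"
    obtain a where a: "\<And>n F. finite F \<Longrightarrow> quad F (fc (slice_h (dyadic M n)) (absop S)) \<le> a n"
      "\<And>N. (\<Sum>n\<le>N. dyadic M n powr (p - 2) * a n) \<le> K * \<sigma>"
      using dyadic_traces[OF 3 B M(3,1) S, folded K_def] by blast
    obtain b where b: "\<And>n F. finite F \<Longrightarrow> quad F (fc (slice_h (dyadic M n)) (absop T)) \<le> b n"
      "\<And>N. (\<Sum>n\<le>N. dyadic M n powr (p - 2) * b n) \<le> K * \<tau>"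
      using dyadic_traces[OF 3 C M(4,1) T, folded K_def] by blast
    have cp: "continuous_on {0..norm (absop R)} (\<lambda>t. t powr p)" using 3 by (intro continuous_on_powr_nonneg) auto
    note cd = continuous_on_dyadic_sum[OF M(1)]
    define c where "c = 2 * (\<alpha> * (K * \<sigma>) + \<beta> * (K * \<tau>))"
    have bound: "quad F (fc (\<lambda>t. t powr p) (absop R)) \<le> c + card F * dyadic M N powr p" if F: "finite F" for F N
    proof -
      have c2: "continuous_on {0..norm (absop R)} (\<lambda>t. 2 * dyadic_sum M p N t)" by (intro continuous_intros cd)
      have "quad F (fc (\<lambda>t. t powr p) (absop R)) \<le> quad F (fc (\<lambda>t. 2 * dyadic_sum M p N t + dyadic M N powr p) (absop R))"
        by (rule quad_fc_mono[OF A cp]) (use M 3 in \<open>auto intro!: continuous_intros cd dyadic_sum_lower\<close>)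
      also have "\<dots> = 2 * quad F (fc (dyadic_sum M p N) (absop R)) + dyadic M N powr p * card F"
        by (simp only: quad_fc_add[OF A c2 continuous_on_const] quad_fc_cmult[OF A cd] quad_fc_const[OF A])
      also have "quad F (fc (dyadic_sum M p N) (absop R)) \<le> (\<Sum>n\<le>N. dyadic M n powr (p - 2) * (\<alpha> * a n + \<beta> * b n))"
        unfolding quad_dyadic_sum[OF A M(1)] unfolding R_def \<alpha>_def \<beta>_def
        by (intro sum_mono mult_left_mono slice_sum dyadic_pos M F a b) auto
      also have "\<dots> = \<alpha> * (\<Sum>n\<le>N. dyadic M n powr (p - 2) * a n) + \<beta> * (\<Sum>n\<le>N. dyadic M n powr (p - 2) * b n)"
        by (simp add: sum_distrib_left sum.distrib algebra_simps)
      also have "\<dots> \<le> \<alpha> * (K * \<sigma>) + \<beta> * (K * \<tau>)"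
        by (intro add_mono mult_left_mono a b ab0)
      finally show ?thesis by (simp add: c_def mult.commute)
    qed
    \<comment> \<open>For fixed F the error \<open>card F * dyadic M N powr p\<close> tends to 0
      with N, while \<open>c\<close> depends on neither F nor N.\<close>
    have "quad F (fc (\<lambda>t. t powr p) (absop R)) \<le> c" if F: "finite F" for F
    proof -
      have "(\<lambda>N. M * (1 / 2) ^ N) \<longlonglongrightarrow> M * 0"
        by (intro tendsto_intros LIMSEQ_realpow_zero) auto
      moreover have "dyadic M = (\<lambda>N. M * (1 / 2) ^ N)" by (simp add: fun_eq_iff dyadic_def power_divide)
      ultimately have "dyadic M \<longlonglongrightarrow> 0" by simp
      hence "(\<lambda>N. dyadic M N powr p) \<longlonglongrightarrow> 0"
        using dyadic_pos[OF M(1)] 3 by (intro tendsto_zero_powrI[of _ _ _ p]) (auto simp: less_imp_le)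
      hence "(\<lambda>N. c + card F * dyadic M N powr p) \<longlonglongrightarrow> c + real (card F) * 0"
        by (intro tendsto_intros)
      from LIMSEQ_le_const[OF this] bound[OF F] show ?thesis by auto
    qed
    thus ?thesis by blast
  qed
  thus ?thesis by (simp add: R_def)
qed

section \<open>Bounded operators between homogeneous normed carriers\<close>

text \<open>Homogeneity and nonnegativity carry the operator norm inequality. Leaving out the
  triangle inequality lets the same lemmas serve Hilbert spaces, quasi-normed spaces, completions
  and duals.\<close>

definition homog :: "('a, 'm) nspace_scheme \<Rightarrow> bool" where
  "homog X \<longleftrightarrow> carrier X \<noteq> {} \<and> (\<forall>x\<in>carrier X. \<forall>a. vscale X a x \<in> carrier X \<and>
     vnorm X (vscale X a x) = cmod a * vnorm X x \<and> 0 \<le> vnorm X x)"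

lemma homogD:
  assumes "homog X" "x \<in> carrier X"
  shows "vscale X a x \<in> carrier X" "vnorm X (vscale X a x) = cmod a * vnorm X x" "0 \<le> vnorm X x"
  using assms unfolding homog_def by blast+

lemma bounded_ops_simps:
  "vzero (bounded_ops X Y) = (\<lambda>x\<in>carrier X. vzero Y)"
  "vadd (bounded_ops X Y) S T = (\<lambda>x\<in>carrier X. vadd Y (S x) (T x))"
  "vscale (bounded_ops X Y) a T = (\<lambda>x\<in>carrier X. vscale Y a (T x))"
  "vnorm (bounded_ops X Y) T = (SUP x \<in> {x \<in> carrier X. vnorm X x \<le> 1}. vnorm Y (T x))"
  by (simp_all add: bounded_ops_def)

lemma bounded_algebra_simps:
  "carrier (bounded_algebra X) = carrier (bounded_ops X X)"
  "vzero (bounded_algebra X) = (\<lambda>x\<in>carrier X. vzero X)"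
  "vadd (bounded_algebra X) S T = (\<lambda>x\<in>carrier X. vadd X (S x) (T x))"
  "vscale (bounded_algebra X) a T = (\<lambda>x\<in>carrier X. vscale X a (T x))"
  "vnorm (bounded_algebra X) T = vnorm (bounded_ops X X) T"
  "vmult (bounded_algebra X) S T = compose (carrier X) S T"
  by (simp_all add: bounded_algebra_def nspace.extend_def nalgebra.fields_def bounded_ops_def)

lemma bounded_opsI:
  assumes "\<And>x. x \<in> carrier X \<Longrightarrow> T x \<in> carrier Y" "T \<in> extensional (carrier X)"
    "\<And>x y. x \<in> carrier X \<Longrightarrow> y \<in> carrier X \<Longrightarrow> T (vadd X x y) = vadd Y (T x) (T y)"
    "\<And>a x. x \<in> carrier X \<Longrightarrow> T (vscale X a x) = vscale Y a (T x)"
    "\<And>x. x \<in> carrier X \<Longrightarrow> vnorm Y (T x) \<le> M * vnorm X x"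
  shows "T \<in> carrier (bounded_ops X Y)"
  using assms by (auto simp: bounded_ops_def PiE_def intro!: exI[of _ M])

lemma bounded_opsD:
  assumes "T \<in> carrier (bounded_ops X Y)"
  shows "x \<in> carrier X \<Longrightarrow> T x \<in> carrier Y" "T \<in> extensional (carrier X)"
    "x \<in> carrier X \<Longrightarrow> y \<in> carrier X \<Longrightarrow> T (vadd X x y) = vadd Y (T x) (T y)"
    "x \<in> carrier X \<Longrightarrow> T (vscale X a x) = vscale Y a (T x)"
    "\<exists>M. \<forall>x\<in>carrier X. vnorm Y (T x) \<le> M * vnorm X x"
  using assms by (auto simp: bounded_ops_def PiE_def)

lemma bounded_ops_eqI:
  assumes "S \<in> carrier (bounded_ops X Y)" "T \<in> carrier (bounded_ops X Y)"
    "\<And>x. x \<in> carrier X \<Longrightarrow> S x = T x"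
  shows "S = T"
  using assms by (intro extensionalityI[of _ "carrier X"]) (auto dest: bounded_opsD(2))

lemma unit_ball_nonempty:
  assumes "homog X"
  shows "\<exists>x\<in>carrier X. vnorm X x = 0"
proof -
  obtain x where "x \<in> carrier X" using assms by (auto simp: homog_def)
  thus ?thesis using homogD(1,2)[OF assms, of x 0] by (intro bexI[of _ "vscale X 0 x"]) auto
qed

lemma bdd_above_bounded_ops:
  assumes X: "homog X" and T: "T \<in> carrier (bounded_ops X Y)"
  shows "bdd_above ((\<lambda>x. vnorm Y (T x)) ` {x \<in> carrier X. vnorm X x \<le> 1})"
proof -
  obtain M where M: "\<forall>x\<in>carrier X. vnorm Y (T x) \<le> M * vnorm X x" using bounded_opsD(5)[OF T] by blast
  show ?thesis
  proof (rule bdd_aboveI2)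
    fix x assume x: "x \<in> {x \<in> carrier X. vnorm X x \<le> 1}"
    have "vnorm Y (T x) \<le> M * vnorm X x" using M x by blast
    also have "\<dots> \<le> \<bar>M\<bar> * 1" using x homogD(3)[OF X] by (intro mult_mono) auto
    finally show "vnorm Y (T x) \<le> \<bar>M\<bar>" by simp
  qed
qed

lemma bounded_ops_norm_nonneg:
  assumes X: "homog X" and Y: "homog Y" and T: "T \<in> carrier (bounded_ops X Y)"
  shows "0 \<le> vnorm (bounded_ops X Y) T"
proof -
  obtain x where x: "x \<in> carrier X" "vnorm X x = 0" using unit_ball_nonempty[OF X] by blast
  have "0 \<le> vnorm Y (T x)" using homogD(3)[OF Y] bounded_opsD(1)[OF T x(1)] by blast
  also have "\<dots> \<le> vnorm (bounded_ops X Y) T" unfolding bounded_ops_simps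
    by (rule cSUP_upper[OF _ bdd_above_bounded_ops[OF X T]]) (use x in auto)
  finally show ?thesis .
qed

lemma bounded_ops_norm_le:
  assumes X: "homog X" and Y: "homog Y" and T: "T \<in> carrier (bounded_ops X Y)" and x: "x \<in> carrier X"
  shows "vnorm Y (T x) \<le> vnorm (bounded_ops X Y) T * vnorm X x"
proof (cases "vnorm X x = 0")
  case True
  obtain M where M: "\<forall>x\<in>carrier X. vnorm Y (T x) \<le> M * vnorm X x" using bounded_opsD(5)[OF T] by blast
  show ?thesis using M[rule_format, OF x] by (simp add: True)
next
  case False
  hence n0: "vnorm X x > 0" using homogD(3)[OF X x] by simp
  let ?c = "of_real (1 / vnorm X x) :: complex"
  have "vnorm X (vscale X ?c x) = 1"
    using homogD(2)[OF X x, of ?c] n0 by (simp add: norm_divide)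
  hence "vnorm Y (T (vscale X ?c x)) \<le> vnorm (bounded_ops X Y) T" unfolding bounded_ops_simps
    by (intro cSUP_upper bdd_above_bounded_ops[OF X T]) (use homogD(1)[OF X x] in auto)
  hence "1 / vnorm X x * vnorm Y (T x) \<le> vnorm (bounded_ops X Y) T"
    using n0 homogD(2)[OF Y bounded_opsD(1)[OF T x], of ?c] by (simp add: bounded_opsD(4)[OF T x] norm_divide)
  thus ?thesis using n0 by (simp add: field_simps)
qed

lemma bounded_ops_norm_least:
  assumes X: "homog X" and M: "M \<ge> 0" "\<And>x. x \<in> carrier X \<Longrightarrow> vnorm Y (T x) \<le> M * vnorm X x"
  shows "vnorm (bounded_ops X Y) T \<le> M"
  unfolding bounded_ops_simps
proof (rule cSUP_least)
  show "{x \<in> carrier X. vnorm X x \<le> 1} \<noteq> {}" using unit_ball_nonempty[OF X] by force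
  fix x assume x: "x \<in> {x \<in> carrier X. vnorm X x \<le> 1}"
  have "vnorm Y (T x) \<le> M * vnorm X x" using M x by blast
  also have "\<dots> \<le> M * 1" using x M by (intro mult_left_mono) auto
  finally show "vnorm Y (T x) \<le> M" by simp
qed

lemma homog_complex_space: "homog complex_space"
  by (simp add: homog_def complex_space_def norm_mult)

section \<open>Algebras of operators on a quasi-normed space\<close>

context complex_vector_space
begin

lemma scale_zero:
  assumes x: "x \<in> carrier X"
  shows "vscale X 0 x = vzero X"
proof -
  let ?z = "vscale X 0 x"
  have z: "?z \<in> carrier X" by (rule scale_closed[OF x])
  obtain w where w: "w \<in> carrier X" "vadd X ?z w = vzero X" using add_inverse[OF z] by blast
  have zz: "?z = vadd X ?z ?z" using scale_add_left[OF x, of 0 0] by simp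
  have "vzero X = vadd X (vadd X ?z ?z) w" using w(2) zz by simp
  also have "\<dots> = vadd X ?z (vzero X)" by (simp add: add_assoc z w)
  finally show ?thesis by (simp add: add_zero z)
qed

lemma add_minus: "x \<in> carrier X \<Longrightarrow> vadd X x (vscale X (- 1) x) = vzero X"
  using scale_add_left[of x 1 "- 1"] by (simp add: scale_one scale_zero)

lemma scale_vzero: "vscale X a (vzero X) = vzero X"
  using scale_scale[OF zero_closed, of a 0] by (simp add: scale_zero zero_closed)

lemma add_swap:
  assumes "a \<in> carrier X" "b \<in> carrier X" "c \<in> carrier X" "d \<in> carrier X"
  shows "vadd X (vadd X a b) (vadd X c d) = vadd X (vadd X a c) (vadd X b d)"
proof -
  have "vadd X (vadd X a b) (vadd X c d) = vadd X a (vadd X (vadd X b c) d)"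
    using assms by (simp add: add_assoc add_closed)
  also have "\<dots> = vadd X a (vadd X (vadd X c b) d)" using assms by (simp add: add_commute)
  also have "\<dots> = vadd X (vadd X a c) (vadd X b d)" using assms by (simp add: add_assoc add_closed)
  finally show ?thesis .
qed

end

text \<open>\<open>E\<close> records the loss in the product estimate: 1 for the operator algebras,
  8 for the Schatten classes.\<close>

locale quasi_normed_algebra =
  fixes A :: "('a, 'm) nalgebra_scheme" and E :: real
  assumes p_const: "0 \<le> E"
    and p_add: "\<lbrakk>x \<in> carrier A; y \<in> carrier A\<rbrakk> \<Longrightarrow> vadd A x y \<in> carrier A"
    and p_scale: "x \<in> carrier A \<Longrightarrow> vscale A a x \<in> carrier A"
    and p_mult: "\<lbrakk>x \<in> carrier A; y \<in> carrier A\<rbrakk> \<Longrightarrow> vmult A x y \<in> carrier A"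
    and p_add_l: "\<lbrakk>x \<in> carrier A; y \<in> carrier A; z \<in> carrier A\<rbrakk> \<Longrightarrow>
          vmult A (vadd A x y) z = vadd A (vmult A x z) (vmult A y z)"
    and p_add_r: "\<lbrakk>x \<in> carrier A; y \<in> carrier A; z \<in> carrier A\<rbrakk> \<Longrightarrow>
          vmult A z (vadd A x y) = vadd A (vmult A z x) (vmult A z y)"
    and p_scale_l: "\<lbrakk>x \<in> carrier A; z \<in> carrier A\<rbrakk> \<Longrightarrow>
          vmult A (vscale A a x) z = vscale A a (vmult A x z)"
    and p_scale_r: "\<lbrakk>x \<in> carrier A; z \<in> carrier A\<rbrakk> \<Longrightarrow>
          vmult A z (vscale A a x) = vscale A a (vmult A z x)"
    and p_norm_pos: "x \<in> carrier A \<Longrightarrow> 0 \<le> vnorm A x"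
    and p_norm_mult: "\<lbrakk>x \<in> carrier A; y \<in> carrier A\<rbrakk> \<Longrightarrow>
          vnorm A (vmult A x y) \<le> E * (vnorm A x * vnorm A y)"

lemma quasi_normed_algebra_subalgebra:
  assumes A: "quasi_normed_algebra A E" and S: "S \<subseteq> carrier A"
    "\<And>x y. x \<in> S \<Longrightarrow> y \<in> S \<Longrightarrow> vadd A x y \<in> S" "\<And>a x. x \<in> S \<Longrightarrow> vscale A a x \<in> S"
    "\<And>x y. x \<in> S \<Longrightarrow> y \<in> S \<Longrightarrow> vmult A x y \<in> S"
  shows "quasi_normed_algebra (A\<lparr>carrier := S\<rparr>) E"
proof -
  interpret quasi_normed_algebra A E by (rule A)
  have "x \<in> carrier A" if "x \<in> S" for x using S(1) that by blast
  thus ?thesis using S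
    by unfold_locales (auto simp: p_const p_add_l p_add_r p_scale_l p_scale_r p_norm_pos p_norm_mult)
qed

lemma vector_subspace:
  assumes A: "complex_vector_space A" and S: "S \<subseteq> carrier A" "vzero A \<in> S"
    "\<And>x y. x \<in> S \<Longrightarrow> y \<in> S \<Longrightarrow> vadd A x y \<in> S" "\<And>a x. x \<in> S \<Longrightarrow> vscale A a x \<in> S"
  shows "complex_vector_space (A\<lparr>carrier := S\<rparr>)"
proof -
  interpret complex_vector_space A by (rule A)
  have cl: "x \<in> carrier A" if "x \<in> S" for x using S(1) that by blast
  show ?thesis
  proof
    fix x assume "x \<in> carrier (A\<lparr>carrier := S\<rparr>)"
    thus "\<exists>y\<in>carrier (A\<lparr>carrier := S\<rparr>). vadd (A\<lparr>carrier := S\<rparr>) x y = vzero (A\<lparr>carrier := S\<rparr>)"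
      using S(4)[of x "- 1"] add_minus[of x] cl by auto
  qed (use S cl in \<open>auto simp: add_assoc add_zero scale_one scale_scale scale_add_left scale_add_right
      intro: add_commute\<close>)
qed

text \<open>Instantiated twice: at the Hilbert space with D = 1 and at its Hilbert-Schmidt operators
  with D = 2, so bounded and compact operators on both are treated once.\<close>

locale quasi_normed_space = complex_vector_space X for X :: "('a, 'm) nspace_scheme" +
  fixes D :: real
  assumes hom: "homog X" and D_nonneg: "0 \<le> D"
    and quasi: "\<lbrakk>x \<in> carrier X; y \<in> carrier X\<rbrakk> \<Longrightarrow> vnorm X (vadd X x y) \<le> D * (vnorm X x + vnorm X y)"
begin

abbreviation "BX \<equiv> bounded_algebra X"

lemma BX_carrier: "carrier BX = carrier (bounded_ops X X)"
  by (rule bounded_algebra_simps)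

lemmas BXD = bounded_opsD[of _ X X, folded BX_carrier]

lemma BX_norm_le: "T \<in> carrier BX \<Longrightarrow> x \<in> carrier X \<Longrightarrow> vnorm X (T x) \<le> vnorm BX T * vnorm X x"
  unfolding bounded_algebra_simps by (rule bounded_ops_norm_le[OF hom hom])

lemma BX_norm_nonneg: "T \<in> carrier BX \<Longrightarrow> 0 \<le> vnorm BX T"
  unfolding bounded_algebra_simps by (rule bounded_ops_norm_nonneg[OF hom hom])

lemma BX_norm_least: "0 \<le> M \<Longrightarrow> (\<And>x. x \<in> carrier X \<Longrightarrow> vnorm X (T x) \<le> M * vnorm X x) \<Longrightarrow> vnorm BX T \<le> M"
  unfolding bounded_algebra_simps by (rule bounded_ops_norm_least[OF hom])

lemma BXI:
  assumes "\<And>x. x \<in> carrier X \<Longrightarrow> T x \<in> carrier X" "T \<in> extensional (carrier X)"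
    "\<And>x y. x \<in> carrier X \<Longrightarrow> y \<in> carrier X \<Longrightarrow> T (vadd X x y) = vadd X (T x) (T y)"
    "\<And>a x. x \<in> carrier X \<Longrightarrow> T (vscale X a x) = vscale X a (T x)"
    "\<And>x. x \<in> carrier X \<Longrightarrow> vnorm X (T x) \<le> M * vnorm X x"
  shows "T \<in> carrier BX"
  unfolding BX_carrier by (rule bounded_opsI[OF assms])

lemma norm_vz: "vnorm X (vzero X) = 0"
  using homogD(2)[OF hom zero_closed, of 0] by (simp add: scale_zero zero_closed)

lemma BX_add: "S \<in> carrier BX \<Longrightarrow> T \<in> carrier BX \<Longrightarrow> vadd BX S T \<in> carrier BX"
  unfolding bounded_algebra_simps(3)
proof (rule BXI[where M = "D * (vnorm BX S + vnorm BX T)"])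
  assume S: "S \<in> carrier BX" and T: "T \<in> carrier BX"
  fix x assume x: "x \<in> carrier X"
  have "vnorm X (vadd X (S x) (T x)) \<le> D * (vnorm X (S x) + vnorm X (T x))"
    by (rule quasi) (simp_all add: BXD(1) S T x)
  also have "\<dots> \<le> D * (vnorm BX S * vnorm X x + vnorm BX T * vnorm X x)"
    by (intro mult_left_mono add_mono BX_norm_le S T x D_nonneg)
  finally show "vnorm X ((\<lambda>x\<in>carrier X. vadd X (S x) (T x)) x) \<le> D * (vnorm BX S + vnorm BX T) * vnorm X x"
    using x by (simp add: algebra_simps)
qed (auto simp: BXD add_closed scale_closed scale_add_right add_swap)

lemma BX_scale: "T \<in> carrier BX \<Longrightarrow> vscale BX a T \<in> carrier BX"
  unfolding bounded_algebra_simps(4)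
proof (rule BXI[where M = "cmod a * vnorm BX T"])
  assume T: "T \<in> carrier BX"
  fix x assume x: "x \<in> carrier X"
  show "vnorm X ((\<lambda>x\<in>carrier X. vscale X a (T x)) x) \<le> cmod a * vnorm BX T * vnorm X x"
    using homogD(2)[OF hom BXD(1)[OF T x], of a] BX_norm_le[OF T x] x by (simp add: mult.assoc mult_left_mono)
qed (auto simp: BXD add_closed scale_closed scale_add_right scale_scale mult.commute)

lemma BX_mult: "S \<in> carrier BX \<Longrightarrow> T \<in> carrier BX \<Longrightarrow> vmult BX S T \<in> carrier BX"
  and BX_norm_mult: "S \<in> carrier BX \<Longrightarrow> T \<in> carrier BX \<Longrightarrow> vnorm BX (vmult BX S T) \<le> vnorm BX S * vnorm BX T"
proof -
  assume S: "S \<in> carrier BX" and T: "T \<in> carrier BX"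
  have le: "vnorm X (compose (carrier X) S T x) \<le> vnorm BX S * vnorm BX T * vnorm X x" if x: "x \<in> carrier X" for x
  proof -
    have "vnorm X (S (T x)) \<le> vnorm BX S * vnorm X (T x)" by (rule BX_norm_le[OF S BXD(1)[OF T x]])
    also have "\<dots> \<le> vnorm BX S * (vnorm BX T * vnorm X x)"
      by (intro mult_left_mono BX_norm_le BX_norm_nonneg S T x)
    finally show ?thesis using x by (simp add: compose_def mult.assoc)
  qed
  show "vmult BX S T \<in> carrier BX"
    unfolding bounded_algebra_simps(6)
    by (rule BXI[OF _ compose_extensional _ _ le]) (auto simp: BXD S T add_closed scale_closed compose_eq)
  show "vnorm BX (vmult BX S T) \<le> vnorm BX S * vnorm BX T"
    unfolding bounded_algebra_simps(6) by (rule BX_norm_least) (simp_all add: le BX_norm_nonneg S T)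
qed

lemma BX_zero: "vzero BX \<in> carrier BX"
  unfolding bounded_algebra_simps(2)
  by (rule BXI[where M = 0]) (auto simp: add_closed scale_closed zero_closed add_zero norm_vz scale_vzero)

lemma BX_norm_scale:
  assumes T: "T \<in> carrier BX"
  shows "vnorm BX (vscale BX a T) = cmod a * vnorm BX T"
proof -
  have *: "vnorm BX (vscale BX a T) \<le> cmod a * vnorm BX T" if T: "T \<in> carrier BX" for a T
  proof (rule BX_norm_least)
    fix x assume x: "x \<in> carrier X"
    show "vnorm X (vscale BX a T x) \<le> cmod a * vnorm BX T * vnorm X x"
      using homogD(2)[OF hom BXD(1)[OF T x], of a] BX_norm_le[OF T x] x
      by (simp add: bounded_algebra_simps(4) mult.assoc mult_left_mono)
  qed (simp add: BX_norm_nonneg T)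
  show ?thesis
  proof (cases "a = 0")
    case True
    thus ?thesis using *[OF T, of 0] BX_norm_nonneg[OF BX_scale[OF T, of 0]] by simp
  next
    case False
    have "vscale BX (1 / a) (vscale BX a T) = T"
      using False BXD(2)[OF T]
      by (auto simp: bounded_algebra_simps(4) BXD(1)[OF T] scale_scale scale_one extensional_def)
    hence "vnorm BX T \<le> cmod (1 / a) * vnorm BX (vscale BX a T)"
      using *[OF BX_scale[OF T, of a], of "1 / a"] by simp
    hence "cmod a * vnorm BX T \<le> vnorm BX (vscale BX a T)" using False by (simp add: norm_divide field_simps)
    thus ?thesis using *[OF T, of a] by simp
  qed
qed

lemma BX_eqI: "S \<in> carrier BX \<Longrightarrow> T \<in> carrier BX \<Longrightarrow> (\<And>x. x \<in> carrier X \<Longrightarrow> S x = T x) \<Longrightarrow> S = T"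
  using bounded_ops_eqI[of S X X T] by (simp add: BX_carrier)

lemma BX_apply:
  "x \<in> carrier X \<Longrightarrow> vadd BX S T x = vadd X (S x) (T x)"
  "x \<in> carrier X \<Longrightarrow> vscale BX a T x = vscale X a (T x)"
  "x \<in> carrier X \<Longrightarrow> vmult BX S T x = S (T x)"
  "x \<in> carrier X \<Longrightarrow> vzero BX x = vzero X"
  by (simp_all add: bounded_algebra_simps compose_def)

lemma BX_vector_space: "complex_vector_space BX"
proof
  fix T assume T: "T \<in> carrier BX"
  show "\<exists>S\<in>carrier BX. vadd BX T S = vzero BX"
    by (rule bexI[of _ "vscale BX (- 1) T"], rule BX_eqI)
       (simp_all add: T BX_add BX_scale BX_zero BX_apply BXD(1) add_minus)
qed (auto simp: BX_add BX_scale BX_zero BX_apply BXD(1) add_closed scale_closed add_assoc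
    add_zero scale_one scale_scale scale_add_left scale_add_right intro!: BX_eqI add_commute)

lemma BX_quasi_normed_algebra: "quasi_normed_algebra BX 1"
  by unfold_locales
     (auto simp: BX_add BX_scale BX_mult BX_apply BXD scale_closed add_closed BX_norm_nonneg BX_norm_mult
       intro!: BX_eqI)

lemma vdist_add:
  assumes "a \<in> carrier X" "b \<in> carrier X" "c \<in> carrier X" "d \<in> carrier X"
  shows "vdist X (vadd X a b) (vadd X c d) \<le> D * (vdist X a c + vdist X b d)"
  using assms quasi[of "vadd X a (vscale X (- 1) c)" "vadd X b (vscale X (- 1) d)"]
  by (simp add: vdist_def scale_add_right add_swap add_closed scale_closed)

lemma vdist_scale:
  assumes "a \<in> carrier X" "b \<in> carrier X"
  shows "vdist X (vscale X k a) (vscale X k b) = cmod k * vdist X a b"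
proof -
  have "vadd X (vscale X k a) (vscale X (- 1) (vscale X k b)) = vscale X k (vadd X a (vscale X (- 1) b))"
    using assms by (simp add: scale_add_right scale_scale scale_closed mult.commute)
  thus ?thesis using assms homogD(2)[OF hom] by (simp add: vdist_def add_closed scale_closed)
qed

lemma vdist_nonneg: "a \<in> carrier X \<Longrightarrow> b \<in> carrier X \<Longrightarrow> 0 \<le> vdist X a b"
  unfolding vdist_def by (rule homogD(3)[OF hom]) (simp add: add_closed scale_closed)

lemma vdist_map:
  assumes T: "T \<in> carrier BX" and ab: "a \<in> carrier X" "b \<in> carrier X"
  shows "vdist X (T a) (T b) \<le> vnorm BX T * vdist X a b"
  using BX_norm_le[OF T, of "vadd X a (vscale X (- 1) b)"] ab
  by (simp add: vdist_def BXD(3)[OF T] BXD(4)[OF T] add_closed scale_closed)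

lemma tends_toI:
  assumes "l \<in> carrier X" "\<And>n. s n \<in> carrier X" "\<And>n. vdist X (s n) l \<le> f n" "f \<longlonglongrightarrow> 0"
  shows "tends_to X s l"
  unfolding tends_to_def
  by (rule conjI[OF assms(1)], rule tendsto_sandwich[OF _ _ tendsto_const assms(4)])
     (use assms vdist_nonneg in auto)

lemma compact_add:
  assumes S: "S \<in> carrier BX" "compact_operator X S" and T: "T \<in> carrier BX" "compact_operator X T"
  shows "compact_operator X (vadd BX S T)"
  unfolding compact_operator_def
proof (intro allI impI)
  fix s :: "nat \<Rightarrow> 'a" assume s: "\<forall>n. s n \<in> carrier X \<and> vnorm X (s n) \<le> 1"
  obtain r l where r: "strict_mono (r :: nat \<Rightarrow> nat)" "tends_to X (\<lambda>n. S (s (r n))) l"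
    using S(2) s unfolding compact_operator_def by blast
  have "\<forall>n. s (r n) \<in> carrier X \<and> vnorm X (s (r n)) \<le> 1" using s by blast
  then obtain r' l' where r': "strict_mono (r' :: nat \<Rightarrow> nat)" "tends_to X (\<lambda>n. T (s (r (r' n)))) l'"
    using T(2)[unfolded compact_operator_def, rule_format, of "\<lambda>n. s (r n)"] by blast
  have "tends_to X (\<lambda>n. vadd BX S T (s (r (r' n)))) (vadd X l l')"
  proof (rule tends_toI[where f = "\<lambda>n. D * (vdist X (S (s (r (r' n)))) l + vdist X (T (s (r (r' n)))) l')"])
    have "(\<lambda>n. vdist X (S (s (r n))) l) \<longlonglongrightarrow> 0" "(\<lambda>n. vdist X (T (s (r (r' n)))) l') \<longlonglongrightarrow> 0"
      using r(2) r'(2) by (simp_all add: tends_to_def)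
    from tendsto_mult[OF tendsto_const tendsto_add[OF LIMSEQ_subseq_LIMSEQ[OF this(1) r'(1)] this(2)], of D]
    show "(\<lambda>n. D * (vdist X (S (s (r (r' n)))) l + vdist X (T (s (r (r' n)))) l')) \<longlonglongrightarrow> 0"
      by (simp add: o_def)
  qed (use r(2) r'(2) s in \<open>auto simp: tends_to_def BX_apply BXD(1) S T add_closed vdist_add\<close>)
  thus "\<exists>r l. strict_mono (r :: nat \<Rightarrow> nat) \<and> tends_to X (\<lambda>n. vadd BX S T (s (r n))) l"
    using strict_mono_o[OF r(1) r'(1)] by (intro exI[of _ "r \<circ> r'"] exI[of _ "vadd X l l'"]) (simp add: o_def)
qed

lemma compact_mult:
  assumes S: "S \<in> carrier BX" and T: "T \<in> carrier BX" "compact_operator X T"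
  shows "compact_operator X (vmult BX S T)"
  unfolding compact_operator_def
proof (intro allI impI)
  fix s :: "nat \<Rightarrow> 'a" assume s: "\<forall>n. s n \<in> carrier X \<and> vnorm X (s n) \<le> 1"
  obtain r l where r: "strict_mono (r :: nat \<Rightarrow> nat)" "tends_to X (\<lambda>n. T (s (r n))) l"
    using T(2) s unfolding compact_operator_def by blast
  have "tends_to X (\<lambda>n. vmult BX S T (s (r n))) (S l)"
  proof (rule tends_toI[where f = "\<lambda>n. vnorm BX S * vdist X (T (s (r n))) l"])
    show "(\<lambda>n. vnorm BX S * vdist X (T (s (r n))) l) \<longlonglongrightarrow> 0"
      using tendsto_mult[OF tendsto_const, of _ 0] r(2) by (fastforce simp: tends_to_def)
  qed (use r(2) s in \<open>auto simp: tends_to_def BX_apply BXD(1) S T vdist_map\<close>)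
  thus "\<exists>r l. strict_mono (r :: nat \<Rightarrow> nat) \<and> tends_to X (\<lambda>n. vmult BX S T (s (r n))) l"
    using r(1) by blast
qed

lemma compact_scale:
  assumes T: "T \<in> carrier BX" "compact_operator X T"
  shows "compact_operator X (vscale BX a T)"
  unfolding compact_operator_def
proof (intro allI impI)
  fix s :: "nat \<Rightarrow> 'a" assume s: "\<forall>n. s n \<in> carrier X \<and> vnorm X (s n) \<le> 1"
  obtain r l where r: "strict_mono (r :: nat \<Rightarrow> nat)" "tends_to X (\<lambda>n. T (s (r n))) l"
    using T(2) s unfolding compact_operator_def by blast
  have "tends_to X (\<lambda>n. vscale BX a T (s (r n))) (vscale X a l)"
  proof (rule tends_toI[where f = "\<lambda>n. cmod a * vdist X (T (s (r n))) l"])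
    show "(\<lambda>n. cmod a * vdist X (T (s (r n))) l) \<longlonglongrightarrow> 0"
      using tendsto_mult[OF tendsto_const, of _ 0] r(2) by (fastforce simp: tends_to_def)
  qed (use r(2) s in \<open>auto simp: tends_to_def BX_apply BXD(1) T vdist_scale scale_closed\<close>)
  thus "\<exists>r l. strict_mono (r :: nat \<Rightarrow> nat) \<and> tends_to X (\<lambda>n. vscale BX a T (s (r n))) l"
    using r(1) by blast
qed

text \<open>Compactness reduces to the bounded scalar sequence \<open>c (s n)\<close>, which has a
  convergent subsequence by Bolzano-Weierstrass. Matrix units and the rank one operators on S_2 are
  instances.\<close>

lemma rank_one:
  assumes F: "F \<in> carrier X"
    and add: "\<And>x y. x \<in> carrier X \<Longrightarrow> y \<in> carrier X \<Longrightarrow> c (vadd X x y) = c x + c y"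
    and scale: "\<And>a x. x \<in> carrier X \<Longrightarrow> c (vscale X a x) = a * c x"
    and bound: "\<And>x. x \<in> carrier X \<Longrightarrow> cmod (c x) \<le> M * vnorm X x"
  shows "(\<lambda>x\<in>carrier X. vscale X (c x) F) \<in> carrier BX"
    "compact_operator X (\<lambda>x\<in>carrier X. vscale X (c x) F)"
proof -
  note nF = homogD(3)[OF hom F]
  show "(\<lambda>x\<in>carrier X. vscale X (c x) F) \<in> carrier BX"
  proof (rule BXI[where M = "M * vnorm X F"])
    fix x assume x: "x \<in> carrier X"
    have "vnorm X (vscale X (c x) F) = cmod (c x) * vnorm X F" by (rule homogD(2)[OF hom F])
    also have "\<dots> \<le> (M * vnorm X x) * vnorm X F" by (intro mult_right_mono bound x nF)
    finally show "vnorm X ((\<lambda>x\<in>carrier X. vscale X (c x) F) x) \<le> M * vnorm X F * vnorm X x"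
      using x by (simp add: mult_ac)
  qed (auto simp: F add_closed scale_closed add scale scale_add_left scale_scale)
  show "compact_operator X (\<lambda>x\<in>carrier X. vscale X (c x) F)"
    unfolding compact_operator_def
  proof (intro allI impI)
    fix s :: "nat \<Rightarrow> 'a" assume s: "\<forall>n. s n \<in> carrier X \<and> vnorm X (s n) \<le> 1"
    have "cmod (c (s n)) \<le> \<bar>M\<bar>" for n
    proof -
      have "cmod (c (s n)) \<le> M * vnorm X (s n)" using bound s by blast
      also have "\<dots> \<le> \<bar>M\<bar> * 1" using s homogD(3)[OF hom] by (intro mult_mono) auto
      finally show ?thesis by simp
    qed
    hence "bounded (range (\<lambda>n. c (s n)))" unfolding bounded_iff by blast
    then obtain k r where r: "strict_mono (r :: nat \<Rightarrow> nat)" "((\<lambda>n. c (s n)) \<circ> r) \<longlonglongrightarrow> k"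
      using bounded_imp_convergent_subsequence by blast
    have d: "vdist X (vscale X p F) (vscale X q F) = cmod (p - q) * vnorm X F" for p q
    proof -
      have "vadd X (vscale X p F) (vscale X (- 1) (vscale X q F)) = vscale X (p - q) F"
        using scale_add_left[OF F, of p "- q"] by (simp add: scale_scale F)
      thus ?thesis by (simp add: vdist_def homogD(2)[OF hom F])
    qed
    have "tends_to X (\<lambda>n. (\<lambda>x\<in>carrier X. vscale X (c x) F) (s (r n))) (vscale X k F)"
    proof (rule tends_toI[where f = "\<lambda>n. cmod (c (s (r n)) - k) * vnorm X F"])
      have "(\<lambda>n. cmod (c (s (r n)) - k)) \<longlonglongrightarrow> 0"
        using r(2) by (simp add: o_def LIM_zero tendsto_norm_zero)
      from tendsto_mult[OF this tendsto_const, of "vnorm X F"]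
      show "(\<lambda>n. cmod (c (s (r n)) - k) * vnorm X F) \<longlonglongrightarrow> 0" by simp
    qed (use s in \<open>auto simp: scale_closed F d\<close>)
    thus "\<exists>r l. strict_mono (r :: nat \<Rightarrow> nat) \<and> tends_to X (\<lambda>n. (\<lambda>x\<in>carrier X. vscale X (c x) F) (s (r n))) l"
      using r(1) by blast
  qed
qed

lemma compact_zero: "compact_operator X (vzero BX)"
  using rank_one(2)[OF zero_closed, of "\<lambda>_. 0" 0] by (simp add: bounded_algebra_simps scale_zero zero_closed)

abbreviation "KX \<equiv> compact_algebra X"

lemma KX_quasi_normed_algebra: "quasi_normed_algebra KX 1"
  unfolding compact_algebra_def
  by (rule quasi_normed_algebra_subalgebra[OF BX_quasi_normed_algebra])
     (auto simp: BX_add BX_scale BX_mult compact_add compact_scale compact_mult)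

lemma KX_vector_space: "complex_vector_space KX"
  unfolding compact_algebra_def
  by (rule vector_subspace[OF BX_vector_space])
     (auto simp: BX_add BX_scale BX_zero compact_zero compact_add compact_scale)

end

section \<open>Orthonormal bases of Hilbert spaces\<close>

context hilbert_space
begin

abbreviation "ip \<equiv> cinner X"
abbreviation "C \<equiv> carrier X"

definition dif :: "'a \<Rightarrow> 'a \<Rightarrow> 'a" where
  "dif x y = vadd X x (vscale X (- 1) y)"

lemma dif_closed [simp]: "x \<in> C \<Longrightarrow> y \<in> C \<Longrightarrow> dif x y \<in> C"
  by (simp add: dif_def add_closed scale_closed)

lemma ip_scale_right: "x \<in> C \<Longrightarrow> y \<in> C \<Longrightarrow> ip x (vscale X a y) = cnj a * ip x y"
  by (simp add: inner_commute[of "vscale X a y" x] inner_scale scale_closed inner_commute[of y x])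

lemma ip_add_right: "x \<in> C \<Longrightarrow> y \<in> C \<Longrightarrow> z \<in> C \<Longrightarrow> ip x (vadd X y z) = ip x y + ip x z"
  by (simp add: inner_commute[of "vadd X y z" x] inner_add add_closed inner_commute[of y x] inner_commute[of z x])

lemma ip_dif_left: "x \<in> C \<Longrightarrow> y \<in> C \<Longrightarrow> z \<in> C \<Longrightarrow> ip (dif x y) z = ip x z - ip y z"
  by (simp add: dif_def inner_add inner_scale scale_closed)

lemma ip_dif_right: "x \<in> C \<Longrightarrow> y \<in> C \<Longrightarrow> z \<in> C \<Longrightarrow> ip z (dif x y) = ip z x - ip z y"
  by (simp add: dif_def ip_add_right ip_scale_right scale_closed)

lemma ip_self_zero: "x \<in> C \<Longrightarrow> Re (ip x x) = 0 \<Longrightarrow> x = vzero X"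
  using inner_pos by fastforce

lemma ip_zero_left: "z \<in> C \<Longrightarrow> ip (vzero X) z = 0"
  using inner_scale[of z z 0] by (simp add: scale_zero)

lemma ip_self_nonneg: "x \<in> C \<Longrightarrow> 0 \<le> Re (ip x x)"
  using inner_pos[of x] ip_zero_left[OF zero_closed] by (cases "x = vzero X") auto

lemma ip_self_Im: "x \<in> C \<Longrightarrow> Im (ip x x) = 0"
  using inner_commute[of x x] by (simp add: complex_eq_iff)

lemma dif_eq_zero:
  assumes x: "x \<in> C" and y: "y \<in> C" and d: "dif x y = vzero X"
  shows "x = y"
proof -
  let ?m = "vscale X (- 1) y"
  have m: "?m \<in> C" by (simp add: y scale_closed)
  have "vadd X y ?m = vadd X (vscale X 1 y) ?m" by (simp add: y scale_one)
  also have "\<dots> = vzero X" using scale_add_left[OF y, of 1 "- 1"] by (simp add: scale_zero y)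
  finally have ym: "vadd X y ?m = vzero X" .
  have "x = vadd X x (vadd X y ?m)" by (simp add: ym add_zero x)
  also have "\<dots> = vadd X x (vadd X ?m y)" by (simp add: add_commute[OF y m])
  also have "\<dots> = vadd X (vadd X x ?m) y" by (simp add: add_assoc x y m)
  also have "\<dots> = vadd X (vzero X) y" using d by (simp add: dif_def)
  also have "\<dots> = y" using add_commute[OF zero_closed y] by (simp add: add_zero y)
  finally show ?thesis .
qed

lemma inner_ext:
  assumes x: "x \<in> C" and y: "y \<in> C" and e: "\<And>z. z \<in> C \<Longrightarrow> ip x z = ip y z"
  shows "x = y"
proof (rule dif_eq_zero[OF x y], rule ip_self_zero)
  show "dif x y \<in> C" using x y by simp
  thus "Re (ip (dif x y) (dif x y)) = 0" using e by (simp add: ip_dif_left x y)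
qed

lemma norm_square: "x \<in> C \<Longrightarrow> (vnorm X x)\<^sup>2 = Re (ip x x)"
  by (simp add: norm_eq ip_self_nonneg)

lemma norm_nonneg: "x \<in> C \<Longrightarrow> 0 \<le> vnorm X x"
  by (simp add: norm_eq ip_self_nonneg)

lemma homog: "homog X"
proof -
  have "vnorm X (vscale X a x) = cmod a * vnorm X x" if x: "x \<in> C" for a x
  proof (rule power2_eq_imp_eq)
    have "ip (vscale X a x) (vscale X a x) = (a * cnj a) * ip x x"
      by (simp add: inner_scale ip_scale_right scale_closed x)
    thus "(vnorm X (vscale X a x))\<^sup>2 = (cmod a * vnorm X x)\<^sup>2"
      by (simp add: norm_square scale_closed x power_mult_distrib complex_norm_square[symmetric] del: of_real_power)
  qed (use x in \<open>auto simp: norm_nonneg scale_closed\<close>)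
  thus ?thesis using zero_closed by (auto simp: homog_def scale_closed norm_nonneg)
qed

lemma vdist_dif: "vdist X x y = vnorm X (dif x y)"
  by (simp add: vdist_def dif_def)

lemma vdist_square: "x \<in> C \<Longrightarrow> y \<in> C \<Longrightarrow> (vdist X x y)\<^sup>2 = Re (ip x x) - 2 * Re (ip x y) + Re (ip y y)"
  by (simp add: vdist_dif norm_square ip_dif_left ip_dif_right inner_commute[of x y])

text \<open>A finite linear combination is described by its inner products, which determine it; this
  avoids forming sums with the addition of the record.\<close>

lemma comb_exists:
  assumes "finite F" "F \<subseteq> C"
  shows "\<exists>y\<in>C. \<forall>z\<in>C. ip y z = (\<Sum>e\<in>F. c e * ip e z)"
  using assms
proof (induction F)
  case empty
  show ?case by (rule bexI[of _ "vzero X"]) (auto simp: ip_zero_left zero_closed)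
next
  case (insert e F)
  then obtain y where y: "y \<in> C" "\<forall>z\<in>C. ip y z = (\<Sum>e\<in>F. c e * ip e z)" by auto
  have e: "e \<in> C" using insert.prems by simp
  show ?case
    by (rule bexI[of _ "vadd X (vscale X (c e) e) y"])
       (use y e insert.hyps in \<open>auto simp: inner_add inner_scale scale_closed add_closed\<close>)
qed

lemma orthonormal_basis_exists: "\<exists>E. orthonormal_basis X E"
proof -
  define A where "A = {E. E \<subseteq> C \<and> (\<forall>d\<in>E. \<forall>e\<in>E. ip d e = (if d = e then 1 else 0))}"
  have "\<exists>M\<in>A. \<forall>N\<in>A. M \<subseteq> N \<longrightarrow> N = M"
  proof (rule subset_Zorn')
    fix CC assume CC: "subset.chain A CC"
    hence sub: "CC \<subseteq> A" and lin: "\<And>U V. U \<in> CC \<Longrightarrow> V \<in> CC \<Longrightarrow> U \<subseteq> V \<or> V \<subseteq> U"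
      by (auto simp: subset.chain_def)
    have "ip d e = (if d = e then 1 else 0)" if a: "d \<in> U" "U \<in> CC" "e \<in> V" "V \<in> CC" for d e U V
    proof -
      obtain W where "W \<in> CC" "d \<in> W" "e \<in> W" using lin[OF a(2,4)] a by blast
      thus ?thesis using sub by (auto simp: A_def)
    qed
    thus "\<Union>CC \<in> A" using sub unfolding A_def by blast
  qed
  then obtain M where M: "M \<in> A" "\<And>N. N \<in> A \<Longrightarrow> M \<subseteq> N \<Longrightarrow> N = M" by blast
  have "x = vzero X" if x: "x \<in> C" and perp: "\<forall>e\<in>M. ip x e = 0" for x
  proof (rule ccontr)
    assume nz: "x \<noteq> vzero X"
    hence pos: "Re (ip x x) > 0" using inner_pos x by blast
    define r where "r = 1 / sqrt (Re (ip x x))"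
    have rr: "r * r * Re (ip x x) = 1" using pos by (simp add: r_def)
    define u where "u = vscale X (of_real r) x"
    have u: "u \<in> C" by (simp add: u_def scale_closed x)
    have xx: "ip x x = of_real (Re (ip x x))" using ip_self_Im[OF x] by (simp add: complex_eq_iff)
    have "ip u u = of_real r * (of_real r * ip x x)"
      by (simp add: u_def inner_scale ip_scale_right scale_closed x)
    also have "\<dots> = of_real (r * r * Re (ip x x))" by (subst xx) simp
    finally have uu: "ip u u = 1" by (simp only: rr of_real_1)
    have ue: "ip u e = 0" "ip e u = 0" if "e \<in> M" for e
    proof -
      have e: "e \<in> C" using M(1) that by (auto simp: A_def)
      show "ip u e = 0" using perp that by (simp add: u_def inner_scale x e)
      thus "ip e u = 0" using inner_commute[OF u e] by simp
    qed
    have "insert u M \<in> A" using M(1) u uu ue unfolding A_def by auto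
    hence "insert u M = M" by (rule M(2)) auto
    hence "u \<in> M" by auto
    thus False using ue uu by fastforce
  qed
  hence "orthonormal_basis X M" using M(1) by (auto simp: orthonormal_basis_def A_def)
  thus ?thesis by blast
qed

end

locale hilbert_onb = hilbert_space X for X :: "('a, 'm) hilbert_scheme" +
  fixes E :: "'a set"
  assumes onb: "orthonormal_basis X E"
begin

lemma E_closed: "e \<in> E \<Longrightarrow> e \<in> C"
  using onb by (auto simp: orthonormal_basis_def)

lemma ip_E: "d \<in> E \<Longrightarrow> e \<in> E \<Longrightarrow> ip d e = (if d = e then 1 else 0)"
  using onb by (auto simp: orthonormal_basis_def)

lemma onb_ext:
  assumes x: "x \<in> C" and y: "y \<in> C" and e: "\<And>e. e \<in> E \<Longrightarrow> ip x e = ip y e"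
  shows "x = y"
proof (rule dif_eq_zero[OF x y])
  have "\<forall>e\<in>E. ip (dif x y) e = 0" using e by (simp add: ip_dif_left x y E_closed)
  thus "dif x y = vzero X" using onb x y unfolding orthonormal_basis_def by simp
qed

definition is_comb :: "'a \<Rightarrow> ('a \<Rightarrow> complex) \<Rightarrow> 'a set \<Rightarrow> bool" where
  "is_comb y c F \<longleftrightarrow> y \<in> C \<and> (\<forall>z\<in>C. ip y z = (\<Sum>e\<in>F. c e * ip e z))"

lemma is_comb_coeff:
  assumes y: "is_comb y c F" and F: "finite F" "F \<subseteq> E" and d: "d \<in> E"
  shows "ip y d = (if d \<in> F then c d else 0)"
proof -
  have "ip y d = (\<Sum>e\<in>F. c e * (if e = d then 1 else 0))"
    using y d F(2) unfolding is_comb_def by (auto simp: E_closed ip_E intro!: sum.cong)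
  thus ?thesis using F(1) by (simp add: if_distrib cong: if_cong)
qed

lemma is_comb_ip:
  assumes y: "is_comb y c F" and F: "finite F" "F \<subseteq> E" and x: "x \<in> C"
  shows "ip y x = (\<Sum>e\<in>F. c e * cnj (ip x e))"
proof -
  have "ip y x = (\<Sum>e\<in>F. c e * ip e x)" using y x by (simp add: is_comb_def)
  also have "\<dots> = (\<Sum>e\<in>F. c e * cnj (ip x e))"
    by (rule sum.cong) (use F(2) in \<open>auto simp: inner_commute[OF x E_closed]\<close>)
  finally show ?thesis .
qed

lemma is_comb_norm:
  assumes y: "is_comb y c F" and F: "finite F" "F \<subseteq> E"
  shows "Re (ip y y) = (\<Sum>e\<in>F. (cmod (c e))\<^sup>2)"
proof -
  have "ip y y = (\<Sum>e\<in>F. c e * cnj (ip y e))"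
    by (rule is_comb_ip[OF y F]) (use y in \<open>simp add: is_comb_def\<close>)
  also have "\<dots> = (\<Sum>e\<in>F. c e * cnj (c e))"
    by (rule sum.cong) (use is_comb_coeff[OF y F] F(2) in auto)
  finally show ?thesis by (simp add: complex_norm_square[symmetric] flip: of_real_sum)
qed

lemma bessel_identity:
  assumes y: "is_comb y c F" and F: "finite F" "F \<subseteq> E" and x: "x \<in> C"
    and c: "\<And>e. e \<in> F \<Longrightarrow> ip x e = c e"
  shows "(vdist X y x)\<^sup>2 = Re (ip x x) - (\<Sum>e\<in>F. (cmod (c e))\<^sup>2)"
proof -
  have "ip y x = (\<Sum>e\<in>F. c e * cnj (c e))"
    unfolding is_comb_ip[OF y F x] by (rule sum.cong) (simp_all add: c)
  hence 1: "Re (ip y x) = (\<Sum>e\<in>F. (cmod (c e))\<^sup>2)"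
    by (simp add: complex_norm_square[symmetric] flip: of_real_sum)
  have "y \<in> C" using y by (simp add: is_comb_def)
  from vdist_square[OF this x] show ?thesis unfolding 1 is_comb_norm[OF y F] by simp
qed

lemma comb: "finite F \<Longrightarrow> F \<subseteq> E \<Longrightarrow> \<exists>y. is_comb y c F"
  using comb_exists[of F c] E_closed unfolding is_comb_def by blast

lemma bessel:
  assumes x: "x \<in> C" and F: "finite F" "F \<subseteq> E"
  shows "(\<Sum>e\<in>F. (cmod (ip x e))\<^sup>2) \<le> Re (ip x x)"
proof -
  obtain y where "is_comb y (\<lambda>e. ip x e) F" using comb[OF F] by blast
  from bessel_identity[OF this F x] show ?thesis using zero_le_power2[of "vdist X y x"] by simp
qed

lemma coeff_le_norm:
  assumes "x \<in> C" "e \<in> E"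
  shows "cmod (ip x e) \<le> vnorm X x"
  by (rule power2_le_imp_le) (use bessel[OF assms(1), of "{e}"] assms in \<open>auto simp: norm_square norm_nonneg\<close>)

text \<open>The basis may be uncountable, so initial segments are replaced by finite sets
  \<open>Fn n\<close> whose sums come within 1 / (n + 1) of the supremum. Any finite set disjoint
  from \<open>Fn n\<close> then has sum at most 1 / (n + 1), which makes the corresponding
  combinations a Cauchy sequence.\<close>

lemma riesz_fischer:
  fixes c :: "'a \<Rightarrow> complex"
  assumes B: "\<And>F. finite F \<Longrightarrow> F \<subseteq> E \<Longrightarrow> (\<Sum>e\<in>F. (cmod (c e))\<^sup>2) \<le> B"
  shows "\<exists>y\<in>C. (\<forall>e\<in>E. ip y e = c e) \<and> Re (ip y y) \<le> B"
proof -
  define q where "q F = (\<Sum>e\<in>F. (cmod (c e))\<^sup>2)" for F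
  define S where "S = (SUP F\<in>{F. finite F \<and> F \<subseteq> E}. q F)"
  have bdd: "bdd_above (q ` {F. finite F \<and> F \<subseteq> E})" by (rule bdd_aboveI2[of _ _ B]) (use B in \<open>auto simp: q_def\<close>)
  have qS: "q F \<le> S" if "finite F" "F \<subseteq> E" for F
    unfolding S_def by (rule cSUP_upper[OF _ bdd]) (use that in auto)
  have "\<exists>F. finite F \<and> F \<subseteq> E \<and> S - 1 / real (Suc n) < q F" for n
  proof -
    have "S - 1 / real (Suc n) < S" by simp
    then obtain F where "F \<in> {F. finite F \<and> F \<subseteq> E}" "S - 1 / real (Suc n) < q F"
      unfolding S_def using less_cSUP_iff[OF _ bdd] by (metis (mono_tags, lifting) empty_subsetI empty_iff finite.emptyI mem_Collect_eq)
    thus ?thesis by blast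
  qed
  then obtain Fn where Fn: "\<And>n. finite (Fn n)" "\<And>n. Fn n \<subseteq> E" "\<And>n. S - 1 / real (Suc n) < q (Fn n)"
    by metis
  have tail: "q G \<le> 1 / real (Suc n)" if G: "finite G" "G \<subseteq> E" "G \<inter> Fn n = {}" for G n
  proof -
    have "q (G \<union> Fn n) = q G + q (Fn n)" unfolding q_def by (rule sum.union_disjoint) (use G Fn in auto)
    thus ?thesis using qS[of "G \<union> Fn n"] Fn(1,2,3)[of n] G by simp
  qed
  obtain y where y: "\<And>n. is_comb (y n) c (Fn n)" using comb[OF Fn(1,2)] by metis
  have yC: "y n \<in> C" for n using y by (simp add: is_comb_def)
  have dist: "(vdist X (y m) (y n))\<^sup>2 \<le> 1 / real (Suc m) + 1 / real (Suc n)" for m n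
  proof -
    let ?G = "Fn m \<union> Fn n"
    define c' where "c' e = (if e \<in> Fn m then c e else 0) - (if e \<in> Fn n then c e else 0)" for e
    have fin: "finite ?G" "?G \<subseteq> E" using Fn by auto
    have "ip (y k) z = (\<Sum>e\<in>?G. (if e \<in> Fn k then c e else 0) * ip e z)" if "z \<in> C" "k = m \<or> k = n" for k z
    proof -
      have "ip (y k) z = (\<Sum>e\<in>Fn k. c e * ip e z)" using y[of k] that by (simp add: is_comb_def)
      also have "\<dots> = (\<Sum>e\<in>?G. (if e \<in> Fn k then c e else 0) * ip e z)"
        by (rule sum.mono_neutral_cong_left) (use fin that in auto)
      finally show ?thesis .
    qed
    hence "is_comb (dif (y m) (y n)) c' ?G"
      using yC by (auto simp: is_comb_def ip_dif_left c'_def left_diff_distrib sum_subtractf)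
    hence "(vdist X (y m) (y n))\<^sup>2 = (\<Sum>e\<in>?G. (cmod (c' e))\<^sup>2)"
      using is_comb_norm[OF _ fin] yC by (simp add: vdist_dif norm_square)
    also have "\<dots> = (\<Sum>e\<in>(Fn m - Fn n) \<union> (Fn n - Fn m). (cmod (c e))\<^sup>2)"
      by (rule sum.mono_neutral_cong_right) (use fin in \<open>auto simp: c'_def\<close>)
    also have "\<dots> = q (Fn m - Fn n) + q (Fn n - Fn m)"
      unfolding q_def by (rule sum.union_disjoint) (use Fn in auto)
    also have "\<dots> \<le> 1 / real (Suc n) + 1 / real (Suc m)"
      by (intro add_mono tail) (use Fn in auto)
    finally show ?thesis by simp
  qed
  have "cauchy_seq X y"
    unfolding cauchy_seq_def
  proof (intro conjI allI impI)
    show "range y \<subseteq> C" using yC by auto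
    fix e :: real assume e: "e > 0"
    obtain N where N: "inverse (real (Suc N)) < e\<^sup>2 / 2" using reals_Archimedean[of "e\<^sup>2 / 2"] e by auto
    have "vdist X (y m) (y n) < e" if "m \<ge> N" "n \<ge> N" for m n
    proof (rule power2_less_imp_less)
      have "1 / real (Suc k) < e\<^sup>2 / 2" if "k \<ge> N" for k
      proof -
        have "1 / real (Suc k) \<le> 1 / real (Suc N)" using that by (intro divide_left_mono) auto
        thus ?thesis using N by (simp add: inverse_eq_divide)
      qed
      from this[OF \<open>m \<ge> N\<close>] this[OF \<open>n \<ge> N\<close>] show "(vdist X (y m) (y n))\<^sup>2 < e\<^sup>2"
        using dist[of m n] by linarith
    qed (use e in simp)
    thus "\<exists>N. \<forall>m\<ge>N. \<forall>n\<ge>N. vdist X (y m) (y n) < e" by blast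
  qed
  then obtain z where z: "z \<in> C" "(\<lambda>n. vdist X (y n) z) \<longlonglongrightarrow> 0"
    using complete unfolding tends_to_def by blast
  have coeff: "ip z e = c e" if e: "e \<in> E" for e
  proof -
    \<comment> \<open>Two errors vanish: the distance of \<open>y n\<close> from the limit, and the
      coefficient missing when \<open>e\<close> is outside \<open>Fn n\<close>, at most the root of
      1 / (n + 1). The sum \<open>0 + 0\<close> is the form delivered by
      \<open>tendsto_add\<close>.\<close>
    have "cmod (c e - ip z e) \<le> 0 + 0"
    proof (rule LIMSEQ_le_const)
      have "(\<lambda>n. sqrt (1 / real (Suc n))) \<longlonglongrightarrow> sqrt 0"
        by (intro tendsto_real_sqrt) (use LIMSEQ_inverse_real_of_nat in \<open>simp add: inverse_eq_divide\<close>)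
      thus "(\<lambda>n. vdist X (y n) z + sqrt (1 / real (Suc n))) \<longlonglongrightarrow> 0 + 0"
        by (intro tendsto_add z(2)) simp
      have "cmod (c e - ip z e) \<le> vdist X (y n) z + sqrt (1 / real (Suc n))" for n
      proof -
        have "cmod (ip (y n) e - ip z e) \<le> vdist X (y n) z"
          using coeff_le_norm[of "dif (y n) z" e] yC z e by (simp add: ip_dif_left E_closed vdist_dif)
        moreover have "cmod (c e - ip (y n) e) \<le> sqrt (1 / real (Suc n))"
        proof (cases "e \<in> Fn n")
          case True thus ?thesis using is_comb_coeff[OF y Fn(1,2) e] by simp
        next
          case False
          hence "(cmod (c e))\<^sup>2 \<le> 1 / real (Suc n)" using tail[of "{e}" n] e by (simp add: q_def)
          thus ?thesis using False is_comb_coeff[OF y Fn(1,2) e] by (simp add: real_le_rsqrt)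
        qed
        ultimately show ?thesis using norm_triangle_ineq[of "c e - ip (y n) e" "ip (y n) e - ip z e"] by simp
      qed
      thus "\<exists>N. \<forall>n\<ge>N. cmod (c e - ip z e) \<le> vdist X (y n) z + sqrt (1 / real (Suc n))" by blast
    qed
    thus ?thesis by simp
  qed
  have "Re (ip z z) \<le> 0\<^sup>2 + B"
  proof (rule LIMSEQ_le_const)
    show "(\<lambda>n. (vdist X (y n) z)\<^sup>2 + B) \<longlonglongrightarrow> 0\<^sup>2 + B" by (intro tendsto_intros z(2))
    have "Re (ip z z) \<le> (vdist X (y n) z)\<^sup>2 + B" for n
    proof -
      have "(vdist X (y n) z)\<^sup>2 = Re (ip z z) - (\<Sum>e\<in>Fn n. (cmod (c e))\<^sup>2)"
        by (rule bessel_identity[OF y Fn(1,2) z(1)]) (use coeff Fn(2) in blast)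
      thus ?thesis using B[OF Fn(1,2), of n] by linarith
    qed
    thus "\<exists>N. \<forall>n\<ge>N. Re (ip z z) \<le> (vdist X (y n) z)\<^sup>2 + B" by blast
  qed
  thus ?thesis using coeff z(1) by (intro bexI[of _ z]) auto
qed

subsection \<open>Embedding into real square-summable families\<close>

text \<open>
  Real and imaginary parts of the coefficients embed the space into \<open>l2\<close> over \<open>'a \<times> bool\<close>; families
  supported on \<open>E \<times> UNIV\<close> form the range, \<open>K\<close> is the adjoint of \<open>J\<close> and \<open>J K\<close> the
  projection onto the range.
\<close>

definition jc :: "'a \<Rightarrow> 'a \<times> bool \<Rightarrow> real" where
  "jc x = (\<lambda>(e, b). if e \<in> E then (if b then Re (ip x e) else Im (ip x e)) else 0)"

definition J :: "'a \<Rightarrow> ('a \<times> bool) l2" where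
  "J x = Abs_l2 (jc x)"

lemma sum_times_bool: "(\<Sum>i\<in>F \<times> UNIV. f i) = (\<Sum>e\<in>F. f (e, True) + f (e, False))"
  by (simp add: sum.cartesian_product' UNIV_bool add.commute)

lemma cf_J_le:
  assumes x: "x \<in> C"
  shows cf_J: "cf (J x) = jc x" and norm_J_le: "norm (J x) \<le> vnorm X x"
proof -
  have "(\<Sum>i\<in>F. (jc x i)\<^sup>2) \<le> (vnorm X x)\<^sup>2" if F: "finite F" for F
  proof -
    let ?G = "fst ` F \<inter> E"
    have "(\<Sum>i\<in>F. (jc x i)\<^sup>2) \<le> (\<Sum>i\<in>?G \<times> UNIV. (jc x i)\<^sup>2)"
    proof -
      have "(\<Sum>i\<in>F. (jc x i)\<^sup>2) = (\<Sum>i\<in>F \<inter> (?G \<times> UNIV). (jc x i)\<^sup>2)"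
      proof (rule sum.mono_neutral_right)
        show "\<forall>i\<in>F - F \<inter> (?G \<times> UNIV). (jc x i)\<^sup>2 = 0"
        proof
          fix i assume "i \<in> F - F \<inter> (?G \<times> UNIV)"
          hence "fst i \<notin> E" by (cases i) force
          thus "(jc x i)\<^sup>2 = 0" by (cases i) (simp add: jc_def)
        qed
      qed (use F in auto)
      also have "\<dots> \<le> (\<Sum>i\<in>?G \<times> UNIV. (jc x i)\<^sup>2)"
        by (rule sum_mono2) (use F in auto)
      finally show ?thesis .
    qed
    also have "\<dots> = (\<Sum>e\<in>?G. (cmod (ip x e))\<^sup>2)"
      by (simp add: sum_times_bool jc_def cmod_power2)
    also have "\<dots> \<le> (vnorm X x)\<^sup>2" using bessel[OF x, of ?G] F by (simp add: norm_square x)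
    finally show ?thesis .
  qed
  note * = l2_of_bounded_sums[OF this norm_nonneg[OF x]]
  show "cf (J x) = jc x" "norm (J x) \<le> vnorm X x"
    using * by (simp_all add: J_def)
qed

definition K :: "('a \<times> bool) l2 \<Rightarrow> 'a" where
  "K v = (SOME y. y \<in> C \<and> (\<forall>e\<in>E. ip y e = Complex (cf v (e, True)) (cf v (e, False))) \<and> vnorm X y \<le> norm v)"

lemma K_props: "K v \<in> C \<and> (\<forall>e\<in>E. ip (K v) e = Complex (cf v (e, True)) (cf v (e, False))) \<and> vnorm X (K v) \<le> norm v"
proof -
  have le: "(\<Sum>e\<in>F. (cmod (Complex (cf v (e, True)) (cf v (e, False))))\<^sup>2) \<le> (norm v)\<^sup>2" if F: "finite F" for F
  proof -
    have "(\<Sum>e\<in>F. (cmod (Complex (cf v (e, True)) (cf v (e, False))))\<^sup>2) = (\<Sum>i\<in>F \<times> UNIV. (cf v i)\<^sup>2)"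
      by (simp add: sum_times_bool cmod_power2)
    also have "\<dots> \<le> (norm v)\<^sup>2" by (rule finite_sum_cf_le) (use F in simp)
    finally show ?thesis .
  qed
  have "\<exists>y\<in>C. (\<forall>e\<in>E. ip y e = Complex (cf v (e, True)) (cf v (e, False))) \<and> Re (ip y y) \<le> (norm v)\<^sup>2"
    by (rule riesz_fischer) (rule le)
  then obtain y where y: "y \<in> C" "\<forall>e\<in>E. ip y e = Complex (cf v (e, True)) (cf v (e, False))" "Re (ip y y) \<le> (norm v)\<^sup>2"
    by blast
  have "vnorm X y \<le> norm v" by (rule power2_le_imp_le) (use y in \<open>auto simp: norm_square\<close>)
  with y have "\<exists>y. y \<in> C \<and> (\<forall>e\<in>E. ip y e = Complex (cf v (e, True)) (cf v (e, False))) \<and> vnorm X y \<le> norm v"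
    by blast
  thus ?thesis unfolding K_def by (rule someI_ex)
qed

lemma K_closed [simp]: "K v \<in> C" using K_props by blast
lemma ip_K: "e \<in> E \<Longrightarrow> ip (K v) e = Complex (cf v (e, True)) (cf v (e, False))" using K_props by blast
lemma norm_K_le: "vnorm X (K v) \<le> norm v" using K_props by blast

lemma K_J [simp]: "x \<in> C \<Longrightarrow> K (J x) = x"
  by (rule onb_ext) (simp_all add: ip_K cf_J jc_def complex_eq_iff)

lemma norm_J: "x \<in> C \<Longrightarrow> norm (J x) = vnorm X x"
  using norm_J_le[of x] norm_K_le[of "J x"] by simp

lemma J_add: "x \<in> C \<Longrightarrow> y \<in> C \<Longrightarrow> J (vadd X x y) = J x + J y"
  by (rule l2_eqI) (auto simp: cf_J add_closed jc_def inner_add E_closed split: prod.splits)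

lemma J_scale: "x \<in> C \<Longrightarrow> J (vscale X (of_real r) x) = r *\<^sub>R J x"
  by (rule l2_eqI) (auto simp: cf_J scale_closed jc_def inner_scale E_closed split: prod.splits)

lemma J_scale_complex:
  "x \<in> C \<Longrightarrow> J (vscale X a x) = Re a *\<^sub>R J x + Im a *\<^sub>R J (vscale X \<i> x)"
  by (rule l2_eqI) (auto simp: cf_J scale_closed jc_def inner_scale E_closed split: prod.splits)

lemma J_dif: "x \<in> C \<Longrightarrow> y \<in> C \<Longrightarrow> J (dif x y) = J x - J y"
  using J_scale[of y "-1"] by (simp add: dif_def J_add scale_closed)

lemma K_add: "K (v + w) = vadd X (K v) (K w)"
  by (rule onb_ext) (auto simp: add_closed ip_K inner_add E_closed complex_eq_iff)

lemma K_scale: "K (r *\<^sub>R v) = vscale X (of_real r) (K v)"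
  by (rule onb_ext) (auto simp: scale_closed ip_K inner_scale E_closed complex_eq_iff)

text \<open>\<open>J\<close> is real linear and isometric, so this is polarisation.\<close>

lemma inner_J_J:
  assumes "x \<in> C" "y \<in> C"
  shows "inner (J x) (J y) = Re (ip x y)"
proof -
  have "(norm (J x - J y))\<^sup>2 = (vdist X x y)\<^sup>2"
    using assms by (simp add: J_dif[symmetric] norm_J vdist_dif)
  hence "(norm (J x))\<^sup>2 + (norm (J y))\<^sup>2 - 2 * inner (J x) (J y) = Re (ip x x) - 2 * Re (ip x y) + Re (ip y y)"
    using assms by (simp add: vdist_square power2_norm_eq_inner inner_diff_left inner_diff_right
        real_inner_class.inner_commute[of "J y" "J x"])
  thus ?thesis using assms by (simp add: norm_J norm_square)
qed

lemma cf_J_K: "cf (J (K v)) (e, b) = (if e \<in> E then cf v (e, b) else 0)"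
  by (simp add: cf_J jc_def ip_K)

lemma inner_J:
  assumes "x \<in> C"
  shows "inner (J x) v = Re (ip x (K v))"
proof -
  have "inner (J x) v = inner (J x) (J (K v))"
    unfolding inner_l2_def
  proof (rule infsum_cong)
    fix i :: "'a \<times> bool"
    show "cf (J x) i * cf v i = cf (J x) i * cf (J (K v)) i"
      by (cases i) (simp add: cf_J_K cf_J[OF assms] jc_def)
  qed
  thus ?thesis by (simp add: inner_J_J assms)
qed

lemma J_E: "e \<in> E \<Longrightarrow> J e = ev (e, True)"
  by (rule l2_eqI) (auto simp: cf_J E_closed jc_def ip_E split: prod.splits)

lemma J_i_E: "e \<in> E \<Longrightarrow> J (vscale X \<i> e) = ev (e, False)"
  by (rule l2_eqI) (auto simp: cf_J E_closed scale_closed inner_scale jc_def ip_E split: prod.splits)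

lemma K_ev_outside: "e \<notin> E \<Longrightarrow> K (ev (e, b)) = vzero X"
  by (rule onb_ext) (auto simp: zero_closed ip_K ip_zero_left E_closed complex_eq_iff)

end

section \<open>Transfer of operators\<close>

context hilbert_onb
begin

abbreviation "B \<equiv> bounded_algebra X"

sublocale Q: quasi_normed_space X 1
proof unfold_locales
  show "homog X" by (rule homog)
  show "vnorm X (vadd X x y) \<le> 1 * (vnorm X x + vnorm X y)" if "x \<in> C" "y \<in> C" for x y
    using norm_triangle_ineq[of "J x" "J y"] that by (simp add: norm_J add_closed flip: J_add)
qed simp

text \<open>The transported operator, extended by zero to the complement of the range of
  \<open>J\<close>. In particular the identity becomes the projection \<open>Pb\<close>.\<close>

definition L :: "('a \<Rightarrow> 'a) \<Rightarrow> ('a \<times> bool) op" where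
  "L T = Blinfun (\<lambda>v. J (T (K v)))"

lemma L_apply:
  assumes T: "T \<in> carrier B"
  shows "L T v = J (T (K v))"
proof -
  obtain M where M: "\<forall>x\<in>C. vnorm X (T x) \<le> M * vnorm X x" using Q.BXD(5)[OF T] by blast
  have "bounded_linear (\<lambda>v. J (T (K v)))"
  proof (rule bounded_linear_intro[of _ "\<bar>M\<bar>"])
    fix v w r
    show "J (T (K (v + w))) = J (T (K v)) + J (T (K w))"
      by (simp add: K_add Q.BXD(3)[OF T] J_add Q.BXD(1)[OF T])
    show "J (T (K (r *\<^sub>R v))) = r *\<^sub>R J (T (K v))"
      by (simp add: K_scale Q.BXD(4)[OF T] J_scale Q.BXD(1)[OF T])
    have "vnorm X (T (K v)) \<le> M * vnorm X (K v)" using M by simp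
    also have "\<dots> \<le> \<bar>M\<bar> * norm v"
      using norm_K_le[of v] norm_nonneg[of "K v"] by (intro mult_mono) auto
    finally show "norm (J (T (K v))) \<le> norm v * \<bar>M\<bar>"
      by (simp add: norm_J Q.BXD(1)[OF T] mult.commute)
  qed
  thus ?thesis by (simp add: L_def bounded_linear_Blinfun_apply)
qed

lemma L_J: "T \<in> carrier B \<Longrightarrow> x \<in> C \<Longrightarrow> L T (J x) = J (T x)"
  by (simp add: L_apply)

lemma norm_L:
  assumes T: "T \<in> carrier B"
  shows "vnorm B T = norm (L T)"
proof (rule antisym)
  show "vnorm B T \<le> norm (L T)"
  proof (rule Q.BX_norm_least)
    fix x assume x: "x \<in> C"
    thus "vnorm X (T x) \<le> norm (L T) * vnorm X x"
      using norm_blinfun[of "L T" "J x"] by (simp add: L_J[OF T] norm_J Q.BXD(1)[OF T])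
  qed simp
  show "norm (L T) \<le> vnorm B T"
  proof (rule norm_blinfun_bound[OF Q.BX_norm_nonneg[OF T]])
    fix v
    have "vnorm X (T (K v)) \<le> vnorm B T * vnorm X (K v)" by (rule Q.BX_norm_le[OF T K_closed])
    also have "\<dots> \<le> vnorm B T * norm v" by (rule mult_left_mono[OF norm_K_le Q.BX_norm_nonneg[OF T]])
    finally show "norm (L T v) \<le> vnorm B T * norm v"
      by (simp add: L_apply[OF T] norm_J Q.BXD(1)[OF T])
  qed
qed

lemma comp_B: "S \<in> carrier B \<Longrightarrow> T \<in> carrier B \<Longrightarrow> compose C S T \<in> carrier B"
  unfolding bounded_algebra_simps(6)[symmetric] by (rule Q.BX_mult)

lemma id_B: "(\<lambda>x\<in>C. x) \<in> carrier B"
  by (rule Q.BXI[where M = 1]) (auto simp: add_closed scale_closed)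

lemma i_B: "(\<lambda>x\<in>C. vscale X \<i> x) \<in> carrier B"
  using Q.BX_scale[OF id_B, of \<i>] by (simp add: bounded_algebra_simps cong: restrict_cong)

lemma map_vzero: "T \<in> carrier B \<Longrightarrow> T (vzero X) = vzero X"
  using Q.BXD(4)[of T "vzero X" 0] Q.BXD(1)[of T "vzero X"] by (simp add: scale_zero zero_closed)

lemma L_add: "S \<in> carrier B \<Longrightarrow> T \<in> carrier B \<Longrightarrow> L (vadd B S T) = L S + L T"
  by (rule blinfun_eqI) (simp add: L_apply Q.BX_add blinfun.add_left, simp add: bounded_algebra_simps J_add Q.BXD(1))

lemma L_scale: "T \<in> carrier B \<Longrightarrow> L (vscale B (of_real r) T) = r *\<^sub>R L T"
  by (rule blinfun_eqI) (simp add: L_apply Q.BX_scale blinfun.scaleR_left, simp add: bounded_algebra_simps J_scale Q.BXD(1))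

lemma L_comp: "S \<in> carrier B \<Longrightarrow> T \<in> carrier B \<Longrightarrow> L (compose C S T) = L S o\<^sub>L L T"
  by (rule blinfun_eqI) (simp add: L_apply comp_B Q.BXD(1), simp add: compose_def)

lemma L_zero: "L (vzero B) = 0"
proof (rule blinfun_eqI)
  fix v
  have "J (vzero X) = 0" using J_scale[of "vzero X" 0] by (simp add: scale_vzero zero_closed)
  thus "L (vzero B) v = blinfun_apply 0 v"
    unfolding L_apply[OF Q.BX_zero] by (simp add: bounded_algebra_simps)
qed

lemma vdist_L: "S \<in> carrier B \<Longrightarrow> T \<in> carrier B \<Longrightarrow> vdist B S T = norm (L S - L T)"
  using L_scale[of T "- 1"] Q.BX_scale[of T "- 1"]
  by (simp add: vdist_def norm_L Q.BX_add L_add)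

lemma L_inj: "S \<in> carrier B \<Longrightarrow> T \<in> carrier B \<Longrightarrow> L S = L T \<Longrightarrow> S = T"
  by (rule Q.BX_eqI) (auto simp: Q.BXD(1) dest: arg_cong[where f = K] L_J, metis Q.BXD(1) K_J L_J)

text \<open>\<open>Pb\<close> is the projection onto the embedded space and \<open>Ib\<close>
  multiplication by i there. Commuting with \<open>Ib\<close> is what makes an operator on the real
  space come from a complex linear one.\<close>

definition Pb :: "('a \<times> bool) op" where "Pb = L (\<lambda>x\<in>C. x)"
definition Ib :: "('a \<times> bool) op" where "Ib = L (\<lambda>x\<in>C. vscale X \<i> x)"

lemma Pb_apply: "Pb v = J (K v)"
  by (simp add: Pb_def L_apply id_B)

lemma Ib_apply: "Ib v = J (vscale X \<i> (K v))"
  by (simp add: Ib_def L_apply i_B)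

lemma Pb_J: "x \<in> C \<Longrightarrow> Pb (J x) = J x"
  by (simp add: Pb_apply)

lemma L_Pb: "T \<in> carrier B \<Longrightarrow> L T (Pb v) = L T v"
  by (simp add: L_apply Pb_apply)

lemma Pb_L: "T \<in> carrier B \<Longrightarrow> Pb (L T v) = L T v"
  by (simp add: L_apply Pb_J Q.BXD(1))

lemma Ib_L: "T \<in> carrier B \<Longrightarrow> Ib (L T v) = L T (Ib v)"
  by (simp add: L_apply Ib_apply Q.BXD(1) Q.BXD(4) scale_closed)

lemma K_Ib: "K (Ib v) = vscale X \<i> (K v)"
  by (simp add: Ib_apply scale_closed)

text \<open>The compression back to the Hilbert space, a left inverse of \<open>L\<close>. In
  general the result is only real linear; commuting with \<open>Ib\<close> makes it complex
  linear.\<close>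

definition U :: "('a \<times> bool) op \<Rightarrow> 'a \<Rightarrow> 'a" where
  "U W = (\<lambda>x\<in>C. K (W (J x)))"

lemma U_B:
  fixes W :: "('a \<times> bool) op"
  assumes W: "\<And>v. Ib (W v) = W (Ib v)"
  shows "U W \<in> carrier B"
  unfolding U_def
proof (rule Q.BXI[where M = "norm W"])
  fix x assume x: "x \<in> C"
  have "vnorm X (K (W (J x))) \<le> norm (W (J x))" by (rule norm_K_le)
  also have "\<dots> \<le> norm W * vnorm X x" using norm_blinfun[of W "J x"] by (simp add: norm_J x)
  finally show "vnorm X ((\<lambda>x\<in>C. K (W (J x))) x) \<le> norm W * vnorm X x" using x by simp
next
  fix a x assume x: "x \<in> C"
  have "J (vscale X \<i> x) = Ib (J x)" by (simp add: Ib_apply x)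
  hence "W (J (vscale X a x)) = Re a *\<^sub>R W (J x) + Im a *\<^sub>R Ib (W (J x))"
    by (simp add: J_scale_complex[OF x, of a] blinfun.add_right blinfun.scaleR_right W)
  hence "K (W (J (vscale X a x))) = vadd X (vscale X (of_real (Re a)) (K (W (J x))))
      (vscale X (of_real (Im a)) (vscale X \<i> (K (W (J x)))))"
    by (simp add: K_add K_scale K_Ib)
  also have "\<dots> = vscale X (of_real (Re a) + of_real (Im a) * \<i>) (K (W (J x)))"
    by (simp add: scale_scale scale_add_left)
  also have "of_real (Re a) + of_real (Im a) * \<i> = a" by (simp add: complex_eq_iff)
  finally show "(\<lambda>x\<in>C. K (W (J x))) (vscale X a x) = vscale X a ((\<lambda>x\<in>C. K (W (J x))) x)"
    using x by (simp add: scale_closed)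
qed (auto simp: add_closed J_add blinfun.add_right K_add)

lemma L_U:
  fixes W :: "('a \<times> bool) op"
  assumes W: "\<And>v. Ib (W v) = W (Ib v)"
  shows "L (U W) v = Pb (W (Pb v))"
  by (simp add: L_apply U_B W Pb_apply) (simp add: U_def)

lemma inner_Pb: "inner (Pb v) w = inner v (Pb w)"
  by (simp add: Pb_apply inner_J real_inner_class.inner_commute[of v] inner_commute[of "K w" "K v"])

lemma inner_L: "T \<in> carrier B \<Longrightarrow> inner (L T v) w = Re (ip (T (K v)) (K w))"
  by (simp add: L_apply inner_J Q.BXD(1))

lemma inner_Ib: "inner (Ib v) w = - inner v (Ib w)"
  by (simp add: Ib_apply inner_J scale_closed inner_scale real_inner_class.inner_commute[of v]
      inner_commute[of "K w" "K v"])

text \<open>The real adjoint commutes with \<open>Ib\<close> because \<open>Ib\<close> is skew, so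
  it compresses to a complex linear operator. The real inner product sees only real parts.\<close>

lemma adjoint:
  assumes T: "T \<in> carrier B"
  shows "adjoint_op X T \<in> carrier B" "L (adjoint_op X T) = adj (L T)"
proof -
  define S where "S = U (adj (L T))"
  have I: "Ib (adj (L T) v) = adj (L T) (Ib v)" for v
  proof (rule inner_eqI)
    fix x
    have "inner x (Ib (adj (L T) v)) = - inner (Ib x) (adj (L T) v)" by (simp add: inner_Ib)
    also have "\<dots> = - inner (L T (Ib x)) v" by (simp add: inner_adj)
    also have "\<dots> = - inner (Ib (L T x)) v" by (simp add: Ib_L T)
    also have "\<dots> = inner (L T x) (Ib v)" by (simp add: inner_Ib)
    also have "\<dots> = inner x (adj (L T) (Ib v))" by (rule inner_adj)
    finally show "inner x (Ib (adj (L T) v)) = inner x (adj (L T) (Ib v))" .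
  qed
  have S: "S \<in> carrier B" unfolding S_def by (rule U_B) (rule I)
  have LS: "L S = adj (L T)"
  proof (rule adj_unique[symmetric])
    fix x y
    have "inner (L T x) y = inner (L T (Pb x)) (Pb y)"
      by (simp add: L_Pb T inner_Pb[symmetric] Pb_L)
    also have "\<dots> = inner (Pb x) (adj (L T) (Pb y))" by (rule inner_adj)
    also have "\<dots> = inner x (L S y)" by (simp add: S_def L_U I inner_Pb)
    finally show "inner (L T x) y = inner x (L S y)" .
  qed
  have re: "Re (ip (T x) y) = Re (ip x (S y))" if x: "x \<in> C" and y: "y \<in> C" for x y
  proof -
    have "Re (ip (T x) y) = inner (L T (J x)) (J y)" by (simp add: inner_L T x y)
    also have "\<dots> = inner (J x) (L S (J y))" by (simp add: LS inner_adj)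
    also have "\<dots> = Re (ip x (S y))" by (simp add: L_J S y inner_J_J x Q.BXD(1)[OF S])
    finally show ?thesis .
  qed
  have adj: "ip (T x) y = ip x (S y)" if x: "x \<in> C" and y: "y \<in> C" for x y
  proof (rule complex_eqI)
    show "Re (ip (T x) y) = Re (ip x (S y))" by (rule re[OF x y])
    \<comment> \<open>The imaginary part is recovered from the real part at i x.\<close>
    have "Re (ip (T (vscale X \<i> x)) y) = Re (ip (vscale X \<i> x) (S y))"
      by (rule re) (simp_all add: x y scale_closed)
    thus "Im (ip (T x) y) = Im (ip x (S y))"
      by (simp add: Q.BXD(4)[OF T x] inner_scale Q.BXD(1)[OF T x] Q.BXD(1)[OF S y] x y)
  qed
  have "adjoint_op X T = S"
    unfolding adjoint_op_def
  proof (rule the_equality)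
    show "S \<in> carrier B \<and> (\<forall>x\<in>C. \<forall>y\<in>C. ip (T x) y = ip x (S y))" using S adj by blast
    fix R assume R: "R \<in> carrier B \<and> (\<forall>x\<in>C. \<forall>y\<in>C. ip (T x) y = ip x (R y))"
    show "R = S"
    proof (rule Q.BX_eqI)
      fix y assume y: "y \<in> C"
      show "R y = S y"
      proof (rule inner_ext)
        fix x assume x: "x \<in> C"
        have "ip x (R y) = ip x (S y)" using R adj[OF x y] x y by simp
        thus "ip (R y) x = ip (S y) x"
          using R S x y by (simp add: inner_commute[of x "R y"] inner_commute[of x "S y"] Q.BXD(1))
      qed (use R S y Q.BXD(1) in auto)
    qed (use R S in auto)
  qed
  thus "adjoint_op X T \<in> carrier B" "L (adjoint_op X T) = adj (L T)" using S LS by simp_all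
qed

section \<open>Functional calculus on the Hilbert space\<close>

lemma op_poly_0: "op_poly X 0 T = vzero B"
  by (simp add: op_poly_def Let_def)

lemma op_poly_pCons:
  assumes T: "T \<in> carrier B"
  shows "op_poly X (pCons c q) T =
    vadd B (vscale B (of_real c) (\<lambda>x\<in>C. x)) (vmult B T (op_poly X q T))"
proof (cases "c = 0 \<and> q = 0")
  case True
  have "vzero B = vadd B (vscale B (of_real 0) (\<lambda>x\<in>C. x)) (vmult B T (vzero B))"
    by (auto simp: bounded_algebra_simps compose_def map_vzero[OF T] scale_zero add_zero zero_closed intro!: restrict_ext)
  thus ?thesis using True by (simp add: op_poly_0)
next
  case False
  thus ?thesis
    by (cases "q = 0")
       (auto simp: op_poly_def Let_def fold_coeffs_pCons_coeff_not_0_eq fold_coeffs_pCons_not_0_0_eq)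
qed

text \<open>\<open>Pb\<close> enters through the constant terms, since the identity of the Hilbert
  space corresponds to the projection and not to the identity of \<open>l2\<close>.\<close>

lemma op_poly_L:
  assumes T: "T \<in> carrier B"
  shows "op_poly X q T \<in> carrier B \<and> (\<forall>v. L (op_poly X q T) v = Pb (pol q (L T) v))"
proof (induction q)
  case 0
  show ?case by (simp add: op_poly_0 Q.BX_zero L_zero)
next
  case (pCons c q)
  have q: "op_poly X q T \<in> carrier B" "\<And>v. L (op_poly X q T) v = Pb (pol q (L T) v)"
    using pCons.IH by auto
  have c: "vscale B (of_real c) (\<lambda>x\<in>C. x) \<in> carrier B" by (rule Q.BX_scale[OF id_B])
  have m: "vmult B T (op_poly X q T) \<in> carrier B"
    unfolding bounded_algebra_simps(6) by (rule comp_B[OF T q(1)])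
  have "L (op_poly X (pCons c q) T) v = Pb (pol (pCons c q) (L T) v)" for v
  proof -
    have "L (op_poly X (pCons c q) T) v = c *\<^sub>R Pb v + L T (L (op_poly X q T) v)"
      unfolding op_poly_pCons[OF T] L_add[OF c m]
      by (simp add: blinfun.add_left L_scale[OF id_B] blinfun.scaleR_left Pb_def)
         (simp add: bounded_algebra_simps L_comp[OF T q(1)])
    also have "\<dots> = Pb (c *\<^sub>R v + L T (pol q (L T) v))"
      by (simp add: q L_Pb T blinfun.add_right blinfun.scaleR_right Pb_L)
    finally show ?thesis by simp
  qed
  thus ?case unfolding op_poly_pCons[OF T] using Q.BX_add[OF c m] by blast
qed

text \<open>On the complement of the embedded space f(L T) is multiplication by f 0, whereas the
  left side vanishes there; hence the projection.\<close>

lemma fun_calculus_L: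
  assumes T: "T \<in> carrier B" and pos: "pos_op (L T)" and f: "continuous_on {0..norm (L T)} f"
  shows "fun_calculus X f T = U (fc f (L T))" "U (fc f (L T)) \<in> carrier B"
    "L (U (fc f (L T))) v = Pb (fc f (L T) v)"
proof -
  let ?W = "fc f (L T)"
  have IW: "Ib (?W v) = ?W (Ib v)" for v by (rule fc_commute[OF pos f]) (rule Ib_L[OF T])
  have PW: "Pb (?W v) = ?W (Pb v)" for v by (rule fc_commute[OF pos f]) (simp add: Pb_L L_Pb T)
  have PP: "Pb (Pb v) = Pb v" for v by (simp add: Pb_apply)
  show UB: "U ?W \<in> carrier B" by (rule U_B) (rule IW)
  show LU: "L (U ?W) v = Pb (?W v)" for v by (simp add: L_U IW PP flip: PW)
  have conv: "(\<lambda>n. vdist B (op_poly X (q n) T) (U ?W)) \<longlonglongrightarrow> 0" if q: "approx (norm (L T)) q f" for q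
  proof (rule tendsto_sandwich[OF _ _ tendsto_const])
    have "(\<lambda>n. pol (q n) (L T) - ?W) \<longlonglongrightarrow> 0" using fc_tendsto[OF pos q] by (simp add: LIM_zero)
    hence "(\<lambda>n. norm Pb * norm (pol (q n) (L T) - ?W)) \<longlonglongrightarrow> norm Pb * 0"
      by (intro tendsto_mult tendsto_const tendsto_norm_zero)
    thus "(\<lambda>n. norm Pb * norm (pol (q n) (L T) - ?W)) \<longlonglongrightarrow> 0" by simp
    have "vdist B (op_poly X (q n) T) (U ?W) \<le> norm Pb * norm (pol (q n) (L T) - ?W)" for n
    proof -
      have "L (op_poly X (q n) T) - L (U ?W) = Pb o\<^sub>L (pol (q n) (L T) - ?W)"
        by (rule blinfun_eqI) (simp add: op_poly_L[OF T] LU blinfun.diff_left blinfun.diff_right)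
      thus ?thesis using op_poly_L[OF T] UB by (simp add: vdist_L norm_blinfun_compose)
    qed
    thus "\<forall>\<^sub>F n in sequentially. vdist B (op_poly X (q n) T) (U ?W) \<le> norm Pb * norm (pol (q n) (L T) - ?W)"
      by simp
    show "\<forall>\<^sub>F n in sequentially. 0 \<le> vdist B (op_poly X (q n) T) (U ?W)"
      using op_poly_L[OF T] UB by (simp add: vdist_L)
  qed
  show "fun_calculus X f T = U ?W"
    unfolding fun_calculus_def norm_L[OF T]
  proof (rule the_equality)
    show "U ?W \<in> carrier B \<and> (\<forall>q. approx (norm (L T)) q f \<longrightarrow> tends_to B (\<lambda>n. op_poly X (q n) T) (U ?W))"
      using UB conv by (simp add: tends_to_def)
    fix S assume S: "S \<in> carrier B \<and> (\<forall>q. approx (norm (L T)) q f \<longrightarrow> tends_to B (\<lambda>n. op_poly X (q n) T) S)"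
    \<comment> \<open>The condition on S quantifies over all approximating sequences; it pins S down
      once at least one of them exists.\<close>
    obtain q where q: "approx (norm (L T)) q f" using approx_exists[OF f] by blast
    have SB: "S \<in> carrier B" using S by blast
    have opB: "op_poly X r T \<in> carrier B" for r using op_poly_L[OF T] by blast
    have "(\<lambda>n. vdist B (op_poly X (q n) T) S) \<longlonglongrightarrow> 0"
      using S q unfolding tends_to_def by blast
    hence 1: "(\<lambda>n. norm (L (op_poly X (q n) T) - L S)) \<longlonglongrightarrow> 0"
      by (simp only: vdist_L[OF opB SB])
    have 2: "(\<lambda>n. norm (L (op_poly X (q n) T) - L (U ?W))) \<longlonglongrightarrow> 0"
      using conv[OF q] by (simp only: vdist_L[OF opB UB])
    have "(\<lambda>n. L (op_poly X (q n) T)) \<longlonglongrightarrow> L S"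
      by (rule LIM_zero_cancel) (rule tendsto_norm_zero_cancel[OF 1])
    moreover have "(\<lambda>n. L (op_poly X (q n) T)) \<longlonglongrightarrow> L (U ?W)"
      by (rule LIM_zero_cancel) (rule tendsto_norm_zero_cancel[OF 2])
    ultimately have "L S = L (U ?W)" by (rule LIMSEQ_unique)
    thus "S = U ?W" using L_inj S UB by blast
  qed
qed

lemma abs_op_L:
  assumes T: "T \<in> carrier B"
  shows "abs_op X T \<in> carrier B" "L (abs_op X T) = absop (L T)"
proof -
  let ?Q = "compose C (adjoint_op X T) T"
  have Q: "?Q \<in> carrier B" by (rule comp_B[OF adjoint(1)[OF T] T])
  have LQ: "L ?Q = adj (L T) o\<^sub>L L T" by (simp add: L_comp adjoint T)
  have pos: "pos_op (L ?Q)" unfolding LQ by (rule pos_op_adj_comp)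
  note F = fun_calculus_L[OF Q pos continuous_on_sqrt_id]
  have e: "fc sqrt (L ?Q) = absop (L T)" by (simp add: absop_def LQ)
  show "abs_op X T \<in> carrier B" using F(1,2) by (simp add: abs_op_def)
  show "L (abs_op X T) = absop (L T)"
  proof (rule blinfun_eqI)
    fix v
    have "L ?Q (v - Pb v) = 0" by (simp add: blinfun.diff_right L_Pb Q)
    hence "fc sqrt (L ?Q) (v - Pb v) = 0" by (simp add: fc_kernel[OF pos continuous_on_sqrt_id])
    hence "absop (L T) v = absop (L T) (Pb v)" by (simp add: e blinfun.diff_right)
    moreover have "Pb (fc sqrt (L ?Q) v) = fc sqrt (L ?Q) (Pb v)"
      by (rule fc_commute[OF pos continuous_on_sqrt_id]) (simp add: Pb_L L_Pb Q)
    ultimately show "L (abs_op X T) v = absop (L T) v"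
      using F(1,3) e by (simp add: abs_op_def)
  qed
qed

lemma abs_op_power_inner:
  assumes T: "T \<in> carrier B" and p: "p > 0" and e: "e \<in> E"
  shows "Re (ip (abs_op_power X p T e) e) = inner (fc (\<lambda>t. t powr p) (absop (L T)) (ev (e, True))) (ev (e, True))"
proof -
  let ?W = "fc (\<lambda>t. t powr p) (absop (L T))"
  have pos: "pos_op (L (abs_op X T))" by (simp add: abs_op_L T pos_absop)
  have "abs_op_power X p T = U ?W"
    unfolding abs_op_power_def
    using fun_calculus_L(1)[OF abs_op_L(1)[OF T] pos continuous_on_powr_nonneg[OF p]] by (simp add: abs_op_L T)
  hence "Re (ip (abs_op_power X p T e) e) = Re (ip (K (?W (J e))) e)" by (simp add: U_def E_closed e)
  also have "\<dots> = Re (ip e (K (?W (J e))))" by (simp add: inner_commute[of e] E_closed e)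
  also have "\<dots> = inner (J e) (?W (J e))" by (simp add: inner_J E_closed e)
  finally show ?thesis by (simp add: J_E e)
qed

text \<open>The real basis of \<open>l2\<close> counts every vector of \<open>E\<close> twice.\<close>

lemma quad_power_L:
  assumes T: "T \<in> carrier B" and p: "p > 0" and F: "finite F"
  shows "quad F (fc (\<lambda>t. t powr p) (absop (L T))) \<le> 2 * (\<Sum>e\<in>fst ` F \<inter> E. Re (ip (abs_op_power X p T e) e))"
proof -
  let ?A = "absop (L T)" and ?W = "fc (\<lambda>t. t powr p) (absop (L T))" and ?G = "fst ` F \<inter> E"
  let ?q = "\<lambda>i. inner (?W (ev i)) (ev i)"
  note A = pos_absop[of "L T"]
  note cp = continuous_on_powr_nonneg[OF p, of "norm ?A"]
  have q0: "?q i \<ge> 0" for i by (rule fc_nonneg[OF A cp]) simp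
  \<comment> \<open>Indices outside E belong to the kernel of |L T|, where the power is
    multiplication by 0 powr p = 0.\<close>
  have out: "?q (e, b) = 0" if "e \<notin> E" for e b
  proof -
    have "norm (?A (ev (e, b))) = 0"
      unfolding norm_absop_apply using that J_scale[of "vzero X" 0]
      by (simp add: L_apply T K_ev_outside map_vzero zero_closed scale_vzero)
    hence "?A (ev (e, b)) = 0" by simp
    thus ?thesis using fc_kernel[OF A cp] p by simp
  qed
  have IW: "Ib (?W v) = ?W (Ib v)" for v
    by (rule fc_commute[OF A cp]) (simp add: Ib_L abs_op_L T flip: abs_op_L(2))
  have PW: "Pb (?W v) = ?W (Pb v)" for v
    by (rule fc_commute[OF A cp]) (simp add: Pb_L L_Pb abs_op_L T flip: abs_op_L(2))
  \<comment> \<open>The second copy of e is \<open>Ib\<close> applied to the first;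
    \<open>Ib\<close> preserves inner products on the embedded space and commutes with the power.
    This equality is the source of the factor 2.\<close>
  have tf: "?q (e, False) = ?q (e, True)" if e: "e \<in> E" for e
  proof -
    have i: "ev (e, False) = Ib (ev (e, True))"
      by (simp add: Ib_apply J_E[symmetric] J_i_E[symmetric] e E_closed)
    have ii: "Ib (Ib v) = - Pb v" for v
    proof -
      have "Ib (Ib v) = J (vscale X (- 1) (K v))" by (simp add: Ib_apply scale_closed scale_scale)
      thus ?thesis using J_scale[of "K v" "- 1"] by (simp add: Pb_apply)
    qed
    have "?q (e, False) = inner (Ib (?W (ev (e, True)))) (Ib (ev (e, True)))"
      by (simp only: i IW)
    also have "\<dots> = inner (?W (ev (e, True))) (Pb (ev (e, True)))" by (simp add: inner_Ib ii)
    also have "Pb (ev (e, True)) = ev (e, True)" by (simp add: J_E[symmetric] e Pb_J E_closed)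
    finally show ?thesis .
  qed
  have "quad F ?W = (\<Sum>i\<in>F \<inter> (?G \<times> UNIV). ?q i)"
    unfolding quad_def
  proof (rule sum.mono_neutral_right[OF F])
    show "\<forall>i\<in>F - F \<inter> (?G \<times> UNIV). ?q i = 0"
    proof
      fix i assume "i \<in> F - F \<inter> (?G \<times> UNIV)"
      hence "fst i \<notin> E" by (cases i) force
      thus "?q i = 0" using out by (cases i) auto
    qed
  qed auto
  also have "\<dots> \<le> (\<Sum>i\<in>?G \<times> UNIV. ?q i)" by (rule sum_mono2) (use F q0 in auto)
  also have "\<dots> = (\<Sum>e\<in>?G. 2 * ?q (e, True))"
    unfolding sum_times_bool by (rule sum.cong) (use tf in auto)
  also have "\<dots> = 2 * (\<Sum>e\<in>?G. Re (ip (abs_op_power X p T e) e))"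
    unfolding sum_distrib_left by (rule sum.cong) (use abs_op_power_inner[OF T p] in auto)
  finally show ?thesis .
qed

lemma sum_power_L:
  assumes T: "T \<in> carrier B" and p: "p > 0" and G: "finite G" "G \<subseteq> E"
  shows "(\<Sum>e\<in>G. Re (ip (abs_op_power X p T e) e)) = quad (G \<times> {True}) (fc (\<lambda>t. t powr p) (absop (L T)))"
proof -
  have "(\<Sum>e\<in>G. Re (ip (abs_op_power X p T e) e)) =
      (\<Sum>e\<in>G. inner (fc (\<lambda>t. t powr p) (absop (L T)) (ev (e, True))) (ev (e, True)))"
    by (rule sum.cong) (use G abs_op_power_inner[OF T p] in auto)
  thus ?thesis by (simp add: quad_def sum.cartesian_product')
qed

lemma power_nonneg:
  assumes "T \<in> carrier B" "p > 0" "e \<in> E"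
  shows "0 \<le> Re (ip (abs_op_power X p T e) e)"
  unfolding abs_op_power_inner[OF assms]
  by (rule fc_nonneg[OF pos_absop continuous_on_powr_nonneg[OF assms(2)]]) simp

lemma power_two:
  assumes T: "T \<in> carrier B" and e: "e \<in> E"
  shows "Re (ip (abs_op_power X 2 T e) e) = (vnorm X (T e))\<^sup>2"
proof -
  let ?A = "absop (L T)"
  have "fc (\<lambda>t. t powr 2) ?A = fc (\<lambda>t. t * t) ?A"
    by (rule fc_cong) (auto simp: powr_numeral power2_eq_square)
  moreover have "inner (fc (\<lambda>t. t * t) ?A x) x = inner (L T x) (L T x)" for x
    using inner_fc_square[where f = "\<lambda>_. 1" and T = "L T" and x = x, OF continuous_on_const]
    by (simp add: fc_const[OF pos_absop])
  ultimately have "Re (ip (abs_op_power X 2 T e) e) = (norm (L T (ev (e, True))))\<^sup>2"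
    by (simp add: abs_op_power_inner T e power2_norm_eq_inner del: inner_ev_right)
  thus ?thesis by (simp add: L_J T E_closed e norm_J Q.BXD(1) flip: J_E)
qed

end

section \<open>Limits along an ultrafilter\<close>

text \<open>Zorn's lemma for families whose finite intersections are infinite. By maximality a set
  outside the family has finite intersection with some finite meet of members; were a set and its
  complement both outside, the two meets together would be finite.\<close>

lemma free_ultrafilter_exists:
  "\<exists>F :: nat filter. F \<noteq> bot \<and> (\<forall>n. eventually (\<lambda>k. n \<le> k) F) \<and>
     (\<forall>P. eventually P F \<or> eventually (\<lambda>k. \<not> P k) F)"
proof -
  define A :: "nat set set set" where "A = {S. \<forall>G. finite G \<longrightarrow> G \<subseteq> S \<longrightarrow> infinite (\<Inter>G)}"
  have "\<exists>M\<in>A. \<forall>N\<in>A. M \<subseteq> N \<longrightarrow> N = M"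
  proof (rule subset_Zorn')
    fix CC assume CC: "subset.chain A CC"
    have "infinite (\<Inter>G)" if G: "finite G" "G \<subseteq> \<Union>CC" for G
    proof (cases "CC = {}")
      case True
      thus ?thesis using G by simp
    next
      case False
      obtain W where "W \<in> CC" "G \<subseteq> W" by (rule finite_subset_Union_chain[OF G False CC])
      moreover have "CC \<subseteq> A" using CC by (simp add: subset.chain_def)
      ultimately show ?thesis using G(1) by (auto simp: A_def)
    qed
    thus "\<Union>CC \<in> A" by (simp add: A_def)
  qed
  then obtain S where S: "S \<in> A" "\<And>N. N \<in> A \<Longrightarrow> S \<subseteq> N \<Longrightarrow> N = S" by blast
  have fip: "infinite (\<Inter>G)" if "finite G" "G \<subseteq> S" for G using S(1) that by (auto simp: A_def)
  have notin: "\<exists>G. finite G \<and> G \<subseteq> S \<and> finite (\<Inter>G \<inter> P)" if P: "P \<notin> S" for P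
  proof -
    have "insert P S \<notin> A" using S(2)[of "insert P S"] P by auto
    then obtain G where G: "finite G" "G \<subseteq> insert P S" "finite (\<Inter>G)" by (auto simp: A_def)
    have "\<Inter>(G - {P}) \<inter> P \<subseteq> \<Inter>G" by auto
    hence "finite (\<Inter>(G - {P}) \<inter> P)" using G(3) finite_subset by blast
    thus ?thesis using G by (intro exI[of _ "G - {P}"]) auto
  qed
  have ultra: "P \<in> S \<or> - P \<in> S" for P
  proof (rule ccontr)
    assume "\<not> (P \<in> S \<or> - P \<in> S)"
    hence "P \<notin> S" "- P \<notin> S" by auto
    from notin[OF this(1)] notin[OF this(2)] obtain G1 G2
      where G: "finite G1" "G1 \<subseteq> S" "finite (\<Inter>G1 \<inter> P)" "finite G2" "G2 \<subseteq> S" "finite (\<Inter>G2 \<inter> - P)"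
      by auto
    have "\<Inter>(G1 \<union> G2) \<subseteq> (\<Inter>G1 \<inter> P) \<union> (\<Inter>G2 \<inter> - P)" by auto
    hence "finite (\<Inter>(G1 \<union> G2))" using G finite_subset by blast
    thus False using fip[of "G1 \<union> G2"] G by auto
  qed
  define F where "F = (INF s\<in>S. principal s)"
  have "F \<noteq> bot" unfolding F_def
  proof (rule INF_filter_not_bot)
    fix G assume G: "G \<subseteq> S" "finite G"
    have "\<Inter>G \<noteq> {}" using fip[OF G(2,1)] by auto
    thus "(INF s\<in>G. principal s) \<noteq> bot" using G by (simp add: INF_principal_finite principal_eq_bot_iff)
  qed
  moreover have ev: "eventually (\<lambda>k. k \<in> P) F" if "P \<in> S" for P
  proof -
    have "F \<le> principal P" unfolding F_def using that by (rule INF_lower)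
    moreover have "eventually (\<lambda>k. k \<in> P) (principal P)" by (simp add: eventually_principal)
    ultimately show ?thesis by (rule filter_leD)
  qed
  have "eventually (\<lambda>k. n \<le> k) F" for n
  proof -
    \<comment> \<open>Asking for infinite rather than nonempty intersections is what makes the
      filter free: the complement of a tail is finite.\<close>
    have "- {n..} \<notin> S"
    proof
      assume "- {n..} \<in> S"
      hence "infinite (\<Inter>{- {n..}})" by (intro fip) auto
      moreover have "- {n..} = {..<n}" by auto
      ultimately show False by simp
    qed
    hence "{n..} \<in> S" using ultra by blast
    from ev[OF this] show ?thesis by simp
  qed
  moreover have "eventually P F \<or> eventually (\<lambda>k. \<not> P k) F" for P
    using ultra[of "Collect P"] ev[of "Collect P"] ev[of "- Collect P"] by auto
  ultimately show ?thesis by blast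
qed

text \<open>Limits along the ultrafilter exist for bounded sequences by compactness of closed discs.
  The last clause uses that the filter is free; it is the one that evaluates the iterated
  limits.\<close>

lemma bounded_limit_functional:
  "\<exists>\<Lambda> :: (nat \<Rightarrow> complex) \<Rightarrow> complex.
     (\<forall>x y. Bseq x \<longrightarrow> Bseq y \<longrightarrow> \<Lambda> (\<lambda>n. x n + y n) = \<Lambda> x + \<Lambda> y) \<and>
     (\<forall>a x. Bseq x \<longrightarrow> \<Lambda> (\<lambda>n. a * x n) = a * \<Lambda> x) \<and>
     (\<forall>x M. (\<forall>n. cmod (x n) \<le> M) \<longrightarrow> cmod (\<Lambda> x) \<le> M) \<and>
     (\<forall>x c N. (\<forall>n\<ge>N. x n = c) \<longrightarrow> \<Lambda> x = c)"
proof -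
  obtain F :: "nat filter" where F: "F \<noteq> bot" "\<And>n. eventually (\<lambda>k. n \<le> k) F"
    "\<And>P. eventually P F \<or> eventually (\<lambda>k. \<not> P k) F"
    using free_ultrafilter_exists by metis
  have conv: "\<exists>l. cmod l \<le> M \<and> (x \<longlongrightarrow> l) F" if x: "\<And>n. cmod (x n) \<le> M" for x :: "nat \<Rightarrow> complex" and M
  proof -
    have "eventually (\<lambda>z. z \<in> cball 0 M) (filtermap x F)"
      using x by (simp add: eventually_filtermap)
    moreover have "filtermap x F \<noteq> bot" using F(1) by (simp add: filtermap_bot_iff)
    ultimately obtain l where l: "l \<in> cball 0 M" "inf (nhds l) (filtermap x F) \<noteq> bot"
      using compact_cball[of "0::complex" M, unfolded compact_filter, rule_format, of "filtermap x F"] by blast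
    have "(x \<longlongrightarrow> l) F"
    proof (rule topological_tendstoI)
      fix S assume S: "open S" "l \<in> S"
      show "eventually (\<lambda>k. x k \<in> S) F"
      proof (rule ccontr)
        assume "\<not> eventually (\<lambda>k. x k \<in> S) F"
        hence "eventually (\<lambda>k. \<not> x k \<in> S) F" using F(3) by blast
        hence "eventually (\<lambda>z. z \<notin> S) (filtermap x F)" by (simp add: eventually_filtermap)
        moreover have "eventually (\<lambda>z. z \<in> S) (nhds l)" using S by (rule eventually_nhds_in_open)
        ultimately have "eventually (\<lambda>z. False) (inf (nhds l) (filtermap x F))"
          unfolding eventually_inf by blast
        thus False using l(2) by (simp add: trivial_limit_def)
      qed
    qed
    thus ?thesis using l(1) by auto
  qed
  have lim: "(x \<longlongrightarrow> Lim F x) F" if x: "Bseq x" for x :: "nat \<Rightarrow> complex"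
  proof -
    obtain M where "\<forall>n. cmod (x n) \<le> M" using x unfolding Bseq_def by blast
    with conv[of x M] obtain l where "(x \<longlongrightarrow> l) F" by blast
    thus ?thesis using tendsto_Lim[OF F(1)] by metis
  qed
  show ?thesis
  proof (intro exI[of _ "Lim F"] conjI allI impI)
    fix x y :: "nat \<Rightarrow> complex" assume "Bseq x" "Bseq y"
    thus "Lim F (\<lambda>n. x n + y n) = Lim F x + Lim F y"
      by (intro tendsto_Lim[OF F(1)] tendsto_add lim)
  next
    fix a and x :: "nat \<Rightarrow> complex" assume "Bseq x"
    thus "Lim F (\<lambda>n. a * x n) = a * Lim F x"
      by (intro tendsto_Lim[OF F(1)] tendsto_mult tendsto_const lim)
  next
    fix x :: "nat \<Rightarrow> complex" and M assume "\<forall>n. cmod (x n) \<le> M"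
    with conv[of x M] obtain l where "cmod l \<le> M" "(x \<longlongrightarrow> l) F" by blast
    thus "cmod (Lim F x) \<le> M" using tendsto_Lim[OF F(1)] by metis
  next
    fix x :: "nat \<Rightarrow> complex" and c N assume "\<forall>n\<ge>N. x n = c"
    hence "eventually (\<lambda>n. x n = c) F" using F(2)[of N] by (auto elim: eventually_mono)
    hence "(x \<longlongrightarrow> c) F" by (rule tendsto_eventually)
    thus "Lim F x = c" by (rule tendsto_Lim[OF F(1)])
  qed
qed

section \<open>A double limit criterion\<close>

locale arens_alg =
  fixes M :: "('a, 'm) nalgebra_scheme" and D :: real
  assumes hom: "homog M"
    and D_nonneg: "0 \<le> D"
    and add_cl: "\<lbrakk>x \<in> carrier M; y \<in> carrier M\<rbrakk> \<Longrightarrow> vadd M x y \<in> carrier M"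
    and mult_cl: "\<lbrakk>x \<in> carrier M; y \<in> carrier M\<rbrakk> \<Longrightarrow> vmult M x y \<in> carrier M"
    and mult_add_l: "\<lbrakk>x \<in> carrier M; y \<in> carrier M; z \<in> carrier M\<rbrakk> \<Longrightarrow>
          vmult M (vadd M x y) z = vadd M (vmult M x z) (vmult M y z)"
    and mult_add_r: "\<lbrakk>x \<in> carrier M; y \<in> carrier M; z \<in> carrier M\<rbrakk> \<Longrightarrow>
          vmult M z (vadd M x y) = vadd M (vmult M z x) (vmult M z y)"
    and mult_scale_l: "\<lbrakk>x \<in> carrier M; z \<in> carrier M\<rbrakk> \<Longrightarrow>
          vmult M (vscale M a x) z = vscale M a (vmult M x z)"
    and mult_scale_r: "\<lbrakk>x \<in> carrier M; z \<in> carrier M\<rbrakk> \<Longrightarrow>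
          vmult M z (vscale M a x) = vscale M a (vmult M z x)"
    and norm_mult_le: "\<lbrakk>x \<in> carrier M; y \<in> carrier M\<rbrakk> \<Longrightarrow>
          vnorm M (vmult M x y) \<le> D * (vnorm M x * vnorm M y)"
begin

abbreviation "MD \<equiv> carrier (dual M)"

lemma dualD:
  assumes "\<phi> \<in> MD"
  shows "x \<in> carrier M \<Longrightarrow> y \<in> carrier M \<Longrightarrow> \<phi> (vadd M x y) = \<phi> x + \<phi> y"
    "x \<in> carrier M \<Longrightarrow> \<phi> (vscale M a x) = a * \<phi> x"
    "x \<in> carrier M \<Longrightarrow> cmod (\<phi> x) \<le> vnorm (dual M) \<phi> * vnorm M x"
    "0 \<le> vnorm (dual M) \<phi>"
  using bounded_opsD(3,4)[OF assms[unfolded dual_def]]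
    bounded_ops_norm_le[OF hom homog_complex_space assms[unfolded dual_def]]
    bounded_ops_norm_nonneg[OF hom homog_complex_space assms[unfolded dual_def]]
  by (auto simp: dual_def complex_space_def)

lemma dualI:
  assumes "\<phi> \<in> extensional (carrier M)"
    "\<And>x y. x \<in> carrier M \<Longrightarrow> y \<in> carrier M \<Longrightarrow> \<phi> (vadd M x y) = \<phi> x + \<phi> y"
    "\<And>a x. x \<in> carrier M \<Longrightarrow> \<phi> (vscale M a x) = a * \<phi> x"
    "\<And>x. x \<in> carrier M \<Longrightarrow> cmod (\<phi> x) \<le> N * vnorm M x"
  shows "\<phi> \<in> MD"
  unfolding dual_def by (rule bounded_opsI[where M = N]) (use assms in \<open>auto simp: complex_space_def\<close>)

lemma dual_simps:
  "vadd (dual M) \<phi> \<psi> = (\<lambda>x\<in>carrier M. \<phi> x + \<psi> x)"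
  "vscale (dual M) a \<phi> = (\<lambda>x\<in>carrier M. a * \<phi> x)"
  by (simp_all add: dual_def bounded_ops_simps complex_space_def)

lemma scale_cl: "x \<in> carrier M \<Longrightarrow> vscale M a x \<in> carrier M"
  by (rule homogD(1)[OF hom])

lemma norm_ge: "x \<in> carrier M \<Longrightarrow> 0 \<le> vnorm M x"
  by (rule homogD(3)[OF hom])

lemma dual_add: "\<phi> \<in> MD \<Longrightarrow> \<psi> \<in> MD \<Longrightarrow> vadd (dual M) \<phi> \<psi> \<in> MD"
  unfolding dual_simps
proof (rule dualI[where N = "vnorm (dual M) \<phi> + vnorm (dual M) \<psi>"])
  assume p: "\<phi> \<in> MD" "\<psi> \<in> MD"
  fix x assume x: "x \<in> carrier M"
  show "cmod ((\<lambda>x\<in>carrier M. \<phi> x + \<psi> x) x) \<le> (vnorm (dual M) \<phi> + vnorm (dual M) \<psi>) * vnorm M x"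
    using norm_triangle_mono[OF dualD(3)[OF p(1) x] dualD(3)[OF p(2) x]] x by (simp add: distrib_right)
qed (auto simp: dualD add_cl scale_cl distrib_left)

lemma dual_scale: "\<phi> \<in> MD \<Longrightarrow> vscale (dual M) a \<phi> \<in> MD"
  unfolding dual_simps
proof (rule dualI[where N = "cmod a * vnorm (dual M) \<phi>"])
  assume p: "\<phi> \<in> MD"
  fix x assume x: "x \<in> carrier M"
  show "cmod ((\<lambda>x\<in>carrier M. a * \<phi> x) x) \<le> cmod a * vnorm (dual M) \<phi> * vnorm M x"
    using mult_left_mono[OF dualD(3)[OF p x], of "cmod a"] x by (simp add: norm_mult mult.assoc)
qed (auto simp: dualD add_cl scale_cl distrib_left)

lemma left_translate_dual:
  assumes w: "\<omega> \<in> MD" and a: "a \<in> carrier M"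
  shows "left_translate M \<omega> a \<in> MD"
  unfolding left_translate_def
proof (rule dualI[where N = "vnorm (dual M) \<omega> * (D * vnorm M a)"])
  fix x assume x: "x \<in> carrier M"
  have "cmod (\<omega> (vmult M a x)) \<le> vnorm (dual M) \<omega> * vnorm M (vmult M a x)"
    by (rule dualD(3)[OF w mult_cl[OF a x]])
  also have "\<dots> \<le> vnorm (dual M) \<omega> * (D * (vnorm M a * vnorm M x))"
    by (intro mult_left_mono norm_mult_le a x dualD(4)[OF w])
  finally show "cmod ((\<lambda>b\<in>carrier M. \<omega> (vmult M a b)) x) \<le> vnorm (dual M) \<omega> * (D * vnorm M a) * vnorm M x"
    using x by (simp add: mult.assoc)
qed (auto simp: dualD[OF w] add_cl scale_cl a mult_cl mult_add_r mult_scale_r)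

lemma right_translate_dual:
  assumes w: "\<omega> \<in> MD" and a: "a \<in> carrier M"
  shows "right_translate M a \<omega> \<in> MD"
  unfolding right_translate_def
proof (rule dualI[where N = "vnorm (dual M) \<omega> * (D * vnorm M a)"])
  fix x assume x: "x \<in> carrier M"
  have "cmod (\<omega> (vmult M x a)) \<le> vnorm (dual M) \<omega> * vnorm M (vmult M x a)"
    by (rule dualD(3)[OF w mult_cl[OF x a]])
  also have "\<dots> \<le> vnorm (dual M) \<omega> * (D * (vnorm M x * vnorm M a))"
    by (intro mult_left_mono norm_mult_le a x dualD(4)[OF w])
  finally show "cmod ((\<lambda>b\<in>carrier M. \<omega> (vmult M b a)) x) \<le> vnorm (dual M) \<omega> * (D * vnorm M a) * vnorm M x"
    using x by (simp add: mult_ac)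
qed (auto simp: dualD[OF w] add_cl scale_cl a mult_cl mult_add_l mult_scale_l)

text \<open>The right action of \<open>ev b\<close> is x \<mapsto> lim_j
  \<open>\<omega> (vmult M x (b j))\<close>, so the first Arens product takes the limit over j
  inside the limit over i, and the second one the other way round. On the matrix
  \<open>of_bool (i \<le> j)\<close> the inner limits are constantly 1 and constantly 0.\<close>

theorem not_arens_regular:
  fixes a b :: "nat \<Rightarrow> 'a"
  assumes a: "\<And>i. a i \<in> carrier M" "\<And>i. vnorm M (a i) \<le> N"
    and b: "\<And>j. b j \<in> carrier M" "\<And>j. vnorm M (b j) \<le> N"
    and w: "\<omega> \<in> MD" and ab: "\<And>i j. \<omega> (vmult M (a i) (b j)) = of_bool (i \<le> j)"
  shows "\<not> arens_regular M"
proof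
  assume reg: "arens_regular M"
  obtain \<Lambda> :: "(nat \<Rightarrow> complex) \<Rightarrow> complex" where L:
    "\<forall>x y. Bseq x \<longrightarrow> Bseq y \<longrightarrow> \<Lambda> (\<lambda>n. x n + y n) = \<Lambda> x + \<Lambda> y"
    "\<forall>a x. Bseq x \<longrightarrow> \<Lambda> (\<lambda>n. a * x n) = a * \<Lambda> x"
    "\<forall>x M. (\<forall>n. cmod (x n) \<le> M) \<longrightarrow> cmod (\<Lambda> x) \<le> M"
    "\<forall>x c N. (\<forall>n\<ge>N. x n = c) \<longrightarrow> \<Lambda> x = c"
    using bounded_limit_functional by (elim exE conjE)
  have L_add: "\<Lambda> (\<lambda>n. x n + y n) = \<Lambda> x + \<Lambda> y" if "Bseq x" "Bseq y" for x y
    using L(1) that by simp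
  have L_scale: "\<Lambda> (\<lambda>n. c * x n) = c * \<Lambda> x" if "Bseq x" for c x
    using L(2) that by simp
  have L_bound: "cmod (\<Lambda> x) \<le> K" if "\<And>n. cmod (x n) \<le> K" for x K
    using L(3) that by simp
  have L_ev: "\<Lambda> x = c" if "\<And>n. n \<ge> m \<Longrightarrow> x n = c" for x c and m :: nat
    using L(4)[rule_format, of m x c] that by blast
  have N0: "N \<ge> 0" by (rule order_trans[OF norm_ge[OF a(1)] a(2)])
  have bnd: "cmod (\<phi> (c n)) \<le> vnorm (dual M) \<phi> * N"
    if "\<phi> \<in> MD" "\<And>i. c i \<in> carrier M" "\<And>i. vnorm M (c i) \<le> N" for \<phi> c and n :: nat
    using order_trans[OF dualD(3)[OF that(1,2)] mult_left_mono[OF that(3) dualD(4)[OF that(1)]]] .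
  \<comment> \<open>The weak-star limit along the ultrafilter of the canonical images of
    \<open>c n\<close> in the bidual.\<close>
  define ev where "ev c = (\<lambda>\<phi>\<in>MD. \<Lambda> (\<lambda>n. \<phi> (c n)))" for c :: "nat \<Rightarrow> 'a"
  have ev_dual: "ev c \<in> carrier (dual (dual M))" if c: "\<And>i. c i \<in> carrier M" "\<And>i. vnorm M (c i) \<le> N" for c
  proof -
    have B: "Bseq (\<lambda>n. \<phi> (c n))" if "\<phi> \<in> MD" for \<phi>
      using bnd[OF that c] by (intro BseqI'[of _ "vnorm (dual M) \<phi> * N"])
    show ?thesis
      unfolding dual_def[of "dual M"]
    proof (rule bounded_opsI[where M = N])
      fix \<phi> \<psi> assume p: "\<phi> \<in> MD" "\<psi> \<in> MD"
      show "ev c (vadd (dual M) \<phi> \<psi>) = vadd complex_space (ev c \<phi>) (ev c \<psi>)"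
        using L_add[OF B[OF p(1)] B[OF p(2)]] p c(1)
        by (simp add: ev_def dual_add complex_space_def) (simp add: dual_simps)
    next
      fix k \<phi> assume p: "\<phi> \<in> MD"
      show "ev c (vscale (dual M) k \<phi>) = vscale complex_space k (ev c \<phi>)"
        using L_scale[OF B[OF p]] p c(1)
        by (simp add: ev_def dual_scale complex_space_def) (simp add: dual_simps)
    next
      fix \<phi> assume p: "\<phi> \<in> MD"
      show "vnorm complex_space (ev c \<phi>) \<le> N * vnorm (dual M) \<phi>"
        using L_bound[OF bnd[OF p c]] p by (simp add: ev_def complex_space_def mult.commute)
    qed (auto simp: ev_def complex_space_def)
  qed
  note f = ev_dual[of a, OF a] and g = ev_dual[of b, OF b]
  have r: "right_action M (ev b) \<omega> = (\<lambda>x\<in>carrier M. \<Lambda> (\<lambda>j. \<omega> (vmult M x (b j))))"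
    unfolding right_action_def
    by (rule restrict_ext) (simp add: ev_def left_translate_dual w, simp add: left_translate_def b)
  have l: "left_action M \<omega> (ev a) = (\<lambda>x\<in>carrier M. \<Lambda> (\<lambda>i. \<omega> (vmult M (a i) x)))"
    unfolding left_action_def
    by (rule restrict_ext) (simp add: ev_def right_translate_dual w, simp add: right_translate_def a)
  have Bl: "cmod (\<omega> (vmult M x (b j))) \<le> vnorm (dual M) \<omega> * (D * N) * vnorm M x"
    "cmod (\<omega> (vmult M (a j) x)) \<le> vnorm (dual M) \<omega> * (D * N) * vnorm M x" if x: "x \<in> carrier M" for x j
  proof -
    have "D * (vnorm M x * vnorm M (b j)) \<le> D * (vnorm M x * N)" "D * (vnorm M (a j) * vnorm M x) \<le> D * (N * vnorm M x)"
      by (intro mult_left_mono mult_right_mono a b norm_ge x D_nonneg)+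
    hence v: "vnorm M (vmult M x (b j)) \<le> D * (vnorm M x * N)" "vnorm M (vmult M (a j) x) \<le> D * (N * vnorm M x)"
      using norm_mult_le[OF x b(1), of j] norm_mult_le[OF a(1) x, of j] by linarith+
    have "vnorm (dual M) \<omega> * vnorm M (vmult M x (b j)) \<le> vnorm (dual M) \<omega> * (D * (vnorm M x * N))"
      "vnorm (dual M) \<omega> * vnorm M (vmult M (a j) x) \<le> vnorm (dual M) \<omega> * (D * (N * vnorm M x))"
      by (rule mult_left_mono[OF v(1) dualD(4)[OF w]], rule mult_left_mono[OF v(2) dualD(4)[OF w]])
    thus "cmod (\<omega> (vmult M x (b j))) \<le> vnorm (dual M) \<omega> * (D * N) * vnorm M x"
      "cmod (\<omega> (vmult M (a j) x)) \<le> vnorm (dual M) \<omega> * (D * N) * vnorm M x"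
      using dualD(3)[OF w mult_cl[OF x b(1)], of j] dualD(3)[OF w mult_cl[OF a(1) x], of j]
      by (simp_all add: mult_ac)
  qed
  have B: "Bseq (\<lambda>j. \<omega> (vmult M x (b j)))" "Bseq (\<lambda>j. \<omega> (vmult M (a j) x))" if "x \<in> carrier M" for x
    using Bl[OF that] by (auto intro!: BseqI'[of _ "vnorm (dual M) \<omega> * (D * N) * vnorm M x"])
  \<comment> \<open>\<open>ev\<close> is restricted to the dual, so the functional it is applied to
    must be shown to lie there before its value can be unfolded.\<close>
  have rd: "right_action M (ev b) \<omega> \<in> MD"
    unfolding r
    by (rule dualI[where N = "vnorm (dual M) \<omega> * (D * N)"])
       (auto simp: add_cl scale_cl mult_add_l mult_scale_l dualD[OF w] b mult_cl L_add L_scale B intro!: L_bound Bl)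
  have ld: "left_action M \<omega> (ev a) \<in> MD"
    unfolding l
    by (rule dualI[where N = "vnorm (dual M) \<omega> * (D * N)"])
       (auto simp: add_cl scale_cl mult_add_r mult_scale_r dualD[OF w] a mult_cl L_add L_scale B intro!: L_bound Bl)
  have "arens_box M (ev a) (ev b) \<omega> = \<Lambda> (\<lambda>i. \<Lambda> (\<lambda>j. of_bool (i \<le> j)))"
    using rd w by (simp add: arens_box_def ev_def[of a]) (simp add: r a ab)
  also have "\<dots> = 1"
  proof (rule L_ev[of 0])
    show "\<Lambda> (\<lambda>j. of_bool (i \<le> j)) = 1" for i by (rule L_ev[of i]) simp
  qed
  finally have 1: "arens_box M (ev a) (ev b) \<omega> = 1" .
  have "arens_diamond M (ev a) (ev b) \<omega> = \<Lambda> (\<lambda>j. \<Lambda> (\<lambda>i. of_bool (i \<le> j)))"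
    using ld w by (simp add: arens_diamond_def ev_def[of b]) (simp add: l b ab)
  also have "\<dots> = 0"
  proof (rule L_ev[of 0])
    show "\<Lambda> (\<lambda>i. of_bool (i \<le> j)) = 0" for j by (rule L_ev[of "Suc j"]) simp
  qed
  finally have "arens_diamond M (ev a) (ev b) \<omega> = 0" .
  moreover have "arens_box M (ev a) (ev b) = arens_diamond M (ev a) (ev b)"
    using reg f g unfolding arens_regular_def by blast
  ultimately show False using 1 by simp
qed

end

section \<open>Completion of a seminormed algebra\<close>

text \<open>Operations on classes are defined as unions over representatives; the union collapses
  once the result does not depend on the representative.\<close>

lemma UN_eq_const:
  assumes "a \<in> A" "\<And>x. x \<in> A \<Longrightarrow> f a = f x"
  shows "(\<Union>x\<in>A. f x) = f a"
proof -
  have "(\<Union>x\<in>A. f x) = (\<Union>x\<in>A. f a)" by (rule SUP_cong[OF refl]) (rule assms(2)[symmetric])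
  thus ?thesis using assms(1) by simp blast
qed

lemma UN_UN_eq_const:
  assumes "a \<in> A" "b \<in> B" "\<And>x y. x \<in> A \<Longrightarrow> y \<in> B \<Longrightarrow> f a b = f x y"
  shows "(\<Union>x\<in>A. \<Union>y\<in>B. f x y) = f a b"
proof -
  have "(\<Union>y\<in>B. f x y) = f a b" if x: "x \<in> A" for x
  proof -
    have "(\<Union>y\<in>B. f x y) = (\<Union>y\<in>B. f a b)"
      by (rule SUP_cong[OF refl]) (rule assms(3)[OF x, symmetric])
    thus ?thesis using assms(2) by auto
  qed
  thus ?thesis using assms(1) by auto
qed

text \<open>Definiteness is not among the axioms: the completion identifies sequences whose distance
  tends to 0. D carries the constant of the second tensor factor.\<close>

locale seminormed_algebra = complex_vector_space T for T :: "('a, 'm) nalgebra_scheme" +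
  fixes D :: real
  assumes D_nonneg: "0 \<le> D"
    and norm_pos: "x \<in> carrier T \<Longrightarrow> 0 \<le> vnorm T x"
    and norm_tri: "\<lbrakk>x \<in> carrier T; y \<in> carrier T\<rbrakk> \<Longrightarrow> vnorm T (vadd T x y) \<le> vnorm T x + vnorm T y"
    and norm_scale: "x \<in> carrier T \<Longrightarrow> vnorm T (vscale T a x) = cmod a * vnorm T x"
    and mult_closed: "\<lbrakk>x \<in> carrier T; y \<in> carrier T\<rbrakk> \<Longrightarrow> vmult T x y \<in> carrier T"
    and mult_add_left: "\<lbrakk>x \<in> carrier T; y \<in> carrier T; z \<in> carrier T\<rbrakk> \<Longrightarrow>
          vmult T (vadd T x y) z = vadd T (vmult T x z) (vmult T y z)"
    and mult_add_right: "\<lbrakk>x \<in> carrier T; y \<in> carrier T; z \<in> carrier T\<rbrakk> \<Longrightarrow>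
          vmult T z (vadd T x y) = vadd T (vmult T z x) (vmult T z y)"
    and mult_scale_left: "\<lbrakk>x \<in> carrier T; z \<in> carrier T\<rbrakk> \<Longrightarrow>
          vmult T (vscale T a x) z = vscale T a (vmult T x z)"
    and mult_scale_right: "\<lbrakk>x \<in> carrier T; z \<in> carrier T\<rbrakk> \<Longrightarrow>
          vmult T z (vscale T a x) = vscale T a (vmult T z x)"
    and norm_mult_bound: "\<lbrakk>x \<in> carrier T; y \<in> carrier T\<rbrakk> \<Longrightarrow>
          vnorm T (vmult T x y) \<le> D * (vnorm T x * vnorm T y)"
begin

abbreviation "CT \<equiv> carrier T"

definition sb :: "'a \<Rightarrow> 'a \<Rightarrow> 'a" where "sb x y = vadd T x (vscale T (- 1) y)"

lemma vdist_sb: "vdist T x y = vnorm T (sb x y)"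
  by (simp add: vdist_def sb_def)

lemma sb_closed: "x \<in> CT \<Longrightarrow> y \<in> CT \<Longrightarrow> sb x y \<in> CT"
  by (simp add: sb_def add_closed scale_closed)

lemma sb_add: "x \<in> CT \<Longrightarrow> y \<in> CT \<Longrightarrow> x' \<in> CT \<Longrightarrow> y' \<in> CT \<Longrightarrow>
    sb (vadd T x x') (vadd T y y') = vadd T (sb x y) (sb x' y')"
  by (simp add: sb_def scale_add_right add_swap scale_closed)

lemma sb_scale: "x \<in> CT \<Longrightarrow> y \<in> CT \<Longrightarrow> sb (vscale T a x) (vscale T a y) = vscale T a (sb x y)"
  by (simp add: sb_def scale_add_right scale_scale scale_closed mult.commute)

lemma sb_split:
  assumes x: "x \<in> CT" and y: "y \<in> CT" and z: "z \<in> CT"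
  shows "sb x z = vadd T (sb x y) (sb y z)"
proof -
  have n: "vscale T (- 1) y \<in> CT" "vscale T (- 1) z \<in> CT" using y z by (simp_all add: scale_closed)
  have "vadd T (sb x y) (sb y z) = vadd T (vadd T x (vscale T (- 1) y)) (vadd T (vscale T (- 1) z) y)"
    by (simp add: sb_def add_commute[OF y n(2)])
  also have "\<dots> = vadd T (vadd T x (vscale T (- 1) z)) (vadd T (vscale T (- 1) y) y)"
    by (rule add_swap) (use x y n in auto)
  also have "vadd T (vscale T (- 1) y) y = vzero T" using add_commute[OF n(1) y] add_minus[OF y] by simp
  finally show ?thesis using x n by (simp add: sb_def add_zero add_closed)
qed

lemma sb_mult:
  assumes "x \<in> CT" "y \<in> CT" "x' \<in> CT" "y' \<in> CT"
  shows "sb (vmult T x x') (vmult T y y') = vadd T (vmult T (sb x y) x') (vmult T y (sb x' y'))"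
proof -
  have "vmult T (sb x y) x' = sb (vmult T x x') (vmult T y x')"
    "vmult T y (sb x' y') = sb (vmult T y x') (vmult T y y')"
    using assms by (simp_all add: sb_def mult_add_left mult_add_right mult_scale_left mult_scale_right scale_closed)
  thus ?thesis using sb_split[of "vmult T x x'" "vmult T y x'" "vmult T y y'"] assms by (simp add: mult_closed)
qed

lemma norm_zero: "vnorm T (vzero T) = 0"
  using norm_scale[OF zero_closed, of 0] by (simp add: scale_zero zero_closed)

lemma d_nonneg: "x \<in> CT \<Longrightarrow> y \<in> CT \<Longrightarrow> 0 \<le> vdist T x y"
  by (simp add: vdist_sb norm_pos sb_closed)

lemma d_self: "x \<in> CT \<Longrightarrow> vdist T x x = 0"
  by (simp add: vdist_def add_minus norm_zero)

lemma d_tri: "x \<in> CT \<Longrightarrow> y \<in> CT \<Longrightarrow> z \<in> CT \<Longrightarrow> vdist T x z \<le> vdist T x y + vdist T y z"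
  using sb_split[of x y z] norm_tri[of "sb x y" "sb y z"] by (simp add: vdist_sb sb_closed)

lemma d_add: "x \<in> CT \<Longrightarrow> y \<in> CT \<Longrightarrow> x' \<in> CT \<Longrightarrow> y' \<in> CT \<Longrightarrow>
    vdist T (vadd T x x') (vadd T y y') \<le> vdist T x y + vdist T x' y'"
  by (simp add: vdist_sb sb_add norm_tri sb_closed)

lemma d_scale: "x \<in> CT \<Longrightarrow> y \<in> CT \<Longrightarrow> vdist T (vscale T a x) (vscale T a y) = cmod a * vdist T x y"
  by (simp add: vdist_sb sb_scale norm_scale sb_closed)

lemma d_sym:
  assumes x: "x \<in> CT" and y: "y \<in> CT"
  shows "vdist T x y = vdist T y x"
proof -
  have "sb y x = vscale T (- 1) (sb x y)"
    using x y by (simp add: sb_def scale_add_right scale_scale scale_closed scale_one add_commute)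
  thus ?thesis using norm_scale[OF sb_closed[OF x y], of "- 1"] by (simp add: vdist_sb)
qed

lemma d_mult: "x \<in> CT \<Longrightarrow> y \<in> CT \<Longrightarrow> x' \<in> CT \<Longrightarrow> y' \<in> CT \<Longrightarrow>
    vdist T (vmult T x x') (vmult T y y') \<le> D * (vdist T x y * vnorm T x') + D * (vnorm T y * vdist T x' y')"
  using norm_tri[of "vmult T (sb x y) x'" "vmult T y (sb x' y')"]
    norm_mult_bound[of "sb x y" x'] norm_mult_bound[of y "sb x' y'"]
  by (simp add: vdist_sb sb_mult sb_closed mult_closed)

lemma norm_diff:
  assumes x: "x \<in> CT" and y: "y \<in> CT"
  shows "\<bar>vnorm T x - vnorm T y\<bar> \<le> vdist T x y"
proof -
  have *: "vnorm T x \<le> vdist T x y + vnorm T y" if x: "x \<in> CT" and y: "y \<in> CT" for x y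
  proof -
    have n: "vscale T (- 1) y \<in> CT" by (rule scale_closed[OF y])
    have "vadd T (sb x y) y = vadd T x (vadd T y (vscale T (- 1) y))"
      using x y n by (simp add: sb_def add_assoc add_commute[OF n y])
    hence "vadd T (sb x y) y = x" by (simp add: add_minus x y add_zero)
    thus ?thesis using norm_tri[OF sb_closed[OF x y] y] by (simp add: vdist_sb)
  qed
  show ?thesis using *[OF x y] *[OF y x] d_sym[OF x y] by linarith
qed

lemma cauchy_closed: "cauchy_seq T s \<Longrightarrow> s n \<in> CT"
  by (auto simp: cauchy_seq_def)

text \<open>Written as convergence along the product filter, the Cauchy property passes to sums,
  multiples and products by the sandwich rule.\<close>

lemma cauchy_iff:
  assumes s: "\<And>n. s n \<in> CT"
  shows "cauchy_seq T s \<longleftrightarrow> ((\<lambda>(m, n). vdist T (s m) (s n)) \<longlongrightarrow> 0) (sequentially \<times>\<^sub>F sequentially)"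
  using s d_nonneg[OF s s]
  by (auto simp: cauchy_seq_def tendsto_iff eventually_prod_sequentially) (meson)+

lemma cauchyI:
  assumes s: "\<And>n. s n \<in> CT" and le: "\<And>m n. vdist T (s m) (s n) \<le> f m n"
    and f: "((\<lambda>(m, n). f m n) \<longlongrightarrow> 0) (sequentially \<times>\<^sub>F sequentially)"
  shows "cauchy_seq T s"
  unfolding cauchy_iff[OF s]
  by (rule tendsto_sandwich[OF _ _ tendsto_const f]) (auto intro!: always_eventually d_nonneg s le)

lemma cauchyD: "cauchy_seq T s \<Longrightarrow> ((\<lambda>(m, n). vdist T (s m) (s n)) \<longlongrightarrow> 0) (sequentially \<times>\<^sub>F sequentially)"
  using cauchy_iff[of s] cauchy_closed by blast

lemma cauchy_const: "x \<in> CT \<Longrightarrow> cauchy_seq T (\<lambda>_. x)"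
  by (auto simp: cauchy_seq_def d_self)

lemma cauchy_add:
  assumes s: "cauchy_seq T s" and t: "cauchy_seq T t"
  shows "cauchy_seq T (\<lambda>n. vadd T (s n) (t n))"
proof (rule cauchyI)
  note c = cauchy_closed[OF s] cauchy_closed[OF t]
  show "vadd T (s n) (t n) \<in> CT" for n by (simp add: add_closed c)
  show "vdist T (vadd T (s m) (t m)) (vadd T (s n) (t n)) \<le> vdist T (s m) (s n) + vdist T (t m) (t n)" for m n
    by (simp add: d_add c)
  show "((\<lambda>(m, n). vdist T (s m) (s n) + vdist T (t m) (t n)) \<longlongrightarrow> 0) (sequentially \<times>\<^sub>F sequentially)"
    using tendsto_add[OF cauchyD[OF s] cauchyD[OF t]] by (simp add: case_prod_unfold)
qed

lemma cauchy_scale: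
  assumes s: "cauchy_seq T s"
  shows "cauchy_seq T (\<lambda>n. vscale T a (s n))"
proof (rule cauchyI)
  note c = cauchy_closed[OF s]
  show "vscale T a (s n) \<in> CT" for n by (simp add: scale_closed c)
  show "vdist T (vscale T a (s m)) (vscale T a (s n)) \<le> cmod a * vdist T (s m) (s n)" for m n
    by (simp add: d_scale c)
  show "((\<lambda>(m, n). cmod a * vdist T (s m) (s n)) \<longlongrightarrow> 0) (sequentially \<times>\<^sub>F sequentially)"
    using tendsto_mult[OF tendsto_const cauchyD[OF s], of "cmod a"] by (simp add: case_prod_unfold)
qed

lemma cauchy_norm_convergent:
  assumes s: "cauchy_seq T s"
  shows "convergent (\<lambda>n. vnorm T (s n))"
proof -
  have "Cauchy (\<lambda>n. vnorm T (s n))"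
  proof (rule CauchyI)
    fix e :: real assume "e > 0"
    then obtain N where N: "\<forall>m\<ge>N. \<forall>n\<ge>N. vdist T (s m) (s n) < e" using s by (auto simp: cauchy_seq_def)
    have "norm (vnorm T (s m) - vnorm T (s n)) < e" if "m \<ge> N" "n \<ge> N" for m n
      using norm_diff[OF cauchy_closed[OF s] cauchy_closed[OF s], of m n] N that by (force simp: real_norm_def)
    thus "\<exists>M. \<forall>m\<ge>M. \<forall>n\<ge>M. norm (vnorm T (s m) - vnorm T (s n)) < e" by blast
  qed
  thus ?thesis by (rule real_Cauchy_convergent)
qed

lemma cauchy_bounded:
  assumes s: "cauchy_seq T s"
  shows "\<exists>K\<ge>0. \<forall>n. vnorm T (s n) \<le> K"
proof -
  have "Bseq (\<lambda>n. vnorm T (s n))" by (rule convergent_imp_Bseq[OF cauchy_norm_convergent[OF s]])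
  then obtain K where "K > 0" "\<forall>n. norm (vnorm T (s n)) \<le> K" unfolding Bseq_def by blast
  thus ?thesis by (intro exI[of _ K]) (force simp: abs_le_iff)
qed

lemma cauchy_mult:
  assumes s: "cauchy_seq T s" and t: "cauchy_seq T t"
  shows "cauchy_seq T (\<lambda>n. vmult T (s n) (t n))"
proof -
  note c = cauchy_closed[OF s] cauchy_closed[OF t]
  obtain K where K: "K \<ge> 0" "\<And>n. vnorm T (s n) \<le> K" using cauchy_bounded[OF s] by blast
  obtain K' where K': "K' \<ge> 0" "\<And>n. vnorm T (t n) \<le> K'" using cauchy_bounded[OF t] by blast
  show ?thesis
  proof (rule cauchyI)
    show "vmult T (s n) (t n) \<in> CT" for n by (simp add: mult_closed c)
    fix m n
    have "D * (vdist T (s m) (s n) * vnorm T (t m)) \<le> D * (vdist T (s m) (s n) * K')"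
      "D * (vnorm T (s n) * vdist T (t m) (t n)) \<le> D * (K * vdist T (t m) (t n))"
      by (intro mult_left_mono mult_right_mono D_nonneg K K' d_nonneg c)+
    thus "vdist T (vmult T (s m) (t m)) (vmult T (s n) (t n)) \<le>
        D * (vdist T (s m) (s n) * K') + D * (K * vdist T (t m) (t n))"
      using d_mult[OF c(1)[of m] c(1)[of n] c(2)[of m] c(2)[of n]] by linarith
  next
    have "((\<lambda>x. D * ((case x of (m, n) \<Rightarrow> vdist T (s m) (s n)) * K') + D * (K * (case x of (m, n) \<Rightarrow> vdist T (t m) (t n))))
        \<longlongrightarrow> D * (0 * K') + D * (K * 0)) (sequentially \<times>\<^sub>F sequentially)"
      by (intro tendsto_intros cauchyD s t)
    thus "((\<lambda>(m, n). D * (vdist T (s m) (s n) * K') + D * (K * vdist T (t m) (t n))) \<longlongrightarrow> 0)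
        (sequentially \<times>\<^sub>F sequentially)"
      by (simp add: case_prod_unfold)
  qed
qed

lemma null_class_eq:
  assumes s: "cauchy_seq T s" and t: "cauchy_seq T t" and d: "(\<lambda>n. vdist T (s n) (t n)) \<longlonglongrightarrow> 0"
  shows "null_class T s = null_class T t"
proof -
  have *: "null_class T s \<subseteq> null_class T t" if s: "cauchy_seq T s" and t: "cauchy_seq T t"
    and d: "(\<lambda>n. vdist T (s n) (t n)) \<longlonglongrightarrow> 0" for s t
  proof
    fix u assume u: "u \<in> null_class T s"
    hence uc: "cauchy_seq T u" "(\<lambda>n. vdist T (s n) (u n)) \<longlonglongrightarrow> 0" by (auto simp: null_class_def)
    note c = cauchy_closed[OF s] cauchy_closed[OF t] cauchy_closed[OF uc(1)]
    have "(\<lambda>n. vdist T (t n) (u n)) \<longlonglongrightarrow> 0"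
    proof (rule tendsto_sandwich[OF _ _ tendsto_const])
      show "(\<lambda>n. vdist T (s n) (t n) + vdist T (s n) (u n)) \<longlonglongrightarrow> 0" using tendsto_add[OF d uc(2)] by simp
      have "vdist T (t n) (u n) \<le> vdist T (s n) (t n) + vdist T (s n) (u n)" for n
        using d_tri[OF c(2)[of n] c(1)[of n] c(3)[of n]] d_sym[OF c(1)[of n] c(2)[of n]] by simp
      thus "\<forall>\<^sub>F n in sequentially. vdist T (t n) (u n) \<le> vdist T (s n) (t n) + vdist T (s n) (u n)" by simp
      show "\<forall>\<^sub>F n in sequentially. 0 \<le> vdist T (t n) (u n)" by (simp add: d_nonneg c)
    qed
    thus "u \<in> null_class T t" using uc by (simp add: null_class_def)
  qed
  have d': "(\<lambda>n. vdist T (t n) (s n)) \<longlonglongrightarrow> 0"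
    using d by (simp add: d_sym[OF cauchy_closed[OF t] cauchy_closed[OF s]])
  show ?thesis using *[OF s t d] *[OF t s d'] by blast
qed

lemma null_class_self: "cauchy_seq T s \<Longrightarrow> s \<in> null_class T s"
  by (simp add: null_class_def d_self cauchy_closed)

lemma null_classD:
  "s' \<in> null_class T s \<Longrightarrow> cauchy_seq T s'" "s' \<in> null_class T s \<Longrightarrow> (\<lambda>n. vdist T (s n) (s' n)) \<longlonglongrightarrow> 0"
  by (auto simp: null_class_def)

section \<open>Operations of the completion\<close>

abbreviation "\<C> \<equiv> algebra_completion T"

lemma completion_carrier: "P \<in> carrier \<C> \<longleftrightarrow> (\<exists>s. cauchy_seq T s \<and> P = null_class T s)"
  by (auto simp: algebra_completion_def)

lemma null_class_carrier: "cauchy_seq T s \<Longrightarrow> null_class T s \<in> carrier \<C>"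
  unfolding completion_carrier by blast

lemma completion_add:
  assumes s: "cauchy_seq T s" and t: "cauchy_seq T t"
  shows "vadd \<C> (null_class T s) (null_class T t) = null_class T (\<lambda>n. vadd T (s n) (t n))"
proof -
  have "null_class T (\<lambda>n. vadd T (s n) (t n)) = null_class T (\<lambda>n. vadd T (s' n) (t' n))"
    if s': "s' \<in> null_class T s" and t': "t' \<in> null_class T t" for s' t'
  proof (rule null_class_eq[OF cauchy_add[OF s t] cauchy_add])
    note c = cauchy_closed[OF s] cauchy_closed[OF t] cauchy_closed[OF null_classD(1)[OF s']]
      cauchy_closed[OF null_classD(1)[OF t']]
    show "(\<lambda>n. vdist T (vadd T (s n) (t n)) (vadd T (s' n) (t' n))) \<longlonglongrightarrow> 0"
    proof (rule tendsto_sandwich[OF _ _ tendsto_const])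
      show "(\<lambda>n. vdist T (s n) (s' n) + vdist T (t n) (t' n)) \<longlonglongrightarrow> 0"
        using tendsto_add[OF null_classD(2)[OF s'] null_classD(2)[OF t']] by simp
    qed (auto intro!: always_eventually d_add d_nonneg add_closed c)
  qed (use null_classD(1) s' t' in auto)
  from UN_UN_eq_const[where f = "\<lambda>s t. null_class T (\<lambda>n. vadd T (s n) (t n))", OF null_class_self[OF s] null_class_self[OF t] this]
  show ?thesis by (simp add: algebra_completion_def)
qed

lemma completion_scale:
  assumes s: "cauchy_seq T s"
  shows "vscale \<C> a (null_class T s) = null_class T (\<lambda>n. vscale T a (s n))"
proof -
  have "null_class T (\<lambda>n. vscale T a (s n)) = null_class T (\<lambda>n. vscale T a (s' n))"
    if s': "s' \<in> null_class T s" for s'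
  proof (rule null_class_eq[OF cauchy_scale[OF s] cauchy_scale])
    note c = cauchy_closed[OF s] cauchy_closed[OF null_classD(1)[OF s']]
    show "(\<lambda>n. vdist T (vscale T a (s n)) (vscale T a (s' n))) \<longlonglongrightarrow> 0"
      using tendsto_mult[OF tendsto_const null_classD(2)[OF s'], of "cmod a"] by (simp add: d_scale c)
  qed (use null_classD(1) s' in auto)
  from UN_eq_const[where f = "\<lambda>s. null_class T (\<lambda>n. vscale T a (s n))", OF null_class_self[OF s] this]
  show ?thesis by (simp add: algebra_completion_def)
qed

lemma completion_mult:
  assumes s: "cauchy_seq T s" and t: "cauchy_seq T t"
  shows "vmult \<C> (null_class T s) (null_class T t) = null_class T (\<lambda>n. vmult T (s n) (t n))"
proof -
  have "null_class T (\<lambda>n. vmult T (s n) (t n)) = null_class T (\<lambda>n. vmult T (s' n) (t' n))"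
    if s': "s' \<in> null_class T s" and t': "t' \<in> null_class T t" for s' t'
  proof (rule null_class_eq[OF cauchy_mult[OF s t] cauchy_mult])
    note c = cauchy_closed[OF s] cauchy_closed[OF t] cauchy_closed[OF null_classD(1)[OF s']]
      cauchy_closed[OF null_classD(1)[OF t']]
    obtain K where K: "K \<ge> 0" "\<And>n. vnorm T (s' n) \<le> K" using cauchy_bounded[OF null_classD(1)[OF s']] by blast
    obtain K' where K': "K' \<ge> 0" "\<And>n. vnorm T (t n) \<le> K'" using cauchy_bounded[OF t] by blast
    show "(\<lambda>n. vdist T (vmult T (s n) (t n)) (vmult T (s' n) (t' n))) \<longlonglongrightarrow> 0"
    proof (rule tendsto_sandwich[OF _ _ tendsto_const])
      have "(\<lambda>n. D * (vdist T (s n) (s' n) * K') + D * (K * vdist T (t n) (t' n))) \<longlonglongrightarrow> D * (0 * K') + D * (K * 0)"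
        by (intro tendsto_intros null_classD(2) s' t')
      thus "(\<lambda>n. D * (vdist T (s n) (s' n) * K') + D * (K * vdist T (t n) (t' n))) \<longlonglongrightarrow> 0" by simp
      have "vdist T (vmult T (s n) (t n)) (vmult T (s' n) (t' n)) \<le>
          D * (vdist T (s n) (s' n) * K') + D * (K * vdist T (t n) (t' n))" for n
      proof -
        have "D * (vdist T (s n) (s' n) * vnorm T (t n)) \<le> D * (vdist T (s n) (s' n) * K')"
          "D * (vnorm T (s' n) * vdist T (t n) (t' n)) \<le> D * (K * vdist T (t n) (t' n))"
          by (intro mult_left_mono mult_right_mono D_nonneg K K' d_nonneg c)+
        thus ?thesis using d_mult[OF c(1)[of n] c(3)[of n] c(2)[of n] c(4)[of n]] by linarith
      qed
      thus "\<forall>\<^sub>F n in sequentially. vdist T (vmult T (s n) (t n)) (vmult T (s' n) (t' n)) \<le>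
          D * (vdist T (s n) (s' n) * K') + D * (K * vdist T (t n) (t' n))" by simp
    qed (auto intro!: always_eventually d_nonneg mult_closed c)
  qed (use null_classD(1) s' t' in auto)
  from UN_UN_eq_const[where f = "\<lambda>s t. null_class T (\<lambda>n. vmult T (s n) (t n))", OF null_class_self[OF s] null_class_self[OF t] this]
  show ?thesis by (simp add: algebra_completion_def)
qed

lemma completion_norm:
  assumes s: "cauchy_seq T s"
  shows "(\<lambda>n. vnorm T (s n)) \<longlonglongrightarrow> vnorm \<C> (null_class T s)"
proof -
  obtain r where r: "(\<lambda>n. vnorm T (s n)) \<longlonglongrightarrow> r" using cauchy_norm_convergent[OF s] by (auto simp: convergent_def)
  have all: "(\<lambda>n. vnorm T (s' n)) \<longlonglongrightarrow> r" if s': "s' \<in> null_class T s" for s'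
  proof -
    have "(\<lambda>n. vnorm T (s n) - vnorm T (s' n)) \<longlonglongrightarrow> 0"
      by (rule Lim_null_comparison[OF _ null_classD(2)[OF s']])
         (auto intro!: always_eventually norm_diff cauchy_closed s null_classD(1)[OF s'])
    from tendsto_diff[OF r this] show ?thesis by simp
  qed
  have "vnorm \<C> (null_class T s) = (THE r. \<forall>s\<in>null_class T s. (\<lambda>n. vnorm T (s n)) \<longlonglongrightarrow> r)"
    by (simp add: algebra_completion_def)
  also have "\<dots> = r"
    by (rule the_equality) (use all null_class_self[OF s] LIMSEQ_unique[OF r] in auto)
  finally show ?thesis using r by simp
qed

lemma completion_arens_alg: "arens_alg \<C> D"
proof
  have cl: "vscale \<C> a P \<in> carrier \<C>" "vnorm \<C> (vscale \<C> a P) = cmod a * vnorm \<C> P" "0 \<le> vnorm \<C> P"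
    if P: "P \<in> carrier \<C>" for P a
  proof -
    obtain s where s: "cauchy_seq T s" "P = null_class T s" using P completion_carrier by blast
    show "vscale \<C> a P \<in> carrier \<C>"
      by (simp add: s(2) completion_scale[OF s(1)] cauchy_scale[OF s(1)] null_class_carrier)
    have "(\<lambda>n. vnorm T (vscale T a (s n))) \<longlonglongrightarrow> vnorm \<C> (vscale \<C> a P)"
      using completion_norm[OF cauchy_scale[OF s(1)]] completion_scale[OF s(1)] s(2) by simp
    moreover have "(\<lambda>n. vnorm T (vscale T a (s n))) \<longlonglongrightarrow> cmod a * vnorm \<C> P"
      unfolding norm_scale[OF cauchy_closed[OF s(1)]] s(2) by (intro tendsto_mult tendsto_const completion_norm s)
    ultimately show "vnorm \<C> (vscale \<C> a P) = cmod a * vnorm \<C> P" by (rule LIMSEQ_unique)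
    show "0 \<le> vnorm \<C> P"
      by (rule LIMSEQ_le_const[OF completion_norm[OF s(1), folded s(2)]]) (auto intro!: norm_pos cauchy_closed s)
  qed
  have "null_class T (\<lambda>_. vzero T) \<in> carrier \<C>"
    by (rule null_class_carrier[OF cauchy_const[OF zero_closed]])
  hence "carrier \<C> \<noteq> {}" by blast
  thus "homog \<C>"
    unfolding homog_def by (intro conjI ballI allI cl)
  show "0 \<le> D" by (rule D_nonneg)
next
  fix x y assume xy: "x \<in> carrier \<C>" "y \<in> carrier \<C>"
  then obtain s t where s: "cauchy_seq T s" "x = null_class T s" and t: "cauchy_seq T t" "y = null_class T t"
    unfolding completion_carrier by blast
  note c = cauchy_closed[OF s(1)] cauchy_closed[OF t(1)]
  show "vadd \<C> x y \<in> carrier \<C>" "vmult \<C> x y \<in> carrier \<C>"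
    using s t by (simp_all add: completion_add completion_mult cauchy_add cauchy_mult null_class_carrier)
  show "vnorm \<C> (vmult \<C> x y) \<le> D * (vnorm \<C> x * vnorm \<C> y)"
  proof (rule LIMSEQ_le)
    show "(\<lambda>n. vnorm T (vmult T (s n) (t n))) \<longlonglongrightarrow> vnorm \<C> (vmult \<C> x y)"
      using completion_norm[OF cauchy_mult[OF s(1) t(1)]] completion_mult[OF s(1) t(1)] s t by simp
    show "(\<lambda>n. D * (vnorm T (s n) * vnorm T (t n))) \<longlonglongrightarrow> D * (vnorm \<C> x * vnorm \<C> y)"
      unfolding s(2) t(2) by (intro tendsto_mult tendsto_const completion_norm s t)
  qed (auto intro!: norm_mult_bound c)
  show "vmult \<C> (vscale \<C> a x) y = vscale \<C> a (vmult \<C> x y)" for a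
    using s t by (simp add: completion_scale completion_mult cauchy_scale cauchy_mult mult_scale_left c)
  show "vmult \<C> y (vscale \<C> a x) = vscale \<C> a (vmult \<C> y x)" for a
    using s t by (simp add: completion_scale completion_mult cauchy_scale cauchy_mult mult_scale_right c)
  fix z assume "z \<in> carrier \<C>"
  then obtain u where u: "cauchy_seq T u" "z = null_class T u" unfolding completion_carrier by blast
  note cu = cauchy_closed[OF u(1)]
  show "vmult \<C> (vadd \<C> x y) z = vadd \<C> (vmult \<C> x z) (vmult \<C> y z)"
    using s t u by (simp add: completion_add completion_mult cauchy_add cauchy_mult mult_add_left c cu)
  show "vmult \<C> z (vadd \<C> x y) = vadd \<C> (vmult \<C> z x) (vmult \<C> z y)"
    using s t u by (simp add: completion_add completion_mult cauchy_add cauchy_mult mult_add_right c cu)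
qed

text \<open>Extension by continuity: the value at a class is the limit along a chosen
  representative, and \<open>om\<close> shows that every representative gives the same
  limit.\<close>

lemma dual_extension:
  fixes w :: "'a \<Rightarrow> complex"
  assumes add: "\<And>x y. x \<in> CT \<Longrightarrow> y \<in> CT \<Longrightarrow> w (vadd T x y) = w x + w y"
    and scale: "\<And>a x. x \<in> CT \<Longrightarrow> w (vscale T a x) = a * w x"
    and bound: "\<And>x. x \<in> CT \<Longrightarrow> cmod (w x) \<le> c * vnorm T x"
  shows "\<exists>\<omega>\<in>carrier (dual \<C>). \<forall>x\<in>CT. \<omega> (null_class T (\<lambda>_. x)) = w x"
proof -
  interpret A: arens_alg \<C> D by (rule completion_arens_alg)
  have diff: "cmod (w x - w y) \<le> c * vdist T x y" if "x \<in> CT" "y \<in> CT" for x y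
    using bound[OF sb_closed[OF that]] that by (simp add: sb_def add scale scale_closed vdist_def)
  have conv: "convergent (\<lambda>n. w (s n))" if s: "cauchy_seq T s" for s
  proof -
    have "Cauchy (\<lambda>n. w (s n))"
    proof (rule CauchyI)
      fix e :: real assume e: "e > 0"
      \<comment> \<open>A strictly positive bound to divide by, whatever the sign of
        \<open>c\<close>.\<close>
      let ?c = "\<bar>c\<bar> + 1"
      have "e / ?c > 0" using e by (simp add: add_nonneg_pos)
      then obtain N where N: "\<forall>m\<ge>N. \<forall>n\<ge>N. vdist T (s m) (s n) < e / ?c"
        using s unfolding cauchy_seq_def by blast
      have "norm (w (s m) - w (s n)) < e" if "m \<ge> N" "n \<ge> N" for m n
      proof -
        have "norm (w (s m) - w (s n)) \<le> c * vdist T (s m) (s n)" by (intro diff cauchy_closed s)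
        also have "\<dots> \<le> ?c * vdist T (s m) (s n)"
          by (intro mult_right_mono d_nonneg cauchy_closed s) auto
        also have "\<dots> < ?c * (e / ?c)" using N that by (intro mult_strict_left_mono) auto
        also have "?c * (e / ?c) = e"
          using abs_ge_zero[of c] by (intro nonzero_mult_div_cancel_left[of ?c e, unfolded times_divide_eq_right[symmetric]]) linarith
        finally show ?thesis .
      qed
      thus "\<exists>M. \<forall>m\<ge>M. \<forall>n\<ge>M. norm (w (s m) - w (s n)) < e" by blast
    qed
    thus ?thesis by (simp add: Cauchy_convergent_iff)
  qed
  define \<omega> where "\<omega> = (\<lambda>P\<in>carrier \<C>. lim (\<lambda>n. w ((SOME s. s \<in> P) n)))"
  have om: "(\<lambda>n. w (s n)) \<longlonglongrightarrow> \<omega> (null_class T s)" if s: "cauchy_seq T s" for s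
  proof -
    define s' where "s' = (SOME t. t \<in> null_class T s)"
    have s': "s' \<in> null_class T s" unfolding s'_def by (rule someI[of "\<lambda>t. t \<in> null_class T s"]) (rule null_class_self[OF s])
    have eq: "\<omega> (null_class T s) = lim (\<lambda>n. w (s' n))"
      using s completion_carrier by (auto simp: \<omega>_def s'_def)
    have l: "(\<lambda>n. w (s' n)) \<longlonglongrightarrow> \<omega> (null_class T s)"
      using conv[OF null_classD(1)[OF s']] unfolding eq by (simp add: convergent_LIMSEQ_iff)
    have "(\<lambda>n. w (s n) - w (s' n)) \<longlonglongrightarrow> 0"
    proof (rule Lim_null_comparison)
      show "\<forall>\<^sub>F n in sequentially. norm (w (s n) - w (s' n)) \<le> c * vdist T (s n) (s' n)"
        by (intro always_eventually allI diff cauchy_closed s null_classD(1)[OF s'])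
      show "(\<lambda>n. c * vdist T (s n) (s' n)) \<longlonglongrightarrow> 0"
        using tendsto_mult[OF tendsto_const null_classD(2)[OF s'], of c] by simp
    qed
    from tendsto_add[OF this l] show ?thesis by simp
  qed
  have "\<omega> \<in> carrier (dual \<C>)"
  proof (rule A.dualI[where N = c])
    show "\<omega> \<in> extensional (carrier \<C>)" by (simp add: \<omega>_def)
  next
    fix x y assume "x \<in> carrier \<C>" "y \<in> carrier \<C>"
    then obtain s t where s: "cauchy_seq T s" "x = null_class T s" and t: "cauchy_seq T t" "y = null_class T t"
      unfolding completion_carrier by blast
    have "(\<lambda>n. w (s n) + w (t n)) \<longlonglongrightarrow> \<omega> (vadd \<C> x y)"
      using om[OF cauchy_add[OF s(1) t(1)]] s t by (simp add: completion_add add cauchy_closed)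
    moreover have "(\<lambda>n. w (s n) + w (t n)) \<longlonglongrightarrow> \<omega> x + \<omega> y"
      unfolding s(2) t(2) by (intro tendsto_add om s t)
    ultimately show "\<omega> (vadd \<C> x y) = \<omega> x + \<omega> y" by (rule LIMSEQ_unique)
  next
    fix a x assume "x \<in> carrier \<C>"
    then obtain s where s: "cauchy_seq T s" "x = null_class T s" unfolding completion_carrier by blast
    have "(\<lambda>n. a * w (s n)) \<longlonglongrightarrow> \<omega> (vscale \<C> a x)"
      using om[OF cauchy_scale[OF s(1)], of a] s by (simp add: completion_scale scale cauchy_closed)
    moreover have "(\<lambda>n. a * w (s n)) \<longlonglongrightarrow> a * \<omega> x"
      unfolding s(2) by (intro tendsto_mult tendsto_const om s)
    ultimately show "\<omega> (vscale \<C> a x) = a * \<omega> x" by (rule LIMSEQ_unique)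
  next
    fix x assume "x \<in> carrier \<C>"
    then obtain s where s: "cauchy_seq T s" "x = null_class T s" unfolding completion_carrier by blast
    show "cmod (\<omega> x) \<le> c * vnorm \<C> x"
    proof (rule LIMSEQ_le)
      show "(\<lambda>n. cmod (w (s n))) \<longlonglongrightarrow> cmod (\<omega> x)" unfolding s(2) by (intro tendsto_norm om s)
      show "(\<lambda>n. c * vnorm T (s n)) \<longlonglongrightarrow> c * vnorm \<C> x"
        unfolding s(2) by (intro tendsto_mult tendsto_const completion_norm s)
    qed (auto intro!: bound cauchy_closed s)
  qed
  moreover have "\<omega> (null_class T (\<lambda>_. x)) = w x" if "x \<in> CT" for x
    using om[OF cauchy_const[OF that]] by (simp add: LIMSEQ_const_iff)
  ultimately show ?thesis by blast
qed

lemma completion_not_arens_regular: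
  fixes a b :: "nat \<Rightarrow> 'a" and w :: "'a \<Rightarrow> complex"
  assumes add: "\<And>x y. x \<in> CT \<Longrightarrow> y \<in> CT \<Longrightarrow> w (vadd T x y) = w x + w y"
    and scale: "\<And>a x. x \<in> CT \<Longrightarrow> w (vscale T a x) = a * w x"
    and bound: "\<And>x. x \<in> CT \<Longrightarrow> cmod (w x) \<le> c * vnorm T x"
    and a: "\<And>i. a i \<in> CT" "\<And>i. vnorm T (a i) \<le> N"
    and b: "\<And>j. b j \<in> CT" "\<And>j. vnorm T (b j) \<le> N"
    and ab: "\<And>i j. w (vmult T (a i) (b j)) = of_bool (i \<le> j)"
  shows "\<not> arens_regular \<C>"
proof -
  interpret A: arens_alg \<C> D by (rule completion_arens_alg)
  obtain \<omega> where om: "\<omega> \<in> carrier (dual \<C>)" "\<And>x. x \<in> CT \<Longrightarrow> \<omega> (null_class T (\<lambda>_. x)) = w x"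
    using dual_extension[OF add scale bound] by blast
  have cc: "null_class T (\<lambda>_. x) \<in> carrier \<C>" "vnorm \<C> (null_class T (\<lambda>_. x)) = vnorm T x" if "x \<in> CT" for x
    using completion_norm[OF cauchy_const[OF that]] cauchy_const[OF that] completion_carrier
    by (auto simp: LIMSEQ_const_iff)
  show ?thesis
  proof (rule A.not_arens_regular[where a = "\<lambda>i. null_class T (\<lambda>_. a i)" and b = "\<lambda>j. null_class T (\<lambda>_. b j)"
        and \<omega> = \<omega> and N = N])
    show "\<omega> (vmult \<C> (null_class T (\<lambda>_. a i)) (null_class T (\<lambda>_. b j))) = of_bool (i \<le> j)" for i j
      by (simp add: completion_mult cauchy_const a b om mult_closed ab)
  qed (use cc a b om in auto)
qed

end

section \<open>The algebraic tensor product\<close>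

text \<open>Scalars act on formal sums through the first factor, so homogeneity of the tensor
  seminorm comes from the norm of A, while B enters the product estimate with its constant
  E.\<close>

locale tensor = V: complex_vector_space A + A: quasi_normed_algebra A 1 + B: quasi_normed_algebra B E
  for A :: "('a, 'm) nalgebra_scheme" and B :: "('b, 'n) nalgebra_scheme" and E :: real +
  assumes A_norm_scale: "x \<in> carrier A \<Longrightarrow> vnorm A (vscale A a x) = cmod a * vnorm A x"
begin

abbreviation "FS \<equiv> formal_sums A B"
abbreviation "st \<equiv> tensor_step A B"
abbreviation "eqv \<equiv> equivclp (tensor_step A B)"
abbreviation "cls \<equiv> tensor_class A B"
abbreviation "AB \<equiv> alg_tensor A B"

lemma A_mult_zero: "z \<in> carrier A \<Longrightarrow> vmult A (vzero A) z = vzero A"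
  "z \<in> carrier A \<Longrightarrow> vmult A z (vzero A) = vzero A"
  using A.p_scale_l[of z z 0] A.p_scale_r[of z z 0] by (simp_all add: V.scale_zero A.p_mult)

lemma FS_empty [simp]: "{#} \<in> FS" by (simp add: formal_sums_def)
lemma FS_plus [simp]: "u + v \<in> FS \<longleftrightarrow> u \<in> FS \<and> v \<in> FS" by (simp add: formal_sums_def)
lemma FS_add_mset [simp]: "add_mset (x, y) v \<in> FS \<longleftrightarrow> x \<in> carrier A \<and> y \<in> carrier B \<and> v \<in> FS"
  by (auto simp: formal_sums_def)

lemma FS_induct [consumes 1, case_names empty add]:
  assumes "u \<in> FS" "P {#}"
    "\<And>x y u. x \<in> carrier A \<Longrightarrow> y \<in> carrier B \<Longrightarrow> u \<in> FS \<Longrightarrow> P u \<Longrightarrow> P (add_mset (x, y) u)"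
  shows "P u"
  using assms(1)
proof (induction u)
  case (add p u)
  thus ?case using assms(3)[of "fst p" "snd p" u] by (cases p) auto
qed (rule assms(2))

lemma step_FS:
  assumes "st u v"
  shows "u \<in> FS" "v \<in> FS"
  using assms by (induction; simp add: A.p_add A.p_scale B.p_add B.p_scale V.zero_closed)+

lemma eqv_FS: "eqv u v \<Longrightarrow> u \<in> FS \<longleftrightarrow> v \<in> FS"
  by (induction rule: equivclp_induct) (use step_FS in blast)+

lemma cls_iff [simp]: "v \<in> cls u \<longleftrightarrow> eqv u v"
  by (simp add: tensor_class_def)

lemma cls_eqI:
  assumes "eqv u v"
  shows "cls u = cls v"
proof -
  have "eqv u w \<longleftrightarrow> eqv v w" for w
    using equivclp_trans[OF assms, of w] equivclp_trans[OF equivclp_sym[OF assms], of w] by blast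
  thus ?thesis by (simp add: set_eq_iff)
qed

lemma eqv_cong:
  assumes f: "\<And>u v. st u v \<Longrightarrow> eqv (f u) (f v)" and uv: "eqv u v"
  shows "eqv (f u) (f v)"
  using uv
proof (induction rule: equivclp_induct)
  case base
  show ?case by simp
next
  case (step y z)
  from step.hyps(2) have "eqv (f y) (f z)"
  proof
    assume "st y z"
    thus ?thesis by (rule f)
  next
    assume "st z y"
    from f[OF this] show ?thesis by (rule equivclp_sym)
  qed
  with step.IH show ?case by (rule equivclp_trans)
qed

lemma step_plus:
  assumes "st u v" "w \<in> FS"
  shows "st (u + w) (v + w)"
  using assms(1)
proof cases
  case (add_left x x' y w')
  thus ?thesis using tensor_step.add_left[of x A x' y B "w' + w"] assms(2) by (simp add: ac_simps)
next
  case (add_right x y y' w')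
  thus ?thesis using tensor_step.add_right[of x A y B y' "w' + w"] assms(2) by (simp add: ac_simps)
next
  case (scale x y w' a)
  thus ?thesis using tensor_step.scale[of x A y B "w' + w" a] assms(2) by (simp add: ac_simps)
next
  case (zero y)
  thus ?thesis using tensor_step.zero[of y B "v + w" A] assms(2) by (simp add: ac_simps)
qed

lemma eqv_plus:
  assumes "eqv u u'" "eqv v v'" "u \<in> FS" "v \<in> FS"
  shows "eqv (u + v) (u' + v')"
proof (rule equivclp_trans)
  show "eqv (u + v) (u' + v)"
    by (rule eqv_cong[OF _ assms(1)]) (use step_plus[OF _ assms(4)] in blast)
  have "u' \<in> FS" using eqv_FS[OF assms(1)] assms(3) by blast
  hence "eqv (v + u') (v' + u')"
    by (intro eqv_cong[OF _ assms(2)]) (use step_plus in blast)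
  thus "eqv (u' + v) (u' + v')" by (simp add: add.commute)
qed

section \<open>Multiples and products of formal sums\<close>

definition sc :: "complex \<Rightarrow> ('a \<times> 'b) multiset \<Rightarrow> ('a \<times> 'b) multiset" where
  "sc a u = {#(vscale A a x, y). (x, y) \<in># u#}"

definition pr :: "('a \<times> 'b) multiset \<Rightarrow> ('a \<times> 'b) multiset \<Rightarrow> ('a \<times> 'b) multiset" where
  "pr u v = (\<Sum>(x, y)\<in>#u. {#(vmult A x x', vmult B y y'). (x', y') \<in># v#})"

lemma sc_simps [simp]: "sc a {#} = {#}" "sc a (u + v) = sc a u + sc a v"
  "sc a (add_mset (x, y) u) = add_mset (vscale A a x, y) (sc a u)"
  by (simp_all add: sc_def)

text \<open>With \<open>prr\<close>, multiplication by an elementary tensor from either side.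
  Together they give recursion rules for \<open>pr\<close> in both arguments, so that either factor
  can be built up pair by pair.\<close>

definition prl :: "'a \<Rightarrow> 'b \<Rightarrow> ('a \<times> 'b) multiset \<Rightarrow> ('a \<times> 'b) multiset" where
  "prl x y v = {#(vmult A x x', vmult B y y'). (x', y') \<in># v#}"

definition prr :: "('a \<times> 'b) multiset \<Rightarrow> 'a \<Rightarrow> 'b \<Rightarrow> ('a \<times> 'b) multiset" where
  "prr u x' y' = {#(vmult A x x', vmult B y y'). (x, y) \<in># u#}"

lemma prl_prr_simps [simp]:
  "prl x y {#} = {#}" "prl x y (v + v') = prl x y v + prl x y v'"
  "prl x y (add_mset (x', y') v) = add_mset (vmult A x x', vmult B y y') (prl x y v)"
  "prr {#} x' y' = {#}" "prr (u + u') x' y' = prr u x' y' + prr u' x' y'"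
  "prr (add_mset (x, y) u) x' y' = add_mset (vmult A x x', vmult B y y') (prr u x' y')"
  by (simp_all add: prl_def prr_def)

lemma pr_simps [simp]: "pr {#} v = {#}" "pr (u + u') v = pr u v + pr u' v"
  "pr u {#} = {#}" "pr u (v + v') = pr u v + pr u v'"
  "pr (add_mset (x, y) u) v = prl x y v + pr u v"
  by (simp_all add: pr_def prl_def case_prod_unfold sum_mset.distrib)

lemma pr_add_mset_r [simp]: "pr u (add_mset (x', y') v) = prr u x' y' + pr u v"
  by (induction u) (auto simp: ac_simps)

lemma sc_FS: "u \<in> FS \<Longrightarrow> sc a u \<in> FS"
  by (induction u rule: FS_induct) (simp_all add: A.p_scale)

lemma prl_FS: "v \<in> FS \<Longrightarrow> x \<in> carrier A \<Longrightarrow> y \<in> carrier B \<Longrightarrow> prl x y v \<in> FS"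
  by (induction v rule: FS_induct) (simp_all add: A.p_mult B.p_mult)

lemma prr_FS: "u \<in> FS \<Longrightarrow> x \<in> carrier A \<Longrightarrow> y \<in> carrier B \<Longrightarrow> prr u x y \<in> FS"
  by (induction u rule: FS_induct) (simp_all add: A.p_mult B.p_mult)

lemma pr_FS: "u \<in> FS \<Longrightarrow> v \<in> FS \<Longrightarrow> pr u v \<in> FS"
  by (induction u rule: FS_induct) (simp_all add: prl_FS)

lemma step_sc:
  assumes "st u v"
  shows "st (sc a u) (sc a v)"
  using assms
proof cases
  case (add_left x x' y w)
  thus ?thesis using tensor_step.add_left[of "vscale A a x" A "vscale A a x'" y B "sc a w"]
    by (simp add: A.p_scale sc_FS V.scale_add_right)
next
  case (add_right x y y' w)
  thus ?thesis using tensor_step.add_right[of "vscale A a x" A y B y' "sc a w"]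
    by (simp add: A.p_scale sc_FS)
next
  case (scale x y w b)
  have "vscale A a (vscale A b x) = vscale A b (vscale A a x)"
    using scale by (simp add: V.scale_scale mult.commute)
  thus ?thesis using tensor_step.scale[of "vscale A a x" A y B "sc a w" b] scale
    by (simp add: A.p_scale sc_FS)
next
  case (zero y)
  thus ?thesis using tensor_step.zero[of y B "sc a v" A] by (simp add: sc_FS V.scale_vzero)
qed

lemma eqv_sc: "eqv u v \<Longrightarrow> eqv (sc a u) (sc a v)"
  by (rule eqv_cong) (use step_sc in blast)+

lemma step_pr_l:
  assumes "st u v" and q: "x0 \<in> carrier A" "y0 \<in> carrier B"
  shows "st (prr u x0 y0) (prr v x0 y0)"
  using assms(1)
proof cases
  case (add_left x x' y w)
  thus ?thesis
    using tensor_step.add_left[of "vmult A x x0" A "vmult A x' x0" "vmult B y y0" B "prr w x0 y0"] q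
    by (simp add: A.p_mult B.p_mult prl_FS prr_FS pr_FS A.p_add_l)
next
  case (add_right x y y' w)
  thus ?thesis
    using tensor_step.add_right[of "vmult A x x0" A "vmult B y y0" B "vmult B y' y0" "prr w x0 y0"] q
    by (simp add: A.p_mult B.p_mult prl_FS prr_FS pr_FS B.p_add_l)
next
  case (scale x y w b)
  thus ?thesis
    using tensor_step.scale[of "vmult A x x0" A "vmult B y y0" B "prr w x0 y0" b] q
    by (simp add: A.p_mult B.p_mult prl_FS prr_FS pr_FS A.p_scale_l B.p_scale_l)
next
  case (zero y)
  thus ?thesis
    using tensor_step.zero[of "vmult B y y0" B "prr v x0 y0" A] q
    by (simp add: B.p_mult prl_FS prr_FS pr_FS A_mult_zero)
qed

lemma step_pr_r:
  assumes "st u v" and q: "x0 \<in> carrier A" "y0 \<in> carrier B"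
  shows "st (prl x0 y0 u) (prl x0 y0 v)"
  using assms(1)
proof cases
  case (add_left x x' y w)
  thus ?thesis
    using tensor_step.add_left[of "vmult A x0 x" A "vmult A x0 x'" "vmult B y0 y" B "prl x0 y0 w"] q
    by (simp add: A.p_mult B.p_mult prl_FS prr_FS pr_FS A.p_add_r)
next
  case (add_right x y y' w)
  thus ?thesis
    using tensor_step.add_right[of "vmult A x0 x" A "vmult B y0 y" B "vmult B y0 y'" "prl x0 y0 w"] q
    by (simp add: A.p_mult B.p_mult prl_FS prr_FS pr_FS B.p_add_r)
next
  case (scale x y w b)
  thus ?thesis
    using tensor_step.scale[of "vmult A x0 x" A "vmult B y0 y" B "prl x0 y0 w" b] q
    by (simp add: A.p_mult B.p_mult prl_FS prr_FS pr_FS A.p_scale_r B.p_scale_r)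
next
  case (zero y)
  thus ?thesis
    using tensor_step.zero[of "vmult B y0 y" B "prl x0 y0 v" A] q
    by (simp add: B.p_mult prl_FS prr_FS pr_FS A_mult_zero)
qed

text \<open>One factor is changed at a time. Multiplying by a single pair maps a relation step to a
  relation step, and the fixed factor is built up by induction.\<close>

lemma eqv_pr:
  assumes u: "eqv u u'" "u \<in> FS" and v: "eqv v v'" "v \<in> FS"
  shows "eqv (pr u v) (pr u' v')"
proof (rule equivclp_trans)
  show "eqv (pr u v) (pr u' v)"
    using v(2)
  proof (induction v rule: FS_induct)
    case (add x y v)
    have "eqv (prr u x y) (prr u' x y)"
      by (rule eqv_cong[OF _ u(1)]) (use step_pr_l[OF _ add.hyps(1,2)] in blast)
    from eqv_plus[OF this add.IH] show ?case
      using add.hyps u(2) by (simp add: prl_FS prr_FS pr_FS)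
  qed simp
  have u': "u' \<in> FS" using eqv_FS[OF u(1)] u(2) by blast
  show "eqv (pr u' v) (pr u' v')"
    using u'
  proof (induction u' rule: FS_induct)
    case (add x y w)
    have "eqv (prl x y v) (prl x y v')"
      by (rule eqv_cong[OF _ v(1)]) (use step_pr_r[OF _ add.hyps(1,2)] in blast)
    from eqv_plus[OF this add.IH] show ?case
      using add.hyps v(2) by (simp add: prl_FS prr_FS pr_FS)
  qed simp
qed

section \<open>Algebraic operations on tensor classes\<close>

lemma AB_carrier: "P \<in> carrier AB \<longleftrightarrow> (\<exists>u\<in>FS. P = cls u)"
  by (auto simp: alg_tensor_def)

lemma cls_AB: "u \<in> FS \<Longrightarrow> cls u \<in> carrier AB"
  unfolding AB_carrier by blast

lemma AB_zero: "vzero AB = cls {#}"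
  by (simp add: alg_tensor_def)

lemma AB_add: "u \<in> FS \<Longrightarrow> v \<in> FS \<Longrightarrow> vadd AB (cls u) (cls v) = cls (u + v)"
  unfolding alg_tensor_def nspace.simps
  by (rule UN_UN_eq_const) (auto intro!: cls_eqI eqv_plus)

lemma AB_scale: "u \<in> FS \<Longrightarrow> vscale AB a (cls u) = cls (sc a u)"
  unfolding alg_tensor_def nspace.simps sc_def[symmetric]
  by (rule UN_eq_const) (auto intro!: cls_eqI eqv_sc)

lemma AB_mult: "u \<in> FS \<Longrightarrow> v \<in> FS \<Longrightarrow> vmult AB (cls u) (cls v) = cls (pr u v)"
  unfolding alg_tensor_def nalgebra.simps pr_def[symmetric]
  by (rule UN_UN_eq_const) (auto intro!: cls_eqI eqv_pr)

lemma sc_inverse: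
  assumes "u \<in> FS"
  shows "eqv (u + sc (- 1) u) {#}"
  using assms
proof (induction u rule: FS_induct)
  case (add x y u)
  have m: "vscale A (- 1) x \<in> carrier A" using add.hyps by (simp add: A.p_scale)
  \<comment> \<open>The sum with zero first component steps both to the pair with its negative and
    to the empty sum, so these two are equivalent.\<close>
  have "st {#(vadd A x (vscale A (- 1) x), y)#} {#(x, y), (vscale A (- 1) x, y)#}"
    using tensor_step.add_left[OF add.hyps(1) m add.hyps(2), of "{#}"] by simp
  moreover have "st {#(vadd A x (vscale A (- 1) x), y)#} {#}"
    using tensor_step.zero[OF add.hyps(2), of "{#}" A] add.hyps(1) by (simp add: V.add_minus)
  ultimately have "eqv {#(x, y), (vscale A (- 1) x, y)#} {#}"
    by (meson equivclp_sym equivclp_trans r_into_equivclp)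
  from eqv_plus[OF this add.IH] add.hyps m show ?case by (simp add: sc_FS add_mset_commute)
qed simp

lemma sc_add_left:
  assumes "u \<in> FS"
  shows "eqv (sc (a + b) u) (sc a u + sc b u)"
  using assms
proof (induction u rule: FS_induct)
  case (add x y u)
  have m: "vscale A a x \<in> carrier A" "vscale A b x \<in> carrier A" using add.hyps by (simp_all add: A.p_scale)
  have "st {#(vscale A (a + b) x, y)#} {#(vscale A a x, y), (vscale A b x, y)#}"
    using tensor_step.add_left[OF m add.hyps(2), of "{#}"] add.hyps(1) by (simp add: V.scale_add_left)
  hence "eqv {#(vscale A (a + b) x, y)#} {#(vscale A a x, y), (vscale A b x, y)#}" by (rule r_into_equivclp)
  from eqv_plus[OF this add.IH] add.hyps m show ?case
    by (simp add: sc_FS A.p_scale add_mset_commute)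
qed simp

lemma sc_one: "u \<in> FS \<Longrightarrow> sc 1 u = u"
  by (induction u rule: FS_induct) (simp_all add: V.scale_one)

lemma sc_sc: "u \<in> FS \<Longrightarrow> sc a (sc b u) = sc (a * b) u"
  by (induction u rule: FS_induct) (simp_all add: V.scale_scale)

lemma prl_sc: "v \<in> FS \<Longrightarrow> x \<in> carrier A \<Longrightarrow> prl (vscale A a x) y v = sc a (prl x y v)"
  by (induction v rule: FS_induct) (simp_all add: A.p_scale_l)

lemma prr_sc: "u \<in> FS \<Longrightarrow> x \<in> carrier A \<Longrightarrow> prr u (vscale A a x) y = sc a (prr u x y)"
  by (induction u rule: FS_induct) (simp_all add: A.p_scale_r)

lemma pr_sc_l: "u \<in> FS \<Longrightarrow> v \<in> FS \<Longrightarrow> pr (sc a u) v = sc a (pr u v)"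
  by (induction u rule: FS_induct) (simp_all add: prl_sc)

lemma pr_sc_r: "v \<in> FS \<Longrightarrow> u \<in> FS \<Longrightarrow> pr u (sc a v) = sc a (pr u v)"
  by (induction v rule: FS_induct) (simp_all add: prr_sc)

lemma AB_vector_space: "complex_vector_space AB"
proof
  show "vzero AB \<in> carrier AB" by (simp add: AB_zero cls_AB)
next
  fix P Q R assume "P \<in> carrier AB" "Q \<in> carrier AB" "R \<in> carrier AB"
  then obtain u v w where "u \<in> FS" "v \<in> FS" "w \<in> FS" "P = cls u" "Q = cls v" "R = cls w"
    unfolding AB_carrier by blast
  thus "vadd AB (vadd AB P Q) R = vadd AB P (vadd AB Q R)" by (simp add: AB_add add.assoc)
next
  fix P Q assume "P \<in> carrier AB" "Q \<in> carrier AB"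
  then obtain u v where uv: "u \<in> FS" "v \<in> FS" "P = cls u" "Q = cls v"
    unfolding AB_carrier by blast
  thus "vadd AB P Q \<in> carrier AB" by (simp add: AB_add cls_AB)
  show "vadd AB P Q = vadd AB Q P" using uv by (simp add: AB_add add.commute)
  show "vscale AB a (vadd AB P Q) = vadd AB (vscale AB a P) (vscale AB a Q)" for a
    using uv by (simp add: AB_add AB_scale sc_FS)
next
  fix P assume "P \<in> carrier AB"
  then obtain u where u: "u \<in> FS" "P = cls u" unfolding AB_carrier by blast
  show "vscale AB a P \<in> carrier AB" for a using u by (simp add: AB_scale sc_FS cls_AB)
  show "vadd AB P (vzero AB) = P" using u by (simp add: AB_add AB_zero)
  show "\<exists>Q\<in>carrier AB. vadd AB P Q = vzero AB"
    by (rule bexI[of _ "cls (sc (- 1) u)"])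
       (use u in \<open>simp_all add: AB_add AB_zero sc_FS cls_AB cls_eqI[OF sc_inverse]\<close>)
  show "vscale AB 1 P = P" using u by (simp add: AB_scale sc_one)
  show "vscale AB a (vscale AB b P) = vscale AB (a * b) P" for a b
    using u by (simp add: AB_scale sc_FS sc_sc)
  show "vscale AB (a + b) P = vadd AB (vscale AB a P) (vscale AB b P)" for a b
    using u by (simp add: AB_scale AB_add sc_FS cls_eqI[OF sc_add_left])
qed

section \<open>The projective seminorm\<close>

definition N :: "('a \<times> 'b) multiset \<Rightarrow> real" where
  "N u = (\<Sum>(x, y)\<in>#u. vnorm A x * vnorm B y)"

lemma N_simps [simp]: "N {#} = 0" "N (u + v) = N u + N v"
  "N (add_mset (x, y) u) = vnorm A x * vnorm B y + N u"
  by (simp_all add: N_def)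

lemma N_nonneg: "u \<in> FS \<Longrightarrow> 0 \<le> N u"
  by (induction u rule: FS_induct) (simp_all add: A.p_norm_pos B.p_norm_pos)

lemma N_sc: "u \<in> FS \<Longrightarrow> N (sc a u) = cmod a * N u"
  by (induction u rule: FS_induct) (simp_all add: A_norm_scale algebra_simps)

lemma N_pr:
  assumes u: "u \<in> FS" and v: "v \<in> FS"
  shows "N (pr u v) \<le> E * (N u * N v)"
  using u
proof (induction u rule: FS_induct)
  case (add x y u)
  have "N (prl x y v) \<le> E * ((vnorm A x * vnorm B y) * N v)"
    using v
  proof (induction v rule: FS_induct)
    case (add x' y' v)
    have "vnorm A (vmult A x x') * vnorm B (vmult B y y') \<le>
        (vnorm A x * vnorm A x') * (E * (vnorm B y * vnorm B y'))"
      using A.p_norm_mult[OF \<open>x \<in> carrier A\<close> add.hyps(1)] B.p_norm_mult[OF \<open>y \<in> carrier B\<close> add.hyps(2)]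
        \<open>x \<in> carrier A\<close> \<open>y \<in> carrier B\<close> add.hyps
      by (intro mult_mono) (simp_all add: A.p_norm_pos B.p_norm_pos B.p_mult)
    thus ?case using add.IH by (simp add: algebra_simps)
  qed simp
  thus ?case using add.IH by (simp add: algebra_simps)
qed simp

lemma AB_norm: "vnorm AB P = (INF u\<in>P. N u)"
  by (simp add: alg_tensor_def N_def)

lemma AB_norm_le:
  assumes "u \<in> FS"
  shows "vnorm AB (cls u) \<le> N u"
  unfolding AB_norm
proof (rule cINF_lower)
  show "bdd_below (N ` cls u)"
    by (rule bdd_belowI2[of _ 0]) (use assms eqv_FS N_nonneg in auto)
qed simp

lemma AB_norm_ge:
  assumes "u \<in> FS" "\<And>v. v \<in> FS \<Longrightarrow> eqv u v \<Longrightarrow> c \<le> N v"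
  shows "c \<le> vnorm AB (cls u)"
  unfolding AB_norm
proof (rule cINF_greatest)
  show "cls u \<noteq> {}" using cls_iff[of u u] by (metis empty_iff equivclp_refl)
qed (use assms eqv_FS in auto)

lemma AB_norm_approx:
  assumes u: "u \<in> FS" and e: "e > 0"
  shows "\<exists>v\<in>FS. cls u = cls v \<and> N v < vnorm AB (cls u) + e"
proof (rule ccontr)
  assume n: "\<not> ?thesis"
  have "vnorm AB (cls u) + e \<le> vnorm AB (cls u)"
  proof (rule AB_norm_ge[OF u])
    fix v assume v: "v \<in> FS" "eqv u v"
    thus "vnorm AB (cls u) + e \<le> N v" using n cls_eqI[OF v(2)] by force
  qed
  thus False using e by simp
qed

lemma AB_norm_scale_le:
  assumes u: "u \<in> FS"
  shows "vnorm AB (cls (sc a u)) \<le> cmod a * vnorm AB (cls u)"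
proof (cases "a = 0")
  case True
  thus ?thesis using AB_norm_le[OF sc_FS[OF u], of 0] by (simp add: N_sc u)
next
  case False
  have "vnorm AB (cls (sc a u)) / cmod a \<le> vnorm AB (cls u)"
  proof (rule AB_norm_ge[OF u])
    fix v assume v: "v \<in> FS" "eqv u v"
    have "vnorm AB (cls (sc a u)) \<le> N (sc a v)"
      using AB_norm_le[OF sc_FS[OF v(1)], of a] cls_eqI[OF eqv_sc[OF v(2)], of a] by simp
    thus "vnorm AB (cls (sc a u)) / cmod a \<le> N v" using False v(1) by (simp add: N_sc field_simps)
  qed
  thus ?thesis using False by (simp add: field_simps)
qed

lemma AB_seminormed_algebra: "seminormed_algebra AB E"
proof -
  interpret C: complex_vector_space AB by (rule AB_vector_space)
  show ?thesis
  proof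
    show "0 \<le> E" by (rule B.p_const)
  next
    fix P assume "P \<in> carrier AB"
    then obtain u where u: "u \<in> FS" "P = cls u" unfolding AB_carrier by blast
    show "0 \<le> vnorm AB P" unfolding u(2) by (rule AB_norm_ge[OF u(1)]) (rule N_nonneg)
    fix a
    show "vnorm AB (vscale AB a P) = cmod a * vnorm AB P"
    proof (cases "a = 0")
      case True
      have "vnorm AB (cls (sc 0 u)) \<ge> 0" by (rule AB_norm_ge[OF sc_FS[OF u(1)]]) (rule N_nonneg)
      thus ?thesis using True AB_norm_scale_le[OF u(1), of 0] u by (simp add: AB_scale)
    next
      case False
      have "vnorm AB (cls u) \<le> cmod (1 / a) * vnorm AB (cls (sc a u))"
        using AB_norm_scale_le[OF sc_FS[OF u(1), of a], of "1 / a"] False by (simp add: sc_sc sc_one u)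
      hence "cmod a * vnorm AB (cls u) \<le> vnorm AB (cls (sc a u))"
        using False by (simp add: norm_divide field_simps)
      thus ?thesis using AB_norm_scale_le[OF u(1), of a] u by (simp add: AB_scale)
    qed
  next
    fix P Q assume "P \<in> carrier AB" "Q \<in> carrier AB"
    then obtain u v where uv: "u \<in> FS" "v \<in> FS" "P = cls u" "Q = cls v"
      unfolding AB_carrier by blast
    show "vmult AB P Q \<in> carrier AB" using uv by (simp add: AB_mult cls_AB pr_FS)
    show "vmult AB (vscale AB a P) Q = vscale AB a (vmult AB P Q)" for a
      using uv by (simp add: AB_mult AB_scale sc_FS pr_FS pr_sc_l)
    show "vmult AB Q (vscale AB a P) = vscale AB a (vmult AB Q P)" for a
      using uv by (simp add: AB_mult AB_scale sc_FS pr_FS pr_sc_r)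
    show "vnorm AB (vadd AB P Q) \<le> vnorm AB P + vnorm AB Q"
    proof (rule field_le_epsilon)
      fix e :: real assume e: "e > 0"
      obtain u' where u': "u' \<in> FS" "cls u = cls u'" "N u' < vnorm AB (cls u) + e / 2"
        using AB_norm_approx[OF uv(1), of "e / 2"] e by auto
      obtain v' where v': "v' \<in> FS" "cls v = cls v'" "N v' < vnorm AB (cls v) + e / 2"
        using AB_norm_approx[OF uv(2), of "e / 2"] e by auto
      have "vnorm AB (vadd AB P Q) \<le> N (u' + v')"
        using AB_norm_le[of "u' + v'"] u' v' uv by (simp add: AB_add)
      thus "vnorm AB (vadd AB P Q) \<le> vnorm AB P + vnorm AB Q + e" using u'(3) v'(3) uv by simp
    qed
    show "vnorm AB (vmult AB P Q) \<le> E * (vnorm AB P * vnorm AB Q)"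
    proof (rule tendsto_lowerbound)
      show "((\<lambda>e. E * ((vnorm AB P + e) * (vnorm AB Q + e))) \<longlongrightarrow> E * (vnorm AB P * vnorm AB Q)) (at_right 0)"
        by (rule tendsto_eq_intros refl)+ simp
      have "vnorm AB (vmult AB P Q) \<le> E * ((vnorm AB P + e) * (vnorm AB Q + e))" if e: "e > 0" for e
      proof -
        obtain u' where u': "u' \<in> FS" "cls u = cls u'" "N u' < vnorm AB (cls u) + e"
          using AB_norm_approx[OF uv(1) e] by auto
        obtain v' where v': "v' \<in> FS" "cls v = cls v'" "N v' < vnorm AB (cls v) + e"
          using AB_norm_approx[OF uv(2) e] by auto
        have "vnorm AB (vmult AB P Q) \<le> N (pr u' v')"
          using AB_norm_le[OF pr_FS[OF u'(1) v'(1)]] u' v' uv by (simp add: AB_mult)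
        also have "\<dots> \<le> E * (N u' * N v')" by (rule N_pr[OF u'(1) v'(1)])
        also have "\<dots> \<le> E * ((vnorm AB P + e) * (vnorm AB Q + e))"
          using u'(3) v'(3) N_nonneg[OF u'(1)] N_nonneg[OF v'(1)] uv
          by (intro mult_left_mono mult_mono B.p_const) auto
        finally show ?thesis .
      qed
      thus "\<forall>\<^sub>F e in at_right 0. vnorm AB (vmult AB P Q) \<le> E * ((vnorm AB P + e) * (vnorm AB Q + e))"
        by (auto simp: eventually_at_filter)
    qed simp
    fix R assume "R \<in> carrier AB"
    then obtain w where w: "w \<in> FS" "R = cls w" unfolding AB_carrier by blast
    show "vmult AB (vadd AB P Q) R = vadd AB (vmult AB P R) (vmult AB Q R)"
      using uv w by (simp add: AB_mult AB_add pr_FS)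
    show "vmult AB R (vadd AB P Q) = vadd AB (vmult AB R P) (vmult AB R Q)"
      using uv w by (simp add: AB_mult AB_add pr_FS)
  qed
qed

text \<open>The universal property: the sum of m over a formal sum is unchanged by each relation, so
  it descends to classes. Its bound by c times the cost holds for every representative and therefore
  for the infimum.\<close>

lemma tensor_functional:
  fixes m :: "'a \<Rightarrow> 'b \<Rightarrow> complex"
  assumes add_l: "\<And>x x' y. x \<in> carrier A \<Longrightarrow> x' \<in> carrier A \<Longrightarrow> y \<in> carrier B \<Longrightarrow>
        m (vadd A x x') y = m x y + m x' y"
    and add_r: "\<And>x y y'. x \<in> carrier A \<Longrightarrow> y \<in> carrier B \<Longrightarrow> y' \<in> carrier B \<Longrightarrow>
        m x (vadd B y y') = m x y + m x y'"
    and scale_l: "\<And>a x y. x \<in> carrier A \<Longrightarrow> y \<in> carrier B \<Longrightarrow> m (vscale A a x) y = a * m x y"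
    and scale_r: "\<And>a x y. x \<in> carrier A \<Longrightarrow> y \<in> carrier B \<Longrightarrow> m x (vscale B a y) = a * m x y"
    and bound: "\<And>x y. x \<in> carrier A \<Longrightarrow> y \<in> carrier B \<Longrightarrow> cmod (m x y) \<le> c * (vnorm A x * vnorm B y)"
    and c: "0 \<le> c"
  shows "\<exists>w. (\<forall>P\<in>carrier AB. \<forall>Q\<in>carrier AB. w (vadd AB P Q) = w P + w Q) \<and>
    (\<forall>a. \<forall>P\<in>carrier AB. w (vscale AB a P) = a * w P) \<and>
    (\<forall>P\<in>carrier AB. cmod (w P) \<le> c * vnorm AB P) \<and>
    (\<forall>x\<in>carrier A. \<forall>y\<in>carrier B. w (cls {#(x, y)#}) = m x y)"
proof -
  define s where "s u = (\<Sum>(x, y)\<in>#u. m x y)" for u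
  have s_simps [simp]: "s {#} = 0" "s (u + v) = s u + s v" "s (add_mset (x, y) u) = m x y + s u" for u v x y
    by (simp_all add: s_def)
  have m0: "m (vzero A) y = 0" if y: "y \<in> carrier B" for y
    using scale_l[OF V.zero_closed y, of 0] by (simp add: V.scale_vzero)
  have step: "s u = s v" if "st u v" for u v
    using that by cases (simp_all add: add_l add_r scale_l scale_r m0)
  have inv: "s u = s v" if "eqv u v" for u v
    using that by (induction rule: equivclp_induct) (auto dest: step)
  define w where "w P = s (SOME u. u \<in> P)" for P
  have w: "w (cls u) = s u" for u
  proof -
    have "(SOME v. v \<in> cls u) \<in> cls u" by (rule someI[of "\<lambda>v. v \<in> cls u" u]) simp
    thus ?thesis unfolding w_def using inv by simp
  qed
  have s_sc: "s (sc a u) = a * s u" if "u \<in> FS" for a u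
    using that by (induction u rule: FS_induct) (simp_all add: scale_l algebra_simps)
  have s_bound: "cmod (s u) \<le> c * N u" if "u \<in> FS" for u
    using that
  proof (induction u rule: FS_induct)
    case (add x y u)
    have "cmod (m x y + s u) \<le> cmod (m x y) + cmod (s u)" by (rule norm_triangle_ineq)
    also have "\<dots> \<le> c * (vnorm A x * vnorm B y) + c * N u" by (intro add_mono bound add)
    finally show ?case by (simp add: distrib_left)
  qed simp
  show ?thesis
  proof (intro exI[of _ w] conjI ballI allI)
    fix P Q assume "P \<in> carrier AB" "Q \<in> carrier AB"
    thus "w (vadd AB P Q) = w P + w Q" by (auto simp: AB_carrier AB_add w)
  next
    fix a P assume "P \<in> carrier AB"
    thus "w (vscale AB a P) = a * w P" by (auto simp: AB_carrier AB_scale w s_sc)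
  next
    fix P assume "P \<in> carrier AB"
    then obtain u where u: "u \<in> FS" "P = cls u" unfolding AB_carrier by blast
    show "cmod (w P) \<le> c * vnorm AB P"
    proof (cases "c = 0")
      case True
      thus ?thesis using s_bound[OF u(1)] by (simp add: u w)
    next
      case False
      hence c0: "c > 0" using c by simp
      have "cmod (s u) / c \<le> vnorm AB (cls u)"
      proof (rule AB_norm_ge[OF u(1)])
        fix v assume "v \<in> FS" "eqv u v"
        thus "cmod (s u) / c \<le> N v" using s_bound[of v] inv[of u v] c0 by (simp add: field_simps)
      qed
      thus ?thesis using c0 by (simp add: u w field_simps)
    qed
  next
    fix x y assume "x \<in> carrier A" "y \<in> carrier B"
    show "w (cls {#(x, y)#}) = m x y" by (simp add: w)
  qed
qed

theorem tensor_not_arens_regular: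
  fixes m :: "'a \<Rightarrow> 'b \<Rightarrow> complex" and a a' :: "nat \<Rightarrow> 'a" and b b' :: "nat \<Rightarrow> 'b"
  assumes m: "\<And>x x' y. x \<in> carrier A \<Longrightarrow> x' \<in> carrier A \<Longrightarrow> y \<in> carrier B \<Longrightarrow>
        m (vadd A x x') y = m x y + m x' y"
      "\<And>x y y'. x \<in> carrier A \<Longrightarrow> y \<in> carrier B \<Longrightarrow> y' \<in> carrier B \<Longrightarrow>
        m x (vadd B y y') = m x y + m x y'"
      "\<And>a x y. x \<in> carrier A \<Longrightarrow> y \<in> carrier B \<Longrightarrow> m (vscale A a x) y = a * m x y"
      "\<And>a x y. x \<in> carrier A \<Longrightarrow> y \<in> carrier B \<Longrightarrow> m x (vscale B a y) = a * m x y"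
      "\<And>x y. x \<in> carrier A \<Longrightarrow> y \<in> carrier B \<Longrightarrow> cmod (m x y) \<le> c * (vnorm A x * vnorm B y)"
      "0 \<le> c"
    and cl: "\<And>i. a i \<in> carrier A" "\<And>i. a' i \<in> carrier A" "\<And>i. b i \<in> carrier B" "\<And>i. b' i \<in> carrier B"
    and nm: "\<And>i. vnorm A (a i) \<le> K" "\<And>i. vnorm A (a' i) \<le> K" "\<And>i. vnorm B (b i) \<le> K" "\<And>i. vnorm B (b' i) \<le> K"
    and lim: "\<And>i j. m (vmult A (a i) (a' j)) (vmult B (b i) (b' j)) = of_bool (i \<le> j)"
  shows "\<not> arens_regular (A \<otimes>\<^sub>\<gamma> B)"
proof -
  interpret S: seminormed_algebra AB E by (rule AB_seminormed_algebra)
  have ex: "\<exists>w. (\<forall>P\<in>carrier AB. \<forall>Q\<in>carrier AB. w (vadd AB P Q) = w P + w Q) \<and>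
    (\<forall>a. \<forall>P\<in>carrier AB. w (vscale AB a P) = a * w P) \<and>
    (\<forall>P\<in>carrier AB. cmod (w P) \<le> c * vnorm AB P) \<and>
    (\<forall>x\<in>carrier A. \<forall>y\<in>carrier B. w (cls {#(x, y)#}) = m x y)"
    by (rule tensor_functional) (simp_all add: m)
  then obtain w where w: "\<forall>P\<in>carrier AB. \<forall>Q\<in>carrier AB. w (vadd AB P Q) = w P + w Q"
    "\<forall>a. \<forall>P\<in>carrier AB. w (vscale AB a P) = a * w P"
    "\<forall>P\<in>carrier AB. cmod (w P) \<le> c * vnorm AB P"
    "\<forall>x\<in>carrier A. \<forall>y\<in>carrier B. w (cls {#(x, y)#}) = m x y"
    by blast
  have K0: "K \<ge> 0" using nm(1)[of 0] A.p_norm_pos[OF cl(1), of 0] by linarith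
  have bd: "vnorm AB (cls {#(x, y)#}) \<le> K * K" if "x \<in> carrier A" "y \<in> carrier B" "vnorm A x \<le> K" "vnorm B y \<le> K" for x y
  proof -
    have "vnorm AB (cls {#(x, y)#}) \<le> vnorm A x * vnorm B y" using AB_norm_le[of "{#(x, y)#}"] that by simp
    also have "\<dots> \<le> K * K" using that K0 by (intro mult_mono) (auto simp: B.p_norm_pos)
    finally show ?thesis .
  qed
  show ?thesis unfolding proj_tensor_def
  proof (rule S.completion_not_arens_regular[where w = w and c = c and N = "K * K"
        and a = "\<lambda>i. cls {#(a i, b i)#}" and b = "\<lambda>j. cls {#(a' j, b' j)#}"])
    show "w (vmult AB (cls {#(a i, b i)#}) (cls {#(a' j, b' j)#})) = of_bool (i \<le> j)" for i j
      using w(4) lim[of i j] by (simp add: AB_mult cl A.p_mult B.p_mult)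
  qed (use w cl nm in \<open>auto intro!: bd cls_AB\<close>)
qed

end

context quasi_normed_space
begin

lemma BX_tensor:
  assumes "quasi_normed_algebra B E"
  shows "tensor BX B E"
  by (intro tensor.intro tensor_axioms.intro BX_vector_space BX_quasi_normed_algebra assms BX_norm_scale)

lemma KX_tensor:
  assumes "quasi_normed_algebra B E"
  shows "tensor KX B E"
proof (intro tensor.intro tensor_axioms.intro KX_vector_space KX_quasi_normed_algebra assms)
  show "vnorm KX (vscale KX a x) = cmod a * vnorm KX x" if "x \<in> carrier KX" for a x
    using BX_norm_scale[of x a] that by (simp add: compact_algebra_def)
qed

end

section \<open>Schatten classes as normed algebras\<close>

text \<open>E is the very basis selected in \<open>positive_trace\<close>, so the trace is a sum
  over E by definition.\<close>

locale hilbert_std = hilbert_onb +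
  assumes E_some: "E = (SOME E. orthonormal_basis X E)"
begin

definition trace_sum :: "real \<Rightarrow> ('a \<Rightarrow> 'a) \<Rightarrow> 'a set \<Rightarrow> real" where
  "trace_sum p T G = (\<Sum>e\<in>G. Re (ip (abs_op_power X p T e) e))"

lemma trace_SUP:
  assumes T: "T \<in> carrier B" and p: "p > 0"
  shows "positive_trace X (abs_op_power X p T) = (SUP G\<in>{G. finite G \<and> G \<subseteq> E}. ennreal (trace_sum p T G))"
proof -
  have "positive_trace X (abs_op_power X p T) =
      (SUP G\<in>{G. finite G \<and> G \<subseteq> E}. \<Sum>e\<in>G. ennreal (Re (ip (abs_op_power X p T e) e)))"
    unfolding positive_trace_def E_some[symmetric] by (rule nonneg_infsum_complete) simp
  also have "\<dots> = (SUP G\<in>{G. finite G \<and> G \<subseteq> E}. ennreal (trace_sum p T G))"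
    unfolding trace_sum_def by (rule SUP_cong[OF refl], rule sum_ennreal) (use power_nonneg[OF T p] in auto)
  finally show ?thesis .
qed

lemma schatten_simps:
  "vzero (schatten p X) = vzero B" "vadd (schatten p X) = vadd B" "vscale (schatten p X) = vscale B"
  "vmult (schatten p X) = vmult B"
  by (simp_all add: schatten_def)

lemma schatten_norm_nonneg: "0 \<le> vnorm (schatten p X) T"
  by (simp add: schatten_def)

lemma schattenI:
  assumes T: "T \<in> carrier B" and p: "p > 0" and c: "\<And>G. finite G \<Longrightarrow> G \<subseteq> E \<Longrightarrow> trace_sum p T G \<le> c"
  shows "T \<in> carrier (schatten p X) \<and> vnorm (schatten p X) T \<le> c powr (1 / p)"
proof -
  have c0: "0 \<le> c" using c[of "{}"] by (simp add: trace_sum_def)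
  have le: "positive_trace X (abs_op_power X p T) \<le> ennreal c"
    unfolding trace_SUP[OF T p] by (rule SUP_least) (use c in \<open>auto intro: ennreal_leI\<close>)
  hence "positive_trace X (abs_op_power X p T) < \<infinity>" by (rule le_less_trans) simp
  moreover have "enn2real (positive_trace X (abs_op_power X p T)) \<le> c" using enn2real_leI[OF c0 le] .
  ultimately show ?thesis using T p by (simp add: schatten_def powr_mono2)
qed

lemma schattenD:
  assumes T: "T \<in> carrier (schatten p X)" and p: "p > 0"
  shows "T \<in> carrier B" and "finite G \<Longrightarrow> G \<subseteq> E \<Longrightarrow> trace_sum p T G \<le> vnorm (schatten p X) T powr p"
proof -
  let ?t = "positive_trace X (abs_op_power X p T)"
  show B: "T \<in> carrier B" using T by (simp add: schatten_def)
  assume G: "finite G" "G \<subseteq> E"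
  have fin: "?t < \<infinity>" using T by (simp add: schatten_def)
  have "ennreal (trace_sum p T G) \<le> ?t" unfolding trace_SUP[OF B p] by (rule SUP_upper) (use G in simp)
  hence "enn2real (ennreal (trace_sum p T G)) \<le> enn2real ?t" by (rule enn2real_mono) (use fin in simp)
  moreover have "0 \<le> trace_sum p T G" unfolding trace_sum_def by (rule sum_nonneg) (use power_nonneg[OF B p] G in auto)
  ultimately show "trace_sum p T G \<le> vnorm (schatten p X) T powr p"
    using p by (simp add: schatten_def powr_powr)
qed

lemma schatten_quadI:
  assumes T: "T \<in> carrier B" and p: "p > 0"
    and c: "\<And>F. finite F \<Longrightarrow> quad F (fc (\<lambda>t. t powr p) (absop (L T))) \<le> c"
  shows "T \<in> carrier (schatten p X) \<and> vnorm (schatten p X) T \<le> c powr (1 / p)"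
  by (rule schattenI[OF T p]) (unfold trace_sum_def, use sum_power_L[OF T p] c in auto)

text \<open>The factor 2 reflects the doubled real basis. It is the source of the constants in
  \<open>schatten_subset_two\<close> and \<open>schatten_mult_two\<close>.\<close>

lemma schatten_quadD:
  assumes T: "T \<in> carrier (schatten p X)" and p: "p > 0" and F: "finite F"
  shows "quad F (fc (\<lambda>t. t powr p) (absop (L T))) \<le> 2 * vnorm (schatten p X) T powr p"
  using quad_power_L[OF schattenD(1)[OF T p] p F] schattenD(2)[OF T p, of "fst ` F \<inter> E"] F
  by (simp add: trace_sum_def)

lemma trace_sum_two:
  assumes T: "T \<in> carrier B" and G: "G \<subseteq> E"
  shows "trace_sum 2 T G = (\<Sum>e\<in>G. (vnorm X (T e))\<^sup>2)"
  unfolding trace_sum_def by (rule sum.cong) (use G power_two[OF T] in auto)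

lemma schatten_twoI:
  assumes T: "T \<in> carrier B" and c: "0 \<le> c"
    and le: "\<And>G. finite G \<Longrightarrow> G \<subseteq> E \<Longrightarrow> (\<Sum>e\<in>G. (vnorm X (T e))\<^sup>2) \<le> c\<^sup>2"
  shows "T \<in> carrier (schatten 2 X) \<and> vnorm (schatten 2 X) T \<le> c"
  using schattenI[OF T, of 2 "c\<^sup>2"] le c by (simp add: trace_sum_two T powr_half_sqrt)

lemma schatten_twoD:
  assumes T: "T \<in> carrier (schatten 2 X)" and G: "finite G" "G \<subseteq> E"
  shows "(\<Sum>e\<in>G. (vnorm X (T e))\<^sup>2) \<le> (vnorm (schatten 2 X) T)\<^sup>2"
  using schattenD[OF T] G schatten_norm_nonneg[of 2 T] by (simp add: trace_sum_two powr_numeral)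

lemma schatten_two_apply_le:
  assumes T: "T \<in> carrier (schatten 2 X)" and e: "e \<in> E"
  shows "vnorm X (T e) \<le> vnorm (schatten 2 X) T"
  by (rule power2_le_imp_le) (use schatten_twoD[OF T, of "{e}"] e schatten_norm_nonneg in auto)

lemma hsum_L_le:
  assumes T: "T \<in> carrier (schatten 2 X)" and F: "finite F"
  shows "hsum F (L T) \<le> 2 * (vnorm (schatten 2 X) T)\<^sup>2"
proof -
  have "fc (\<lambda>t. t powr 2) (absop (L T)) = fc (\<lambda>t. t * t) (absop (L T))"
    by (rule fc_cong) (auto simp: powr_numeral power2_eq_square)
  thus ?thesis using schatten_quadD[OF T _ F] schatten_norm_nonneg[of 2 T]
    by (simp add: hsum_eq_quad powr_numeral)
qed

text \<open>The doubled basis turns \<open>schatten_le_hsum\<close> into the bound 2^(2/p) v^2 for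
  the square, and 2^(2/p) \<le> 4 because p \<ge> 1.\<close>

lemma schatten_subset_two:
  assumes p: "1 \<le> p" "p \<le> 2" and T: "T \<in> carrier (schatten p X)"
  shows "T \<in> carrier (schatten 2 X) \<and> vnorm (schatten 2 X) T \<le> 2 * vnorm (schatten p X) T"
proof -
  let ?v = "vnorm (schatten p X) T"
  have p0: "p > 0" using p by simp
  note v0 = schatten_norm_nonneg[of p T]
  have B: "T \<in> carrier B" by (rule schattenD(1)[OF T p0])
  have "(2 * ?v powr p) powr (2 / p) = 2 powr (2 / p) * ?v\<^sup>2"
    using p0 v0 by (simp add: powr_mult powr_powr powr_numeral)
  also have "\<dots> \<le> 2 powr 2 * ?v\<^sup>2"
    using p by (intro mult_right_mono powr_mono) (auto simp: field_simps)
  finally have c: "(2 * ?v powr p) powr (2 / p) \<le> (2 * ?v)\<^sup>2" by (simp add: power_mult_distrib)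
  show ?thesis
  proof (rule schatten_twoI[OF B])
    fix G assume G: "finite G" "G \<subseteq> E"
    have "(\<Sum>e\<in>G. (vnorm X (T e))\<^sup>2) = (\<Sum>e\<in>G. (norm (L T (ev (e, True))))\<^sup>2)"
      by (rule sum.cong) (use G in \<open>auto simp: J_E[symmetric] L_J B E_closed norm_J Q.BXD(1) subset_iff\<close>)
    also have "\<dots> = hsum (G \<times> {True}) (L T)" by (simp add: hsum_def sum.cartesian_product')
    also have "\<dots> \<le> (2 * ?v powr p) powr (2 / p)"
      by (rule schatten_le_hsum[OF p]) (use G schatten_quadD[OF T p0] in auto)
    finally show "(\<Sum>e\<in>G. (vnorm X (T e))\<^sup>2) \<le> (2 * ?v)\<^sup>2" using c by linarith
  qed (use v0 in simp)
qed

lemma schatten_add: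
  assumes p: "1 \<le> p" "p \<le> 2" and S: "S \<in> carrier (schatten p X)" and T: "T \<in> carrier (schatten p X)"
  shows "vadd B S T \<in> carrier (schatten p X)"
proof -
  have p0: "p > 0" using p by simp
  note B = schattenD(1)[OF S p0] schattenD(1)[OF T p0]
  obtain c where "\<And>F. finite F \<Longrightarrow> quad F (fc (\<lambda>t. t powr p) (absop ((id_blinfun o\<^sub>L L S) + (id_blinfun o\<^sub>L L T)))) \<le> c"
    using schatten_sum[OF p schatten_quadD[OF S p0] schatten_quadD[OF T p0], of id_blinfun id_blinfun] by blast
  moreover have "(id_blinfun o\<^sub>L L S) + (id_blinfun o\<^sub>L L T) = L (vadd B S T)"
    by (rule blinfun_eqI) (simp add: L_add B blinfun.add_left)
  ultimately show ?thesis using schatten_quadI[OF Q.BX_add[OF B] p0, of c] by simp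
qed

text \<open>A complex scalar is an operator on the real space, not a real multiple; it enters as the
  left factor \<open>?Y\<close> of \<open>schatten_sum\<close>.\<close>

lemma schatten_scale:
  assumes p: "1 \<le> p" "p \<le> 2" and T: "T \<in> carrier (schatten p X)"
  shows "vscale B a T \<in> carrier (schatten p X)"
proof -
  have p0: "p > 0" using p by simp
  note B = schattenD(1)[OF T p0]
  let ?Y = "L (vscale B a (\<lambda>x\<in>C. x))"
  obtain c where "\<And>F. finite F \<Longrightarrow> quad F (fc (\<lambda>t. t powr p) (absop ((?Y o\<^sub>L L T) + (0 o\<^sub>L L T)))) \<le> c"
    using schatten_sum[OF p schatten_quadD[OF T p0] schatten_quadD[OF T p0], of ?Y 0] by blast
  moreover have "(?Y o\<^sub>L L T) + (0 o\<^sub>L L T) = L (vscale B a T)"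
  proof -
    have "compose C (vscale B a (\<lambda>x\<in>C. x)) T = vscale B a T"
      by (rule Q.BX_eqI[OF comp_B[OF Q.BX_scale[OF id_B] B] Q.BX_scale[OF B]])
         (simp add: compose_eq bounded_algebra_simps(4) Q.BXD(1)[OF B])
    hence "?Y o\<^sub>L L T = L (vscale B a T)" using L_comp[OF Q.BX_scale[OF id_B] B, of a] by simp
    moreover have "0 o\<^sub>L L T = 0" by (rule blinfun_eqI) simp
    ultimately show ?thesis by simp
  qed
  ultimately show ?thesis using schatten_quadI[OF Q.BX_scale[OF B, of a] p0, of c] by simp
qed

lemma schatten_mult_two:
  assumes p: "1 \<le> p" and S: "S \<in> carrier (schatten 2 X)" and T: "T \<in> carrier (schatten 2 X)"
  shows "compose C S T \<in> carrier (schatten p X) \<and>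
    vnorm (schatten p X) (compose C S T) \<le> 2 * vnorm (schatten 2 X) S * vnorm (schatten 2 X) T"
proof -
  let ?s = "vnorm (schatten 2 X) S" and ?t = "vnorm (schatten 2 X) T"
  have p0: "p > 0" using p by simp
  note st0 = schatten_norm_nonneg[of 2 S] schatten_norm_nonneg[of 2 T]
  have B: "S \<in> carrier B" "T \<in> carrier B" using schattenD(1)[OF S] schattenD(1)[OF T] by simp_all
  have "sqrt (2 * ?s\<^sup>2) * sqrt (2 * ?t\<^sup>2) = 2 * ?s * ?t"
    using st0 by (simp add: real_sqrt_mult)
  hence "quad F (fc (\<lambda>t. t powr p) (absop (L (compose C S T)))) \<le> (2 * ?s * ?t) powr p" if "finite F" for F
    using schatten_comp[OF p that hsum_L_le[OF S] hsum_L_le[OF T]] by (simp add: L_comp B)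
  from schatten_quadI[OF comp_B[OF B] p0 this] show ?thesis
    using st0 p0 by (simp add: powr_powr)
qed

text \<open>A product is estimated through S_2: a factor 2 for embedding each operand and a factor 2
  for the product of Hilbert-Schmidt operators, together 8.\<close>

lemma schatten_quasi_normed_algebra:
  assumes p: "1 \<le> p" "p \<le> 2"
  shows "quasi_normed_algebra (schatten p X) 8"
proof -
  let ?S = "carrier (schatten p X)"
  have p0: "p > 0" using p by simp
  have mult: "vmult B S T \<in> ?S \<and> vnorm (schatten p X) (vmult B S T) \<le> 8 * (vnorm (schatten p X) S * vnorm (schatten p X) T)"
    if S: "S \<in> ?S" and T: "T \<in> ?S" for S T
  proof -
    let ?s = "vnorm (schatten p X) S" and ?t = "vnorm (schatten p X) T"
    note S2 = schatten_subset_two[OF p S] and T2 = schatten_subset_two[OF p T]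
    note * = schatten_mult_two[OF p(1) conjunct1[OF S2] conjunct1[OF T2]]
    have "vnorm (schatten 2 X) S * vnorm (schatten 2 X) T \<le> (2 * ?s) * (2 * ?t)"
      using S2 T2 schatten_norm_nonneg by (intro mult_mono) auto
    thus ?thesis using * unfolding bounded_algebra_simps(6) by (auto simp: mult_ac)
  qed
  note BB = schattenD(1)[OF _ p0] and A = quasi_normed_algebra.p_add_l[OF Q.BX_quasi_normed_algebra] quasi_normed_algebra.p_add_r[OF Q.BX_quasi_normed_algebra]
    quasi_normed_algebra.p_scale_l[OF Q.BX_quasi_normed_algebra] quasi_normed_algebra.p_scale_r[OF Q.BX_quasi_normed_algebra]
  show ?thesis
    by unfold_locales (simp_all add: schatten_simps schatten_add[OF p] schatten_scale[OF p] mult A BB schatten_norm_nonneg)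
qed

section \<open>Hilbert-Schmidt operators as a quasi-normed space\<close>

abbreviation "HS \<equiv> hilbert_schmidt X"

lemma HS_simps:
  "carrier HS = carrier (schatten 2 X)" "vzero HS = vzero B" "vadd HS = vadd B" "vscale HS = vscale B"
  "vnorm HS = vnorm (schatten 2 X)"
  by (simp_all add: hilbert_schmidt_def nspace.extend_def nspace.truncate_def hilbert.fields_def schatten_simps)

lemma HS_B: "T \<in> carrier HS \<Longrightarrow> T \<in> carrier B"
  using schattenD(1)[of T 2] by (simp add: HS_simps)

lemma HS_norm_nonneg: "0 \<le> vnorm HS T"
  by (simp add: HS_simps schatten_norm_nonneg)

lemma HS_apply:
  "x \<in> C \<Longrightarrow> vadd HS S T x = vadd X (S x) (T x)" "x \<in> C \<Longrightarrow> vscale HS a T x = vscale X a (T x)"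
  by (simp_all add: HS_simps bounded_algebra_simps)

text \<open>Everything is read off from sums of squares over the basis: |u + v|^2 \<le> 2|u|^2 +
  2|v|^2 at each basis vector yields the constant 2, and homogeneity follows from the inequality for
  a together with that for 1 / a.\<close>

lemma HS_quasi_normed_space: "quasi_normed_space HS 2"
proof (intro quasi_normed_space.intro quasi_normed_space_axioms.intro)
  have z: "vzero B \<in> carrier (schatten 2 X)"
    using schatten_twoI[OF Q.BX_zero, of 0] by (simp add: bounded_algebra_simps(2) E_closed Q.norm_vz subset_iff)
  have sel: "vzero (B\<lparr>carrier := G\<rparr>) = vzero B" "vadd (B\<lparr>carrier := G\<rparr>) = vadd B"
    "vscale (B\<lparr>carrier := G\<rparr>) = vscale B" "carrier (B\<lparr>carrier := G\<rparr>) = G" for G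
    by simp_all
  have "complex_vector_space (B\<lparr>carrier := carrier HS\<rparr>)"
    by (rule vector_subspace[OF Q.BX_vector_space])
       (use HS_B in \<open>auto simp: HS_simps schatten_add schatten_scale z\<close>)
  from this[unfolded complex_vector_space_def sel] show "complex_vector_space HS"
    unfolding complex_vector_space_def HS_simps .
  have le: "vnorm HS (vscale HS a T) \<le> cmod a * vnorm HS T" if T: "T \<in> carrier HS" for a T
  proof -
    have "(\<Sum>e\<in>G. (vnorm X (vscale B a T e))\<^sup>2) \<le> (cmod a * vnorm HS T)\<^sup>2" if G: "finite G" "G \<subseteq> E" for G
    proof -
      have "(\<Sum>e\<in>G. (vnorm X (vscale B a T e))\<^sup>2) = (\<Sum>e\<in>G. (cmod a)\<^sup>2 * (vnorm X (T e))\<^sup>2)"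
        by (rule sum.cong)
           (use G homogD(2)[OF homog] Q.BXD(1)[OF HS_B[OF T]] in \<open>auto simp: bounded_algebra_simps(4) E_closed subset_iff power_mult_distrib\<close>)
      also have "\<dots> = (cmod a)\<^sup>2 * (\<Sum>e\<in>G. (vnorm X (T e))\<^sup>2)" by (simp add: sum_distrib_left)
      also have "\<dots> \<le> (cmod a)\<^sup>2 * (vnorm HS T)\<^sup>2"
        using schatten_twoD[of T G] T G by (intro mult_left_mono) (auto simp: HS_simps)
      finally show ?thesis by (simp add: power_mult_distrib)
    qed
    from schatten_twoI[OF Q.BX_scale[OF HS_B[OF T]] _ this] show ?thesis
      by (simp add: HS_simps schatten_norm_nonneg)
  qed
  have "vnorm HS (vscale HS a T) = cmod a * vnorm HS T" if T: "T \<in> carrier HS" for a T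
  proof (cases "a = 0")
    case True
    thus ?thesis using le[OF T, of 0] HS_norm_nonneg[of "vscale HS 0 T"] by simp
  next
    case False
    have aT: "vscale HS a T \<in> carrier HS" using T schatten_scale[of 2 T a] by (simp add: HS_simps)
    have "vscale HS (1 / a) (vscale HS a T) = T"
      by (rule Q.BX_eqI) (use False T in \<open>simp_all add: HS_simps HS_B Q.BX_scale Q.BX_apply Q.BXD(1) scale_scale scale_one\<close>)
    hence "vnorm HS T \<le> cmod (1 / a) * vnorm HS (vscale HS a T)" using le[OF aT, of "1 / a"] by simp
    thus ?thesis using le[OF T, of a] False by (simp add: norm_divide field_simps)
  qed
  thus "homog HS" using z by (auto simp: homog_def HS_simps schatten_norm_nonneg schatten_scale)
  fix S T assume S: "S \<in> carrier HS" and T: "T \<in> carrier HS"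
  let ?s = "vnorm HS S" and ?t = "vnorm HS T"
  have "(\<Sum>e\<in>G. (vnorm X (vadd B S T e))\<^sup>2) \<le> (2 * (?s + ?t))\<^sup>2" if G: "finite G" "G \<subseteq> E" for G
  proof -
    have "(\<Sum>e\<in>G. (vnorm X (vadd B S T e))\<^sup>2) \<le> (\<Sum>e\<in>G. 2 * (vnorm X (S e))\<^sup>2 + 2 * (vnorm X (T e))\<^sup>2)"
    proof (rule sum_mono)
      fix e assume "e \<in> G"
      hence e: "e \<in> C" using G E_closed by blast
      note cl = Q.BXD(1)[OF HS_B[OF S] e] Q.BXD(1)[OF HS_B[OF T] e]
      have "(vnorm X (vadd B S T e))\<^sup>2 \<le> (vnorm X (S e) + vnorm X (T e))\<^sup>2"
        using Q.quasi[OF cl] e norm_nonneg[OF add_closed[OF cl]] by (intro power_mono) (simp_all add: Q.BX_apply)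
      also have "\<dots> \<le> 2 * (vnorm X (S e))\<^sup>2 + 2 * (vnorm X (T e))\<^sup>2"
        using sum_squares_bound[of "vnorm X (S e)" "vnorm X (T e)"] by (simp add: power2_sum)
      finally show "(vnorm X (vadd B S T e))\<^sup>2 \<le> 2 * (vnorm X (S e))\<^sup>2 + 2 * (vnorm X (T e))\<^sup>2" .
    qed
    also have "\<dots> \<le> 2 * ?s\<^sup>2 + 2 * ?t\<^sup>2"
      using schatten_twoD[of S G] schatten_twoD[of T G] S T G
      by (simp add: sum.distrib HS_simps flip: sum_distrib_left)
    also have "\<dots> \<le> (2 * (?s + ?t))\<^sup>2"
      using HS_norm_nonneg[of S] HS_norm_nonneg[of T] by (simp add: power2_eq_square algebra_simps)
    finally show ?thesis .
  qed
  from schatten_twoI[OF Q.BX_add[OF HS_B[OF S] HS_B[OF T]] _ this]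
  show "vnorm HS (vadd HS S T) \<le> 2 * (?s + ?t)"
    using HS_norm_nonneg by (simp add: HS_simps)
qed simp

end

section \<open>The matrix unit construction\<close>

context hilbert_std
begin

lemma finite_basis_not_infinite_dimensional:
  assumes "finite E"
  shows "\<not> infinite_dimensional X"
proof -
  have "S = C" if S: "linear_subspace X S" "E \<subseteq> S" for S
  proof
    show "S \<subseteq> C" using S(1) by (simp add: linear_subspace_def)
    have in_S: "\<exists>y\<in>S. is_comb y c F" if "finite F" "F \<subseteq> E" for F and c :: "'a \<Rightarrow> complex"
      using that
    proof (induction F)
      case empty
      show ?case using S(1) by (intro bexI[of _ "vzero X"])
          (auto simp: is_comb_def zero_closed ip_zero_left linear_subspace_def)
    next
      case (insert e F)
      then obtain y where y: "y \<in> S" "is_comb y c F" by auto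
      have e: "e \<in> S" "e \<in> C" using insert.prems S(2) E_closed by auto
      have "vadd X (vscale X (c e) e) y \<in> S" using S(1) y e by (simp add: linear_subspace_def)
      moreover have "is_comb (vadd X (vscale X (c e) e) y) c (insert e F)"
        using y e insert.hyps by (simp add: is_comb_def add_closed scale_closed inner_add inner_scale)
      ultimately show ?case by blast
    qed
    show "C \<subseteq> S"
    proof
      fix x assume x: "x \<in> C"
      obtain y where y: "y \<in> S" "is_comb y (\<lambda>e. ip x e) E" using in_S[OF assms order_refl] by blast
      have "y = x"
      proof (rule onb_ext[OF _ x])
        show "y \<in> C" using y(2) by (simp add: is_comb_def)
        show "ip y e = ip x e" if "e \<in> E" for e using is_comb_coeff[OF y(2) assms order_refl that] that by simp
      qed
      thus "x \<in> S" using y by simp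
    qed
  qed
  moreover have "linear_subspace X C"
    by (simp add: linear_subspace_def zero_closed add_closed scale_closed)
  ultimately have "linear_span X E = C" using E_closed unfolding linear_span_def by blast
  thus ?thesis using assms E_closed unfolding infinite_dimensional_def by blast
qed

section \<open>Matrix units\<close>

definition matrix_unit :: "'a \<Rightarrow> 'a \<Rightarrow> 'a \<Rightarrow> 'a" where
  "matrix_unit a b = (\<lambda>x\<in>C. vscale X (ip x b) a)"

context
  fixes a b assumes a: "a \<in> E" and b: "b \<in> E"
begin

lemma matrix_unit_B: "matrix_unit a b \<in> carrier B"
  unfolding matrix_unit_def
  by (rule Q.rank_one(1)[where M = 1])
     (auto simp: a b E_closed inner_add inner_scale coeff_le_norm)

lemma matrix_unit_E: "e \<in> E \<Longrightarrow> matrix_unit a b e = (if e = b then a else vzero X)"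
  using a b by (simp add: matrix_unit_def E_closed ip_E scale_one scale_zero)

lemma norm_E: "vnorm X a = 1"
  using a by (simp add: norm_eq E_closed ip_E)

lemma matrix_unit_two: "matrix_unit a b \<in> carrier (schatten 2 X) \<and> vnorm (schatten 2 X) (matrix_unit a b) \<le> 1"
proof (rule schatten_twoI[OF matrix_unit_B])
  fix G assume G: "finite G" "G \<subseteq> E"
  have "(\<Sum>e\<in>G. (vnorm X (matrix_unit a b e))\<^sup>2) = (\<Sum>e\<in>G. if e = b then 1 else 0)"
    by (rule sum.cong) (use G in \<open>auto simp: matrix_unit_E norm_E Q.norm_vz\<close>)
  also have "\<dots> \<le> 1" using G by simp
  finally show "(\<Sum>e\<in>G. (vnorm X (matrix_unit a b e))\<^sup>2) \<le> 1\<^sup>2" by simp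
qed simp

end

lemma matrix_unit_mult:
  assumes "a \<in> E" "b \<in> E" "c \<in> E"
  shows "compose C (matrix_unit a b) (matrix_unit b c) = matrix_unit a c"
  using assms
  by (intro Q.BX_eqI comp_B matrix_unit_B)
     (simp_all add: matrix_unit_def compose_eq scale_closed E_closed inner_scale ip_E)

text \<open>As E_ab = E_aa E_ab is a product of two Hilbert-Schmidt operators of norm at most 1,
  membership in S_p and the bound 2 follow without computing |E_ab|^p.\<close>

lemma matrix_unit_schatten:
  assumes p: "1 \<le> p" and ab: "a \<in> E" "b \<in> E"
  shows "matrix_unit a b \<in> carrier (schatten p X)" "vnorm (schatten p X) (matrix_unit a b) \<le> 2"
proof -
  note 1 = matrix_unit_two[OF ab(1) ab(1)] and 2 = matrix_unit_two[OF ab]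
  note * = schatten_mult_two[OF p conjunct1[OF 1] conjunct1[OF 2], unfolded matrix_unit_mult[OF ab(1) ab]]
  show "matrix_unit a b \<in> carrier (schatten p X)" using * by blast
  have "vnorm (schatten 2 X) (matrix_unit a a) * vnorm (schatten 2 X) (matrix_unit a b) \<le> 1 * 1"
    using 1 2 by (intro mult_mono) (auto simp: schatten_norm_nonneg)
  thus "vnorm (schatten p X) (matrix_unit a b) \<le> 2" using * by simp
qed

section \<open>Rank one operators on S_2 and the double sequence\<close>

sublocale H: quasi_normed_space HS 2 by (rule HS_quasi_normed_space)

text \<open>Matrix entries as bounded functionals on S_2; the written factor 1 fits the premise of
  \<open>H.rank_one\<close>.\<close>

lemma HS_coeff:
  assumes d: "d \<in> E" and e: "e \<in> E"
  shows "A \<in> carrier HS \<Longrightarrow> A' \<in> carrier HS \<Longrightarrow> ip (vadd HS A A' d) e = ip (A d) e + ip (A' d) e"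
    "A \<in> carrier HS \<Longrightarrow> ip (vscale HS c A d) e = c * ip (A d) e"
    "A \<in> carrier HS \<Longrightarrow> cmod (ip (A d) e) \<le> 1 * vnorm HS A"
proof -
  show "A \<in> carrier HS \<Longrightarrow> A' \<in> carrier HS \<Longrightarrow> ip (vadd HS A A' d) e = ip (A d) e + ip (A' d) e"
    using d e by (simp add: HS_apply E_closed inner_add Q.BXD(1) HS_B)
  show "A \<in> carrier HS \<Longrightarrow> ip (vscale HS c A d) e = c * ip (A d) e"
    using d e by (simp add: HS_apply E_closed inner_scale Q.BXD(1) HS_B)
  assume A: "A \<in> carrier HS"
  have "cmod (ip (A d) e) \<le> vnorm X (A d)" by (rule coeff_le_norm[OF Q.BXD(1)[OF HS_B[OF A] E_closed[OF d]] e])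
  also have "\<dots> \<le> vnorm HS A" using schatten_two_apply_le[of A d] A d by (simp add: HS_simps)
  finally show "cmod (ip (A d) e) \<le> 1 * vnorm HS A" by simp
qed

definition coeff_op :: "'a \<Rightarrow> 'a \<Rightarrow> 'a \<Rightarrow> 'a \<Rightarrow> ('a \<Rightarrow> 'a) \<Rightarrow> 'a \<Rightarrow> 'a" where
  "coeff_op d e a b = (\<lambda>A\<in>carrier HS. vscale HS (ip (A d) e) (matrix_unit a b))"

lemma coeff_op:
  assumes d: "d \<in> E" and e: "e \<in> E" and a: "a \<in> E" and b: "b \<in> E"
  shows "coeff_op d e a b \<in> carrier H.BX" "compact_operator HS (coeff_op d e a b)"
  unfolding coeff_op_def using matrix_unit_two[OF a b] HS_coeff[OF d e]
  by (intro H.rank_one[where M = 1]; simp add: HS_simps)+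

context
  fixes s :: "nat \<Rightarrow> 'a"
  assumes s: "inj s" "range s \<subseteq> E"
begin

lemma s_E [simp]: "s i \<in> E" using s(2) by blast

definition row_op :: "nat \<Rightarrow> ('a \<Rightarrow> 'a) \<Rightarrow> 'a \<Rightarrow> 'a" where
  "row_op i = coeff_op (s 0) (s i) (s 0) (s 0)"

text \<open>The overview's operator with index j is \<open>column_op j j\<close>. Keeping the
  truncation point n separate from the column j allows induction on the number of rank one
  terms.\<close>

primrec column_op :: "nat \<Rightarrow> nat \<Rightarrow> ('a \<Rightarrow> 'a) \<Rightarrow> 'a \<Rightarrow> 'a" where
  "column_op j 0 = coeff_op (s j) (s 0) (s 0) (s 0)"
| "column_op j (Suc n) = vadd H.BX (column_op j n) (coeff_op (s j) (s (Suc n)) (s (Suc n)) (s 0))"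

lemma row_op: "row_op i \<in> carrier H.BX" "compact_operator HS (row_op i)"
  unfolding row_op_def by (intro coeff_op s_E)+

lemma column_op: "column_op j n \<in> carrier H.BX \<and> compact_operator HS (column_op j n)"
  by (induction n) (simp_all add: coeff_op H.BX_add H.compact_add)

lemma norm_row_op: "vnorm H.BX (row_op i) \<le> 1"
proof (rule H.BX_norm_least)
  fix A assume A: "A \<in> carrier HS"
  note u = matrix_unit_two[OF s_E[of 0] s_E[of 0]]
  have "vnorm HS (row_op i A) = cmod (ip (A (s 0)) (s i)) * vnorm HS (matrix_unit (s 0) (s 0))"
    using homogD(2)[OF H.hom, of "matrix_unit (s 0) (s 0)"] u A by (simp add: row_op_def coeff_op_def HS_simps)
  also have "\<dots> \<le> vnorm HS A * 1"
    using HS_coeff(3)[OF s_E s_E A] u HS_norm_nonneg by (intro mult_mono) (auto simp: HS_simps schatten_norm_nonneg)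
  finally show "vnorm HS (row_op i A) \<le> 1 * vnorm HS A" by simp
qed simp

text \<open>The image of A has a single nonzero column: column j of A, projected to the span of
  \<open>s 0\<close>, ..., \<open>s n\<close> and moved to column 0.\<close>

lemma column_op_apply:
  assumes A: "A \<in> carrier HS"
  shows "is_comb (column_op j n A (s 0)) (\<lambda>e. ip (A (s j)) e) (s ` {..n}) \<and>
    (\<forall>e\<in>E. e \<noteq> s 0 \<longrightarrow> column_op j n A e = vzero X)"
proof (induction n)
  case 0
  show ?case using A
    by (simp add: coeff_op_def HS_apply matrix_unit_E E_closed is_comb_def scale_closed inner_scale scale_vzero)
next
  case (Suc n)
  have "s (Suc n) \<notin> s ` {..n}" using s(1) by (auto dest: injD)
  hence "sum f (s ` {..Suc n}) = f (s (Suc n)) + sum f (s ` {..n})" for f :: "'a \<Rightarrow> complex"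
    by (simp add: atMost_Suc)
  thus ?case using Suc A
    by (simp add: H.BX_apply coeff_op_def HS_apply matrix_unit_E E_closed is_comb_def scale_closed add_closed inner_add
        inner_scale scale_vzero add_zero zero_closed)
qed

text \<open>Although n + 1 rank one terms are added, the bound stays 1: by Bessel the truncated
  column is no longer than column j of A, which is bounded by the Hilbert-Schmidt norm.\<close>

lemma norm_column_op: "vnorm H.BX (column_op j n) \<le> 1"
proof (rule H.BX_norm_least)
  fix A assume A: "A \<in> carrier HS"
  note ra = column_op_apply[OF A, of j n]
  let ?y = "column_op j n A (s 0)" and ?x = "A (s j)"
  have x: "?x \<in> C" by (rule Q.BXD(1)[OF HS_B[OF A] E_closed[OF s_E]])
  have y: "?y \<in> C" using ra by (simp add: is_comb_def)
  have F: "finite (s ` {..n})" "s ` {..n} \<subseteq> E" using s(2) by auto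
  have "(vnorm X ?y)\<^sup>2 = (\<Sum>e\<in>s ` {..n}. (cmod (ip ?x e))\<^sup>2)"
    using is_comb_norm[OF conjunct1[OF ra] F] by (simp add: norm_square y)
  also have "\<dots> \<le> (vnorm X ?x)\<^sup>2" using bessel[OF x F] by (simp add: norm_square x)
  also have "\<dots> \<le> (vnorm HS A)\<^sup>2"
    using schatten_two_apply_le[of A "s j"] A norm_nonneg[OF x] by (intro power_mono) (simp_all add: HS_simps)
  finally have yA: "(vnorm X ?y)\<^sup>2 \<le> (vnorm HS A)\<^sup>2" .
  have rA: "column_op j n A \<in> carrier HS" by (rule H.BXD(1)[OF conjunct1[OF column_op] A])
  have "(\<Sum>e\<in>G. (vnorm X (column_op j n A e))\<^sup>2) \<le> (vnorm HS A)\<^sup>2" if G: "finite G" "G \<subseteq> E" for G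
  proof -
    have "(\<Sum>e\<in>G. (vnorm X (column_op j n A e))\<^sup>2) = (\<Sum>e\<in>G. if e = s 0 then (vnorm X ?y)\<^sup>2 else 0)"
      by (rule sum.cong) (use G ra in \<open>auto simp: Q.norm_vz\<close>)
    also have "\<dots> \<le> (vnorm X ?y)\<^sup>2" using G by simp
    finally show ?thesis using yA by simp
  qed
  from schatten_twoI[OF HS_B[OF rA] HS_norm_nonneg this]
  show "vnorm HS (column_op j n A) \<le> 1 * vnorm HS A" by (simp add: HS_simps)
qed simp

text \<open>Column j of the matrix unit is \<open>s i\<close>, which survives truncation after
  \<open>s j\<close> exactly when i \<le> j; the row operator then reads off that entry.\<close>

lemma row_op_column_op:
  "ip (row_op i (column_op j j (matrix_unit (s i) (s j))) (s 0)) (s 0) = of_bool (i \<le> j)"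
proof -
  let ?A = "matrix_unit (s i) (s j)"
  have A: "?A \<in> carrier HS" using matrix_unit_two[of "s i" "s j"] by (simp add: HS_simps)
  have rA: "column_op j j ?A \<in> carrier HS" by (rule H.BXD(1)[OF conjunct1[OF column_op] A])
  have F: "finite (s ` {..j})" "s ` {..j} \<subseteq> E" using s(2) by auto
  have "ip (column_op j j ?A (s 0)) (s i) = (if s i \<in> s ` {..j} then ip (?A (s j)) (s i) else 0)"
    by (rule is_comb_coeff[OF conjunct1[OF column_op_apply[OF A]] F s_E])
  also have "\<dots> = of_bool (i \<le> j)"
    using s(1) by (auto simp: matrix_unit_E ip_E dest: injD)
  finally show ?thesis using rA
    by (simp add: row_op_def coeff_op_def HS_apply matrix_unit_E E_closed inner_scale ip_E)
qed

text \<open>A stands for either operator algebra: it carries the operations of the bounded operators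
  and contains the compact ones. The constant c = 2 comes from \<open>schatten_subset_two\<close>,
  and K = 2 from the bound on matrix units in S_p.\<close>

lemma tensor_schatten_not_arens_regular:
  fixes A :: "(('a \<Rightarrow> 'a) \<Rightarrow> 'a \<Rightarrow> 'a, 'm) nalgebra_scheme"
  assumes p: "1 \<le> p" "p \<le> 2" and A: "tensor A (schatten p X) 8"
    and sub: "carrier A \<subseteq> carrier H.BX"
    and eq: "vadd A = vadd H.BX" "vscale A = vscale H.BX" "vmult A = vmult H.BX" "vnorm A = vnorm H.BX"
    and cl: "\<And>T. T \<in> carrier H.BX \<Longrightarrow> compact_operator HS T \<Longrightarrow> T \<in> carrier A"
  shows "\<not> arens_regular (A \<otimes>\<^sub>\<gamma> schatten p X)"
proof (rule tensor.tensor_not_arens_regular[OF A, where m = "\<lambda>T S. ip (T S (s 0)) (s 0)" and c = 2 and K = 2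
      and a = row_op and a' = "\<lambda>j. column_op j j" and b = "\<lambda>i. matrix_unit (s i) (s 0)" and b' = "\<lambda>j. matrix_unit (s 0) (s j)"])
  have BX: "T \<in> carrier H.BX" if "T \<in> carrier A" for T using sub that by blast
  have HS: "S \<in> carrier HS" if "S \<in> carrier (schatten p X)" for S
    using schatten_subset_two[OF p that] by (simp add: HS_simps)
  have sch: "vadd (schatten p X) = vadd HS" "vscale (schatten p X) = vscale HS"
    by (simp_all add: schatten_simps HS_simps)
  fix T T' S S' k
  assume T: "T \<in> carrier A" and S: "S \<in> carrier (schatten p X)"
  note TS = H.BXD(1)[OF BX[OF T] HS[OF S]]
  show "ip (vscale A k T S (s 0)) (s 0) = k * ip (T S (s 0)) (s 0)"
    using HS_coeff(2)[OF s_E s_E TS] HS[OF S] by (simp add: eq H.BX_apply)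
  show "ip (T (vscale (schatten p X) k S) (s 0)) (s 0) = k * ip (T S (s 0)) (s 0)"
    using HS_coeff(2)[OF s_E s_E TS] by (simp add: sch H.BXD(4)[OF BX[OF T] HS[OF S]])
  have "cmod (ip (T S (s 0)) (s 0)) \<le> vnorm HS (T S)" using HS_coeff(3)[OF s_E s_E TS] by simp
  also have "\<dots> \<le> vnorm H.BX T * vnorm HS S" by (rule H.BX_norm_le[OF BX[OF T] HS[OF S]])
  also have "\<dots> \<le> vnorm H.BX T * (2 * vnorm (schatten p X) S)"
    using schatten_subset_two[OF p S] by (intro mult_left_mono H.BX_norm_nonneg BX T) (simp add: HS_simps)
  finally show "cmod (ip (T S (s 0)) (s 0)) \<le> 2 * (vnorm A T * vnorm (schatten p X) S)" by (simp add: eq mult_ac)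
  show "ip (vadd A T T' S (s 0)) (s 0) = ip (T S (s 0)) (s 0) + ip (T' S (s 0)) (s 0)" if T': "T' \<in> carrier A"
    using HS_coeff(1)[OF s_E s_E TS H.BXD(1)[OF BX[OF T'] HS[OF S]]] HS[OF S] by (simp add: eq H.BX_apply)
  show "ip (T (vadd (schatten p X) S S') (s 0)) (s 0) = ip (T S (s 0)) (s 0) + ip (T S' (s 0)) (s 0)"
    if S': "S' \<in> carrier (schatten p X)"
    using HS_coeff(1)[OF s_E s_E TS H.BXD(1)[OF BX[OF T] HS[OF S']]]
    by (simp add: sch H.BXD(3)[OF BX[OF T] HS[OF S] HS[OF S']])
next
  fix i j
  show "row_op i \<in> carrier A" "column_op i i \<in> carrier A" using row_op column_op by (simp_all add: cl)
  show "matrix_unit (s i) (s 0) \<in> carrier (schatten p X)" "matrix_unit (s 0) (s i) \<in> carrier (schatten p X)"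
    "vnorm (schatten p X) (matrix_unit (s i) (s 0)) \<le> 2" "vnorm (schatten p X) (matrix_unit (s 0) (s i)) \<le> 2"
    using matrix_unit_schatten[OF p(1)] by simp_all
  show "vnorm A (row_op i) \<le> 2" "vnorm A (column_op i i) \<le> 2"
    using norm_row_op[of i] norm_column_op[of i i] by (simp_all add: eq)
  have "matrix_unit (s i) (s j) \<in> carrier HS" using matrix_unit_two[of "s i" "s j"] by (simp add: HS_simps)
  thus "ip (vmult A (row_op i) (column_op j j) (vmult (schatten p X) (matrix_unit (s i) (s 0)) (matrix_unit (s 0) (s j))) (s 0)) (s 0) =
      of_bool (i \<le> j)"
    using row_op_column_op[of i j] by (simp add: schatten_simps bounded_algebra_simps(6)[of X] matrix_unit_mult eq H.BX_apply)
qed simp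

end

end

theorem corollary4p8:
  fixes H :: "'h hilbert" and p :: real
  assumes "hilbert_space H"
    and "infinite_dimensional H"
    and "1 \<le> p" and "p \<le> 2"
  shows "\<not> arens_regular (bounded_algebra (hilbert_schmidt H) \<otimes>\<^sub>\<gamma> schatten p H) \<and>
         \<not> arens_regular (compact_algebra (hilbert_schmidt H) \<otimes>\<^sub>\<gamma> schatten p H)"
proof -
  interpret hilbert_space H by fact
  define E where "E = (SOME E. orthonormal_basis H E)"
  have "orthonormal_basis H E" unfolding E_def using orthonormal_basis_exists by (rule someI_ex)
  then interpret S: hilbert_std H E by unfold_locales (simp_all add: E_def)
  have "infinite E" using S.finite_basis_not_infinite_dimensional assms(2) by blast
  then obtain s :: "nat \<Rightarrow> 'h" where s: "inj s" "range s \<subseteq> E" using infinite_countable_subset by blast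
  note B = S.schatten_quasi_normed_algebra[OF assms(3,4)]
  show ?thesis
  proof
    show "\<not> arens_regular (bounded_algebra (hilbert_schmidt H) \<otimes>\<^sub>\<gamma> schatten p H)"
      by (rule S.tensor_schatten_not_arens_regular[OF s assms(3,4) S.H.BX_tensor[OF B]]) simp_all
    show "\<not> arens_regular (compact_algebra (hilbert_schmidt H) \<otimes>\<^sub>\<gamma> schatten p H)"
      by (rule S.tensor_schatten_not_arens_regular[OF s assms(3,4) S.H.KX_tensor[OF B]])
         (auto simp: compact_algebra_def)
  qed
qed

end
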